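(* Let $\lambda_+,\lambda_-\ge 0$ be not both zero, let $p\in(0,1)$, and fix a sign $\eta\in\{+,-\}$. Let $Y^{(0)}_t$ be the position at time $t$ of the push-tagged particle started at site $0$ in the Toom process with rates $\lambda_\pm$ started from $\mathrm{Ber}_p$ conditioned on $\sigma_0(0)=\eta 1$. Then there is a constant $D>0$ such that, as $n\to\infty$, $$\left(\frac{Y^{(0)}_{nt}-v_\eta\, nt}{\sqrt n}\right)_{t\in[0,1]}\ \Longrightarrow\ \big(\sqrt{D}\,B_t\big)_{t\in[0,1]}$$ in distribution on Skorokhod space, where $B$ is standard Brownian motion and $$v_+=\frac{\lambda_+}{1-p}-\lambda_-\frac{1-p}{p^2},\qquad v_-=\frac{\lambda_-}{p}-\lambda_+\frac{p}{(1-p)^2}.$$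
   Context: Toom process: $\Omega=\{-1,+1\}^{\mathbf Z}$; a site $x$ with $\sigma(x)=\pm1$ is thought of as occupied by a $\pm$ particle. $\mathrm{Ber}_p$ is the product measure on $\Omega$ with $\mathrm{Ber}_p(\sigma(x)=+1)=p$. Let $N_{x,\eta}$, $x\in\mathbf Z$, $\eta\in\{+,-\}$, be independent Poisson processes, $N_{x,\eta}$ of rate $\lambda_\eta$. At each arrival of $N_{x,\eta}$: if $\sigma(x)\neq\eta$ nothing happens; if $\sigma(x)=\eta$, then the values of $\sigma(x)$ and $\sigma(z)$ are exchanged, where $z=\min\{y>x:\sigma(y)=-\eta\}$. Known fact (from earlier work): started from $\mathrm{Ber}_p$ (independent of the clocks) these rules define almost surely a càdlàg process $(\sigma_t)_{t\ge0}$ in $\Omega$, a measurable function of the initial configuration and the clocks (constructed for short times as the limit of the corresponding systems on large cycles $[-L,L)$), and $\mathrm{Ber}_p$ is invariant. Push-tagged particles: one follows labelled particles according to the following convention. If the clock $(x,\eta)$ rings, all sites in $[x,x+r-1]$ have sign $\eta$ and $x+r$ has sign $-\eta$ ($r\ge1$), then each of the $\eta$-particles at $x,\dots,x+r-1$ moves one site to the right, and the $-\eta$-particle at $x+r$ moves to $x$. (This gives the same unlabelled configuration as the exchange rule and preserves the order among particles of the same sign.) $Y^{(x)}_t$ is the position at time $t$ of the particle that was at $x$ at time $0$. *)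

theory Defs
  imports "HOL-Probability.Probability"
begin

section \<open>Cadlag functions and Skorokhod space\<close>

text \<open>At the end points of \<open>T\<close> one of the two filters is trivial, so that right continuity is not
  required at the maximum of \<open>T\<close>, nor a left limit at the minimum.\<close>

definition cadlag_on :: "real set \<Rightarrow> (real \<Rightarrow> 'a::topological_space) \<Rightarrow> bool" where
  "cadlag_on T f \<longleftrightarrow> (\<forall>t\<in>T. (f \<longlongrightarrow> f t) (at t within T \<inter> {t<..})
      \<and> (\<exists>l. (f \<longlongrightarrow> l) (at t within T \<inter> {..<t})))"

definition left_lim :: "(real \<Rightarrow> 'a::t2_space) \<Rightarrow> real \<Rightarrow> 'a" where
  "left_lim f t = Lim (at_left t) f"

lemma cadlag_on_const: "cadlag_on T (\<lambda>_. c)"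
  unfolding cadlag_on_def by (auto intro: tendsto_const)

lemma cadlag_on_cong:
  assumes "\<And>t. t \<in> T \<Longrightarrow> f t = g t" "cadlag_on T f"
  shows "cadlag_on T g"
proof -
  have "(g \<longlongrightarrow> l) (at t within T \<inter> S)" if "(f \<longlongrightarrow> l) (at t within T \<inter> S)" for l t S
    using that assms(1) by (auto elim!: Lim_transform_eventually simp: eventually_at_filter)
  then show ?thesis
    using assms unfolding cadlag_on_def by metis
qed

typedef skorokhod = "{f :: real \<Rightarrow> real. f \<in> extensional {0..1} \<and> cadlag_on {0..1} f}"
  morphisms skorokhod_path Abs_skorokhod
  by (rule exI[of _ "restrict (\<lambda>_. 0) {0..1}"])
    (auto intro: cadlag_on_cong[OF _ cadlag_on_const[of _ 0]])

text \<open>Junk unless \<open>f\<close> is cadlag on \<open>[0,1]\<close>; the values of \<open>f\<close> outside \<open>[0,1]\<close> are discarded.\<close>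

definition skorokhod_of :: "(real \<Rightarrow> real) \<Rightarrow> skorokhod" where
  "skorokhod_of f = Abs_skorokhod (restrict f {0..1})"

lemma skorokhod_path_of:
  assumes "cadlag_on {0..1} f" "t \<in> {0..1}"
  shows "skorokhod_path (skorokhod_of f) t = f t"
proof -
  have "cadlag_on {0..1} (restrict f {0..1})"
    using assms(1) by (rule cadlag_on_cong[rotated]) simp
  then show ?thesis
    unfolding skorokhod_of_def using assms(2) by (subst Abs_skorokhod_inverse) auto
qed

definition time_changes :: "(real \<Rightarrow> real) set" where
  "time_changes = {l. strict_mono_on {0..1} l \<and> continuous_on {0..1} l \<and> l ` {0..1} = {0..1}}"

definition skorokhod_close :: "(real \<Rightarrow> real) \<Rightarrow> (real \<Rightarrow> real) \<Rightarrow> real \<Rightarrow> bool" where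
  "skorokhod_close f g e \<longleftrightarrow>
     (\<exists>l\<in>time_changes. \<forall>t\<in>{0..1}. \<bar>l t - t\<bar> \<le> e \<and> \<bar>f t - g (l t)\<bar> \<le> e)"

lemma skorokhod_close_nonneg: "skorokhod_close f g e \<Longrightarrow> 0 \<le> e"
  unfolding skorokhod_close_def by (force dest: bspec[of _ _ 0])

lemma skorokhod_close_mono: "skorokhod_close f g e \<Longrightarrow> e \<le> e' \<Longrightarrow> skorokhod_close f g e'"
  unfolding skorokhod_close_def by (meson order_trans)

lemma id_time_change: "(\<lambda>t. t) \<in> time_changes"
  by (auto simp: time_changes_def strict_mono_on_def)

lemma skorokhod_close_refl: "skorokhod_close f f 0"
  unfolding skorokhod_close_def using id_time_change by (auto intro!: bexI[of _ "\<lambda>t. t"])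

lemma time_change_in: "l \<in> time_changes \<Longrightarrow> t \<in> {0..1} \<Longrightarrow> l t \<in> {0..1}"
  by (auto simp: time_changes_def)

lemma skorokhod_close_sym:
  assumes "skorokhod_close f g e"
  shows "skorokhod_close g f e"
proof -
  obtain l where l: "l \<in> time_changes" "\<And>t. t \<in> {0..1} \<Longrightarrow> \<bar>l t - t\<bar> \<le> e \<and> \<bar>f t - g (l t)\<bar> \<le> e"
    using assms unfolding skorokhod_close_def by blast
  have sm: "strict_mono_on {0..1} l" and co: "continuous_on {0..1} l" and im: "l ` {0..1} = {0..1}"
    using l(1) by (auto simp: time_changes_def)
  have inj: "inj_on l {0..1}"
    using sm by (rule strict_mono_on_imp_inj_on)
  define k where "k = inv_into {0..1} l"
  have kin: "k t \<in> {0..1}" if "t \<in> {0..1}" for t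
    using that im unfolding k_def by (metis inv_into_into)
  have lk: "l (k t) = t" if "t \<in> {0..1}" for t
    using that im unfolding k_def by (metis f_inv_into_f)
  have kl: "k (l t) = t" if "t \<in> {0..1}" for t
    using that inj unfolding k_def by (rule inv_into_f_f[rotated])
  have "strict_mono_on {0..1} k"
  proof (rule strict_mono_onI)
    fix r s :: real assume rs: "r \<in> {0..1}" "s \<in> {0..1}" "r < s"
    show "k r < k s"
    proof (rule ccontr)
      assume "\<not> k r < k s"
      then have "l (k s) \<le> l (k r)"
        using strict_mono_on_leD[OF sm, of "k s" "k r"] kin rs by auto
      then show False using lk rs by auto
    qed
  qed
  moreover have "continuous_on {0..1} k"
    using continuous_on_inv[OF co] kl im by (metis compact_Icc)
  moreover have "k ` {0..1} = {0..1}"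
  proof
    show "k ` {0..1} \<subseteq> {0..1}" using kin by blast
    show "{0..1} \<subseteq> k ` {0..1}" using kl time_change_in[OF l(1)] by (metis imageI subsetI)
  qed
  ultimately have "k \<in> time_changes"
    by (simp add: time_changes_def)
  moreover have "\<bar>k t - t\<bar> \<le> e \<and> \<bar>g t - f (k t)\<bar> \<le> e" if "t \<in> {0..1}" for t
    using l(2)[OF kin[OF that]] lk[OF that] by (simp add: abs_minus_commute)
  ultimately show ?thesis
    unfolding skorokhod_close_def by blast
qed

lemma skorokhod_close_trans:
  assumes "skorokhod_close f g a" "skorokhod_close g h b"
  shows "skorokhod_close f h (a + b)"
proof -
  obtain l where l: "l \<in> time_changes" "\<And>t. t \<in> {0..1} \<Longrightarrow> \<bar>l t - t\<bar> \<le> a \<and> \<bar>f t - g (l t)\<bar> \<le> a"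
    using assms(1) unfolding skorokhod_close_def by blast
  obtain k where k: "k \<in> time_changes" "\<And>t. t \<in> {0..1} \<Longrightarrow> \<bar>k t - t\<bar> \<le> b \<and> \<bar>g t - h (k t)\<bar> \<le> b"
    using assms(2) unfolding skorokhod_close_def by blast
  have "strict_mono_on {0..1} (k \<circ> l)"
    using l(1) k(1) time_change_in[OF l(1)] by (auto simp: time_changes_def strict_mono_on_def)
  moreover have "continuous_on {0..1} (k \<circ> l)"
    using l(1) k(1) by (intro continuous_on_compose) (simp_all add: time_changes_def)
  moreover have "(k \<circ> l) ` {0..1} = {0..1}"
    using l(1) k(1) by (simp only: time_changes_def mem_Collect_eq image_comp[symmetric])
  ultimately have "k \<circ> l \<in> time_changes"
    by (simp add: time_changes_def)
  moreover have "\<bar>(k \<circ> l) t - t\<bar> \<le> a + b \<and> \<bar>f t - h ((k \<circ> l) t)\<bar> \<le> a + b" if "t \<in> {0..1}" for t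
    using l(2)[OF that] k(2)[OF time_change_in[OF l(1) that]] by auto
  ultimately show ?thesis
    unfolding skorokhod_close_def by blast
qed

lemma cadlag_on_bounded:
  fixes f :: "real \<Rightarrow> real"
  assumes "cadlag_on {0..1} f"
  shows "\<exists>C. \<forall>t\<in>{0..1}. \<bar>f t\<bar> \<le> C"
proof -
  have "\<exists>U C. open U \<and> t \<in> U \<and> (\<forall>s\<in>U \<inter> {0..1}. \<bar>f s\<bar> \<le> C)" if t: "t \<in> {0..1}" for t
  proof -
    from assms t obtain l where r: "(f \<longlongrightarrow> f t) (at t within {0..1} \<inter> {t<..})"
      and l: "(f \<longlongrightarrow> l) (at t within {0..1} \<inter> {..<t})"
      unfolding cadlag_on_def by blast
    from tendstoD[OF r zero_less_one] obtain U1 where U1: "open U1" "t \<in> U1"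
      "\<And>s. s \<in> U1 \<Longrightarrow> s \<in> {0..1} \<Longrightarrow> t < s \<Longrightarrow> dist (f s) (f t) < 1"
      unfolding eventually_at_topological by fastforce
    from tendstoD[OF l zero_less_one] obtain U2 where U2: "open U2" "t \<in> U2"
      "\<And>s. s \<in> U2 \<Longrightarrow> s \<in> {0..1} \<Longrightarrow> s < t \<Longrightarrow> dist (f s) l < 1"
      unfolding eventually_at_topological by fastforce
    have "\<bar>f s\<bar> \<le> \<bar>f t\<bar> + \<bar>l\<bar> + 1" if "s \<in> (U1 \<inter> U2) \<inter> {0..1}" for s
    proof (cases s t rule: linorder_cases)
      case less then show ?thesis using U2(3)[of s] that by (auto simp: dist_real_def)
    next
      case greater then show ?thesis using U1(3)[of s] that by (auto simp: dist_real_def)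
    qed auto
    then show ?thesis
      using U1 U2 by (intro exI[of _ "U1 \<inter> U2"] exI[of _ "\<bar>f t\<bar> + \<bar>l\<bar> + 1"]) auto
  qed
  then obtain U C where UC: "\<And>t. t \<in> {0..1} \<Longrightarrow> open (U t) \<and> t \<in> U t"
    "\<And>t s. t \<in> {0..1} \<Longrightarrow> s \<in> U t \<Longrightarrow> s \<in> {0..1} \<Longrightarrow> \<bar>f s\<bar> \<le> C t"
    by (metis IntI)
  have "compact {0..1::real}" by simp
  then obtain J where J: "J \<subseteq> {0..1}" "finite J" "{0..1} \<subseteq> (\<Union>t\<in>J. U t)"
    by (rule compactE_image[of _ "{0..1}" U]) (use UC in auto)
  have "\<bar>f s\<bar> \<le> (\<Sum>t\<in>J. \<bar>C t\<bar>)" if s: "s \<in> {0..1}" for s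
  proof -
    obtain t where t: "t \<in> J" "s \<in> U t" using J s by blast
    then have "\<bar>f s\<bar> \<le> \<bar>C t\<bar>" using UC(2)[of t s] J s by force
    also have "\<dots> \<le> (\<Sum>t\<in>J. \<bar>C t\<bar>)" using J t by (intro member_le_sum) auto
    finally show ?thesis .
  qed
  then show ?thesis by blast
qed

lemma skorokhod_close_exists:
  assumes "cadlag_on {0..1} f" "cadlag_on {0..1} g"
  shows "\<exists>e. skorokhod_close f g e"
proof -
  obtain C D where "\<forall>t\<in>{0..1}. \<bar>f t\<bar> \<le> C" "\<forall>t\<in>{0..1}. \<bar>g t\<bar> \<le> D"
    using cadlag_on_bounded[OF assms(1)] cadlag_on_bounded[OF assms(2)] by blast
  then have "\<forall>t\<in>{0..1}. \<bar>t - t\<bar> \<le> \<bar>C\<bar> + \<bar>D\<bar> \<and> \<bar>f t - g t\<bar> \<le> \<bar>C\<bar> + \<bar>D\<bar>"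
    by fastforce
  then show ?thesis
    unfolding skorokhod_close_def by (intro exI bexI[OF _ id_time_change])
qed

lemma skorokhod_close_zero:
  assumes f: "cadlag_on {0..1} f" and g: "cadlag_on {0..1} g"
    and close: "\<And>e. 0 < e \<Longrightarrow> skorokhod_close f g e" and t: "t \<in> {0..1}"
  shows "f t = g t"
proof (cases "t = 1")
  case True
  have "\<bar>f 1 - g 1\<bar> \<le> e" if e: "0 < e" for e
  proof -
    obtain l where l: "l \<in> time_changes" "\<And>s. s \<in> {0..1} \<Longrightarrow> \<bar>f s - g (l s)\<bar> \<le> e"
      using close[OF e] unfolding skorokhod_close_def by blast
    have "l 1 = 1"
    proof (rule ccontr)
      assume "l 1 \<noteq> 1"
      have "1 \<in> l ` {0..1}" using l(1) by (simp add: time_changes_def)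
      then obtain s where s: "s \<in> {0..1}" "l s = 1" by (metis imageE)
      then have "s < 1" using \<open>l 1 \<noteq> 1\<close> by (cases "s = 1") auto
      moreover have "strict_mono_on {0..1} l" using l(1) by (simp add: time_changes_def)
      ultimately have "l s < l 1" using s(1) by (auto elim!: strict_mono_onD)
      then show False using time_change_in[OF l(1), of 1] s by auto
    qed
    then show ?thesis using l(2)[of 1] by simp
  qed
  then have "\<bar>f 1 - g 1\<bar> \<le> 0" using field_le_epsilon[of "\<bar>f 1 - g 1\<bar>" 0] by simp
  then show ?thesis using True by simp
next
  case False
  then have t1: "0 \<le> t" "t < 1" using t by auto
  have "\<bar>f t - g t\<bar> \<le> 4 * e" if e: "0 < e" for e
  proof -
    have "(f \<longlongrightarrow> f t) (at t within {0..1} \<inter> {t<..})" "(g \<longlongrightarrow> g t) (at t within {0..1} \<inter> {t<..})"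
      using f g t unfolding cadlag_on_def by auto
    then have "\<forall>\<^sub>F s in at t within {0..1} \<inter> {t<..}. dist (f s) (f t) < e \<and> dist (g s) (g t) < e"
      using e by (auto dest: tendstoD intro: eventually_conj)
    then obtain d where d: "d > 0"
      "\<And>s. s \<in> {0..1} \<Longrightarrow> t < s \<Longrightarrow> dist s t < d \<Longrightarrow> dist (f s) (f t) < e \<and> dist (g s) (g t) < e"
      unfolding eventually_at by auto
    obtain m where m: "0 < m" "m \<le> d" "m \<le> 1 - t"
      using d(1) t1 by (intro that[of "min d (1 - t)"]) auto
    define s where "s = t + m / 2"
    obtain h where h: "0 < h" "h \<le> e" "h \<le> m / 4"
      using e m by (intro that[of "min e (m / 4)"]) auto
    obtain l where l: "l \<in> time_changes" "\<And>s. s \<in> {0..1} \<Longrightarrow> \<bar>l s - s\<bar> \<le> h \<and> \<bar>f s - g (l s)\<bar> \<le> h"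
      using close[OF h(1)] unfolding skorokhod_close_def by blast
    have s: "s \<in> {0..1}" "t < s" "dist s t < d"
      using m t1 by (auto simp: s_def dist_real_def)
    have ls: "\<bar>l s - s\<bar> \<le> h" using l(2)[OF s(1)] by blast
    have "l s \<in> {0..1}" using time_change_in[OF l(1) s(1)] .
    moreover have "t < l s" using ls h m unfolding s_def by linarith
    moreover have "dist (l s) t < d" using ls h m unfolding s_def dist_real_def by linarith
    ultimately have "dist (g (l s)) (g t) < e" using d(2) by blast
    moreover have "dist (f s) (f t) < e" using d(2) s by blast
    moreover have "\<bar>f s - g (l s)\<bar> \<le> e" using l(2)[OF s(1)] h(2) by linarith
    ultimately show ?thesis unfolding dist_real_def by linarith
  qed
  from this[of "e / 4" for e] have "\<bar>f t - g t\<bar> \<le> e" if "0 < e" for e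
    using that by simp
  then have "\<bar>f t - g t\<bar> \<le> 0" using field_le_epsilon[of "\<bar>f t - g t\<bar>" 0] by simp
  then show ?thesis by simp
qed

lemma cadlag_skorokhod_path: "cadlag_on {0..1} (skorokhod_path f)"
  using skorokhod_path[of f] by simp

text \<open>The Skorokhod (J1) metric; its topology and Borel sets are those of the type class.\<close>

instantiation skorokhod :: metric_space
begin

definition dist_skorokhod :: "skorokhod \<Rightarrow> skorokhod \<Rightarrow> real" where
  "dist_skorokhod f g = Inf {e. skorokhod_close (skorokhod_path f) (skorokhod_path g) e}"

definition uniformity_skorokhod :: "(skorokhod \<times> skorokhod) filter" where
  "uniformity_skorokhod = (INF e\<in>{0<..}. principal {(x, y). dist x y < e})"

definition open_skorokhod :: "skorokhod set \<Rightarrow> bool" where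
  "open_skorokhod U \<longleftrightarrow> (\<forall>x\<in>U. \<forall>\<^sub>F (x', y) in uniformity. x' = x \<longrightarrow> y \<in> U)"

instance
proof
  have ne: "{e. skorokhod_close (skorokhod_path f) (skorokhod_path g) e} \<noteq> {}" for f g
    using skorokhod_close_exists[OF cadlag_skorokhod_path cadlag_skorokhod_path] by auto
  have bd: "bdd_below {e. skorokhod_close (skorokhod_path f) (skorokhod_path g) e}" for f g
    by (intro bdd_belowI[of _ 0]) (auto intro: skorokhod_close_nonneg)
  have less: "skorokhod_close (skorokhod_path f) (skorokhod_path g) e" if lt: "dist f g < e" for f g e
  proof -
    obtain e' where "skorokhod_close (skorokhod_path f) (skorokhod_path g) e'" "e' < e"
      using cInf_lessD[OF ne, of f g e] lt unfolding dist_skorokhod_def by blast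
    then show ?thesis
      using skorokhod_close_mono less_imp_le by blast
  qed
  have le: "dist f g \<le> e" if "skorokhod_close (skorokhod_path f) (skorokhod_path g) e" for f g e
    unfolding dist_skorokhod_def using that bd by (intro cInf_lower) auto
  show "uniformity = (INF e\<in>{0<..}. principal {(x::skorokhod, y). dist x y < e})"
    by (rule uniformity_skorokhod_def)
  show "open U \<longleftrightarrow> (\<forall>x\<in>U. \<forall>\<^sub>F (x', y) in uniformity. x' = x \<longrightarrow> y \<in> U)" for U :: "skorokhod set"
    by (rule open_skorokhod_def)
  show "dist x y = 0 \<longleftrightarrow> x = y" for x y :: skorokhod
  proof
    assume xy: "dist x y = 0"
    have "skorokhod_path x = skorokhod_path y"
    proof (rule extensionalityI[of _ "{0..1}"])
      show "skorokhod_path x \<in> extensional {0..1}" "skorokhod_path y \<in> extensional {0..1}"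
        using skorokhod_path[of x] skorokhod_path[of y] by auto
      show "skorokhod_path x t = skorokhod_path y t" if "t \<in> {0..1}" for t
        by (rule skorokhod_close_zero[OF cadlag_skorokhod_path cadlag_skorokhod_path _ that])
          (use less xy in auto)
    qed
    then show "x = y" by (simp add: skorokhod_path_inject)
  next
    assume "x = y"
    then have "dist x y \<le> 0" using le[OF skorokhod_close_refl] by simp
    moreover have "0 \<le> dist x y"
      unfolding dist_skorokhod_def using ne by (intro cInf_greatest) (auto intro: skorokhod_close_nonneg)
    ultimately show "dist x y = 0" by simp
  qed
  show "dist x y \<le> dist x z + dist y z" for x y z :: skorokhod
  proof (rule field_le_epsilon)
    fix e :: real assume e: "0 < e"
    have "skorokhod_close (skorokhod_path x) (skorokhod_path z) (dist x z + e / 2)"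
      "skorokhod_close (skorokhod_path y) (skorokhod_path z) (dist y z + e / 2)"
      using e by (auto intro!: less)
    then have "dist x y \<le> (dist x z + e / 2) + (dist y z + e / 2)"
      by (intro le) (rule skorokhod_close_trans[OF _ skorokhod_close_sym])
    then show "dist x y \<le> dist x z + dist y z + e" by simp
  qed
qed

end

definition converges_in_distribution ::
    "'a measure \<Rightarrow> (nat \<Rightarrow> 'a \<Rightarrow> 'c::topological_space) \<Rightarrow> 'b measure \<Rightarrow> ('b \<Rightarrow> 'c) \<Rightarrow> bool" where
  "converges_in_distribution M X W Z \<longleftrightarrow>
     (\<forall>n. X n \<in> borel_measurable M) \<and> Z \<in> borel_measurable W \<and>
     (\<forall>F :: 'c \<Rightarrow> real. continuous_on UNIV F \<and> bounded (range F) \<longrightarrow>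
        (\<lambda>n. \<integral>\<omega>. F (X n \<omega>) \<partial>M) \<longlonglongrightarrow> (\<integral>\<omega>. F (Z \<omega>) \<partial>W))"

section \<open>Brownian motion and Poisson processes\<close>

text \<open>Processes have time set \<open>[0,\<infinity>)\<close>; values at negative times are irrelevant.\<close>

definition standard_brownian_motion :: "'b measure \<Rightarrow> ('b \<Rightarrow> real \<Rightarrow> real) \<Rightarrow> bool" where
  "standard_brownian_motion W B \<longleftrightarrow> prob_space W
     \<and> (\<forall>t\<ge>0. (\<lambda>\<omega>. B \<omega> t) \<in> borel_measurable W)
     \<and> (\<forall>\<omega>\<in>space W. B \<omega> 0 = 0 \<and> continuous_on {0..} (B \<omega>))
     \<and> (\<forall>s t. 0 \<le> s \<and> s < t \<longrightarrow>
          distributed W lborel (\<lambda>\<omega>. B \<omega> t - B \<omega> s) (\<lambda>x. ennreal (normal_density 0 (sqrt (t - s)) x)))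
     \<and> (\<forall>\<tau> :: nat \<Rightarrow> real. 0 \<le> \<tau> 0 \<and> incseq \<tau> \<longrightarrow>
          prob_space.indep_vars W (\<lambda>_. borel) (\<lambda>i \<omega>. B \<omega> (\<tau> (Suc i)) - B \<omega> (\<tau> i)) UNIV)"

text \<open>The weights are written out instead of using \<open>poisson_pmf\<close>, which excludes rate \<open>0\<close>.\<close>

definition poisson_process :: "'a measure \<Rightarrow> real \<Rightarrow> ('a \<Rightarrow> real \<Rightarrow> nat) \<Rightarrow> bool" where
  "poisson_process M r N \<longleftrightarrow>
     (\<forall>t\<ge>0. (\<lambda>\<omega>. N \<omega> t) \<in> measurable M (count_space UNIV))
     \<and> (\<forall>\<omega>\<in>space M. N \<omega> 0 = 0 \<and> mono_on {0..} (N \<omega>) \<and> cadlag_on {0..} (N \<omega>))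
     \<and> (\<forall>s t k. 0 \<le> s \<and> s \<le> t \<longrightarrow>
          measure M {\<omega>\<in>space M. N \<omega> t - N \<omega> s = k} = (r * (t - s)) ^ k / fact k * exp (- (r * (t - s))))
     \<and> (\<forall>\<tau> :: nat \<Rightarrow> real. 0 \<le> \<tau> 0 \<and> incseq \<tau> \<longrightarrow>
          prob_space.indep_vars M (\<lambda>_. count_space UNIV) (\<lambda>i \<omega>. N \<omega> (\<tau> (Suc i)) - N \<omega> (\<tau> i)) UNIV)"

definition arrival :: "(real \<Rightarrow> nat) \<Rightarrow> real \<Rightarrow> bool" where
  "arrival c t \<longleftrightarrow> 0 < t \<and> (\<forall>s. 0 \<le> s \<and> s < t \<longrightarrow> c s < c t)"

section \<open>The Toom process\<close>

text \<open>Signs are booleans: \<open>True\<close> stands for \<open>+1\<close>, \<open>False\<close> for \<open>-1\<close>, so \<open>s y \<noteq> \<eta>\<close> says that \<open>y\<close>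
  carries the sign \<open>-\<eta>\<close>. A clock is indexed by a pair \<open>(x, \<eta>)\<close>.\<close>

type_synonym sign = bool
type_synonym config = "int \<Rightarrow> sign"
type_synonym clocks = "int \<times> sign \<Rightarrow> real \<Rightarrow> nat"

definition config_space :: "config measure" where
  "config_space = (\<Pi>\<^sub>M x\<in>UNIV. count_space UNIV)"

definition Ber :: "real \<Rightarrow> config measure" where
  "Ber p = (\<Pi>\<^sub>M x\<in>UNIV. measure_pmf (bernoulli_pmf p))"

definition rate :: "real \<Rightarrow> real \<Rightarrow> sign \<Rightarrow> real" where
  "rate lp lm \<eta> = (if \<eta> then lp else lm)"

definition partner :: "int \<Rightarrow> sign \<Rightarrow> config \<Rightarrow> int" where
  "partner x \<eta> s = (LEAST y. x < y \<and> s y \<noteq> \<eta>)"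

definition exchange :: "config \<Rightarrow> int \<Rightarrow> int \<Rightarrow> config" where
  "exchange s x z = s(x := s z, z := s x)"

definition toom_ring :: "int \<Rightarrow> sign \<Rightarrow> config \<Rightarrow> config" where
  "toom_ring x \<eta> s = (if s x = \<eta> \<and> (\<exists>y>x. s y \<noteq> \<eta>) then exchange s x (partner x \<eta> s) else s)"

definition push :: "int \<Rightarrow> sign \<Rightarrow> config \<Rightarrow> int \<Rightarrow> int" where
  "push x \<eta> s y =
     (if s x = \<eta> \<and> (\<exists>z>x. s z \<noteq> \<eta>)
      then if x \<le> y \<and> y < partner x \<eta> s then y + 1
           else if y = partner x \<eta> s then x else y
      else y)"

text \<open>On the cycle \<open>[-L, L)\<close> the search for the partner runs through the periodic extension of the
  configuration. Only the values on \<open>[-L, L)\<close> matter; all others are left unchanged.\<close>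

definition wrap :: "nat \<Rightarrow> int \<Rightarrow> int" where
  "wrap L y = (y + int L) mod (2 * int L) - int L"

definition cycle_ring :: "nat \<Rightarrow> int \<Rightarrow> sign \<Rightarrow> config \<Rightarrow> config" where
  "cycle_ring L x \<eta> s =
     (let s' = s \<circ> wrap L
      in if s x = \<eta> \<and> (\<exists>y>x. s' y \<noteq> \<eta>) then exchange s x (wrap L (partner x \<eta> s')) else s)"

definition cycle_arrivals :: "nat \<Rightarrow> clocks \<Rightarrow> real \<Rightarrow> (int \<times> sign) set" where
  "cycle_arrivals L c u = {(x, \<eta>). x \<in> {- int L..<int L} \<and> arrival (c (x, \<eta>)) u}"

text \<open>State at time \<open>t\<close> of the cycle \<open>[-L, L)\<close> started at time \<open>a\<close> from \<open>s\<close>. Almost surely the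
  clocks of the cycle ring finitely often in \<open>(a, t]\<close> and never simultaneously; otherwise the value
  is junk.\<close>

definition cycle_config :: "nat \<Rightarrow> clocks \<Rightarrow> real \<Rightarrow> config \<Rightarrow> real \<Rightarrow> config" where
  "cycle_config L c a s t =
     fold (\<lambda>u. case (THE i. i \<in> cycle_arrivals L c u) of (x, \<eta>) \<Rightarrow> cycle_ring L x \<eta>)
       (sorted_list_of_set {u. a < u \<and> u \<le> t \<and> cycle_arrivals L c u \<noteq> {}}) s"

definition toom_clocks :: "'a measure \<Rightarrow> real \<Rightarrow> real \<Rightarrow> ('a \<Rightarrow> clocks) \<Rightarrow> bool" where
  "toom_clocks M lp lm N \<longleftrightarrow>
     (\<forall>x \<eta>. poisson_process M (rate lp lm \<eta>) (\<lambda>\<omega>. N \<omega> (x, \<eta>)))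
     \<and> prob_space.indep_vars M (\<lambda>_. \<Pi>\<^sub>M t\<in>{0..}. count_space UNIV) (\<lambda>i \<omega>. restrict (N \<omega> i) {0..}) UNIV"

definition config_before :: "(real \<Rightarrow> config) \<Rightarrow> real \<Rightarrow> config" where
  "config_before \<sigma> t = (\<lambda>x. left_lim (\<lambda>s. \<sigma> s x) t)"

definition obeys_toom_rules :: "clocks \<Rightarrow> (real \<Rightarrow> config) \<Rightarrow> bool" where
  "obeys_toom_rules c \<sigma> \<longleftrightarrow>
     (\<forall>t x \<eta>. arrival (c (x, \<eta>)) t \<longrightarrow> \<sigma> t = toom_ring x \<eta> (config_before \<sigma> t))
     \<and> (\<forall>t>0. (\<nexists>x \<eta>. arrival (c (x, \<eta>)) t) \<longrightarrow> \<sigma> t = config_before \<sigma> t)"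

text \<open>Infinitely many clocks ring in every time interval, so the rules by themselves do not single
  out the process. It is constructed on time intervals of a short length \<open>\<delta>\<close>: on each of them it is
  the almost sure limit, site by site, of the systems on the cycles \<open>[-L, L)\<close> that start from the
  configuration at the beginning of the interval and are driven by the same clocks.\<close>

definition toom_process ::
    "'a measure \<Rightarrow> real \<Rightarrow> real \<Rightarrow> config measure \<Rightarrow> ('a \<Rightarrow> clocks) \<Rightarrow> ('a \<Rightarrow> real \<Rightarrow> config) \<Rightarrow> bool" where
  "toom_process M lp lm \<mu> N \<sigma> \<longleftrightarrow> prob_space M
     \<and> toom_clocks M lp lm N
     \<and> (\<forall>t\<ge>0. (\<lambda>\<omega>. \<sigma> \<omega> t) \<in> measurable M config_space)
     \<and> distr M config_space (\<lambda>\<omega>. \<sigma> \<omega> 0) = \<mu>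
     \<and> prob_space.indep_set M
          (sets (vimage_algebra (space M) (\<lambda>\<omega>. \<sigma> \<omega> 0) config_space))
          (sets (vimage_algebra (space M) (\<lambda>\<omega> i. restrict (N \<omega> i) {0..})
             (\<Pi>\<^sub>M i\<in>UNIV. \<Pi>\<^sub>M t\<in>{0..}. count_space UNIV)))
     \<and> (AE \<omega> in M. cadlag_on {0..} (\<sigma> \<omega>) \<and> obeys_toom_rules (N \<omega>) (\<sigma> \<omega>))
     \<and> (\<exists>\<delta>>0. \<forall>k::nat. AE \<omega> in M. \<forall>t\<in>{real k * \<delta>..real (Suc k) * \<delta>}.
          (\<lambda>L. cycle_config L (N \<omega>) (real k * \<delta>) (\<sigma> \<omega> (real k * \<delta>)) t) \<longlonglongrightarrow> \<sigma> \<omega> t)"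

definition follows_push_rules ::
    "clocks \<Rightarrow> (real \<Rightarrow> config) \<Rightarrow> (real \<Rightarrow> int) \<Rightarrow> bool" where
  "follows_push_rules c \<sigma> y \<longleftrightarrow>
     (\<forall>t x \<eta>. arrival (c (x, \<eta>)) t \<longrightarrow> y t = push x \<eta> (config_before \<sigma> t) (left_lim y t))
     \<and> (\<forall>t>0. (\<nexists>x \<eta>. arrival (c (x, \<eta>)) t) \<longrightarrow> y t = left_lim y t)"

text \<open>The position of the particle that starts at \<open>x\<close>, in a version all of whose paths are cadlag.\<close>

definition push_tagged_position ::
    "'a measure \<Rightarrow> ('a \<Rightarrow> clocks) \<Rightarrow> ('a \<Rightarrow> real \<Rightarrow> config) \<Rightarrow> int \<Rightarrow> ('a \<Rightarrow> real \<Rightarrow> int) \<Rightarrow> bool" where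
  "push_tagged_position M N \<sigma> x Y \<longleftrightarrow>
     (\<forall>t\<ge>0. (\<lambda>\<omega>. Y \<omega> t) \<in> measurable M (count_space UNIV))
     \<and> (\<forall>\<omega>\<in>space M. cadlag_on {0..} (Y \<omega>))
     \<and> (AE \<omega> in M. Y \<omega> 0 = x \<and> follows_push_rules (N \<omega>) (\<sigma> \<omega>) (Y \<omega>))"

definition tagged_speed :: "real \<Rightarrow> real \<Rightarrow> real \<Rightarrow> sign \<Rightarrow> real" where
  "tagged_speed lp lm p \<eta> =
     (if \<eta> then lp / (1 - p) - lm * ((1 - p) / p\<^sup>2) else lm / p - lp * (p / (1 - p)\<^sup>2))"

end

theory Submission
  imports Defs
begin

text \<open>Let \<open>\<pi>\<close> be the product law. The law of the pair formed by the position of the tag and the word of any fixed length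
 to its left satisfies a linear forward equation, by the compensator formula for the clocks. As in Burke's theorem
 for queues, the products of a measure of the position with \<open>\<pi>\<close> are preserved by this equation, and its solutions
 that are dominated by \<open>\<pi>\<close> are unique; the domination comes from the approximating cycles, whose rings preserve
 product weights. Hence, given any event of the past, the environment to the left of the tag is again \<open>\<pi>\<close>, so
 that the increments of the position are independent and stationary: the position is a compound Poisson process
 that jumps by \<open>1\<close> at rate \<open>\<lambda>\<^sub>\<eta> / q\<close> and by \<open>-k\<close> at rate \<open>\<lambda>\<^sub>-\<^sub>\<eta> q^k\<close>, where \<open>q\<close> is the density of the opposite sign.
 The invariance principle then follows from the convergence of the increments on a grid, because step functions on
 fine grids approximate a cadlag path and Ottaviani's inequality controls the oscillation between grid points.\<close>

subsection \<open>Moves of the tag and of the word to its left\<close>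

text \<open>The tag only feels its left side: it is pushed by a run of its own sign ending at it and
  thrown back by a run of the opposite sign ending just before it, and what a ring does to the tag
  and to its left never depends on the sites to its right. Position and left word therefore satisfy
  an equation of their own, but it does not close at any word length: a ring beyond the end of the
  word acts on it as soon as its run reaches the word, and the loss rate grows linearly with the
  length. Uniqueness thus cannot come from a bounded operator; it is obtained in a scale of weighted
  norms, one rung of which is spent per integration. The other obstacle is that infinitely many
  clocks ring in every interval: there is no first ring to condition on, and the rules alone do not
  make the process a function of the past clocks. Adaptedness and domination, with a constant
  \<open>C0\<close> that pays for conditioning on the sign at \<open>0\<close>, are therefore
  carried over from time-discretised cycles, and rates enter only through limits of slot
  counts.\<close>

abbreviation (input) iff_ascii :: "bool => bool => bool" (infixr "<->" 25) where "A <-> B \<equiv> A \<longleftrightarrow> B"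

abbreviation (input) limseq_ascii :: "(nat => 'a::topological_space) => 'a => bool" (infixr "---->" 60) where
 "X ----> L \<equiv> X \<longlonglongrightarrow> L"

text \<open>\<open>LEAST\<close> over \<open>int\<close> means something only once a minimum is
  known to exist, so the search runs over the natural distances \<open>k\<close> from
  \<open>x + 1\<close>.\<close>

lemma first_opposite:
 fixes x :: int and s :: config
 assumes "EX z>x. s z ~= ep"
 obtains z where "x < z" "s z ~= ep" "!!u. x < u ==> u < z ==> s u = ep" "partner x ep s = z"
proof -
 obtain z0 where z0: "x < z0" "s z0 ~= ep" using assms by blast
 define P where "P k = (s (x + 1 + int k) ~= ep)" for k
 have "P (nat (z0 - x - 1))" using z0 unfolding P_def by (simp add: nat_diff_distrib)
 hence PL: "P (LEAST k. P k)" by (rule LeastI)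
 define z where "z = x + 1 + int (LEAST k. P k)"
 have 1: "s z ~= ep" using PL unfolding P_def z_def .
 have 2: "s u = ep" if "x < u" "u < z" for u
 proof -
  have "~ P (nat (u - x - 1))" by (rule not_less_Least) (use that in "simp add: z_def")
  thus ?thesis using that unfolding P_def by simp
 qed
 have 3: "x < z" unfolding z_def by simp
 have "partner x ep s = z" unfolding partner_def
 proof (rule Least_equality)
  show "x < z & s z ~= ep" using 1 3 by simp
  show "z <= y" if "x < y & s y ~= ep" for y using that 2[of y] by force
 qed
 thus ?thesis using that 1 2 3 by blast
qed

text \<open>Required position and word come first, actual position and configuration last, so that
  \<open>at_word y w\<close> is a predicate on states. Letter \<open>0\<close> is the site next to
  the tag.\<close>

definition at_word :: "int => bool list => int => config => bool" where
 "at_word y w y' s = (y' = y & (ALL i<length w. s (y - 1 - int i) = w ! i))"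

datatype gain_kind = Swap bool nat | Push | Jump
datatype loss_kind = Out bool | Self

type_synonym move = "(int \<times> sign) \<times> (int \<times> bool list)"

text \<open>A move \<open>((x, \<epsilon>), (y', w'))\<close> says that the clock \<open>(x, \<epsilon>)\<close> rings while the tag, of sign \<open>e\<close>, is at \<open>y'\<close> and the
 word \<open>w'\<close> is read from there to the left. The moves into and out of the state \<open>(y, w)\<close> are enumerated, without
 repetition, by \<open>gain\<close> and \<open>loss\<close>.\<close>

definition swap_word :: "bool => nat => nat => bool list => bool list" where
 "swap_word ep j d w = (if d < length w then w[j := ~ ep, d := ep]
   else w[j := ~ ep] @ replicate (d - length w + 1) ep)"

text \<open>The conditions describe the word after the ring, the result the word before it;
  \<open>d\<close> measures the distance of the ringing site. In a \<open>Swap\<close> the partner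
  sat at letter \<open>j\<close>: afterwards the letters from \<open>j\<close> to
  \<open>d - 1\<close> carry \<open>ep\<close> and letter \<open>d\<close> does not. In a
  \<open>Push\<close> the ring gave letter \<open>d\<close> of the new word the opposite sign, and
  deleting it yields the word seen from the old position; \<open>d = 0\<close> is the tag's own
  clock. In a \<open>Jump\<close> the tag lands on the ringing site, and the run it crossed stood in
  front of \<open>w\<close>. If the ring starts beyond the word, the earlier word is lengthened
  until every site used by the ring is visible.\<close>

fun gain :: "bool => int => bool list => gain_kind => nat => move option" where
 "gain e y w (Swap ep j) d =
   (if j < length w & j < d & (ALL l. j <= l & l < d & l < length w --> w ! l = ep) & (d < length w --> w ! d ~= ep)
   then Some ((y - 1 - int d, ep), (y, swap_word ep j d w)) else None)"
| "gain e y w Push d =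
   (if (ALL l. l < d & l < length w --> w ! l = e) & (d < length w --> w ! d ~= e)
   then Some ((y - 1 - int d, e), (y - 1, if d < length w then take d w @ drop (Suc d) w else replicate d e))
   else None)"
| "gain e y w Jump d = Some ((y, ~ e), (y + 1 + int d, replicate (Suc d) (~ e) @ w))"

text \<open>A ring of the right sign at a letter of the word always destroys the state: its partner
  is a letter of the word or the tag moves. A ring beyond the word does so exactly if all letters
  from the end of the word to the ringing site carry \<open>ep\<close>; otherwise its partner is
  found before the word is reached.\<close>

fun loss :: "bool => int => bool list => loss_kind => nat => move option" where
 "loss e y w (Out ep) d =
   (if d < length w --> w ! d = ep
   then Some ((y - 1 - int d, ep), (y, if d < length w then w else w @ replicate (d - length w + 1) ep)) else None)"
| "loss e y w Self d = (if d = 0 then Some ((y, e), (y, w)) else None)"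

declare gain.simps [simp del] loss.simps [simp del]

definition gain_kinds :: "bool list => gain_kind set" where
 "gain_kinds w = (%(ep, j). Swap ep j) ` (UNIV \<times> {..<length w}) Un {Push, Jump}"

definition loss_kinds :: "loss_kind set" where
 "loss_kinds = {Out True, Out False, Self}"

definition matches :: "move option => int \<times> sign => int => config => bool" where
 "matches m i y s = ((EX y' w'. m = Some (i, (y', w')) & at_word y' w' y s))"

definition good_ring :: "bool => int => bool => int => config => bool" where
 "good_ring e x ep y s = (s y = e & (s x = ep --> (EX z>x. s z ~= ep)))"

text \<open>Only the places of \<open>x\<close> and of its partner relative to the tag matter. A
  ring to the right of the tag leaves the tag and its left side alone, since the partner lies
  further right; if the partner is the tag itself, the tag is thrown back to
  \<open>x\<close>.\<close>

lemma ring_cases: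
 assumes "good_ring e x ep y s"
 obtains (idle) "s x ~= ep" "push x ep s y = y" "toom_ring x ep s = s"
 | (right) z where "y < x" "push x ep s y = y" "x < z" "toom_ring x ep s = s(x := ~ ep, z := ep)" "s x = ep" "s z = (~ ep)"
 | (inner) z where "x < z" "z < y" "s x = ep" "s z = (~ ep)" "!!u. x < u ==> u < z ==> s u = ep"
   "push x ep s y = y" "toom_ring x ep s = s(x := ~ ep, z := ep)"
 | (pushed) z where "x <= y" "y < z" "s x = ep" "ep = e" "s z = (~ ep)" "!!u. x < u ==> u < z ==> s u = ep"
   "push x ep s y = y + 1" "toom_ring x ep s = s(x := ~ ep, z := ep)"
 | (jump) "x < y" "s x = ep" "ep = (~ e)" "!!u. x < u ==> u < y ==> s u = ep"
   "push x ep s y = x" "toom_ring x ep s = s(x := ~ ep, y := ep)"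
proof (cases "s x = ep")
 case False thus ?thesis using that(1) by (simp add: push_def toom_ring_def)
next
 case True
 hence ex: "EX z>x. s z ~= ep" and sy: "s y = e" using assms by (auto simp: good_ring_def)
 obtain z where z: "x < z" "s z ~= ep" "!!u. x < u ==> u < z ==> s u = ep" "partner x ep s = z"
  using first_opposite[OF ex] by blast
 have r: "toom_ring x ep s = s(x := ~ ep, z := ep)"
  using True ex z by (auto simp: toom_ring_def exchange_def)
 have sz: "s z = (~ ep)" using z(2) by auto
 have p: "push x ep s y = (if x <= y & y < z then y + 1 else if y = z then x else y)"
  using True ex z(4) by (simp add: push_def)
 consider "y < x" | "z < y" | "y = z" | "x <= y" "y < z" using z(1) by linarith
 thus ?thesis
 proof cases
  case 1 thus ?thesis using that(2)[of z] z p r True sz by auto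
 next
  case 2 thus ?thesis using that(3)[of z] z p r True sz by auto
 next
  case 3 thus ?thesis using that(5) z p r True sz sy by auto
 next
  case 4
  have "s y = ep" using 4 z(3)[of y] True by (cases "y = x") auto
  thus ?thesis
   by (intro that(4)[of z]) (use 4 p r True sz sy z(3) in simp_all)
 qed
qed

section \<open>Moves into a state\<close>

lemma at_word_cong_nth:
 assumes "length w = n" "!!i. i < n ==> w ! i = f i"
 shows "at_word y w y s = (ALL i<n. s (y - 1 - int i) = f i)"
 using assms by (auto simp: at_word_def)

lemma swap_word_at:
 assumes "j < length w" "j < d"
 shows "at_word y (swap_word ep j d w) y s = (ALL i < max (Suc d) (length w). s (y - 1 - int i) =
    (if i = j then ~ ep else if i = d \<or> length w <= i then ep else w ! i))"
 by (rule at_word_cong_nth)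
  (use assms in "auto simp: swap_word_def nth_append nth_list_update simp del: replicate_Suc")

lemma push_word_at:
 "at_word y (if d < length w then take d w @ drop (Suc d) w else replicate d e) y s <->
   (ALL i < max d (length w - 1). s (y - 1 - int i) =
    (if i < d then (if d < length w then w ! i else e) else w ! Suc i))"
 by (rule at_word_cong_nth) (auto simp: nth_append)

lemma jump_word_at:
 "at_word y (replicate n e @ w) y s = ((ALL i < n. s (y - 1 - int i) = e) & (ALL i<length w. s (y - 1 - int n - int i) = w ! i))"
proof -
 have "at_word y (replicate n e @ w) y s = ((ALL i < n + length w. s (y - 1 - int i) = (if i < n then e else w ! (i - n))))"
  by (rule at_word_cong_nth) (auto simp: nth_append)
 also have "... = ((ALL i < n. s (y - 1 - int i) = e) & (ALL i<length w. s (y - 1 - int n - int i) = w ! i))"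
  (is "_ = (?A & ?B)")
 proof
  assume l: "ALL i < n + length w. s (y - 1 - int i) = (if i < n then e else w ! (i - n))"
  have "s (y - 1 - int n - int i) = w ! i" if "i < length w" for i
   using l[rule_format, of "n + i"] that by (simp add: algebra_simps)
  thus "?A & ?B" using l by auto
 next
  assume r: "?A & ?B"
  show "ALL i < n + length w. s (y - 1 - int i) = (if i < n then e else w ! (i - n))"
  proof (intro allI impI)
   fix i assume "i < n + length w"
   thus "s (y - 1 - int i) = (if i < n then e else w ! (i - n))"
    using r conjunct2[OF r, rule_format, of "i - n"] by (cases "i < n") (auto simp: of_nat_diff algebra_simps)
  qed
 qed
 finally show ?thesis .
qed

lemma matches_Some: "matches (Some (i', (y0, w0))) i y' s = (i' = i & y' = y0 & at_word y0 w0 y0 s)"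
 unfolding matches_def by (auto simp: at_word_def)

lemma matches_if: "matches (if P then m else None) i y' s <-> P & matches m i y' s"
 unfolding matches_def by simp

lemma swap_match:
 "matches (gain e y w (Swap de j) d) (x, ep) y' s = (de = ep & y' = y & x = y - 1 - int d &
   j < length w & j < d & (ALL l. j <= l & l < d & l < length w --> w ! l = ep) & (d < length w --> w ! d ~= ep) &
   (ALL i < max (Suc d) (length w). s (y - 1 - int i) =
    (if i = j then ~ ep else if i = d \<or> length w <= i then ep else w ! i)))"
proof (cases "j < length w & j < d")
 case True
 thus ?thesis
  unfolding gain.simps matches_if matches_Some swap_word_at[OF conjunct1[OF True] conjunct2[OF True]] prod.inject
  by blast
next
 case False
 thus ?thesis by (auto simp: matches_if gain.simps)
qed

lemma push_match:
 "matches (gain e y w Push d) (x, ep) y' s = (ep = e & y' = y - 1 & x = y - 1 - int d &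
   (ALL l. l < d & l < length w --> w ! l = e) & (d < length w --> w ! d ~= e) &
   (ALL i < max d (length w - 1). s (y - 2 - int i) =
    (if i < d then (if d < length w then w ! i else e) else w ! Suc i)))"
proof -
 have *: "y - 2 - int i = (y - 1) - 1 - int i" for i by simp
 show ?thesis unfolding * gain.simps matches_if matches_Some push_word_at prod.inject by blast
qed

lemma jump_match:
 "matches (gain e y w Jump d) (x, ep) y' s = (ep = (~ e) & x = y & y' = y + 1 + int d &
   (ALL i < Suc d. s (y + int d - int i) = (~ e)) & at_word y w y s)"
proof -
 have "at_word (y + 1 + int d) (replicate (Suc d) (~ e) @ w) (y + 1 + int d) s <->
   (ALL i < Suc d. s (y + int d - int i) = (~ e)) & at_word y w y s"
  by (subst jump_word_at) (simp add: at_word_def algebra_simps)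
 thus ?thesis
  unfolding gain.simps matches_Some by auto
qed

lemma int_between_nat:
 fixes u y :: int
 assumes "u < y" obtains i where "u = y - 1 - int i"
 by (rule that[of "nat (y - 1 - u)"]) (use assms in simp)

text \<open>Ring and partner both lie left of the tag, so the tag stays and only a
  \<open>Swap\<close> can match: a \<open>Push\<close> or a \<open>Jump\<close> would need a
  constant stretch running over the partner, where the sign changes. The state is new only if the
  partner is a letter of the word.\<close>

lemma gain_inner:
 assumes z: "x < z" "z < y'" "s x = ep" "s z = (~ ep)" and bt: "!!u. x < u ==> u < z ==> s u = ep"
  and sy: "s y' = e"
 shows "(EX ka:gain_kinds w. EX d. matches (gain e y w ka d) (x, ep) y' s) <->
   ~ at_word y w y' s & at_word y w y' (s(x := ~ ep, z := ep))" (is "?l = (?r)")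
proof -
 let ?M = "%ka d. matches (gain e y w ka d) (x, ep) y' s"
 obtain d where d: "x = y' - 1 - int d" using int_between_nat[of x y'] z by auto
 obtain j where j: "z = y' - 1 - int j" using int_between_nat[of z y'] z by auto
 define c where "c i = s (y' - 1 - int i)" for i
 have cj: "c j = (~ ep)" and cd: "c d = ep" and jd: "j < d" using z d j by (auto simp: c_def)
 have cb: "c i = ep" if "j < i" "i <= d" for i
  using bt[of "y' - 1 - int i"] that d j cd by (cases "i = d") (auto simp: c_def)
 have aft: "(s(x := ~ ep, z := ep)) (y' - 1 - int i) = (if i = d then ~ ep else if i = j then ep else c i)" for i
  using d j jd by (auto simp: c_def)
 have no_push: "~ ?M Push k" for k
 proof
  assume m: "?M Push k"
  have k: "y' = y - 1" "x = y - 1 - int k" "ep = e" using m unfolding push_match by auto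
  hence "k = Suc d" using d by simp
  hence "s (y - 2 - int j) = (if k < length w then w ! j else e)" "k < length w ==> w ! j = e"
   using m jd unfolding push_match by auto
  thus False using cj k by (auto simp: c_def split: if_splits)
 qed
 have no_jump: "~ ?M Jump k" for k
 proof
  assume m: "?M Jump k"
  have k: "y' = y + 1 + int k" "x = y" "ep = (~ e)" using m unfolding jump_match by auto
  hence "k = d" using d by simp
  hence "s (y + int k - int j) = (~ e)" using m jd unfolding jump_match by auto
  thus False using cj k by (auto simp: c_def split: if_splits)
 qed
 have "?l = (EX j'<length w. EX d'. ?M (Swap ep j') d')"
  (is "_ = (?swap)")
 proof
  assume ?l
  then obtain ka d' where ka: "ka : gain_kinds w" and m: "?M ka d'" by blast
  show ?swap
  proof (cases ka)
   case (Swap de j')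
   have "de = ep" "j' < length w" using m unfolding Swap swap_match by blast+
   thus ?thesis using m Swap by blast
  qed (use m no_push no_jump in blast)+
 next
  assume ?swap
  then obtain j' d' where m: "j' < length w" "?M (Swap ep j') d'" by blast
  moreover have "Swap ep j' : gain_kinds w" using m(1) by (auto simp: gain_kinds_def)
  ultimately show ?l by blast
 qed
 also have "... = (y' = y & j < length w & (ALL i<length w. (if i = d then ~ ep else if i = j then ep else c i) = w ! i))"
  (is "_ = (?m)")
 proof
  assume "EX j'<length w. EX d'. ?M (Swap ep j') d'"
  then obtain j' d' where m: "?M (Swap ep j') d'" by blast
  have y: "y' = y" "d' = d" "j' < length w" "j' < d" using m d unfolding swap_match by auto
  have m1: "!!l. j' <= l ==> l < d ==> l < length w ==> w ! l = ep" and m2: "d < length w ==> w ! d ~= ep"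
   and m3: "!!i. i < max (Suc d) (length w) ==> c i = (if i = j' then ~ ep else if i = d \<or> length w <= i then ep else w ! i)"
   using m y unfolding swap_match c_def by auto
  have "j' = j"
  proof (rule ccontr)
   assume "j' ~= j"
   then consider "j < j'" | "j' < j" by linarith
   thus False
   proof cases
    case 1
    thus False using cb[of j'] m3[of j'] y by auto
   next
    case 2
    have "j < max (Suc d) (length w)" using jd by simp
    hence c: "c j = (if j = d \<or> length w <= j then ep else w ! j)" using m3 2 by simp
    hence "j < length w" using cj by (cases "length w <= j") auto
    hence "w ! j = ep" "c j = w ! j" using m1[of j] c 2 jd by auto
    thus False using cj by simp
   qed
  qed
  thus ?m using y m1[of j] m2 m3 jd by auto
 next
  assume m: ?m
  hence w: "w ! i = (if i = d then ~ ep else if i = j then ep else c i)" if "i < length w" for i using that by auto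
  have "?M (Swap ep j) d"
   unfolding swap_match
  proof (intro conjI allI impI)
   show "y' = y" "x = y - 1 - int d" "j < length w" "j < d" using m d jd by auto
   show "w ! l = ep" if "j <= l & l < d & l < length w" for l
    using that w[of l] cb[of l] by (cases "l = j") auto
   show "w ! d ~= ep" if "d < length w" using w[OF that] by simp
   fix i assume i: "i < max (Suc d) (length w)"
   have "s (y - 1 - int i) = c i" using m by (simp add: c_def)
   also have "c i = (if i = j then ~ ep else if i = d \<or> length w <= i then ep else w ! i)"
   proof -
    consider "i = j" | "i = d" | "i ~= j" "i ~= d" "length w <= i" | "i ~= j" "i ~= d" "i < length w" by linarith
    thus ?thesis
    proof cases
     case 3
     hence "j < i" "i <= d" using i m by auto
     thus ?thesis using cb 3 by simp
    next
     case 4 thus ?thesis using w[of i] by simp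
    qed (use cj cd jd in simp_all)
   qed
   finally show "s (y - 1 - int i) = (if i = j then ~ ep else if i = d \<or> length w <= i then ep else w ! i)" .
  qed simp
  thus "EX j'<length w. EX d'. ?M (Swap ep j') d'" using m by blast
 qed
 also have "... = (?r)"
 proof -
  have A: "at_word y w y' (s(x := ~ ep, z := ep)) <->
   y' = y & (ALL i<length w. (if i = d then ~ ep else if i = j then ep else c i) = w ! i)"
  proof (cases "y' = y")
   case True show ?thesis unfolding at_word_def True[symmetric] aft by simp
  qed (simp add: at_word_def)
  have B: "at_word y w y' s = (y' = y & (ALL i<length w. c i = w ! i))"
  proof (cases "y' = y")
   case True show ?thesis unfolding at_word_def c_def True[symmetric] by simp
  qed (simp add: at_word_def)
  \<comment> \<open>If the partner lies beyond the word, so does the ringing site, and no visible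
    letter changes.\<close>
  show ?thesis
  proof (cases "j < length w")
   case True
   hence "~ (ALL i<length w. c i = w ! i)"
    if "ALL i<length w. (if i = d then ~ ep else if i = j then ep else c i) = w ! i"
    using that[rule_format, of j] cj jd by force
   thus ?thesis using A B True by blast
  next
   case False
   hence "(ALL i<length w. c i = w ! i) <-> (ALL i<length w. (if i = d then ~ ep else if i = j then ep else c i) = w ! i)"
    using jd by auto
   thus ?thesis using A B False by blast
  qed
 qed
 finally show ?thesis .
qed

lemma swap_matchD:
 assumes "matches (gain e y w (Swap de j) d) (x, ep) y' s"
 shows "de = ep" "y' = y" "x = y - 1 - int d" "j < d" "s (y - 1 - int j) = (~ ep)" "s x = ep"
  "!!i. j < i ==> i <= d ==> s (y - 1 - int i) = ep"
proof -
 note m = assms[unfolded swap_match]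
 show "de = ep" "y' = y" "x = y - 1 - int d" "j < d" using m by auto
 have c: "s (y - 1 - int i) = (if i = j then ~ ep else if i = d \<or> length w <= i then ep else w ! i)" if "i <= d" for i
  using m that by auto
 show "s (y - 1 - int j) = (~ ep)" using c[of j] m by simp
 show *: "s (y - 1 - int i) = ep" if i: "j < i" "i <= d" for i
 proof -
  have "i = d \<or> length w <= i \<or> w ! i = ep" using m i by (meson le_neq_implies_less less_imp_le not_le)
  thus ?thesis using c[OF i(2)] i by auto
 qed
 show "s x = ep" using *[of d] m by simp
qed

lemma push_matchD:
 assumes "matches (gain e y w Push d) (x, ep) y' s" "s y' = e"
 shows "ep = e" "y' = y - 1" "x = y - 1 - int d" "!!u. x <= u ==> u <= y' ==> s u = e"
proof -
 note m = assms(1)[unfolded push_match]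
 show y: "ep = e" "y' = y - 1" "x = y - 1 - int d" using m by auto
 have c: "s (y - 2 - int i) = e" if "i < d" for i
  using m that by (auto simp del: of_nat_less_iff)
 show "s u = e" if "x <= u" "u <= y'" for u
 proof (cases "u = y'")
  case True thus ?thesis using assms by simp
 next
  case False
  hence "nat (y - 2 - u) < d" "y - 2 - int (nat (y - 2 - u)) = u" using that y by auto
  thus ?thesis using c by metis
 qed
qed

lemma jump_matchD:
 assumes "matches (gain e y w Jump d) (x, ep) y' s"
 shows "ep = (~ e)" "x = y" "y' = y + 1 + int d" "!!u. x <= u ==> u < y' ==> s u = (~ e)"
proof -
 note m = assms[unfolded jump_match]
 show y: "ep = (~ e)" "x = y" "y' = y + 1 + int d" using m by auto
 show "s u = (~ e)" if "x <= u" "u < y'" for u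
 proof -
  have "nat (y + int d - u) < Suc d" "y + int d - int (nat (y + int d - u)) = u" using that y by auto
  thus ?thesis using m by metis
 qed
qed

lemma gain_site:
 assumes m: "matches (gain e y w ka d) (x, ep) y' s" and sy: "s y' = e"
 shows "s x = ep & x <= y'"
proof (cases ka)
 case (Swap de j) thus ?thesis using swap_matchD[OF m[unfolded Swap]] by auto
next
 case Push thus ?thesis using push_matchD[OF m[unfolded Push] sy] by auto
next
 case Jump thus ?thesis using jump_matchD[OF m[unfolded Jump]] by auto
qed

text \<open>Displacement and sign tell the three kinds apart, the ringing site fixes
  \<open>d\<close>, and in a \<open>Swap\<close> the partner is the first opposite letter to the
  right of that site. This keeps an entrance into the state from being counted twice.\<close>

lemma gain_unique:
 assumes m: "matches (gain e y w ka d) (x, ep) y' s" and m': "matches (gain e y w ka' d') (x, ep) y' s" and sy: "s y' = e"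
 shows "ka = ka' & d = d'"
proof -
 let ?M = "%ka d. matches (gain e y w ka d) (x, ep) y' s"
 have sp: False if "?M (Swap de j) a" "?M Push b" for de j a b
  using swap_matchD(2)[OF that(1)] push_matchD(2)[OF that(2) sy] by simp
 have sj: False if "?M (Swap de j) a" "?M Jump b" for de j a b
  using swap_matchD(2)[OF that(1)] jump_matchD(3)[OF that(2)] by simp
 have pj: False if "?M Push a" "?M Jump b" for a b
  using push_matchD(1)[OF that(1) sy] jump_matchD(1)[OF that(2)] by simp
 have ss: "de = de' & j = j' & a = b" if "?M (Swap de j) a" "?M (Swap de' j') b" for de de' j j' a b
 proof -
  note 1 = swap_matchD[OF that(1)] and 2 = swap_matchD[OF that(2)]
  have ab: "a = b" using 1(3) 2(3) by simp
  have "j = j'"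
  proof (rule ccontr)
   assume "j ~= j'"
   hence "j < j' \<or> j' < j" by linarith
   thus False
    using 1(7)[of j'] 2(7)[of j] 1(4,5) 2(4,5) ab by (metis less_imp_le)
  qed
  thus ?thesis using 1(1) 2(1) ab by simp
 qed
 have pp: "a = b" if "?M Push a" "?M Push b" for a b
  using push_matchD(3)[OF that(1) sy] push_matchD(3)[OF that(2) sy] by simp
 have jj: "a = b" if "?M Jump a" "?M Jump b" for a b
  using jump_matchD(3)[OF that(1)] jump_matchD(3)[OF that(2)] by simp
 show ?thesis
 proof (cases ka)
  case 1: (Swap de j)
  show ?thesis
  proof (cases ka')
   case 2: (Swap de' j') show ?thesis using ss[OF m[unfolded 1] m'[unfolded 2]] 1 2 by simp
  next
   case 2: Push show ?thesis using sp[OF m[unfolded 1] m'[unfolded 2]] by simp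
  next
   case 2: Jump show ?thesis using sj[OF m[unfolded 1] m'[unfolded 2]] by simp
  qed
 next
  case 1: Push
  show ?thesis
  proof (cases ka')
   case 2: (Swap de' j') show ?thesis using sp[OF m'[unfolded 2] m[unfolded 1]] by simp
  next
   case 2: Push show ?thesis using pp[OF m[unfolded 1] m'[unfolded 2]] 1 2 by simp
  next
   case 2: Jump show ?thesis using pj[OF m[unfolded 1] m'[unfolded 2]] by simp
  qed
 next
  case 1: Jump
  show ?thesis
  proof (cases ka')
   case 2: (Swap de' j') show ?thesis using sj[OF m'[unfolded 2] m[unfolded 1]] by simp
  next
   case 2: Push show ?thesis using pj[OF m'[unfolded 2] m[unfolded 1]] by simp
  next
   case 2: Jump show ?thesis using jj[OF m[unfolded 1] m'[unfolded 2]] 1 2 by simp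
  qed
 qed
qed

lemma gain_pushed:
 assumes z: "x <= y'" "y' < z" and bt: "!!u. x <= u ==> u <= y' ==> s u = e"
 shows "(EX ka:gain_kinds w. EX d. matches (gain e y w ka d) (x, e) y' s) <->
   ~ at_word y w y' s & at_word y w (y' + 1) (s(x := ~ e, z := e))" (is "?l = (?r)")
proof -
 define d where "d = nat (y' - x)"
 have d: "x = y' - int d" using z by (simp add: d_def)
 define c where "c i = s (y' - int i)" for i
 have ce: "c i = e" if "i <= d" for i using bt[of "y' - int i"] that d by (auto simp: c_def)
 have aft: "(s(x := ~ e, z := e)) (y' - int i) = (if i = d then ~ e else c i)" for i
  using z d by (auto simp: c_def)
 have sy: "s y' = e" using bt z by simp
 have A: "at_word y w (y' + 1) (s(x := ~ e, z := e)) <-> y' = y - 1 & (ALL i<length w. (if i = d then ~ e else c i) = w ! i)"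
 proof (cases "y = y' + 1")
  case True show ?thesis unfolding at_word_def True using aft by simp
 qed (auto simp: at_word_def)
 show ?thesis
 proof
  assume ?l
  then obtain ka k where m: "matches (gain e y w ka k) (x, e) y' s" by blast
  have "ka = Push"
  proof (cases ka)
   case (Swap de j)
   hence s: "matches (gain e y w (Swap de j) k) (x, e) y' s" using m by simp
   have "s (y - 1 - int j) = e" using swap_matchD[OF s] bt[of "y - 1 - int j"] by simp
   thus ?thesis using swap_matchD(5)[OF s] by simp
  next
   case Jump thus ?thesis using jump_matchD(1)[OF m[unfolded Jump]] by simp
  qed simp
  note m = m[unfolded this]
  have y: "y' = y - 1" "k = d" using push_matchD[OF m sy] d by auto
  have m1: "!!l. l < d ==> l < length w ==> w ! l = e" and m2: "d < length w ==> w ! d ~= e"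
   and m3: "!!i. i < max d (length w - 1) ==> s (y - 2 - int i) =
    (if i < d then (if d < length w then w ! i else e) else w ! Suc i)"
   using m y(2) unfolding push_match by blast+
  have "(if i = d then ~ e else c i) = w ! i" if i: "i < length w" for i
  proof -
   consider "i = d" | "i < d" | "d < i" by linarith
   thus ?thesis
   proof cases
    case 3
    then obtain i' where i': "i = Suc i'" by (cases i) auto
    have "s (y - 2 - int i') = w ! Suc i'" using m3[of i'] i i' 3 by auto
    moreover have "y' - int i = y - 2 - int i'" using y i' by simp
    hence "c i = s (y - 2 - int i')" by (simp only: c_def)
    ultimately show ?thesis using 3 i' by simp
   next
    case 1 thus ?thesis using m2 i by auto
   next
    case 2 thus ?thesis using m1[of i] i ce[of i] by simp
   qed
  qed
  thus ?r using A y by (simp add: at_word_def)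
 next
  assume ?r
  hence y: "y' = y - 1" and w: "!!i. i < length w ==> w ! i = (if i = d then ~ e else c i)" using A by auto
  have P: "matches (gain e y w Push d) (x, e) y' s"
   unfolding push_match
  proof (intro conjI allI impI)
   show "y' = y - 1" "x = y - 1 - int d" using y d by auto
   show "w ! l = e" if "l < d & l < length w" for l using that w ce by auto
   show "w ! d ~= e" if "d < length w" using that w by auto
   fix i assume i: "i < max d (length w - 1)"
   have "y - 2 - int i = y' - int (Suc i)" using y by simp
   hence "s (y - 2 - int i) = c (Suc i)" by (simp only: c_def)
   also have "... = (if i < d then (if d < length w then w ! i else e) else w ! Suc i)"
    using ce[of "Suc i"] ce[of i] w[of i] w[of "Suc i"] i by auto
   finally show "s (y - 2 - int i) = (if i < d then (if d < length w then w ! i else e) else w ! Suc i)" .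
  qed simp
  have Q: "Push : gain_kinds w" by (simp add: gain_kinds_def)
  show ?l using P Q by (rule_tac bexI[where x = Push], rule_tac exI[where x = d])
 qed
qed

lemma gain_jump:
 assumes z: "x < y'" and bt: "!!u. x <= u ==> u < y' ==> s u = (~ e)" and sy: "s y' = e"
 shows "(EX ka:gain_kinds w. EX d. matches (gain e y w ka d) (x, ~ e) y' s) <->
   ~ at_word y w y' s & at_word y w x (s(x := e, y' := ~ e))" (is "?l = (?r)")
proof -
 have "(s(x := e, y' := ~ e)) (x - 1 - int i) = s (x - 1 - int i)" for i using z by simp
 hence A: "at_word y w x (s(x := e, y' := ~ e)) <-> x = y & at_word y w y s"
  unfolding at_word_def by (cases "x = y") simp_all
 show ?thesis
 proof
  assume ?l
  then obtain ka k where m: "matches (gain e y w ka k) (x, ~ e) y' s" by blast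
  have "ka = Jump"
  proof (cases ka)
   case (Swap de j)
   hence s: "matches (gain e y w (Swap de j) k) (x, ~ e) y' s" using m by simp
   have "s (y - 1 - int j) = (~ e)" using swap_matchD[OF s] bt[of "y - 1 - int j"] by simp
   thus ?thesis using swap_matchD(5)[OF s] by simp
  next
   case Push thus ?thesis using push_matchD(1)[OF m[unfolded Push] sy] by simp
  qed simp
  note m = m[unfolded this]
  thus ?r using A z m[unfolded jump_match] by (auto simp: at_word_def)
 next
  assume ?r
  hence y: "x = y" "at_word y w y s" using A by auto
  have P: "matches (gain e y w Jump (nat (y' - x - 1))) (x, ~ e) y' s"
   unfolding jump_match using y z bt by auto
  have Q: "Jump : gain_kinds w" by (simp add: gain_kinds_def)
  show ?l using P Q by (rule_tac bexI[where x = Jump], rule_tac exI[where x = "nat (y' - x - 1)"])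
 qed
qed

lemma at_word_cong:
 assumes "!!u. u < y ==> s u = s' u"
 shows "at_word y w y' s = (at_word y w y' s')"
 unfolding at_word_def using assms by simp

text \<open>The enumeration is complete: a ring enters the state exactly when one of the listed
  moves occurs. Together with \<open>gain_unique\<close> this turns pathwise numbers of entrances
  into sums over \<open>gain\<close>.\<close>

theorem gain_iff:
 assumes g: "good_ring e x ep y' s"
 shows "(EX ka:gain_kinds w. EX d. matches (gain e y w ka d) (x, ep) y' s) <->
   ~ at_word y w y' s & at_word y w (push x ep s y') (toom_ring x ep s)" (is "?l = (?r)")
proof -
 have sy: "s y' = e" using g by (simp add: good_ring_def)
 have gs: "s x = ep & x <= y'" if "matches (gain e y w ka d) (x, ep) y' s" for ka d
  using gain_site that sy by blast
 from g show ?thesis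
 proof (cases rule: ring_cases)
  case idle
  hence "~ ?l" using gs by blast
  thus ?thesis unfolding idle by blast
 next
  case (right z)
  hence "~ ?l" using gs by force
  moreover have "at_word y w y' (toom_ring x ep s) = (at_word y w y' s)"
  proof (cases "y' = y")
   case True
   show ?thesis by (rule at_word_cong) (use right True in auto)
  qed (simp add: at_word_def)
  ultimately show ?thesis unfolding right(2) by blast
 next
  case (inner z)
  show ?thesis unfolding inner(6,7)
   by (rule gain_inner) (use inner sy in auto)
 next
  case (pushed z)
  have "s u = e" if "x <= u" "u <= y'" for u
   using pushed(3,4) pushed(6)[of u] pushed(2) that by (cases "u = x") auto
  thus ?thesis using gain_pushed[of x y' z s e w y] pushed by auto
 next
  case jump
  have "s u = (~ e)" if "x <= u" "u < y'" for u
   using jump(2,3) jump(4)[of u] that by (cases "u = x") auto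
  thus ?thesis using gain_jump[of x y' s e w y] jump sy by auto
 qed
qed

section \<open>Moves out of a state\<close>

lemma out_match:
 "matches (loss e y w (Out de) d) (x, ep) y' s = (de = ep & y' = y & x = y - 1 - int d & at_word y w y s &
   (d < length w --> w ! d = ep) & (ALL i. length w <= i & i <= d --> s (y - 1 - int i) = ep))"
proof -
 have "at_word y (if d < length w then w else w @ replicate (d - length w + 1) de) y s <->
   at_word y w y s & (ALL i. length w <= i & i <= d --> s (y - 1 - int i) = de)"
 proof (cases "d < length w")
  case False
  have "at_word y (w @ replicate (d - length w + 1) de) y s = (ALL i<Suc d. s (y - 1 - int i) = (if i < length w then w ! i else de))"
   using False by (intro at_word_cong_nth) (auto simp: nth_append simp del: replicate_Suc)
  also have "... = (at_word y w y s & (ALL i. length w <= i & i <= d --> s (y - 1 - int i) = de))"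
   (is "?P = _")
  proof
   assume P: ?P
   have "s (y - 1 - int i) = w ! i" if "i < length w" for i using P[rule_format, of i] that False by simp
   moreover have "s (y - 1 - int i) = de" if "length w <= i & i <= d" for i using P[rule_format, of i] that by simp
   ultimately show "at_word y w y s & (ALL i. length w <= i & i <= d --> s (y - 1 - int i) = de)"
    unfolding at_word_def by blast
  qed (simp add: at_word_def)
  finally show ?thesis using False by simp
 qed auto
 thus ?thesis unfolding loss.simps matches_if matches_Some prod.inject by auto
qed

lemma self_match:
 "matches (loss e y w Self d) (x, ep) y' s = (d = 0 & ep = e & y' = y & x = y & at_word y w y s)"
 unfolding loss.simps matches_if matches_Some prod.inject by auto

lemma loss_unique:
 assumes m: "matches (loss e y w ka d) (x, ep) y' s" and m': "matches (loss e y w ka' d') (x, ep) y' s"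
 shows "ka = ka' & d = d'"
 using assms by (cases ka; cases ka') (auto simp: out_match self_match)

lemma loss_match:
 assumes sy: "s y' = e"
 shows "(EX ka:loss_kinds. EX d. matches (loss e y w ka d) (x, ep) y' s) <->
  at_word y w y' s & s x = ep & x <= y' & (ALL i. length w <= i & x <= y - 1 - int i --> s (y - 1 - int i) = ep)"
  (is "?l = (?r)")
proof
 assume ?l
 then obtain ka d where m: "matches (loss e y w ka d) (x, ep) y' s" by blast
 show ?r
 proof (cases ka)
  case (Out de)
  note m = m[unfolded Out out_match]
  hence "s x = ep" by (cases "d < length w") (auto simp: at_word_def)
  thus ?thesis using m by auto
 next
  case Self
  thus ?thesis using m sy by (auto simp: self_match)
 qed
next
 assume r: ?r
 hence y: "y' = y" by (simp add: at_word_def)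
 show ?l
 proof (cases "x = y'")
  case True
  hence "matches (loss e y w Self 0) (x, ep) y' s" using r y sy by (auto simp: self_match)
  thus ?thesis unfolding loss_kinds_def by blast
 next
  case False
  then obtain d where d: "x = y - 1 - int d" using int_between_nat[of x y] r y by auto
  have "matches (loss e y w (Out ep) d) (x, ep) y' s"
   using r y d by (auto simp: out_match at_word_def)
  moreover have "Out ep : loss_kinds" by (cases ep) (auto simp: loss_kinds_def)
  ultimately show ?thesis by blast
 qed
qed

theorem loss_iff:
 assumes g: "good_ring e x ep y' s"
 shows "(EX ka:loss_kinds. EX d. matches (loss e y w ka d) (x, ep) y' s) <->
   at_word y w y' s & ~ at_word y w (push x ep s y') (toom_ring x ep s)"
proof -
 let ?Q = "ALL i. length w <= i & x <= y - 1 - int i --> s (y - 1 - int i) = ep"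
 have sy: "s y' = e" using g by (simp add: good_ring_def)
 have L: "(EX ka:loss_kinds. EX d. matches (loss e y w ka d) (x, ep) y' s) <->
  at_word y w y' s & s x = ep & x <= y' & ?Q"
  by (rule loss_match) (rule sy)
 have "at_word y w y' s & s x = ep & x <= y' & ?Q
  <-> at_word y w y' s & ~ at_word y w (push x ep s y') (toom_ring x ep s)"
  using g
 proof (cases rule: ring_cases)
  case idle
  thus ?thesis unfolding idle(2,3) by blast
 next
  case (right z)
  have "at_word y w y' (toom_ring x ep s) = (at_word y w y' s)"
  proof (cases "y' = y")
   case True
   show ?thesis by (rule at_word_cong) (use right True in auto)
  qed (simp add: at_word_def)
  thus ?thesis unfolding right(2) using right(1) by auto
 next
  case (inner z)
  show ?thesis
  proof (cases "at_word y w y' s")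
   case True
   hence y: "y' = y" by (simp add: at_word_def)
   obtain j where j: "z = y - 1 - int j" using int_between_nat[of z y] inner y by auto
   \<comment> \<open>A partner beyond the word would itself break the run that \<open>?Q\<close>
     demands.\<close>
   have "?Q <-> j < length w"
   proof
    assume a: "?Q"
    show "j < length w" using a[rule_format, of j] inner j by force
   next
    assume jl: "j < length w"
    show "?Q"
    proof (intro allI impI)
     fix i assume "length w <= i & x <= y - 1 - int i"
     thus "s (y - 1 - int i) = ep"
      using jl j inner(3) inner(5)[of "y - 1 - int i"] by (cases "x = y - 1 - int i") auto
    qed
   qed
   also have "... = (~ at_word y w (push x ep s y') (toom_ring x ep s))"
   proof
    assume jl: "j < length w"
    have "s z = w ! j" using True jl j by (simp add: at_word_def)
    thus "~ at_word y w (push x ep s y') (toom_ring x ep s)"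
     unfolding inner(6,7) using jl j inner(4) unfolding at_word_def by force
   next
    assume n: "~ at_word y w (push x ep s y') (toom_ring x ep s)"
    show "j < length w"
    proof (rule ccontr)
     assume "~ j < length w"
     hence "(s(x := ~ ep, z := ep)) (y - 1 - int i) = s (y - 1 - int i)" if "i < length w" for i
      using j inner(1) that by simp
     hence "at_word y w (push x ep s y') (toom_ring x ep s)"
      unfolding inner(6,7) using True unfolding at_word_def by simp
     thus False using n by simp
    qed
   qed
   finally show ?thesis using True inner by auto
  qed simp
 next
  case (pushed z)
  have *: "s u = ep" if "x <= u" "u < y'" for u
   using pushed(3) pushed(6)[of u] pushed(2) that by (cases "u = x") auto
  have "?Q" if "y' = y"
   using * that by simp
  moreover have "~ at_word y w (push x ep s y') (toom_ring x ep s)" if "y' = y"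
   using pushed(7) that by (simp add: at_word_def)
  ultimately show ?thesis using pushed(1,3) unfolding at_word_def[of y w y'] by blast
 next
  case jump
  have *: "s u = ep" if "x <= u" "u < y'" for u
   using jump(2) jump(4)[of u] that by (cases "u = x") auto
  have "?Q" if "y' = y"
   using * that by simp
  moreover have "~ at_word y w (push x ep s y') (toom_ring x ep s)" if "y' = y"
   using jump(1,5) that by (simp add: at_word_def)
  moreover have "x <= y'" using jump(1) by simp
  ultimately show ?thesis using jump(2) unfolding at_word_def[of y w y'] by blast
 qed
 thus ?thesis unfolding L .
qed

section \<open>Geometric sums and product weights of words\<close>

lemma sums_tail_geometric:
 fixes f :: "nat => real"
 assumes "!!d. d < r ==> f d = 0" "!!k. f (k + r) = b * rh ^ k" "0 <= rh" "rh < 1"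
 shows "f sums (b / (1 - rh))"
proof -
 have "(%k. b * rh ^ k) sums (b * (1 / (1 - rh)))"
  using assms by (intro sums_mult geometric_sums) simp
 hence "(%k. f (k + r)) sums (b / (1 - rh))" using assms(2) by simp
 hence "f sums (b / (1 - rh) + (SUM d<r. f d))" by (simp add: sums_iff_shift)
 thus ?thesis using assms(1) by simp
qed

lemma sum_tail_geometric_le:
 fixes f :: "nat => real"
 assumes nn: "!!d. 0 <= f d" and a: "(SUM d<r. f d) <= a" and b: "!!k. f (k + r) <= b * rh ^ k" and "0 <= rh" "rh < 1"
 shows "summable f" "suminf f <= a + b / (1 - rh)"
proof -
 have g: "(%k. b * rh ^ k) sums (b * (1 / (1 - rh)))"
  using assms by (intro sums_mult geometric_sums) simp
 have s: "summable (%k. f (k + r))"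
  by (rule summable_comparison_test[OF _ sums_summable[OF g]]) (use nn b in auto)
 thus "summable f" by (simp add: summable_iff_shift)
 hence "suminf f = (\<Sum>k. f (k + r)) + (SUM d<r. f d)" by (rule suminf_split_initial_segment)
 also have "(\<Sum>k. f (k + r)) <= b * (1 / (1 - rh))"
  using suminf_le[OF b s sums_summable[OF g]] sums_unique[OF g] by simp
 finally show "suminf f <= a + b / (1 - rh)" using a by simp
qed

lemma sum_if_card:
 fixes a :: real and n :: nat
 shows "(SUM j<n. if P j then a else 0) = real (card {j. j < n & P j}) * a"
proof -
 have "(SUM j<n. if P j then a else 0) = (SUM j:{j. j < n & P j}. a)"
  by (rule sum.mono_neutral_cong_right) auto
 thus ?thesis by simp
qed

text \<open>\<open>e\<close> is the sign of the tag, \<open>p0\<close> the density of that sign, and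
  \<open>ra\<close> gives the clock rate for each sign.\<close>

locale word_weights =
 fixes e :: sign and p0 :: real and ra :: "sign => real"
 assumes p0: "0 < p0" "p0 < 1" and ra: "!!ep. 0 <= ra ep"
begin

definition wt :: "bool => real" where "wt b = (if b = e then p0 else 1 - p0)"

definition word_wt :: "bool list => real" where "word_wt w = prod_list (map wt w)"

lemma wt_pos: "0 < wt b" and wt_less1: "wt b < 1"
 using p0 by (auto simp: wt_def)

lemma wt_not: "wt (~ b) = 1 - wt b"
 by (cases "b = e") (auto simp: wt_def)

lemma word_wt_Nil [simp]: "word_wt [] = 1" and word_wt_Cons [simp]: "word_wt (b # w) = wt b * word_wt w"
 and word_wt_append [simp]: "word_wt (w @ w') = word_wt w * word_wt w'"
 and word_wt_replicate [simp]: "word_wt (replicate n b) = wt b ^ n"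
 by (auto simp: word_wt_def)

lemma word_wt_pos: "0 < word_wt w"
 by (induction w) (auto simp: wt_pos)

lemma word_wt_update: "j < length w ==> word_wt (w[j := b]) * wt (w ! j) = word_wt w * wt b"
 by (induction w arbitrary: j) (auto split: nat.split simp: less_Suc_eq_0_disj mult_ac)

lemma word_wt_delete: "d < length w ==> word_wt (take d w @ drop (Suc d) w) * wt (w ! d) = word_wt w"
 by (subst (3) id_take_nth_drop[of d w]) auto

lemma word_wt_swap:
 assumes "j < d" "d < length w" "w ! j = ep" "w ! d = (~ ep)"
 shows "word_wt (w[j := ~ ep, d := ep]) = word_wt w"
proof -
 have "word_wt (w[j := ~ ep, d := ep]) * wt (~ ep) = word_wt (w[j := ~ ep]) * wt ep"
  using word_wt_update[of d "w[j := ~ ep]" ep] assms by simp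
 also have "... = word_wt w * wt (~ ep)"
  using word_wt_update[of j w "~ ep"] assms by simp
 finally show ?thesis using wt_pos[of "~ ep"] by simp
qed

lemma word_wt_flip:
 assumes "j < length w" "w ! j = ep"
 shows "word_wt (w[j := ~ ep]) = word_wt w * (1 - wt ep) / wt ep"
 using word_wt_update[OF assms(1), of "~ ep"] assms wt_pos[of ep] by (simp add: field_simps wt_not)

definition move_term :: "(int => bool list => real) => move option => real" where
 "move_term F m = (case m of None => 0 | Some (i, y', w') => ra (snd i) * F y' w')"

lemma move_term_simps [simp]: "move_term F None = 0"
 "move_term F (Some (i, y', w')) = ra (snd i) * F y' w'"
 by (auto simp: move_term_def)

lemma move_term_if: "move_term F (if P then m else None) = (if P then move_term F m else 0)"
 by simp

text \<open>Applied to the occupation times of all states, \<open>gain_sum\<close> and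
  \<open>loss_sum\<close> are the expected numbers of entrances into and exits from
  \<open>(y, w)\<close>.\<close>

definition gain_sum :: "(int => bool list => real) => int => bool list => real" where
 "gain_sum F y w = (SUM ka:gain_kinds w. \<Sum>d. move_term F (gain e y w ka d))"

definition loss_sum :: "(int => bool list => real) => int => bool list => real" where
 "loss_sum F y w = (SUM ka:loss_kinds. \<Sum>d. move_term F (loss e y w ka d))"

lemma finite_gain_kinds [simp]: "finite (gain_kinds w)" and finite_loss_kinds [simp]: "finite loss_kinds"
 by (auto simp: gain_kinds_def loss_kinds_def)

lemma sum_gain_kinds:
 "(SUM ka:gain_kinds w. g ka) = (SUM ep:UNIV. SUM j<length w. g (Swap ep j)) + g Push + (g Jump :: real)"
proof -
 have "inj_on (%(ep, j). Swap ep j) (UNIV \<times> {..<length w})" by (auto simp: inj_on_def)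
 hence "(SUM ka:(%(ep, j). Swap ep j) ` (UNIV \<times> {..<length w}). g ka) = (SUM ep:UNIV. SUM j<length w. g (Swap ep j))"
  by (simp add: sum.reindex sum.cartesian_product case_prod_unfold o_def)
 moreover have "(SUM ka:gain_kinds w. g ka) = (SUM ka:(%(ep, j). Swap ep j) ` (UNIV \<times> {..<length w}). g ka) + (SUM ka:{Push, Jump}. g ka)"
  unfolding gain_kinds_def by (rule sum.union_disjoint) auto
 ultimately show ?thesis by simp
qed

lemma sum_loss_kinds: "(SUM ka:loss_kinds. g ka) = (SUM ep:UNIV. g (Out ep)) + (g Self :: real)"
 unfolding loss_kinds_def UNIV_bool by (simp add: add_ac)

subsection \<open>Product functionals\<close>

context
 fixes V :: "int => real" and C :: real
 assumes V: "!!y. \<bar>V y\<bar> <= C"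
begin

abbreviation "PF \<equiv> %y w. word_wt w * V y"

text \<open>If the run of \<open>ep\<close> from letter \<open>j\<close> ends inside the word,
  exactly one distance contributes, and the exchange keeps the weight. If it reaches the end of the
  word, flipping letter \<open>j\<close> costs the factor \<open>(1 - wt ep) / wt ep\<close> and the
  added letters give \<open>wt ep + wt ep ^ 2 + ...\<close>, whose sum undoes it. Either way each
  letter \<open>ep\<close> yields the same amount.\<close>

lemma prod_swap:
 assumes "j < length w"
 shows "(%d. move_term PF (gain e y w (Swap ep j) d)) sums (if w ! j = ep then ra ep * (word_wt w * V y) else 0)"
proof (cases "w ! j = ep")
 case False
 hence "move_term PF (gain e y w (Swap ep j) d) = 0" for d
  using assms by (auto simp: gain.simps move_term_if)
 thus ?thesis using False by simp
next
 case True
 let ?f = "%d. move_term PF (gain e y w (Swap ep j) d)"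
 show ?thesis
 proof (cases "EX d. j < d & d < length w & w ! d ~= ep")
  case ex: True
  define d0 where "d0 = (LEAST d. j < d & d < length w & w ! d ~= ep)"
  have d0: "j < d0" "d0 < length w" "w ! d0 ~= ep" using LeastI_ex[OF ex] unfolding d0_def by auto
  have bef: "w ! l = ep" if "j <= l" "l < d0" for l
   using not_less_Least[of l "%d. j < d & d < length w & w ! d ~= ep"] that d0 True
   unfolding d0_def[symmetric] by (cases "l = j") auto
  have "?f d = 0" if "d ~= d0" for d
  proof (cases "d < d0")
   case True
   thus ?thesis using bef[of d] d0 by (auto simp: gain.simps move_term_if)
  next
   case False
   hence "j <= d0 & d0 < d & d0 < length w & w ! d0 ~= ep" using that d0 by auto
   hence "~ (ALL l. j <= l & l < d & l < length w --> w ! l = ep)" by blast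
   thus ?thesis by (simp only: gain.simps move_term_if) simp
  qed
  hence "?f sums ?f d0" by (intro sums_finite[of "{d0}" ?f, simplified]) auto
  moreover have "?f d0 = ra ep * (word_wt w * V y)"
   using d0 bef assms word_wt_swap[of j d0 w ep] True by (auto simp: gain.simps swap_word_def)
  ultimately show ?thesis using True by simp
 next
  case nex: False
  have "?f d = 0" if "d < length w" for d
   using nex that by (auto simp: gain.simps move_term_if)
  moreover have "?f (k + length w) = ra ep * (word_wt w * (1 - wt ep) * V y) * wt ep ^ k" for k
  proof -
   have "ALL l. j <= l & l < k + length w & l < length w --> w ! l = ep"
    using nex True by (metis le_neq_implies_less)
   hence "?f (k + length w) = ra ep * (word_wt (w[j := ~ ep]) * wt ep ^ Suc k * V y)"
    using assms by (simp add: gain.simps swap_word_def)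
   thus ?thesis using word_wt_flip[OF assms True] wt_pos[of ep] by simp
  qed
  ultimately have "?f sums (ra ep * (word_wt w * (1 - wt ep) * V y) / (1 - wt ep))"
   by (intro sums_tail_geometric[of "length w"]) (use wt_pos[of ep] wt_less1[of ep] in auto)
  thus ?thesis using wt_less1[of ep] True by simp
 qed
qed

text \<open>The same dichotomy as for exchanges: either the first letter of the opposite sign is
  deleted, which divides the weight by \<open>1 - p0\<close>, or all letters have sign
  \<open>e\<close> and the powers of \<open>p0\<close> sum to the same factor.\<close>

lemma prod_push:
 "(%d. move_term PF (gain e y w Push d)) sums (ra e * (word_wt w * V (y - 1)) / (1 - p0))"
proof (cases "EX d. d < length w & w ! d ~= e")
 case ex: True
 let ?f = "%d. move_term PF (gain e y w Push d)"
 define d0 where "d0 = (LEAST d. d < length w & w ! d ~= e)"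
 have d0: "d0 < length w" "w ! d0 ~= e" using LeastI_ex[OF ex] unfolding d0_def by auto
 have bef: "w ! l = e" if "l < d0" for l
  using not_less_Least[of l "%d. d < length w & w ! d ~= e"] that d0
  unfolding d0_def[symmetric] by auto
 have "?f d = 0" if "d ~= d0" for d
 proof (cases "d < d0")
  case True
  thus ?thesis using bef[of d] d0 by (auto simp: gain.simps move_term_if)
 next
  case False
  hence "d0 < d & d0 < length w & w ! d0 ~= e" using that d0 by auto
  hence "~ (ALL l. l < d & l < length w --> w ! l = e)" by blast
  thus ?thesis by (simp only: gain.simps move_term_if) simp
 qed
 hence "?f sums ?f d0" by (intro sums_finite[of "{d0}" ?f, simplified]) auto
 moreover have "?f d0 = ra e * (word_wt (take d0 w @ drop (Suc d0) w) * V (y - 1))"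
  using d0 bef by (auto simp: gain.simps)
 moreover have "word_wt (take d0 w @ drop (Suc d0) w) = word_wt w / (1 - p0)"
  using word_wt_delete[OF d0(1)] d0(2) p0 by (simp add: wt_def field_simps)
 ultimately show ?thesis by simp
next
 case nex: False
 let ?f = "%d. move_term PF (gain e y w Push d)"
 have w: "w = replicate (length w) e"
  using nex by (intro nth_equalityI) auto
 have "?f d = 0" if "d < length w" for d
  using nex that by (auto simp: gain.simps move_term_if)
 moreover have "?f (k + length w) = ra e * (word_wt w * V (y - 1)) * p0 ^ k" for k
 proof -
  have "?f (k + length w) = ra e * (p0 ^ (k + length w) * V (y - 1))"
   using nex by (simp add: gain.simps wt_def)
  moreover have "word_wt w = p0 ^ length w" by (subst w) (simp add: wt_def)
  ultimately show ?thesis by (simp add: power_add mult_ac)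
 qed
 ultimately show ?thesis by (intro sums_tail_geometric[of "length w"]) (use p0 in auto)
qed

lemma prod_jump_summable: "summable (%d. (1 - p0) ^ Suc d * V (y + 1 + int d))"
proof (rule summable_comparison_test)
 show "EX N. ALL n>=N. norm ((1 - p0) ^ Suc n * V (y + 1 + int n)) <= (1 - p0) ^ Suc n * C"
  using V p0 by (auto simp: abs_mult intro!: mult_mono)
 show "summable (%n. (1 - p0) ^ Suc n * C)"
  using p0 by (intro summable_mult2) (simp add: summable_mult)
qed

lemma prod_jump:
 "(%d. move_term PF (gain e y w Jump d)) sums (ra (~ e) * (word_wt w * (\<Sum>d. (1 - p0) ^ Suc d * V (y + 1 + int d))))"
proof -
 have "(%d. ra (~ e) * (word_wt w * ((1 - p0) ^ Suc d * V (y + 1 + int d)))) sums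
   (ra (~ e) * (word_wt w * (\<Sum>d. (1 - p0) ^ Suc d * V (y + 1 + int d))))"
  by (intro sums_mult summable_sums prod_jump_summable)
 moreover have "move_term PF (gain e y w Jump d) = ra (~ e) * (word_wt w * ((1 - p0) ^ Suc d * V (y + 1 + int d)))" for d
  by (simp add: gain.simps wt_def)
 ultimately show ?thesis by simp
qed

lemma prod_out:
 "(%d. move_term PF (loss e y w (Out ep) d)) sums
   (ra ep * (word_wt w * V y) * (real (card {d. d < length w & w ! d = ep}) + wt ep / (1 - wt ep)))"
proof -
 let ?f = "%d. move_term PF (loss e y w (Out ep) d)"
 have "(%k. ra ep * (word_wt w * V y) * wt ep * wt ep ^ k) sums (ra ep * (word_wt w * V y) * wt ep * (1 / (1 - wt ep)))"
  using wt_pos[of ep] wt_less1[of ep] by (intro sums_mult geometric_sums) simp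
 moreover have "?f (k + length w) = ra ep * (word_wt w * V y) * wt ep * wt ep ^ k" for k
  by (simp add: loss.simps)
 ultimately have "(%k. ?f (k + length w)) sums (ra ep * (word_wt w * V y) * wt ep * (1 / (1 - wt ep)))" by simp
 hence "?f sums (ra ep * (word_wt w * V y) * wt ep * (1 / (1 - wt ep)) + (SUM d<length w. ?f d))"
  by (rule sums_iff_shift[THEN iffD1])
 moreover have "(SUM d<length w. ?f d) = (SUM d<length w. if w ! d = ep then ra ep * (word_wt w * V y) else 0)"
  by (intro sum.cong) (auto simp: loss.simps)
 moreover have "... = real (card {d. d < length w & w ! d = ep}) * (ra ep * (word_wt w * V y))"
  by (rule sum_if_card)
 ultimately show ?thesis by (simp add: algebra_simps)
qed

lemma prod_self: "(%d. move_term PF (loss e y w Self d)) sums (ra e * (word_wt w * V y))"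
 using sums_finite[of "{0}" "%d. move_term PF (loss e y w Self d)"] by (simp add: loss.simps)

text \<open>Entrances by exchange yield \<open>ra ep\<close> for each letter \<open>ep\<close>,
  exactly what exits through rings at these letters remove. For the sign \<open>e\<close> the
  remaining loss is \<open>p0 / (1 - p0)\<close> from rings beyond the word plus \<open>1\<close>
  from the tag's own clock, together \<open>1 / (1 - p0)\<close>; for the opposite sign it is
  \<open>(1 - p0) / p0\<close>. The bracket is the forward operator of a walk on the integers and
  does not involve \<open>w\<close>.\<close>

theorem burke:
 "gain_sum PF y w - loss_sum PF y w = word_wt w *
   (ra e / (1 - p0) * (V (y - 1) - V y) +
   ra (~ e) * ((\<Sum>d. (1 - p0) ^ Suc d * V (y + 1 + int d)) - (1 - p0) / p0 * V y))"
proof -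
 have sw: "(SUM j<length w. \<Sum>d. move_term PF (gain e y w (Swap ep j) d)) =
   ra ep * (word_wt w * V y) * real (card {d. d < length w & w ! d = ep})" for ep
 proof -
  have "(SUM j<length w. \<Sum>d. move_term PF (gain e y w (Swap ep j) d)) =
    (SUM j<length w. if w ! j = ep then ra ep * (word_wt w * V y) else 0)"
   by (intro sum.cong refl sums_unique[symmetric] prod_swap) simp
  thus ?thesis unfolding sum_if_card by simp
 qed
 have "gain_sum PF y w = (SUM ep:UNIV. ra ep * (word_wt w * V y) * real (card {d. d < length w & w ! d = ep}))
   + ra e * (word_wt w * V (y - 1)) / (1 - p0) + ra (~ e) * (word_wt w * (\<Sum>d. (1 - p0) ^ Suc d * V (y + 1 + int d)))"
  unfolding gain_sum_def sum_gain_kinds sw sums_unique[OF prod_push, symmetric] sums_unique[OF prod_jump, symmetric] ..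
 moreover have "loss_sum PF y w = (SUM ep:UNIV. ra ep * (word_wt w * V y) * (real (card {d. d < length w & w ! d = ep}) + wt ep / (1 - wt ep)))
   + ra e * (word_wt w * V y)"
  unfolding loss_sum_def sum_loss_kinds
  sums_unique[OF prod_out, symmetric] sums_unique[OF prod_self, symmetric] ..
 moreover have "(SUM ep:UNIV. ra ep * (word_wt w * V y) * (real (card {d. d < length w & w ! d = ep}) + wt ep / (1 - wt ep)))
  = (SUM ep:UNIV. ra ep * (word_wt w * V y) * real (card {d. d < length w & w ! d = ep})) +
   (ra e * (word_wt w * V y) * (p0 / (1 - p0)) + ra (~ e) * (word_wt w * V y) * ((1 - p0) / p0))"
 proof -
  have U: "UNIV = {e, ~ e}" by auto
  show ?thesis unfolding U by (simp add: wt_def algebra_simps)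
 qed
 moreover have u: "p0 / (1 - p0) = 1 / (1 - p0) - 1" using p0 by (simp add: field_simps)
 ultimately have "gain_sum PF y w - loss_sum PF y w = ra e * (word_wt w * V (y - 1)) / (1 - p0)
   + ra (~ e) * (word_wt w * (\<Sum>d. (1 - p0) ^ Suc d * V (y + 1 + int d)))
   - (ra e * (word_wt w * V y) * (1 / (1 - p0)) + ra (~ e) * (word_wt w * V y) * ((1 - p0) / p0))"
  unfolding u by (simp add: right_diff_distrib)
 moreover have "G = P * (a / h * (v' - v) + b * (x - r * v))"
  if "G = a * (P * v') / h + b * (P * x) - (a * (P * v) * (1 / h) + b * (P * v) * r)" for G a P v v' h b x r :: real
  unfolding that by (simp add: algebra_simps diff_divide_distrib)
 ultimately show ?thesis by blast
qed

end

subsection \<open>Bounds\<close>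

lemma sum_at_most_one:
 fixes f :: "nat => real"
 assumes "0 <= a" "!!d. d < r ==> f d <= a" "!!d d'. d < d' ==> d' < r ==> f d ~= 0 ==> f d' = 0"
 shows "(SUM d<r. f d) <= a"
proof (cases "EX d<r. f d ~= 0")
 case True
 then obtain d0 where d0: "d0 < r" "f d0 ~= 0" by blast
 have "f d = 0" if "d < r" "d ~= d0" for d
  using assms(3)[of d d0] assms(3)[of d0 d] that d0 by (metis linorder_neqE_nat)
 hence "(SUM d<r. f d) = (SUM d:{d0}. f d)"
  using d0 by (intro sum.mono_neutral_right) auto
 thus ?thesis using assms(2) d0 by simp
qed (use assms(1) in auto)

definition min_wt :: real where "min_wt = min p0 (1 - p0)"

lemma min_wt: "0 < min_wt" "min_wt <= wt b" "1 <= 1 / min_wt" "(1 - wt b) / wt b <= 1 / min_wt" "1 / wt b <= 1 / min_wt"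
proof -
 show 1: "0 < min_wt" and 2: "min_wt <= wt b" using p0 by (auto simp: min_wt_def wt_def)
 show "1 <= 1 / min_wt" using 1 2 wt_less1[of b] by simp
 show "(1 - wt b) / wt b <= 1 / min_wt" using 1 2 wt_pos[of b] wt_less1[of b] by (intro frac_le) auto
 show "1 / wt b <= 1 / min_wt" using 1 2 by (intro frac_le) auto
qed

text \<open>The factor 10 is twice the sum of the 2 for gains and the 3 for losses in
  \<open>gain_loss_bound\<close>; the doubling is spent in \<open>defect_eq\<close>, where two such
  estimates are added.\<close>

definition rate_bound :: "real => real" where
 "rate_bound rh = 10 * ((ra True + ra False) * (1 / min_wt + 1 / min_wt / (1 - rh)))"

text \<open>Flipping or deleting one letter raises the weight of a word at most by the factor
  \<open>1 / min_wt\<close>.\<close>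

definition cap :: "real => real => bool list => real" where
 "cap B th w = B * word_wt w * th ^ length w / min_wt"

context
 fixes F :: "int => bool list => real" and B th rh :: real
 assumes F: "!!y w. \<bar>F y w\<bar> <= B * word_wt w * th ^ length w" and B: "0 <= B"
  and th: "1 <= th" "!!b. th * wt b <= rh" "rh < 1"
begin

abbreviation (input) "bd w \<equiv> B * word_wt w * th ^ length w"

lemma rho: "0 <= rh" using th(1) th(2)[of True] wt_pos[of True]
 by (meson less_eq_real_def mult_nonneg_nonneg order_trans zero_le_one)

lemma bd_nonneg: "0 <= bd w" using B th word_wt_pos[of w] by simp

lemma cap_nonneg: "0 <= cap B th w" using bd_nonneg[of w] min_wt(1) by (simp add: cap_def)

lemma bd_le_cap: "bd w <= cap B th w" using mult_left_mono[OF min_wt(3) bd_nonneg[of w]] by (simp add: cap_def)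

lemma tail_le: assumes "0 <= A" shows "A * (wt b ^ k * th ^ k) <= A * rh ^ k"
proof -
 have "(wt b * th) ^ k <= rh ^ k"
  by (rule power_mono) (use th(1) th(2)[of b] wt_pos[of b] in "auto simp: mult.commute")
 thus ?thesis using assms by (simp add: power_mult_distrib mult_left_mono)
qed

lemma F_le: assumes "B * word_wt v * th ^ length v <= X" shows "ra ep * \<bar>F y v\<bar> <= ra ep * X"
 by (intro mult_left_mono order_trans[OF F assms] ra)

text \<open>Inside the word at most one distance contributes, because the first opposite letter
  after \<open>j\<close> blocks all later ones; beyond it the terms decay like
  \<open>rh ^ k\<close>.\<close>

lemma swap_bound:
 fixes y :: int and w :: "bool list" and ep :: bool
  and j :: nat
 assumes j: "j < length w"
 defines "f \<equiv> %d. \<bar>move_term F (gain e y w (Swap ep j) d)\<bar>"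
 shows "summable f" "suminf f <= ra ep * cap B th w + ra ep * cap B th w / (1 - rh)"
proof -
 have act: "f d = (if (ALL l. j <= l & l < d & l < length w --> w ! l = ep) & j < d & (d < length w --> w ! d ~= ep)
   then ra ep * \<bar>F y (swap_word ep j d w)\<bar> else 0)" for d
  using j ra[of ep] unfolding f_def gain.simps by (auto simp: abs_mult)
 have 1: "(SUM d<length w. f d) <= ra ep * cap B th w"
 proof -
  have s1: "0 <= ra ep * cap B th w" by (rule mult_nonneg_nonneg[OF ra cap_nonneg])
  have s2: "f d <= ra ep * cap B th w" if d: "d < length w" for d
  proof -
  show ?thesis
  proof (cases "f d = 0")
   case False
   hence a: "w ! j = ep" "w ! d = (~ ep)" "j < d"
    using j d unfolding act by (auto split: if_splits)
   hence "word_wt (swap_word ep j d w) = word_wt w" using word_wt_swap d by (simp add: swap_word_def)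
   hence "ra ep * \<bar>F y (swap_word ep j d w)\<bar> <= ra ep * cap B th w"
    using d bd_le_cap by (intro F_le) (simp add: swap_word_def)
   thus ?thesis using False unfolding act by (auto split: if_splits)
  qed (use s1 in simp)
  qed
  have s3: "f d' = 0" if "d < d'" "d' < length w" "f d ~= 0" for d d'
   using that unfolding act by (auto split: if_splits)
  show ?thesis by (rule sum_at_most_one) (use s1 s2 s3 in blast)+
 qed
 have 2: "f (k + length w) <= ra ep * cap B th w * rh ^ k" for k
 proof (cases "f (k + length w) = 0")
  case True thus ?thesis using ra[of ep] cap_nonneg rho by simp
 next
  case False
  hence a: "w ! j = ep" using j unfolding act by (auto split: if_splits)
  have "word_wt (w[j := ~ ep]) <= word_wt w * (1 / min_wt)"
   using word_wt_flip[OF j a] mult_left_mono[OF min_wt(4)[of ep], of "word_wt w"] word_wt_pos[of w] by simp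
  hence "B * word_wt (w[j := ~ ep]) * th ^ length w <= cap B th w"
   using mult_left_mono[of "word_wt (w[j := ~ ep])" "word_wt w * (1 / min_wt)" "B * th ^ length w"] B th(1)
   by (simp add: cap_def mult_ac)
  hence "B * word_wt (w[j := ~ ep]) * th ^ length w * (wt ep ^ Suc k * th ^ Suc k) <= cap B th w * (wt ep ^ Suc k * th ^ Suc k)"
   using wt_pos[of ep] th(1) by (intro mult_right_mono) auto
  also have "... <= cap B th w * rh ^ Suc k" by (rule tail_le) (rule cap_nonneg)
  also have "... <= cap B th w * rh ^ k" using rho th(3) cap_nonneg by (intro mult_left_mono power_decreasing) auto
  finally have "ra ep * \<bar>F y (swap_word ep j (k + length w) w)\<bar> <= ra ep * (cap B th w * rh ^ k)"
   by (intro F_le) (simp add: swap_word_def power_add mult_ac)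
  thus ?thesis using False unfolding act by (auto split: if_splits)
 qed
 show "summable f" "suminf f <= ra ep * cap B th w + ra ep * cap B th w / (1 - rh)"
  using sum_tail_geometric_le[OF _ 1 2 rho th(3)] by (auto simp: f_def)
qed

lemma push_bound:
 fixes y :: int and w :: "bool list"
 defines "f \<equiv> %d. \<bar>move_term F (gain e y w Push d)\<bar>"
 shows "summable f" "suminf f <= ra e * cap B th w + ra e * cap B th w / (1 - rh)"
proof -
 have act: "f d = (if (ALL l. l < d & l < length w --> w ! l = e) & (d < length w --> w ! d ~= e)
   then ra e * \<bar>F (y - 1) (if d < length w then take d w @ drop (Suc d) w else replicate d e)\<bar> else 0)" for d
  using ra[of e] unfolding f_def gain.simps by (auto simp: abs_mult)
 have 1: "(SUM d<length w. f d) <= ra e * cap B th w"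
 proof -
  have s1: "0 <= ra e * cap B th w" by (rule mult_nonneg_nonneg[OF ra cap_nonneg])
  have s2: "f d <= ra e * cap B th w" if d: "d < length w" for d
  proof -
  have "word_wt (take d w @ drop (Suc d) w) = word_wt w * (1 / wt (w ! d))"
   using word_wt_delete[OF d] wt_pos[of "w ! d"] by (simp add: field_simps)
  also have "... <= word_wt w * (1 / min_wt)"
   using min_wt(5) word_wt_pos[of w] by (intro mult_left_mono) auto
  finally have "B * word_wt (take d w @ drop (Suc d) w) * th ^ (length w - 1) <= B * (word_wt w * (1 / min_wt)) * th ^ length w"
   using B th(1) word_wt_pos min_wt(1) by (intro mult_mono power_increasing) (auto intro!: mult_nonneg_nonneg simp: less_imp_le)
  hence "ra e * \<bar>F (y - 1) (take d w @ drop (Suc d) w)\<bar> <= ra e * cap B th w"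
   using d by (intro F_le) (simp add: min_def cap_def)
  thus ?thesis using d s1 unfolding act by simp
  qed
  have s3: "f d' = 0" if "d < d'" "d' < length w" "f d ~= 0" for d d'
   using that unfolding act by (auto split: if_splits)
  show ?thesis by (rule sum_at_most_one) (use s1 s2 s3 in blast)+
 qed
 have 2: "f (k + length w) <= ra e * cap B th w * rh ^ k" for k
 proof (cases "f (k + length w) = 0")
  case True thus ?thesis using ra[of e] cap_nonneg rho by simp
 next
  case False
  hence "ALL l. l < length w --> w ! l = e" unfolding act by (auto split: if_splits)
  hence "w = replicate (length w) e" by (intro nth_equalityI) auto
  hence w: "word_wt w = wt e ^ length w" by (metis word_wt_replicate)
  have "bd w * (wt e ^ k * th ^ k) <= bd w * rh ^ k" by (rule tail_le) (rule bd_nonneg)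
  also have "... <= cap B th w * rh ^ k" using bd_le_cap rho by (intro mult_right_mono) auto
  finally have "ra e * \<bar>F (y - 1) (replicate (k + length w) e)\<bar> <= ra e * (cap B th w * rh ^ k)"
   by (intro F_le) (simp add: w power_add mult_ac)
  thus ?thesis using False unfolding act by (auto split: if_splits)
 qed
 show "summable f" "suminf f <= ra e * cap B th w + ra e * cap B th w / (1 - rh)"
  using sum_tail_geometric_le[OF _ 1 2 rho th(3)] by (auto simp: f_def)
qed

lemma jump_bound:
 fixes y :: int and w :: "bool list"
 defines "f \<equiv> %d. \<bar>move_term F (gain e y w Jump d)\<bar>"
 shows "summable f" "suminf f <= ra (~ e) * cap B th w + ra (~ e) * cap B th w / (1 - rh)"
proof -
 have 1: "(SUM d<0. f d) <= ra (~ e) * cap B th w" using mult_nonneg_nonneg[OF ra cap_nonneg] by simp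
 have 2: "f (k + 0) <= ra (~ e) * cap B th w * rh ^ k" for k
 proof -
  have "bd w * (wt (~ e) ^ Suc k * th ^ Suc k) <= bd w * rh ^ Suc k" by (rule tail_le) (rule bd_nonneg)
  also have "... <= bd w * rh ^ k" using rho th(3) bd_nonneg by (intro mult_left_mono power_decreasing) auto
  also have "... <= cap B th w * rh ^ k" using bd_le_cap rho by (intro mult_right_mono) auto
  finally have "ra (~ e) * \<bar>F (y + 1 + int k) (replicate (Suc k) (~ e) @ w)\<bar> <= ra (~ e) * (cap B th w * rh ^ k)"
   by (intro F_le) (simp add: power_add mult_ac)
  thus ?thesis using ra[of "~ e"] unfolding f_def gain.simps by (simp add: abs_mult)
 qed
 show "summable f" "suminf f <= ra (~ e) * cap B th w + ra (~ e) * cap B th w / (1 - rh)"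
  using sum_tail_geometric_le[OF _ 1 2 rho th(3)] by (auto simp: f_def)
qed

lemma out_bound:
 fixes y :: int and w :: "bool list" and ep :: bool
 defines "f \<equiv> %d. \<bar>move_term F (loss e y w (Out ep) d)\<bar>"
 shows "summable f" "suminf f <= real (length w) * (ra ep * bd w) + ra ep * cap B th w / (1 - rh)"
proof -
 have act: "f d = (if d < length w --> w ! d = ep then ra ep * \<bar>F y (if d < length w then w else w @ replicate (d - length w + 1) ep)\<bar> else 0)" for d
  using ra[of ep] unfolding f_def loss.simps by (auto simp: abs_mult)
 have 1: "(SUM d<length w. f d) <= real (length w) * (ra ep * bd w)"
 proof -
  have "f d <= ra ep * bd w" if "d < length w" for d
   using F_le[of w "bd w" ep y] that mult_nonneg_nonneg[OF ra[of ep] bd_nonneg[of w]] unfolding act by simp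
  thus ?thesis using sum_bounded_above[of "{..<length w}" f "ra ep * bd w"] by simp
 qed
 have 2: "f (k + length w) <= ra ep * cap B th w * rh ^ k" for k
 proof -
  have "bd w * (wt ep ^ Suc k * th ^ Suc k) <= bd w * rh ^ Suc k" by (rule tail_le) (rule bd_nonneg)
  also have "... <= bd w * rh ^ k" using rho th(3) bd_nonneg by (intro mult_left_mono power_decreasing) auto
  also have "... <= cap B th w * rh ^ k" using bd_le_cap rho by (intro mult_right_mono) auto
  finally have "ra ep * \<bar>F y (w @ replicate (Suc k) ep)\<bar> <= ra ep * (cap B th w * rh ^ k)"
   by (intro F_le) (simp add: power_add mult_ac)
  thus ?thesis unfolding act by simp
 qed
 show "summable f" "suminf f <= real (length w) * (ra ep * bd w) + ra ep * cap B th w / (1 - rh)"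
  using sum_tail_geometric_le[OF _ 1 2 rho th(3)] by (auto simp: f_def)
qed

lemma self_bound:
 fixes y :: int and w :: "bool list"
 defines "f \<equiv> %d. \<bar>move_term F (loss e y w Self d)\<bar>"
 shows "summable f" "suminf f <= ra e * bd w"
proof -
 have "f sums (SUM d:{0}. f d)" by (rule sums_finite) (auto simp: f_def loss.simps)
 moreover have "f 0 <= ra e * bd w"
  using F_le[of w "bd w" e y] ra[of e] by (simp add: f_def loss.simps abs_mult)
 ultimately show "summable f" "suminf f <= ra e * bd w" by (auto simp: sums_iff)
qed

lemma gain_summable: "ka : gain_kinds w ==> summable (%d. \<bar>move_term F (gain e y w ka d)\<bar>)"
 using swap_bound(1) push_bound(1) jump_bound(1) by (auto simp: gain_kinds_def)

lemma loss_summable: "ka : loss_kinds ==> summable (%d. \<bar>move_term F (loss e y w ka d)\<bar>)"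
 using out_bound(1) self_bound(1) by (auto simp: loss_kinds_def)

text \<open>Each added letter costs \<open>th * wt b\<close>, which is at most
  \<open>rh < 1\<close>, so every sum over the ringing distance is bounded independently of the
  word. The factor \<open>length w + 1\<close> remains: exchanges and exits can happen at each
  letter, and the operator is unbounded for this reason alone.\<close>

theorem gain_loss_bound:
 "\<bar>gain_sum F y w\<bar> + \<bar>loss_sum F y w\<bar> <= rate_bound rh / 2 * (real (length w) + 1) * bd w"
proof -
 define R where "R = ra True + ra False"
 define c where "c = 1 / min_wt + 1 / min_wt / (1 - rh)"
 have R: "0 <= ra ep" "ra ep <= R" "0 <= R" for ep
  using ra[of True] ra[of False] by (cases ep; simp add: R_def)+
 have m: "1 <= 1 / min_wt" "0 <= 1 / min_wt / (1 - rh)" using min_wt th(3) by auto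
 hence c1: "1 <= c" unfolding c_def by linarith
 let ?b = "R * (c * bd w)"
 have b0: "0 <= ?b" using R c1 bd_nonneg[of w] by auto
 have e1: "ra ep * cap B th w + ra ep * cap B th w / (1 - rh) <= ?b" for ep
 proof -
  have "ra ep * cap B th w + ra ep * cap B th w / (1 - rh) = ra ep * (c * bd w)"
   by (simp add: c_def cap_def algebra_simps)
  also have "... <= ?b" using R(2) c1 bd_nonneg[of w] by (intro mult_right_mono) auto
  finally show ?thesis .
 qed
 have le: "\<bar>suminf (%d. g d)\<bar> <= X" if "summable (%d. \<bar>g d\<bar>)" "suminf (%d. \<bar>g d\<bar>) <= X" for g :: "nat => real" and X
  using summable_rabs[OF that(1)] that(2) by linarith
 have "\<bar>gain_sum F y w\<bar> <= (SUM ka:gain_kinds w. \<bar>\<Sum>d. move_term F (gain e y w ka d)\<bar>)"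
  unfolding gain_sum_def by (rule sum_abs)
 also have "... = (SUM ep:UNIV. SUM j<length w. \<bar>\<Sum>d. move_term F (gain e y w (Swap ep j) d)\<bar>) +
   \<bar>\<Sum>d. move_term F (gain e y w Push d)\<bar> + \<bar>\<Sum>d. move_term F (gain e y w Jump d)\<bar>"
  by (rule sum_gain_kinds)
 also have "... <= (SUM ep:(UNIV :: bool set). SUM j<length w. ?b) + ?b + ?b"
  by (intro add_mono sum_mono le swap_bound push_bound jump_bound order_trans[OF swap_bound(2) e1]
    order_trans[OF push_bound(2) e1] order_trans[OF jump_bound(2) e1]) auto
 also have "... = 2 * (real (length w) + 1) * ?b" by (simp add: algebra_simps)
 finally have 1: "\<bar>gain_sum F y w\<bar> <= 2 * (real (length w) + 1) * ?b" .
 have rb: "ra ep * bd w <= ?b" for ep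
 proof (rule mult_mono)
  show "bd w <= c * bd w" using mult_right_mono[OF c1 bd_nonneg[of w]] by simp
 qed (use R bd_nonneg[of w] in simp_all)
 have e2: "real (length w) * (ra ep * bd w) + ra ep * cap B th w / (1 - rh) <= (real (length w) + 1) * ?b" for ep
 proof -
  have "ra ep * bd w <= ?b" by (rule rb)
  hence "real (length w) * (ra ep * bd w) <= real (length w) * ?b" by (intro mult_left_mono) auto
  moreover have "ra ep * cap B th w / (1 - rh) <= ?b"
  proof -
   have "0 <= ra ep * cap B th w"
    using ra[of ep] bd_nonneg[of w] min_wt(1) by (simp add: cap_def)
   thus ?thesis using e1[of ep] by linarith
  qed
  ultimately show ?thesis by (simp add: algebra_simps)
 qed
 have e3: "ra e * bd w <= (real (length w) + 1) * ?b"
 proof -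
  have "ra e * bd w <= ?b" by (rule rb)
  also have "... <= (real (length w) + 1) * ?b" using mult_right_mono[OF _ b0, of 1 "real (length w) + 1"] by simp
  finally show ?thesis .
 qed
 have "\<bar>loss_sum F y w\<bar> <= (SUM ka:loss_kinds. \<bar>\<Sum>d. move_term F (loss e y w ka d)\<bar>)"
  unfolding loss_sum_def by (rule sum_abs)
 also have "... = (SUM ep:UNIV. \<bar>\<Sum>d. move_term F (loss e y w (Out ep) d)\<bar>) + \<bar>\<Sum>d. move_term F (loss e y w Self d)\<bar>"
  by (rule sum_loss_kinds)
 also have "... <= (SUM ep:(UNIV :: bool set). (real (length w) + 1) * ?b) + (real (length w) + 1) * ?b"
  by (intro add_mono sum_mono le out_bound self_bound order_trans[OF out_bound(2) e2] order_trans[OF self_bound(2) e3])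
 also have "... = 3 * (real (length w) + 1) * ?b" by (simp add: algebra_simps)
 finally have 2: "\<bar>loss_sum F y w\<bar> <= 3 * (real (length w) + 1) * ?b" .
 have "rate_bound rh = 10 * (R * c)" by (simp add: rate_bound_def R_def c_def)
 hence "rate_bound rh / 2 * (real (length w) + 1) * bd w = 5 * (real (length w) + 1) * ?b" by (simp add: mult_ac)
 with 1 2 show ?thesis by (simp add: algebra_simps)
qed

end

end

section \<open>Uniqueness of dominated solutions of the forward equation\<close>

text \<open>One term of the exponential series. With \<open>x = n\<close> it becomes the bound on
  \<open>n ^ n / fact n\<close> that lets the iterated estimate converge.\<close>

lemma power_over_fact_le_exp:
 fixes x :: real
 assumes "0 <= x" shows "x ^ n / fact n <= exp x"
proof -
 have "(%k. x ^ k /\<^sub>R fact k) sums exp x" by (rule exp_converges)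
 hence s: "summable (%k. x ^ k /\<^sub>R fact k)" "exp x = (\<Sum>k. x ^ k /\<^sub>R fact k)"
  by (auto simp: sums_iff)
 have "(SUM k:{n}. x ^ k /\<^sub>R fact k) <= (\<Sum>k. x ^ k /\<^sub>R fact k)"
  by (rule sum_le_suminf[OF s(1)]) (use assms in auto)
 thus ?thesis using s(2) by (simp add: divide_inverse mult.commute)
qed

lemma has_integral_shifted_power:
 fixes a t c :: real
 assumes "a <= t"
 shows "((%s. c * (s - a) ^ j / fact j) has_integral (c * (t - a) ^ Suc j / fact (Suc j))) {a..t}"
proof -
 have "((%s. c * (s - a) ^ j / fact j) has_integral
   (c * (t - a) ^ Suc j / fact (Suc j) - c * (a - a) ^ Suc j / fact (Suc j))) {a..t}"
 proof (rule fundamental_theorem_of_calculus[OF assms])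
  fix s assume "s : {a..t}"
  have "((%s. c * (s - a) ^ Suc j / fact (Suc j)) has_real_derivative c * (s - a) ^ j / fact j) (at s within {a..t})"
   by (rule derivative_eq_intros refl | simp)+
  thus "((%s. c * (s - a) ^ Suc j / fact (Suc j)) has_vector_derivative c * (s - a) ^ j / fact j) (at s within {a..t})"
   by (simp add: has_real_derivative_iff_has_vector_derivative)
 qed
 thus ?thesis by simp
qed

context word_weights
begin

lemma gain_sum_add:
 assumes "!!ka. ka : gain_kinds w ==> summable (%d. \<bar>move_term F (gain e y w ka d)\<bar>)"
  and "!!ka. ka : gain_kinds w ==> summable (%d. \<bar>move_term G (gain e y w ka d)\<bar>)"
 shows "gain_sum (%y w. F y w + G y w) y w = gain_sum F y w + gain_sum G y w"
proof -
 have "move_term (%y w. F y w + G y w) m = move_term F m + move_term G m" for m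
  by (auto simp: move_term_def algebra_simps split: option.split)
 thus ?thesis unfolding gain_sum_def sum.distrib[symmetric]
  by (intro sum.cong refl) (simp add: assms summable_rabs_cancel suminf_add)
qed

lemma loss_sum_add:
 assumes "!!ka. ka : loss_kinds ==> summable (%d. \<bar>move_term F (loss e y w ka d)\<bar>)"
  and "!!ka. ka : loss_kinds ==> summable (%d. \<bar>move_term G (loss e y w ka d)\<bar>)"
 shows "loss_sum (%y w. F y w + G y w) y w = loss_sum F y w + loss_sum G y w"
proof -
 have "move_term (%y w. F y w + G y w) m = move_term F m + move_term G m" for m
  by (auto simp: move_term_def algebra_simps split: option.split)
 thus ?thesis unfolding loss_sum_def sum.distrib[symmetric]
  by (intro sum.cong refl) (simp add: assms summable_rabs_cancel suminf_add)
qed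

text \<open>\<open>kap\<close> exceeds \<open>1\<close>, yet words that get an extra factor
  \<open>kap\<close> per letter still have summable tails: \<open>kap * max_wt\<close> is
  \<open>tail_rho\<close>, half way between \<open>max_wt\<close> and \<open>1\<close>. The interval
  from \<open>1\<close> to \<open>kap\<close> is the room in which the norms can be
  weakened.\<close>

definition max_wt :: real where "max_wt = max p0 (1 - p0)"
definition tail_rho :: real where "tail_rho = (1 + max_wt) / 2"
definition kap :: real where "kap = tail_rho / max_wt"

lemma max_wt: "0 < max_wt" "max_wt < 1" "wt b <= max_wt"
 using p0 by (auto simp: max_wt_def wt_def)

lemma kap: "1 < kap" "kap * wt b <= tail_rho" "tail_rho < 1" "0 < ln kap"
proof -
 show 1: "1 < kap" using max_wt by (simp add: kap_def tail_rho_def field_simps)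
 show "kap * wt b <= tail_rho"
  using max_wt mult_left_mono[OF max_wt(3)[of b], of kap] 1 by (simp add: kap_def)
 show "tail_rho < 1" using max_wt by (simp add: tail_rho_def)
 show "0 < ln kap" using 1 by simp
qed

text \<open>The cost of one integration, up to the factor \<open>n\<close> of
  \<open>poly_exp_trade\<close>; the summand \<open>1\<close> keeps it positive when both rates
  vanish.\<close>

definition growth :: real where "growth = rate_bound tail_rho * kap / ln kap + 1"

lemma rate_bound_nonneg: "0 <= rate_bound tail_rho"
 unfolding rate_bound_def using ra[of True] ra[of False] min_wt(1) kap(3) by simp

lemma growth_pos: "0 < growth"
 using rate_bound_nonneg kap by (simp add: growth_def add_nonneg_pos)

text \<open>The factor \<open>r + 1\<close> from the unbounded operator is absorbed by passing from
  the \<open>j\<close>-th to the next of \<open>n\<close> geometric rungs between \<open>1\<close>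
  and \<open>kap\<close>. It is the inequality \<open>x <= exp x\<close> at
  \<open>x = (r + 1) * ln kap / n\<close>, which explains the price proportional to
  \<open>n\<close>.\<close>

lemma poly_exp_trade:
 assumes "0 < n"
 shows "(real r + 1) * exp (ln kap * real j / real n) ^ r <= real n * kap / ln kap * exp (ln kap * real (Suc j) / real n) ^ r"
proof -
 let ?x = "(real r + 1) * ln kap / real n"
 have n: "0 < real n" "1 <= real n" using assms by auto
 have "?x <= exp ?x" using exp_ge_add_one_self[of ?x] by linarith
 hence "real n / ln kap * ?x <= real n / ln kap * exp ?x" using kap(4) n by (intro mult_left_mono) auto
 hence "real r + 1 <= real n / ln kap * exp ?x" using kap(4) n by simp
 also have "exp ?x = exp (ln kap * real r / real n) * exp (ln kap / real n)"
 proof -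
  have "?x = ln kap * real r / real n + ln kap / real n" using n by (simp add: field_simps)
  thus ?thesis by (simp only: exp_add)
 qed
 also have "exp (ln kap / real n) <= exp (ln kap)"
  using kap(4) n divide_left_mono[of 1 "real n" "ln kap"] by simp
 also have "exp (ln kap) = kap" using kap(1) by simp
 finally have "real r + 1 <= real n / ln kap * (exp (ln kap * real r / real n) * kap)"
  using kap(4) n by (simp add: mult_left_mono divide_right_mono)
 hence "(real r + 1) * exp (ln kap * real j / real n) ^ r <=
   real n / ln kap * (exp (ln kap * real r / real n) * kap) * exp (ln kap * real j / real n) ^ r"
  by (intro mult_right_mono) auto
 also have "... = real n * kap / ln kap * (exp (ln kap * real r / real n) * exp (ln kap * real j / real n) ^ r)"
  by simp
 also have "exp (ln kap * real r / real n) * exp (ln kap * real j / real n) ^ r = exp (ln kap * real (Suc j) / real n) ^ r"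
 proof -
  have "ln kap * real r / real n + real r * (ln kap * real j / real n) = real r * (ln kap * real (Suc j) / real n)"
   using n by (simp add: field_simps)
  thus ?thesis by (simp only: exp_of_nat_mult[symmetric] exp_add[symmetric])
 qed
 finally show ?thesis .
qed

context
 fixes m :: "real => int => bool list => real" and a C :: real
 assumes cont: "!!y w. continuous_on {a..} (%t. m t y w)"
  and nonneg: "!!t y w. a <= t ==> 0 <= m t y w" and le: "!!t y w. a <= t ==> m t y w <= C * word_wt w"
  and eq: "!!s t y w. a <= s ==> s <= t ==> m t y w - m s y w =
    gain_sum (%y w. integral {s..t} (%u. m u y w)) y w - loss_sum (%y w. integral {s..t} (%u. m u y w)) y w"
begin

definition defect :: "real => int => bool list => real" where
 "defect t y w = m t y w - word_wt w * m t y []"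

lemma C_nonneg: "0 <= C" using nonneg[of a 0 "[]"] le[of a 0 "[]"] by simp

lemma cont_sub: "a <= s ==> continuous_on {s..t} (%u. m u y w)"
 by (rule continuous_on_subset[OF cont]) auto

lemma cont_defect: "a <= s ==> continuous_on {s..t} (%u. defect u y w)"
 unfolding defect_def by (intro continuous_intros cont_sub)

lemma defect_le: assumes "a <= t" shows "\<bar>defect t y w\<bar> <= C * word_wt w"
proof -
 have "word_wt w * m t y [] <= word_wt w * C"
  using le[OF assms, of y "[]"] word_wt_pos[of w] by (intro mult_left_mono) auto
 moreover have "0 <= word_wt w * m t y []" using nonneg[OF assms] word_wt_pos[of w] by simp
 ultimately show ?thesis using le[OF assms, of y w] nonneg[OF assms, of y w]
  unfolding defect_def by (simp add: mult.commute abs_le_iff)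
qed

lemma integral_bounded:
 fixes f :: "real => real"
 assumes "a <= s" "s <= t" "continuous_on {s..t} f" "!!u. s <= u ==> u <= t ==> \<bar>f u\<bar> <= c * (u - s) ^ j / fact j"
 shows "\<bar>integral {s..t} f\<bar> <= c * (t - s) ^ Suc j / (fact (Suc j) :: real)"
proof -
 have "norm (integral {s..t} f) <= integral {s..t} (%u. c * (u - s) ^ j / fact j)"
 proof (rule integral_norm_bound_integral)
  show "f integrable_on {s..t}" using assms(3) by (rule integrable_continuous_real)
  show "(%u. c * (u - s) ^ j / fact j) integrable_on {s..t}"
   using has_integral_shifted_power[OF assms(2)] by (rule has_integral_integrable)
  show "norm (f u) <= c * (u - s) ^ j / fact j" if "u : {s..t}" for u using assms(4) that by auto
 qed
 also have "... = c * (t - s) ^ Suc j / fact (Suc j)"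
  using has_integral_shifted_power[OF assms(2)] by (rule integral_unique)
 finally show ?thesis by simp
qed

lemma V_eq:
 assumes s: "a <= s" "s <= t"
 defines "V \<equiv> %y. integral {s..t} (%u. m u y [])"
 shows "\<bar>V y\<bar> <= C * (t - s)"
proof -
 have "\<bar>m u y []\<bar> <= C * (u - s) ^ 0 / fact 0" if "s <= u" "u <= t" for u
  using nonneg[of u y "[]"] le[of u y "[]"] that s by simp
 from integral_bounded[OF s cont_sub[OF s(1)] this] show ?thesis unfolding V_def by simp
qed

text \<open>Subtracting \<open>word_wt w\<close> times the equation of the empty word removes the
  product part on both sides: by \<open>burke\<close> its contribution has exactly this form. The
  defect thus solves the same equation up to the correction at the empty word.\<close>

lemma defect_eq:
 assumes s: "a <= s" "s <= t" and init: "!!y w. defect s y w = 0"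
  and D: "!!y w. \<bar>integral {s..t} (%u. defect u y w)\<bar> <= B * word_wt w * th ^ length w"
  and th: "0 <= B" "1 <= th" "!!b. th * wt b <= rh" "rh < 1"
 shows "\<bar>defect t y w\<bar> <= rate_bound rh * (real (length w) + 1) * (B * word_wt w * th ^ length w)"
proof -
 define V where "V y = integral {s..t} (%u. m u y [])" for y
 define F where "F y w = integral {s..t} (%u. defect u y w)" for y w
 have V: "\<bar>V y\<bar> <= C * (t - s)" for y unfolding V_def by (rule V_eq[OF s])
 note F = D[folded F_def]
 have split: "(%y w. integral {s..t} (%u. m u y w)) = (%y w. F y w + word_wt w * V y)"
 proof (intro ext)
  fix y w
  have "integral {s..t} (%u. m u y w) = integral {s..t} (%u. defect u y w + word_wt w * m u y [])"
   by (simp add: defect_def)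
  also have "... = F y w + integral {s..t} (%u. word_wt w * m u y [])"
   unfolding F_def by (intro integral_add integrable_continuous_real cont_defect s continuous_intros cont_sub)
  finally show "integral {s..t} (%u. m u y w) = F y w + word_wt w * V y" by (simp add: V_def)
 qed
 have PF: "\<bar>word_wt w * V y\<bar> <= C * (t - s) * word_wt w * 1 ^ length w" for y w
  using mult_left_mono[OF V[of y], of "word_wt w"] word_wt_pos[of w] by (simp add: abs_mult mult.commute)
 have PF0: "0 <= C * (t - s)" using C_nonneg s by simp
 note sg = gain_summable[where F = F, OF F th] and sl = loss_summable[where F = F, OF F th]
 have w1: "1 * wt b <= tail_rho" for b
 proof -
  have "1 * wt b <= kap * wt b" using kap(1) wt_pos[of b] by (intro mult_right_mono) auto
  thus ?thesis using kap(2)[of b] by linarith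
 qed
 note pg = gain_summable[where F = "%y w. word_wt w * V y", OF PF PF0 order_refl w1 kap(3)]
  and pl = loss_summable[where F = "%y w. word_wt w * V y", OF PF PF0 order_refl w1 kap(3)]
 have e: "m t y w - m s y w = gain_sum F y w - loss_sum F y w +
   (gain_sum (%y w. word_wt w * V y) y w - loss_sum (%y w. word_wt w * V y) y w)" for y w
  unfolding eq[OF s] split by (simp add: gain_sum_add[OF sg pg] loss_sum_add[OF sl pl])
 have "defect t y w = (m t y w - m s y w) - word_wt w * (m t y [] - m s y [])"
  using init[of y w] unfolding defect_def by (simp add: algebra_simps)
 also have "... = (gain_sum F y w - loss_sum F y w) - word_wt w * (gain_sum F y [] - loss_sum F y [])"
  unfolding e burke[OF V] by (simp add: algebra_simps)
 finally have de: "defect t y w = (gain_sum F y w - loss_sum F y w) - word_wt w * (gain_sum F y [] - loss_sum F y [])" .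
 let ?X = "rate_bound rh / 2 * (real (length w) + 1) * (B * word_wt w * th ^ length w)"
 have 1: "\<bar>gain_sum F y w - loss_sum F y w\<bar> <= ?X"
  using gain_loss_bound[where F = F, OF F th, where y = y and w = w] by linarith
 have 2: "\<bar>gain_sum F y [] - loss_sum F y []\<bar> <= rate_bound rh / 2 * B"
 proof -
  have "\<bar>gain_sum F y []\<bar> + \<bar>loss_sum F y []\<bar> <= rate_bound rh / 2 * B"
   using gain_loss_bound[where F = F, OF F th, where y = y and w = "[]"] by simp
  thus ?thesis by linarith
 qed
 hence rb: "0 <= rate_bound rh / 2 * B" by linarith
 have "\<bar>word_wt w * (gain_sum F y [] - loss_sum F y [])\<bar> <= word_wt w * (rate_bound rh / 2 * B)"
  using 2 word_wt_pos[of w] by (simp add: abs_mult)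
 also have "... <= word_wt w * (rate_bound rh / 2 * B) * ((real (length w) + 1) * th ^ length w)"
 proof -
  have "1 * 1 <= (real (length w) + 1) * th ^ length w" using th(2) by (intro mult_mono) auto
  thus ?thesis using mult_left_mono[of 1 _ "word_wt w * (rate_bound rh / 2 * B)"] rb word_wt_pos[of w] by simp
 qed
 also have "... = ?X" by (simp add: mult_ac)
 finally have 3: "\<bar>word_wt w * (gain_sum F y [] - loss_sum F y [])\<bar> <= ?X" .
 show ?thesis using 1 3 unfolding de by linarith
qed

text \<open>Each integration gains a factor \<open>(t - s) / Suc j\<close> and loses one rung of the
  scale of norms, as in a Cauchy-Kovalevskaya argument. Exactly \<open>n\<close> iterations are
  possible before the weight per letter reaches \<open>kap\<close>.\<close>

lemma defect_iterate:
 assumes s: "a <= s" and init: "!!y w. defect s y w = 0" and n: "0 < n"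
 shows "j <= n ==> s <= t ==>
  \<bar>defect t y w\<bar> <= C * word_wt w * exp (ln kap * real j / real n) ^ length w * (real n * growth) ^ j * (t - s) ^ j / fact j"
proof (induction j arbitrary: t y w)
 case 0
 thus ?case using defect_le[of t y w] s by simp
next
 case (Suc j)
 define th where "th = exp (ln kap * real j / real n)"
 have th: "1 <= th" using kap(4) by (simp add: th_def)
 have "th <= exp (ln kap * 1)" unfolding th_def exp_le_cancel_iff times_divide_eq_right[symmetric]
  using Suc.prems n kap(4) by (intro mult_left_mono) auto
 hence "th <= kap" using kap(1) by simp
 hence th2: "th * wt b <= tail_rho" for b
  using kap(2)[of b] wt_pos[of b] by (meson mult_right_mono less_imp_le order_trans)
 define B where "B = C * (real n * growth) ^ j * (t - s) ^ Suc j / fact (Suc j)"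
 have B0: "0 <= B" using C_nonneg growth_pos Suc.prems by (simp add: B_def)
 have D: "\<bar>integral {s..t} (%u. defect u y w)\<bar> <= B * word_wt w * th ^ length w" for y w
 proof -
  have "\<bar>integral {s..t} (%u. defect u y w)\<bar> <=
    C * word_wt w * th ^ length w * (real n * growth) ^ j * (t - s) ^ Suc j / fact (Suc j)"
   by (rule integral_bounded[OF s Suc.prems(2) cont_defect[OF s]])
    (use Suc.IH[OF Suc_leD[OF Suc.prems(1)]] in "auto simp: th_def")
  thus ?thesis by (simp add: B_def mult_ac)
 qed
 have "\<bar>defect t y w\<bar> <= rate_bound tail_rho * (real (length w) + 1) * (B * word_wt w * th ^ length w)"
  by (rule defect_eq[OF s Suc.prems(2) init D B0 th th2 kap(3)])
 also have "... = rate_bound tail_rho * B * word_wt w * ((real (length w) + 1) * th ^ length w)" by simp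
 also have "... <= rate_bound tail_rho * B * word_wt w * (real n * kap / ln kap * exp (ln kap * real (Suc j) / real n) ^ length w)"
  unfolding th_def using rate_bound_nonneg B0 word_wt_pos[of w]
  by (intro mult_left_mono poly_exp_trade n) auto
 also have "... = B * word_wt w * exp (ln kap * real (Suc j) / real n) ^ length w * (real n * (rate_bound tail_rho * kap / ln kap))"
  by simp
 also have "... <= B * word_wt w * exp (ln kap * real (Suc j) / real n) ^ length w * (real n * growth)"
  using B0 word_wt_pos[of w] by (intro mult_left_mono) (auto simp: growth_def)
 also have "... = C * word_wt w * exp (ln kap * real (Suc j) / real n) ^ length w * (real n * growth) ^ Suc j * (t - s) ^ Suc j / fact (Suc j)"
  by (simp add: B_def mult_ac)
 finally show ?case .
qed

text \<open>After \<open>n\<close> iterations the bound contains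
  \<open>n ^ n / fact n <= exp n\<close> times \<open>(growth * (t - s)) ^ n\<close>. The length of
  the time step makes the product at most \<open>(1 / 2) ^ n\<close>, and \<open>n\<close> is
  arbitrary.\<close>

lemma defect_step:
 assumes s: "a <= s" and init: "!!y w. defect s y w = 0" and t: "s <= t" "t <= s + 1 / (2 * exp 1 * growth)"
 shows "defect t y w = 0"
proof -
 have le: "\<bar>defect t y w\<bar> <= C * word_wt w * kap ^ length w * (1 / 2) ^ n" if n: "0 < n" for n
 proof -
  have "\<bar>defect t y w\<bar> <= C * word_wt w * exp (ln kap * real n / real n) ^ length w * (real n * growth) ^ n * (t - s) ^ n / fact n"
   by (rule defect_iterate[OF s init n order_refl t(1)])
  also have "exp (ln kap * real n / real n) = kap" using n kap(1) by simp
  also have "C * word_wt w * kap ^ length w * (real n * growth) ^ n * (t - s) ^ n / fact n =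
    C * word_wt w * kap ^ length w * ((real n ^ n / fact n) * (growth * (t - s)) ^ n)"
   by (simp add: power_mult_distrib)
  also have "... <= C * word_wt w * kap ^ length w * (exp (real n) * (1 / (2 * exp 1)) ^ n)"
  proof -
   have "growth * (t - s) <= growth * (1 / (2 * exp 1 * growth))"
    using t growth_pos by (intro mult_left_mono) auto
   also have "... = 1 / (2 * exp 1)" using growth_pos by simp
   finally have A: "(growth * (t - s)) ^ n <= (1 / (2 * exp 1)) ^ n"
    using growth_pos t by (intro power_mono) auto
   have "real n ^ n / fact n * (growth * (t - s)) ^ n <= exp (real n) * (1 / (2 * exp 1)) ^ n"
   proof (rule mult_mono[OF power_over_fact_le_exp A])
    show "0 <= (growth * (t - s)) ^ n" using growth_pos t by simp
   qed simp_all
   moreover have "0 <= C * word_wt w * kap ^ length w" using C_nonneg word_wt_pos[of w] kap(1) by simp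
   ultimately show ?thesis by (rule mult_left_mono)
  qed
  also have "C * word_wt w * kap ^ length w * (exp (real n) * (1 / (2 * exp 1)) ^ n) = C * word_wt w * kap ^ length w * (1 / 2 :: real) ^ n"
  proof -
   have "exp (real n) * (1 / (2 * exp 1)) ^ n = (exp 1 * (1 / (2 * exp 1))) ^ n"
    using exp_of_nat_mult[of n "1 :: real"] by (simp only: power_mult_distrib mult_1_right)
   moreover have "exp 1 * (1 / (2 * exp 1)) = (1 / 2 :: real)" by simp
   ultimately show ?thesis by (simp only:)
  qed
  finally show ?thesis .
 qed
 have "(%n. C * word_wt w * kap ^ length w * (1 / 2) ^ n) ----> C * word_wt w * kap ^ length w * 0"
  by (intro tendsto_mult tendsto_const LIMSEQ_realpow_zero) auto
 hence "\<bar>defect t y w\<bar> <= C * word_wt w * kap ^ length w * 0"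
  by (rule LIMSEQ_le_const) (use le in "auto intro!: exI[of _ 1]")
 thus ?thesis by simp
qed

text \<open>The time step of \<open>defect_step\<close> depends neither on the starting time nor on
  the solution, so finitely many steps reach any \<open>t\<close>.\<close>

theorem product_preserved:
 assumes init: "!!y w. m a y w = word_wt w * m a y []" and t: "a <= t"
 shows "m t y w = word_wt w * m t y []"
proof -
 define h where "h = 1 / (2 * exp 1 * growth)"
 have h: "0 < h" using growth_pos by (simp add: h_def)
 have *: "ALL y w. defect t y w = 0" if "a <= t" "t <= a + real k * h" for k t
  using that
 proof (induction k arbitrary: t)
  case 0
  hence "t = a" by simp
  have "defect a y w = 0" for y w unfolding defect_def using init[of y w] by linarith
  thus ?case using `t = a` by blast
 next
  case (Suc k)
  show ?case
  proof (cases "t <= a + real k * h")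
   case False
   have "ALL y w. defect (a + real k * h) y w = 0" by (rule Suc.IH) (use h in simp_all)
   hence d: "!!y w. defect (a + real k * h) y w = 0" by blast
   have "defect t y w = 0" for y w
   proof (rule defect_step[OF _ d])
    show "a <= a + real k * h" "a + real k * h <= t" using h False by simp_all
    have "t <= a + real k * h + h" using Suc.prems(2) by (simp add: distrib_right)
    thus "t <= a + real k * h + 1 / (2 * exp 1 * growth)" by (simp only: h_def)
   qed
   thus ?thesis by blast
  qed (use Suc in blast)
 qed
 obtain k where "(t - a) / h <= real k" using real_arch_simple by blast
 hence "t <= a + real k * h" using h by (simp add: field_simps)
 hence "defect t y w = 0" using *[OF t] by blast
 thus ?thesis by (simp add: defect_def)
qed

end

end

abbreviation (input) cx :: "real => complex" where "cx \<equiv> complex_of_real"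

subsection \<open>Cadlag paths with discrete values\<close>

lemma cadlag_right_const:
 fixes f :: "real => 'a::discrete_topology"
 assumes "cadlag_on {0..} f" "0 <= t"
 obtains ep where "0 < ep" "!!s. t <= s ==> s < t + ep ==> f s = f t"
proof -
 have "(f \<longlongrightarrow> f t) (at t within {0..} Int {t<..})" using assms by (simp add: cadlag_on_def)
 hence "eventually (%s. f s = f t) (at t within {0..} Int {t<..})" by (simp add: tendsto_discrete)
 then obtain d where d: "0 < d" "!!s. s : {0..} Int {t<..} ==> s ~= t ==> dist s t < d ==> f s = f t"
  unfolding eventually_at by blast
 show ?thesis
 proof (rule that[OF d(1)])
  show "f s = f t" if "t <= s" "s < t + d" for s
   using d(2)[of s] that assms(2) by (cases "s = t") (auto simp: dist_real_def)
 qed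
qed

lemma cadlag_left_const:
 fixes f :: "real => 'a::{discrete_topology, t2_space}"
 assumes "cadlag_on {0..} f" "0 < t"
 obtains ep where "0 < ep" "ep <= t" "!!s. t - ep < s ==> s < t ==> f s = left_lim f t"
proof -
 obtain l where "(f \<longlongrightarrow> l) (at t within {0..} Int {..<t})" using assms by (force simp: cadlag_on_def)
 hence "eventually (%s. f s = l) (at t within {0..} Int {..<t})" by (simp add: tendsto_discrete)
 then obtain d where d: "0 < d" "!!s. s : {0..} Int {..<t} ==> s ~= t ==> dist s t < d ==> f s = l"
  unfolding eventually_at by blast
 have l: "f s = l" if "t - min d t < s" "s < t" for s
  using d(2)[of s] that by (auto simp: dist_real_def)
 have "eventually (%s. f s = l) (at_left t)"
  unfolding eventually_at_left_field using l d(1) assms(2) by (intro exI[of _ "t - min d t"]) auto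
 hence "(f \<longlongrightarrow> l) (at_left t)" by (simp add: tendsto_discrete)
 hence "left_lim f t = l" unfolding left_lim_def by (intro tendsto_Lim) auto
 thus ?thesis using that[of "min d t"] d(1) assms(2) l by auto
qed

definition counting_path :: "(real => nat) => bool" where
 "counting_path c = (c 0 = 0 & mono_on {0..} c & cadlag_on {0..} c)"

lemma counting_path_mono: "counting_path c ==> 0 <= s ==> s <= t ==> c s <= c t"
 unfolding counting_path_def mono_on_def by auto

lemma arrival_imp_increase: "counting_path c ==> arrival c u ==> 0 <= s ==> s < u ==> u <= t ==> c s < c t"
 using counting_path_mono[of c u t] unfolding arrival_def by force

text \<open>The arrival is the first time at which \<open>c\<close> has reached the value
  \<open>c t\<close>; right continuity makes this infimum a minimum.\<close>

lemma increase_imp_arrival: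
 assumes c: "counting_path c" and st: "0 <= s" "c s < c t" "s < t"
 obtains u where "arrival c u" "s < u" "u <= t"
proof -
 define S where "S = {v. s <= v & v <= t & c t <= c v}"
 have tS: "t : S" using st by (simp add: S_def)
 have bd: "bdd_below S" by (auto simp: S_def)
 define u where "u = Inf S"
 have su: "s <= u" unfolding u_def using tS by (intro cInf_greatest) (auto simp: S_def)
 have ut: "u <= t" unfolding u_def using tS bd by (rule cInf_lower)
 obtain ep where e: "0 < ep" "!!v. u <= v ==> v < u + ep ==> c v = c u"
  using cadlag_right_const[of c u] c su st by (auto simp: counting_path_def)
 obtain v where v: "v : S" "v < u + ep"
  using cInf_lessD[of S "u + ep"] tS e(1) unfolding u_def by auto
 have "u <= v" unfolding u_def using v(1) bd by (rule cInf_lower)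
 hence cu: "c t <= c u" using e(2)[of v] v by (auto simp: S_def)
 hence "s ~= u" using st by auto
 hence s: "s < u" using su by simp
 have "c v < c u" if "0 <= v" "v < u" for v
 proof (rule ccontr)
  assume "~ c v < c u"
  hence ge: "c t <= c v" using cu by simp
  hence "s <= v" using counting_path_mono[OF c that(1), of s] st by force
  hence "v : S" using that ut ge by (simp add: S_def)
  hence "u <= v" unfolding u_def using bd by (rule cInf_lower)
  thus False using that by simp
 qed
 hence "arrival c u" using s st unfolding arrival_def by auto
 thus ?thesis using that s ut by blast
qed

lemma increase_iff_arrival:
 assumes "counting_path c" "0 <= s" "s <= t"
 shows "(c s < c t) = (EX u. arrival c u & s < u & u <= t)"
proof
 assume "c s < c t"
 moreover from this have "s < t" using assms(3) by (cases "s = t") auto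
 ultimately show "EX u. arrival c u & s < u & u <= t" using increase_imp_arrival[OF assms(1,2)] by metis
qed (use arrival_imp_increase[OF assms(1)] assms in blast)

text \<open>A counting path is injective on its arrival times and takes finitely many values up to
  \<open>t\<close>.\<close>

lemma finite_arrivals:
 assumes c: "counting_path c"
 shows "finite {u. arrival c u & u <= t}"
proof -
 have inj: "inj_on c {u. arrival c u & u <= t}"
 proof (rule linorder_inj_onI)
  fix x y assume "x < y" "x : {u. arrival c u & u <= t}" "y : {u. arrival c u & u <= t}"
  hence "0 <= x" "ALL s. 0 <= s & s < y --> c s < c y" by (auto simp: arrival_def)
  thus "c x ~= c y" using `x < y` by force
 qed auto
 have "c ` {u. arrival c u & u <= t} <= {..c t}"
  using counting_path_mono[OF c] by (auto simp: arrival_def)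
 thus ?thesis using inj finite_subset[OF _ finite_atMost] by (metis finite_imageD)
qed

lemma sum_increments:
 fixes f :: "nat => nat"
 assumes "!!l. l < j ==> f l <= f (Suc l)"
 shows "(SUM l<j. f (Suc l) - f l) + f 0 = f j"
 using assms
proof (induction j)
 case (Suc j)
 hence "(SUM l<j. f (Suc l) - f l) + f 0 = f j" "f j <= f (Suc j)" by auto
 thus ?case by simp
qed simp

subsection \<open>The clocks of the Toom process\<close>

locale toom =
 fixes M :: "'a measure" and lp lm p :: real and \<eta> :: sign and N :: "'a => clocks"
  and sg :: "'a => real => config" and Y :: "'a => real => int"
 assumes lp: "0 <= lp" and lm: "0 <= lm" and p01: "0 < p" "p < 1"
  and process: "toom_process M lp lm (uniform_measure (Ber p) {s. s 0 = \<eta>}) N sg"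
  and tagged: "push_tagged_position M N sg 0 Y"

sublocale toom < prob_space M
 using process by (simp add: toom_process_def)

context toom
begin

abbreviation rt :: "int \<times> sign => real" where "rt i \<equiv> rate lp lm (snd i)"

lemma rt_nonneg: "0 <= rt i" using lp lm by (simp add: rate_def)

lemma poisson: "poisson_process M (rt i) (%om. N om i)"
 using process by (cases i) (auto simp: toom_process_def toom_clocks_def)

lemma counting: "om : space M ==> counting_path (N om i)"
 using poisson[of i] by (auto simp: poisson_process_def counting_path_def)

lemma measurable_N [measurable]: "0 <= t ==> (%om. N om i t) : measurable M (count_space UNIV)"
 using poisson[of i] by (auto simp: poisson_process_def)

lemma measurable_sg [measurable]: "0 <= t ==> (%om. sg om t) : measurable M config_space"
 using process by (auto simp: toom_process_def)

lemma measurable_Y [measurable]: "0 <= t ==> (%om. Y om t) : measurable M (count_space UNIV)"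
 using tagged by (auto simp: push_tagged_position_def)

lemma measurable_sg_site [measurable]:
 assumes "0 <= t" shows "(%om. sg om t x) : measurable M (count_space UNIV)"
proof -
 have "(%s. s x) : measurable config_space (count_space UNIV)"
  unfolding config_space_def by (rule measurable_component_singleton) simp
 from measurable_compose[OF measurable_sg[OF assms] this] show ?thesis .
qed

definition incr :: "int \<times> sign => real => real => 'a => bool" where
 "incr i s t om = (N om i s < N om i t)"

lemma measurable_incr [measurable]:
 assumes "0 <= s" "0 <= t" shows "Measurable.pred M (incr i s t)"
proof -
 have "incr i s t = (%om. EX n m. N om i s = n & N om i t = m & n < m)" by (auto simp: incr_def)
 also have "Measurable.pred M ..." using assms by measurable
 finally show ?thesis .
qed

lemma prob_not_incr:
 assumes "0 <= s" "s <= t"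
 shows "prob {om:space M. ~ incr i s t om} = exp (- (rt i * (t - s)))"
proof -
 have "prob {om:space M. N om i t - N om i s = 0} = (rt i * (t - s)) ^ 0 / fact 0 * exp (- (rt i * (t - s)))"
  using poisson[of i] assms unfolding poisson_process_def by blast
 moreover have "{om:space M. ~ incr i s t om} = {om:space M. N om i t - N om i s = 0}"
  using counting_path_mono[OF counting assms] by (auto simp: incr_def)
 ultimately show ?thesis by simp
qed

definition incr_prob :: "int \<times> sign => real => real" where "incr_prob i h = 1 - exp (- (rt i * h))"

lemma prob_incr:
 assumes "0 <= s" "s <= t"
 shows "prob {om:space M. incr i s t om} = incr_prob i (t - s)"
proof -
 have t: "0 <= t" using assms by simp
 note [measurable] = measurable_incr[OF assms(1) t, of i]
 have m: "{om:space M. ~ incr i s t om} : events" by measurable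
 have "{om:space M. incr i s t om} = space M - {om:space M. ~ incr i s t om}" by auto
 thus ?thesis by (simp only: prob_compl[OF m] prob_not_incr[OF assms] incr_prob_def)
qed

lemma incr_prob_le: "0 <= h ==> incr_prob i h <= rt i * h"
 using exp_ge_add_one_self[of "- (rt i * h)"] by (simp add: incr_prob_def)

lemma incr_prob_nonneg: "0 <= h ==> 0 <= incr_prob i h" and incr_prob_le1: "incr_prob i h <= 1"
 using rt_nonneg[of i] by (auto simp: incr_prob_def)

text \<open>A Poisson process comes with independent increments along increasing sequences only. The
  sorted times of \<open>S\<close> together with \<open>0\<close> and \<open>t\<close> form such a
  sequence: the increments before index \<open>K\<close> determine all values on \<open>S\<close>,
  and the increment at \<open>K\<close> is the one after \<open>t\<close>.\<close>

lemma indep_clock_past: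
 assumes S: "finite S" "S <= {0..t}" and tu: "0 <= t" "t <= u"
 shows "prob {om:space M. (ALL s:S. N om i s : A s) & (incr i t u om <-> b)} =
   prob {om:space M. ALL s:S. N om i s : A s} * prob {om:space M. incr i t u om <-> b}"
proof -
 define xs where "xs = sorted_list_of_set (insert 0 (insert t S))"
 have set_xs: "set xs = insert 0 (insert t S)" unfolding xs_def by (rule set_sorted_list_of_set) (use S in simp)
 have sxs: "sorted xs" "distinct xs" by (simp_all only: xs_def sorted_sorted_list_of_set distinct_sorted_list_of_set)
 define K where "K = length xs - 1"
 have len: "length xs = Suc K" using set_xs by (cases xs) (auto simp: K_def)
 have xs0: "xs ! 0 = 0"
 proof -
  obtain j where "j < length xs" "xs ! j = 0" using set_xs by (metis in_set_conv_nth insertI1)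
  hence "xs ! 0 <= 0" using sorted_nth_mono[OF sxs(1), of 0 j] by simp
  moreover have "xs ! 0 : set xs" using len by (intro nth_mem) simp
  ultimately show ?thesis using set_xs S tu by auto
 qed
 have xsK: "xs ! K = t"
 proof -
  obtain j where "j < length xs" "xs ! j = t" using set_xs by (metis in_set_conv_nth insertI1 insertI2)
  hence "t <= xs ! K" using sorted_nth_mono[OF sxs(1), of j K] len by simp
  moreover have "xs ! K : set xs" using len by (intro nth_mem) simp
  ultimately show ?thesis using set_xs S tu by auto
 qed
 have xs_in: "xs ! j : {0..t}" if "j <= K" for j
  using nth_mem[of j xs] that len set_xs S tu by auto
 \<comment> \<open>The sequence has to be infinite; it is continued by the constant
   \<open>u\<close>, so that all increments after index \<open>K\<close> vanish.\<close>
 define ta where "ta j = (if j <= K then xs ! j else u)" for j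
 have inc: "incseq ta"
  unfolding incseq_Suc_iff
 proof
  fix j
  consider "Suc j <= K" | "j = K" | "K < j" by linarith
  thus "ta j <= ta (Suc j)"
  proof cases
   case 1
   hence "xs ! j <= xs ! Suc j" using len by (intro sorted_nth_mono[OF sxs(1)]) auto
   thus ?thesis using 1 by (simp add: ta_def)
  next
   case 2 thus ?thesis using xsK tu by (simp add: ta_def)
  qed (simp add: ta_def)
 qed
 have t0: "ta 0 = 0" using xs0 by (simp add: ta_def)
 have tnn: "0 <= ta j" for j using xs_in[of j] tu by (auto simp: ta_def)
 define X where "X l om = N om i (ta (Suc l)) - N om i (ta l)" for l om
 have ind: "indep_vars (%_. count_space UNIV) X UNIV"
  using poisson[of i] inc t0 unfolding poisson_process_def X_def by auto
 have Ntau: "N om i (ta j) = (SUM l<j. X l om)" if "om : space M" for j om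
 proof -
  have "(SUM l<j. X l om) + N om i (ta 0) = N om i (ta j)"
   unfolding X_def
   by (rule sum_increments) (rule counting_path_mono[OF counting[OF that] tnn incseq_SucD[OF inc]])
  moreover have "N om i (ta 0) = 0" using counting[OF that, of i] t0 by (simp add: counting_path_def)
  ultimately show ?thesis by simp
 qed
 have "EX j. ALL s:S. j s <= K & xs ! j s = s"
  using set_xs len by (intro bchoice) (metis in_set_conv_nth insertI2 less_Suc_eq_le)
 then obtain j where j: "!!s. s : S ==> j s <= K" "!!s. s : S ==> xs ! j s = s" by blast
 have Ns: "N om i s = (SUM l<j s. X l om)" if "om : space M" "s : S" for om s
  using Ntau[OF that(1), of "j s"] j[OF that(2)] by (simp add: ta_def)
 have inK: "incr i t u om = (0 < X K om)" for om
  using xsK by (simp add: incr_def X_def ta_def)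
 let ?L = "%om. restrict (%l. X l om) {..<K}" and ?R = "%om. restrict (%l. X l om) {K}"
 have iv: "indep_var (PiM {..<K} (%_. count_space UNIV)) ?L
    (PiM {K} (%_. count_space UNIV)) ?R"
  by (rule indep_var_restrict[OF ind]) auto
 define P where "P = {x : space (PiM {..<K} (%_. count_space (UNIV :: nat set))). ALL s:S. (SUM l<j s. x l) : A s}"
 define Q where "Q = {x : space (PiM {K} (%_. count_space (UNIV :: nat set))). (0 < x K) = b}"
 have Pm: "P : sets (PiM {..<K} (%_. count_space UNIV))" and Qm: "Q : sets (PiM {K} (%_. count_space UNIV))"
  unfolding P_def Q_def by (auto simp: count_space_PiM_finite)
 have "prob ((%om. (?L om, ?R om)) -` (P \<times> Q) Int space M) =
   prob (?L -` P Int space M) * prob (?R -` Q Int space M)"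
  by (rule indep_varD[OF iv Pm Qm])
 moreover have "?L -` P Int space M = {om:space M. ALL s:S. N om i s : A s}"
 proof -
  have "?L om : P <-> (ALL s:S. N om i s : A s)" if "om : space M" for om
  proof -
   have "(SUM l<j s. ?L om l) = N om i s" if "s : S" for s
    unfolding Ns[OF `om : space M` that] using j(1)[OF that] by (intro sum.cong) auto
   thus ?thesis by (simp add: P_def space_PiM)
  qed
  thus ?thesis by blast
 qed
 moreover have "?R -` Q Int space M = {om:space M. incr i t u om <-> b}"
  by (auto simp: Q_def space_PiM inK)
 moreover have "(%om. (?L om, ?R om)) -` (P \<times> Q) Int space M =
   (?L -` P Int space M) Int (?R -` Q Int space M)"
  by auto
 moreover have "{om:space M. (ALL s:S. N om i s : A s) & (incr i t u om <-> b)} =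
   {om:space M. ALL s:S. N om i s : A s} Int {om:space M. incr i t u om <-> b}" by auto
 ultimately show ?thesis by simp
qed

subsection \<open>The past, completed by null sets\<close>

abbreviation (input) "rect B I S A \<equiv> {om:space M. sg om 0 : B & (ALL i:I. ALL s:S. N om i s : A i s)}"

text \<open>A generator of the past that is stable under intersections, as the passage to generated
  sigma-algebras requires.\<close>

definition past_rects :: "real => 'a set set" where
 "past_rects t = {rect B I S A | B I S A.
   B : sets config_space & finite I & finite S & S <= {0..t}}"

lemma past_rectsI:
 "B : sets config_space ==> finite I ==> finite S ==> S <= {0..t} ==>
  rect B I S A : past_rects t"
 unfolding past_rects_def by blast

lemma clock_set [measurable]:
 assumes "0 <= s" shows "{om:space M. N om i s : A} : events"
proof -
 have "(%om. N om i s) -` A Int space M : events" using measurable_N[OF assms, of i] by (rule measurable_sets) simp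
 also have "(%om. N om i s) -` A Int space M = {om:space M. N om i s : A}" by auto
 finally show ?thesis .
qed

lemma clocks_set:
 assumes "finite S" "S <= {0..t}" shows "{om:space M. ALL s:S. N om i s : A s} : events"
 using assms by (intro sets.sets_Collect_finite_All) (auto intro!: clock_set)

lemma init_set: "B : sets config_space ==> {om:space M. sg om 0 : B} : events"
 using measurable_sets[OF measurable_sg[of 0], of B] by (simp add: vimage_def Int_def conj_commute)

lemma past_rects_events: "past_rects t <= events"
proof
 fix X assume "X : past_rects t"
 then obtain B I S A where X: "X = rect B I S A"
  "B : sets config_space" "finite I" "finite S" "S <= {0..t}" unfolding past_rects_def by blast
 have "{om:space M. ALL i:I. ALL s:S. N om i s : A i s} : events"
  using X by (intro sets.sets_Collect_finite_All clocks_set) auto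
 moreover have "{om:space M. sg om 0 : B} : events" using X by (intro init_set)
 ultimately show "X : events" unfolding X(1) by (intro sets.sets_Collect_conj)
qed

lemma past_rects_Int_stable: "Int_stable (past_rects t)"
 unfolding Int_stable_def
proof (intro ballI)
 fix X X' assume "X : past_rects t" "X' : past_rects t"
 then obtain B I S A B' I' S' A' where
  X: "X = rect B I S A"
  "B : sets config_space" "finite I" "finite S" "S <= {0..t}"
  and X': "X' = rect B' I' S' A'"
  "B' : sets config_space" "finite I'" "finite S'" "S' <= {0..t}" unfolding past_rects_def by blast
 have "X Int X' = {om:space M. sg om 0 : B Int B' & (ALL i:I Un I'. ALL s:S Un S'. N om i s :
   (if i : I & s : S then A i s else UNIV) Int (if i : I' & s : S' then A' i s else UNIV))}"
  unfolding X(1) X'(1) by auto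
 also have "... : past_rects t" using X X' by (intro past_rectsI) auto
 finally show "X Int X' : past_rects t" .
qed

lemma indep_initial_clocks:
 assumes B: "B : sets config_space" and J: "finite J" "!!i. i : J ==> C i : sets (\<Pi>\<^sub>M t\<in>{0..}. count_space UNIV)"
 shows "prob {om:space M. sg om 0 : B & (ALL i:J. restrict (N om i) {0..} : C i)} =
   prob {om:space M. sg om 0 : B} * (PROD i:J. prob {om:space M. restrict (N om i) {0..} : C i})"
proof -
 let ?P = "\<Pi>\<^sub>M t\<in>{0..}. count_space (UNIV :: nat set)"
 let ?Q = "\<Pi>\<^sub>M i\<in>(UNIV :: (int \<times> sign) set). ?P"
 have iv: "indep_vars (%_. ?P) (%i om. restrict (N om i) {0..}) UNIV"
  using process by (simp add: toom_process_def toom_clocks_def)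
 have rv: "(%om. restrict (N om i) {0..}) : measurable M ?P" for i
  using iv by (simp add: indep_vars_def)
 have ind: "indep_set (sets (vimage_algebra (space M) (%om. sg om 0) config_space))
   (sets (vimage_algebra (space M) (%om i. restrict (N om i) {0..}) ?Q))"
  using process by (simp add: toom_process_def)
 define G where "G = {om:space M. ALL i:J. restrict (N om i) {0..} : C i}"
 have 1: "{om:space M. sg om 0 : B} : sets (vimage_algebra (space M) (%om. sg om 0) config_space)"
  using in_vimage_algebra[OF B, of "%om. sg om 0" "space M"] by (simp add: vimage_def Int_def conj_commute)
 have "{x : space ?Q. ALL i:J. x i : C i} : sets ?Q"
  using J by (intro sets.sets_Collect_finite_All) (auto intro!: sets_Collect_single')
 from in_vimage_algebra[OF this, of "%om i. restrict (N om i) {0..}" "space M"]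
 have 2: "G : sets (vimage_algebra (space M) (%om i. restrict (N om i) {0..}) ?Q)"
  by (simp add: G_def vimage_def Int_def conj_commute space_PiM PiE_iff)
 have "prob ({om:space M. sg om 0 : B} Int G) = prob {om:space M. sg om 0 : B} * prob G"
  by (rule indep_setD[OF ind 1 2])
 moreover have "prob G = (PROD i:J. prob {om:space M. restrict (N om i) {0..} : C i})"
 proof (cases "J = {}")
  case True thus ?thesis by (simp add: G_def prob_space)
 next
  case False
  have "prob (INT i:J. (%om. restrict (N om i) {0..}) -` C i Int space M) =
    (PROD i:J. prob ((%om. restrict (N om i) {0..}) -` C i Int space M))"
   using J False by (intro indep_varsD[OF iv]) auto
  moreover have "(INT i:J. (%om. restrict (N om i) {0..}) -` C i Int space M) = G"
   using False by (auto simp: G_def)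
  moreover have "(%om. restrict (N om i) {0..}) -` C i Int space M = {om:space M. restrict (N om i) {0..} : C i}" for i
   by auto
  ultimately show ?thesis by simp
 qed
 moreover have "{om:space M. sg om 0 : B} Int G = {om:space M. sg om 0 : B & (ALL i:J. restrict (N om i) {0..} : C i)}"
  by (auto simp: G_def)
 ultimately show ?thesis by simp
qed

lemma path_set:
 assumes "finite S" "S <= {0..}" "0 <= t" "0 <= u"
 shows "{f : space (\<Pi>\<^sub>M t\<in>{0..}. count_space (UNIV :: nat set)). (ALL s:S. f s : A s) & (Z --> (f t < f u <-> b))}
   : sets (\<Pi>\<^sub>M t\<in>{0..}. count_space (UNIV :: nat set))" (is "_ : sets ?P")
proof -
 have "{f : space ?P. f s : A s} : sets ?P" if "s : S" for s
  using assms that by (intro sets_Collect_single') auto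
 hence 1: "{f : space ?P. ALL s:S. f s : A s} : sets ?P" using assms by (intro sets.sets_Collect_finite_All) auto
 have [measurable]: "(%f. f t) : measurable ?P (count_space UNIV)" "(%f. f u) : measurable ?P (count_space UNIV)"
  using assms by (auto intro!: measurable_component_singleton)
 have "Measurable.pred ?P (%f. Z --> ((EX n m. f t = n & f u = m & n < m) <-> b))" by measurable
 hence "{f : space ?P. Z --> (f t < f u <-> b)} : sets ?P" by simp
 from sets.sets_Collect_conj[OF this 1] show ?thesis by (simp add: conj_commute)
qed

definition pattern_prob :: "(int \<times> sign) set => (int \<times> sign) set => real => real" where
 "pattern_prob I J h = (PROD i:I. if i : J then incr_prob i h else 1 - incr_prob i h)"

lemma prob_incr_iff:
 assumes "0 <= s" "s <= t"
 shows "prob {om:space M. incr i s t om <-> b} = (if b then incr_prob i (t - s) else 1 - incr_prob i (t - s))"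
 using prob_incr[OF assms, of i] prob_not_incr[OF assms, of i] by (cases b) (simp_all add: incr_prob_def)

text \<open>Independence is used twice: between the initial configuration and the different clocks,
  and within each clock between its values up to \<open>t\<close> and its increment after
  \<open>t\<close>.\<close>

lemma indep_rect_future:
 assumes X: "X : past_rects t" and tu: "0 <= t" "t <= u" and J: "finite J"
 shows "prob (X Int {om:space M. ALL i:J. incr i t u om <-> i : K}) = prob X * pattern_prob J K (u - t)"
proof -
 obtain B I S A where X: "X = rect B I S A"
  and B: "B : sets config_space" and I: "finite I" and S: "finite S" "S <= {0..t}"
  using X unfolding past_rects_def by blast
 let ?P = "\<Pi>\<^sub>M t\<in>{0..}. count_space (UNIV :: nat set)"
 define A' where "A' i s = (if i : I then A i s else UNIV)" for i s
 \<comment> \<open>With \<open>Z\<close> true the set also prescribes the increment after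
   \<open>t\<close>, with \<open>Z\<close> false only the past; comparing the two factors clock by
   clock isolates the future.\<close>
 define C where "C Z i = {f : space ?P. (ALL s:S. f s : A' i s) & (Z & i : J --> (f t < f u <-> i : K))}" for Z i
 have Cm: "C Z i : sets ?P" for Z i unfolding C_def by (rule path_set) (use S tu in auto)
 have mem: "restrict (N om i) {0..} : C Z i <-> (ALL s:S. N om i s : A' i s) & (Z & i : J --> (incr i t u om <-> i : K))" for Z i om
  using S tu by (auto simp: C_def space_PiM incr_def subset_iff)
 have fin: "finite (I Un J)" using I J by simp
 have pc: "prob {om:space M. restrict (N om i) {0..} : C True i} =
   prob {om:space M. restrict (N om i) {0..} : C False i} * (if i : J then if i : K then incr_prob i (u - t) else 1 - incr_prob i (u - t) else 1)" for i
  unfolding mem using indep_clock_past[OF S tu, of i "A' i" "i : K"] prob_incr_iff[OF tu, of i "i : K"] by auto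
 have "prob (X Int {om:space M. ALL i:J. incr i t u om <-> i : K}) =
   prob {om:space M. sg om 0 : B & (ALL i:I Un J. restrict (N om i) {0..} : C True i)}"
  unfolding mem X A'_def by (intro arg_cong[where f = prob]) auto
 also have "... = prob {om:space M. sg om 0 : B} * (PROD i:I Un J. prob {om:space M. restrict (N om i) {0..} : C True i})"
  by (rule indep_initial_clocks[OF B fin Cm])
 also have "... = prob {om:space M. sg om 0 : B} * (PROD i:I Un J. prob {om:space M. restrict (N om i) {0..} : C False i}) *
   (PROD i:I Un J. if i : J then if i : K then incr_prob i (u - t) else 1 - incr_prob i (u - t) else 1)"
  unfolding pc prod.distrib by simp
 also have "prob {om:space M. sg om 0 : B} * (PROD i:I Un J. prob {om:space M. restrict (N om i) {0..} : C False i}) =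
   prob {om:space M. sg om 0 : B & (ALL i:I Un J. restrict (N om i) {0..} : C False i)}"
  by (rule indep_initial_clocks[OF B fin Cm, symmetric])
 also have "... = prob X"
  unfolding mem X A'_def by (intro arg_cong[where f = prob]) auto
 also have "(PROD i:I Un J. if i : J then if i : K then incr_prob i (u - t) else 1 - incr_prob i (u - t) else 1) = pattern_prob J K (u - t)"
  unfolding pattern_prob_def by (rule prod.mono_neutral_cong_right) (use fin in auto)
 finally show ?thesis .
qed

definition null_sub :: "'a set set" where
 "null_sub = {Z. Z <= space M & (EX Z':null_sets M. Z <= Z')}"

definition FF :: "real => 'a measure" where
 "FF t = sigma (space M) (past_rects t Un null_sub)"

lemma FF_generators: "past_rects t Un null_sub <= Pow (space M)"
proof -
 have "past_rects t <= Pow (space M)" by (rule order_trans[OF past_rects_events sets.space_closed])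
 moreover have "null_sub <= Pow (space M)" unfolding null_sub_def by blast
 ultimately show ?thesis by blast
qed

lemma space_FF [simp]: "space (FF t) = space M"
 unfolding FF_def by (rule space_measure_of[OF FF_generators])

lemma sets_FF: "sets (FF t) = sigma_sets (space M) (past_rects t Un null_sub)"
 unfolding FF_def by (rule sets_measure_of[OF FF_generators])

text \<open>Completion changes sets only on null sets; through this, independence proved on the
  generator reaches \<open>FF t\<close>.\<close>

lemma FF_AE_eq:
 assumes "A : sets (FF t)"
 shows "EX A':sigma_sets (space M) (past_rects t). AE om in M. om : A <-> om : A'"
 using assms unfolding sets_FF
proof (induction A rule: sigma_sets.induct)
 case (Basic A)
 thus ?case
 proof
  assume "A : null_sub"
  then obtain Z where "Z : null_sets M" "A <= Z" by (auto simp: null_sub_def)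
  hence "AE om in M. om : A <-> om : {}" by (intro AE_I'[of Z]) auto
  thus ?thesis using sigma_sets.Empty by (intro bexI)
 qed (intro bexI[of _ A] sigma_sets.Basic, auto)
next
 case Empty
 thus ?case by (intro bexI[of _ "{}"] sigma_sets.Empty) auto
next
 case (Compl A)
 then obtain A' where "A' : sigma_sets (space M) (past_rects t)" "AE om in M. om : A <-> om : A'" by blast
 thus ?case by (intro bexI[of _ "space M - A'"] sigma_sets.Compl) auto
next
 case (Union A)
 then obtain A' where A': "!!i. A' i : sigma_sets (space M) (past_rects t)" "!!i :: nat. AE om in M. om : A i <-> om : A' i" by metis
 hence "AE om in M. ALL i. om : A i <-> om : A' i" by (simp add: AE_all_countable)
 hence "AE om in M. om : (UN i. A i) <-> om : (UN i. A' i)" by eventually_elim auto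
 thus ?case using A' by (intro bexI[of _ "UN i. A' i"] sigma_sets.Union) auto
qed

text \<open>The Markov property in the only form that is used: a finite pattern of ringing and
  silent clocks after \<open>t\<close> is independent of the completed past.\<close>

theorem indep_FF_future:
 assumes A: "A : sets (FF t)" "A : events" and tu: "0 <= t" "t <= u" and J: "finite J"
 shows "prob (A Int {om:space M. ALL i:J. incr i t u om <-> i : K}) = prob A * pattern_prob J K (u - t)"
proof -
 define G where "G = {om:space M. ALL i:J. incr i t u om <-> i : K}"
 have G: "G : events" unfolding G_def
  using J tu by (intro sets.sets_Collect_finite_All) (auto intro!: predE measurable_incr)
 have r: "X : past_rects t ==> prob (X Int G) = prob X * pattern_prob J K (u - t)" for X
  unfolding G_def by (rule indep_rect_future[OF _ tu J])
 have sp: "space M : past_rects t"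
 proof -
  have "{om:space M. sg om 0 : space config_space & (ALL i:{}. ALL s:{}. N om i s : {})} : past_rects t"
   by (rule past_rectsI) auto
  moreover have "space config_space = UNIV" by (simp add: config_space_def space_PiM)
  ultimately show ?thesis by simp
 qed
 have pG: "prob G = pattern_prob J K (u - t)"
  using r[OF sp] sets.sets_into_space[OF G] by (simp add: prob_space Int_absorb1)
 have "indep_set (past_rects t) {G}"
  by (rule indep_setI) (use r pG G past_rects_events in auto)
 hence i: "indep_set (sigma_sets (space M) (past_rects t)) (sigma_sets (space M) {G})"
  by (rule indep_set_sigma_sets[OF _ past_rects_Int_stable]) (simp add: Int_stable_def)
 obtain A' where A': "A' : sigma_sets (space M) (past_rects t)" "AE om in M. om : A <-> om : A'"
  using FF_AE_eq[OF A(1)] by blast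
 have A'e: "A' : events" using A'(1) sets.sigma_sets_subset[OF past_rects_events] by blast
 have "prob (A Int G) = prob (A' Int G)"
  by (rule finite_measure_eq_AE) (use A' A A'e G in auto)
 also have "... = prob A' * prob G" by (rule indep_setD[OF i A'(1)]) (rule sigma_sets.Basic, simp)
 also have "prob A' = prob A" by (rule finite_measure_eq_AE) (use A' A A'e in auto)
 finally have "prob (A Int G) = prob A * pattern_prob J K (u - t)" unfolding pG .
 thus ?thesis unfolding G_def .
qed

lemma past_rects_mono:
 assumes "s <= t" shows "past_rects s <= past_rects t"
proof
 fix X assume "X : past_rects s"
 then obtain B I S A where X: "X = rect B I S A"
  "B : sets config_space" "finite I" "finite S" "S <= {0..s}" unfolding past_rects_def by blast
 have "S <= {0..t}" using X(5) assms by auto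
 thus "X : past_rects t" unfolding X(1) using X(2-4) by (intro past_rectsI)
qed

lemma FF_mono: "s <= t ==> sets (FF s) <= sets (FF t)"
 unfolding sets_FF by (rule sigma_sets_mono') (use past_rects_mono in blast)

lemma pred_FF_mono: "Measurable.pred (FF s) P ==> s <= t ==> Measurable.pred (FF t) P"
 using FF_mono[of s t] by (auto simp: pred_def)

text \<open>The reason for completing the past: configuration and tag are only almost sure limits of
  adapted quantities.\<close>

lemma pred_FF_AE:
 assumes P: "Measurable.pred (FF t) P" and eq: "AE om in M. P om <-> Q om"
 shows "Measurable.pred (FF t) Q"
proof -
 obtain Z where Z: "Z : null_sets M" "{om:space M. ~ (P om <-> Q om)} <= Z"
  using eq by (auto elim!: AE_E simp: null_sets_def)
 have n: "X : sets (FF t)" if "X <= Z Int space M" for X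
 proof -
  have "X : null_sub" using that Z(1) unfolding null_sub_def by blast
  thus ?thesis unfolding sets_FF by (intro sigma_sets.Basic UnI2)
 qed
 have "{om:space M. Q om} = ({om:space M. P om} - (Z Int space M)) Un {om:space M. Q om & om : Z}"
  using Z(2) by auto
 also have "... : sets (FF t)"
 proof -
  have a: "{om:space M. P om} : sets (FF t)" using P by (simp add: pred_def)
  have b: "Z Int space M : sets (FF t)" and c: "{om:space M. Q om & om : Z} : sets (FF t)"
   by (rule n, blast)+
  show ?thesis by (rule sets.Un[OF sets.Diff[OF a b] c])
 qed
 finally show ?thesis by (simp add: pred_def)
qed

lemma pred_FF_init: "0 <= t ==> Measurable.pred (FF t) (%om. sg om 0 x)"
proof -
 have "{s. s x} : sets config_space"
 proof -
  have "{s : space config_space. s x : {True}} : sets config_space"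
   unfolding config_space_def by (rule sets_Collect_single') auto
  thus ?thesis by (simp add: config_space_def space_PiM)
 qed
 hence "{om:space M. sg om 0 : {s. s x} & (ALL i:{}. ALL s:{}. N om i s : {})} : past_rects t"
  by (intro past_rectsI) auto
 thus ?thesis unfolding pred_def sets_FF by (auto intro: sigma_sets.Basic)
qed

lemma pred_FF_incr:
 assumes "0 <= s" "s <= u" "u <= t" shows "Measurable.pred (FF t) (incr i s u)"
proof -
 have *: "{om:space M. N om i s = m} : sets (FF t)" if "0 <= s" "s <= t" for s m
 proof -
  have "{om:space M. sg om 0 : space config_space & (ALL i:{i}. ALL s:{s}. N om i s : {m})} : past_rects t"
   using that by (intro past_rectsI) auto
  thus ?thesis unfolding sets_FF by (auto intro: sigma_sets.Basic simp: config_space_def space_PiM)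
 qed
 define B where "B n m = (if n < m then {om:space M. N om i s = n} Int {om:space M. N om i u = m} else {})" for n m
 have B: "B n m : sets (FF t)" for n m
  using *[of s n] *[of u m] assms by (auto simp: B_def)
 have "{om:space M. incr i s u om} = (UN n. UN m. B n m)"
  by (auto simp: incr_def B_def split: if_splits)
 also have "... : sets (FF t)"
  by (rule sets.countable_UN, rule image_subsetI)+ (rule B)
 finally show ?thesis by (simp add: pred_def)
qed

end

subsection \<open>Rings on a cycle preserve the product weights\<close>

definition window :: "nat => int set" where "window L = {- int L..<int L}"

lemma finite_window [simp]: "finite (window L)" by (simp add: window_def)

lemma wrap_in: "0 < L ==> wrap L y : window L"
 using pos_mod_bound[of "2 * int L" "y + int L"] pos_mod_sign[of "2 * int L" "y + int L"]
 unfolding wrap_def window_def by auto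

lemma wrap_id: "y : window L ==> wrap L y = y"
 by (simp add: wrap_def window_def mod_pos_pos_trivial)

lemma wrap_shift: "wrap L (y + 2 * int L * k) = wrap L y"
proof -
 have "y + 2 * int L * k + int L = (y + int L) + k * (2 * int L)" by (simp add: algebra_simps)
 thus ?thesis unfolding wrap_def by (simp only: mod_mult_self1)
qed

lemma wrap_eq_iff: "(wrap L y = wrap L z) = (EX k. z = y + 2 * int L * k)"
proof
 assume "wrap L y = wrap L z"
 hence "(y + int L) mod (2 * int L) = (z + int L) mod (2 * int L)" by (simp add: wrap_def)
 hence "2 * int L dvd (y + int L) - (z + int L)" by (simp add: mod_eq_dvd_iff)
 then obtain k where "(y + int L) - (z + int L) = 2 * int L * k" by (rule dvdE)
 hence "z = y + 2 * int L * (- k)" by simp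
 thus "EX k. z = y + 2 * int L * k" by blast
qed (auto simp: wrap_shift)

definition opp_ex :: "nat => int => bool => config => bool" where
 "opp_ex L x ep s = (s x = ep & (EX y>x. (s \<circ> wrap L) y ~= ep))"

text \<open>A first opposite site one turn or more away would have a copy one turn earlier, so the
  partner lies within \<open>2 * int L\<close> sites.\<close>

lemma cycle_ring_cases:
 assumes "0 < L" "x : window L" "opp_ex L x ep s"
 obtains z where "x < z" "z < x + 2 * int L" "s (wrap L z) = (~ ep)" "!!u. x < u ==> u < z ==> s (wrap L u) = ep"
  "cycle_ring L x ep s = s(x := ~ ep, wrap L z := ep)" "wrap L z ~= x" "partner x ep (s \<circ> wrap L) = z"
proof -
 have ex: "EX y>x. (s \<circ> wrap L) y ~= ep" and sx: "s x = ep" using assms by (auto simp: opp_ex_def)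
 obtain z where z: "x < z" "(s \<circ> wrap L) z ~= ep" "!!u. x < u ==> u < z ==> (s \<circ> wrap L) u = ep" "partner x ep (s \<circ> wrap L) = z"
  using first_opposite[OF ex] by blast
 have wx: "wrap L (x + 2 * int L * k) = x" for k using wrap_shift wrap_id[OF assms(2)] by simp
 have "z < x + 2 * int L"
 proof (rule ccontr)
  assume n: "~ z < x + 2 * int L"
  have "z ~= x + 2 * int L" using wx[of 1] sx z(2) by auto
  hence "x < z - 2 * int L" using n by simp
  moreover have "wrap L (z - 2 * int L) = wrap L z" using wrap_shift[of L z "-1"] by simp
  ultimately show False using z(2) z(3)[of "z - 2 * int L"] assms(1) by simp
 qed
 moreover have "wrap L z ~= x" using z(2) sx by auto
 moreover have "cycle_ring L x ep s = s(x := ~ ep, wrap L z := ep)"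
  using ex sx z(2,4) unfolding cycle_ring_def Let_def exchange_def by auto
 ultimately show ?thesis using that[of z] z by auto
qed

lemma cycle_ring_trivial: "~ opp_ex L x ep s ==> cycle_ring L x ep s = s"
 unfolding cycle_ring_def opp_ex_def Let_def by auto

text \<open>The site at which the ring ends. It is the additional information that makes a ring
  reversible.\<close>

definition target :: "nat => bool => config => int => int" where
 "target L ep s x = (if opp_ex L x ep s then wrap L (partner x ep (s \<circ> wrap L)) else x)"

lemma target_in: "0 < L ==> x : window L ==> target L ep s x : window L"
 by (simp add: target_def wrap_in)

lemma opp_ex_ring:
 assumes "0 < L" "x : window L" "opp_ex L x ep s"
 shows "cycle_ring L x ep s (target L ep s x) = ep" "cycle_ring L x ep s x = (~ ep)"
 by (rule cycle_ring_cases[OF assms]; simp add: assms(3) target_def)+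

lemma no_opp_const:
 assumes "0 < L" "~ opp_ex L x ep s" "s x = ep" "y : window L"
 shows "s y = ep"
proof -
 have "EX k. x < y + 2 * int L * int k"
 proof (cases "y <= x")
  case True
  define q where "q = 2 * int L * (x - y + 1)"
  have "1 * (x - y + 1) <= q" unfolding q_def using assms(1) True by (intro mult_right_mono) auto
  hence "x - y + 1 <= q" by (simp only: mult_1)
  hence "x < y + q" by linarith
  hence "x < y + 2 * int L * (x - y + 1)" unfolding q_def .
  moreover have "x - y + 1 = int (nat (x - y + 1))" using True by simp
  ultimately show ?thesis by metis
 next
  case False
  hence "x < y + 2 * int L * int 0" by simp
  thus ?thesis by blast
 qed
 then obtain k where k: "x < y + 2 * int L * int k" by blast
 have "(s \<circ> wrap L) (y + 2 * int L * int k) = ep" using assms(2,3) k unfolding opp_ex_def by blast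
 thus ?thesis using wrap_shift[of L y "int k"] wrap_id[OF assms(4)] by simp
qed

text \<open>A ring can be undone once its target is known: going left from the target through the
  run of \<open>ep\<close>, the first opposite site is the one that rang. A ring without effect
  cannot be confused with an effective one: the target would carry \<open>ep\<close> in a cycle that
  is entirely \<open>ep\<close>, but an effective ring leaves \<open>~ ep\<close> behind.\<close>

lemma cycle_ring_inj:
 assumes L: "0 < L" and x: "x1 : window L" "x2 : window L"
  and eq: "cycle_ring L x1 ep s1 = cycle_ring L x2 ep s2" "target L ep s1 x1 = target L ep s2 x2"
 shows "s1 = s2 & x1 = x2"
proof -
 have mixed: False if o: "opp_ex L x1 ep s1" "~ opp_ex L x2 ep s2" and x: "x1 : window L" "x2 : window L"
  and eq: "cycle_ring L x1 ep s1 = cycle_ring L x2 ep s2" "target L ep s1 x1 = target L ep s2 x2" for x1 x2 s1 s2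
 proof -
  have t: "cycle_ring L x2 ep s2 = s2" "target L ep s2 x2 = x2" using o(2) by (simp_all add: cycle_ring_trivial target_def)
  have "s2 x2 = ep" using opp_ex_ring(1)[OF L x(1) o(1)] unfolding eq t by simp
  hence "s2 x1 = ep" by (rule no_opp_const[OF L o(2) _ x(1)])
  thus False using opp_ex_ring(2)[OF L x(1) o(1)] unfolding eq t by simp
 qed
 consider "~ opp_ex L x1 ep s1" "~ opp_ex L x2 ep s2" | "opp_ex L x1 ep s1" "opp_ex L x2 ep s2"
  using mixed[OF _ _ x eq] mixed[OF _ _ x(2,1) eq[symmetric]] by blast
 thus ?thesis
 proof cases
  case 1 thus ?thesis using eq by (simp add: cycle_ring_trivial target_def)
 next
  case 2
  obtain z1 where z1: "x1 < z1" "z1 < x1 + 2 * int L" "s1 (wrap L z1) = (~ ep)" "!!u. x1 < u ==> u < z1 ==> s1 (wrap L u) = ep"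
   "cycle_ring L x1 ep s1 = s1(x1 := ~ ep, wrap L z1 := ep)" "wrap L z1 ~= x1" "partner x1 ep (s1 \<circ> wrap L) = z1"
   using cycle_ring_cases[OF L x(1) 2(1)] by blast
  obtain z2 where z2: "x2 < z2" "z2 < x2 + 2 * int L" "s2 (wrap L z2) = (~ ep)" "!!u. x2 < u ==> u < z2 ==> s2 (wrap L u) = ep"
   "cycle_ring L x2 ep s2 = s2(x2 := ~ ep, wrap L z2 := ep)" "wrap L z2 ~= x2" "partner x2 ep (s2 \<circ> wrap L) = z2"
   using cycle_ring_cases[OF L x(2) 2(2)] by blast
  define r where "r = cycle_ring L x1 ep s1"
  have r2: "r = cycle_ring L x2 ep s2" using eq(1) by (simp add: r_def)
  have wz: "wrap L z1 = wrap L z2" using eq(2) 2 z1(7) z2(7) by (simp add: target_def)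
  then obtain k where k: "z2 = z1 + 2 * int L * k" by (auto simp: wrap_eq_iff)
  have run1: "r (wrap L u) = ep" if "x1 < u" "u <= z1" for u
  proof -
   have "wrap L u ~= x1"
   proof
    assume "wrap L u = x1"
    hence "wrap L x1 = wrap L u" using wrap_id[OF x(1)] by simp
    then obtain j where j: "u = x1 + 2 * int L * j" by (auto simp: wrap_eq_iff)
    hence "0 < 2 * int L * j" "2 * int L * j < 2 * int L * 1" using that z1(2) by auto
    hence "0 < j" "j < 1" using L by (auto simp: zero_less_mult_iff)
    thus False by simp
   qed
   thus ?thesis using z1(4)[of u] that unfolding r_def z1(5) by (cases "u = z1") auto
  qed
  have run2: "r (wrap L u) = ep" if "x2 < u" "u <= z2" for u
  proof -
   have "wrap L u ~= x2"
   proof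
    assume "wrap L u = x2"
    hence "wrap L x2 = wrap L u" using wrap_id[OF x(2)] by simp
    then obtain j where j: "u = x2 + 2 * int L * j" by (auto simp: wrap_eq_iff)
    hence "0 < 2 * int L * j" "2 * int L * j < 2 * int L * 1" using that z2(2) by auto
    hence "0 < j" "j < 1" using L by (auto simp: zero_less_mult_iff)
    thus False by simp
   qed
   thus ?thesis using z2(4)[of u] that unfolding r2 z2(5) by (cases "u = z2") auto
  qed
  have R1: "r = s1(x1 := ~ ep, wrap L z1 := ep)" unfolding r_def by (rule z1(5))
  have R2: "r = s2(x2 := ~ ep, wrap L z2 := ep)" unfolding r2 by (rule z2(5))
  have rx1: "r x1 = (~ ep)" unfolding R1 using z1(6) by simp
  have rx2: "r x2 = (~ ep)" unfolding R2 using z2(6) by simp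
  note rx = rx1 rx2
  \<comment> \<open>Both runs end at the same site of the cycle. If their starting sites differed,
    one of them would lie inside the other run, where the result is \<open>ep\<close>, whereas a
    starting site carries \<open>~ ep\<close>.\<close>
  have "x2 - 2 * int L * k = x1"
  proof (rule ccontr)
   assume "x2 - 2 * int L * k ~= x1"
   then consider "x1 < x2 - 2 * int L * k" | "x2 < x1 + 2 * int L * k" by linarith
   thus False
   proof cases
    case 1
    hence "r (wrap L (x2 - 2 * int L * k)) = ep" by (rule run1) (use z2(1) k in linarith)
    moreover have "wrap L (x2 - 2 * int L * k) = x2" using wrap_shift[of L x2 "- k"] wrap_id[OF x(2)] by simp
    ultimately show False using rx by simp
   next
    case 2
    hence "r (wrap L (x1 + 2 * int L * k)) = ep" by (rule run2) (use z1(1) k in linarith)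
    thus False using rx wrap_shift[of L x1 k] wrap_id[OF x(1)] by simp
   qed
  qed
  hence "wrap L x1 = wrap L x2" by (simp add: wrap_eq_iff) (metis diff_add_cancel)
  hence xx: "x1 = x2" using wrap_id x by simp
  have "s1 = r(x1 := ep, wrap L z1 := ~ ep)"
   unfolding R1 using 2(1) z1(3,6) by (auto simp: opp_ex_def fun_eq_iff)
  moreover have "s2 = r(x2 := ep, wrap L z2 := ~ ep)"
   unfolding R2 using 2(2) z2(3,6) by (auto simp: opp_ex_def fun_eq_iff)
  ultimately have "s1 = s2" by (simp only: xx wz)
  thus ?thesis using xx wz by simp
 qed
qed

definition occ :: "nat => config => int set" where "occ L s = {x : window L. s x}"

definition set_ring :: "nat => int => bool => int set => int set" where
 "set_ring L x ep A = occ L (cycle_ring L x ep (%y. y : A))"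

lemma cycle_ring_local:
 assumes L: "0 < L" and x: "x : window L" and eq: "!!y. y : window L ==> s y = s' y" and y: "y : window L"
 shows "cycle_ring L x ep s y = cycle_ring L x ep s' y"
proof -
 have w: "s \<circ> wrap L = s' \<circ> wrap L" using eq wrap_in[OF L] by auto
 hence o: "opp_ex L x ep s = opp_ex L x ep s'" using eq[OF x] by (simp add: opp_ex_def)
 show ?thesis
 proof (cases "opp_ex L x ep s")
  case True
  hence "(s x = ep & (EX y>x. (s' \<circ> wrap L) y ~= ep))" "(s' x = ep & (EX y>x. (s' \<circ> wrap L) y ~= ep))"
   using o w unfolding opp_ex_def by auto
  hence "cycle_ring L x ep s = exchange s x (wrap L (partner x ep (s' \<circ> wrap L)))"
   "cycle_ring L x ep s' = exchange s' x (wrap L (partner x ep (s' \<circ> wrap L)))"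
   unfolding cycle_ring_def Let_def w by auto
  thus ?thesis using eq x y wrap_in[OF L] by (simp add: exchange_def)
 next
  case False
  thus ?thesis using o eq y by (simp add: cycle_ring_trivial)
 qed
qed

lemma occ_ring: "0 < L ==> x : window L ==> occ L (cycle_ring L x ep s) = set_ring L x ep (occ L s)"
 unfolding set_ring_def occ_def using cycle_ring_local[of L x s "%y. y : {x : window L. s x}"] by auto

lemma cycle_ring_outside: "0 < L ==> x : window L ==> y ~: window L ==> cycle_ring L x ep s y = s y"
 using wrap_in[of L] by (auto simp: cycle_ring_def exchange_def Let_def)

definition set_wt :: "nat => real => int set => real" where
 "set_wt L p A = p ^ card A * (1 - p) ^ (card (window L) - card A)"

lemma card_move: "finite B ==> x : B ==> w ~: B - {x} ==> card (insert w (B - {x})) = card B"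
 by (metis card_Suc_Diff1 card_insert_disjoint finite_Diff)

lemma card_occ_ring:
 assumes L: "0 < L" and x: "x : window L"
 shows "card (set_ring L x ep A) = card (A Int window L)"
proof -
 let ?s = "%y. y : A"
 show ?thesis
 proof (cases "opp_ex L x ep ?s")
  case True
  obtain z where z: "?s (wrap L z) = (~ ep)" "cycle_ring L x ep ?s = ?s(x := ~ ep, wrap L z := ep)" "wrap L z ~= x"
   using cycle_ring_cases[OF L x True] by blast
  have sx: "?s x = ep" using True by (simp add: opp_ex_def)
  define w where "w = wrap L z"
  have w: "w : window L" unfolding w_def by (rule wrap_in[OF L])
  show ?thesis
  proof (cases ep)
   case True
   have "set_ring L x ep A = insert w (A Int window L - {x})"
    using z True sx w x unfolding set_ring_def occ_def w_def[symmetric] by auto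
   moreover have "w ~: A Int window L - {x}" "x : A Int window L" using z(1) True sx x by (auto simp: w_def)
   ultimately show ?thesis using card_move[of "A Int window L"] finite_window[of L] by (metis finite_Int)
  next
   case False
   have "set_ring L x ep A = insert x (A Int window L - {w})"
    using z False sx w x unfolding set_ring_def occ_def w_def[symmetric] by auto
   moreover have "x ~: A Int window L - {w}" "w : A Int window L" using z(1) False sx w by (auto simp: w_def)
   ultimately show ?thesis using card_move[of "A Int window L"] finite_window[of L] by (metis finite_Int)
  qed
 next
  case False
  thus ?thesis by (simp add: set_ring_def cycle_ring_trivial occ_def Int_def conj_commute)
 qed
qed

text \<open>A pair \<open>(A, x)\<close> that leads to \<open>B\<close> is determined by its target,
  which is one of the sites of the cycle. As many rings lead out of \<open>B\<close>, so at most as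
  many lead in as out.\<close>

lemma preimage_count:
 assumes L: "0 < L"
 shows "card {(A, x). A <= window L & x : window L & set_ring L x ep A = B} <= card (window L)"
proof (rule card_inj_on_le)
 define f where "f = (%(A :: int set, x). target L ep (%y. y : A) x)"
 show "inj_on f {(A, x). A <= window L & x : window L & set_ring L x ep A = B}"
 proof (rule inj_onI, clarify)
  fix A x A' x'
  assume a: "A <= window L" "x : window L" "A' <= window L" "x' : window L" "f (A, x) = f (A', x')"
   "set_ring L x' ep A' = set_ring L x ep A"
  have "cycle_ring L x ep (%y. y : A) y = cycle_ring L x' ep (%y. y : A') y" for y
  proof (cases "y : window L")
   case True
   thus ?thesis using a(6) by (auto simp: set_ring_def occ_def set_eq_iff)
  next
   case False
   hence "y ~: A" "y ~: A'" using a by auto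
   thus ?thesis using cycle_ring_outside[OF L _ False] a by simp
  qed
  hence "cycle_ring L x ep (%y. y : A) = cycle_ring L x' ep (%y. y : A')" by blast
  moreover have "target L ep (%y. y : A) x = target L ep (%y. y : A') x'" using a(5) by (simp add: f_def)
  ultimately have "(%y. y : A) = (%y. y : A') & x = x'" by (rule cycle_ring_inj[OF L a(2,4)])
  thus "A = A' & x = x'" by (auto simp: fun_eq_iff)
 qed
 show "f ` {(A, x). A <= window L & x : window L & set_ring L x ep A = B} <= window L"
  using target_in[OF L] by (auto simp: f_def)
qed simp

text \<open>A ring preserves the number of \<open>+\<close> sites, so all preimages of
  \<open>B\<close> have the weight of \<open>B\<close>; counting them gives the bound. This is the
  stationarity of the product weights, in the form of an inequality that passes to dominated
  laws.\<close>

theorem ring_weight_sum: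
 assumes L: "0 < L" and p: "0 <= p" "p <= 1" and C: "0 <= C" and u: "!!A. A <= window L ==> u A <= C * set_wt L p A"
 shows "(SUM x:window L. SUM A:{A:Pow (window L). set_ring L x ep A = B}. u A) <= real (card (window L)) * (C * set_wt L p B)"
proof -
 define S where "S = {(A, x). A <= window L & x : window L & set_ring L x ep A = B}"
 have fin: "finite S" by (rule finite_subset[of _ "Pow (window L) \<times> window L"]) (auto simp: S_def)
 have "(SUM x:window L. SUM A:{A:Pow (window L). set_ring L x ep A = B}. u A) =
   (SUM (x, A):(SIGMA x:window L. {A:Pow (window L). set_ring L x ep A = B}). u A)"
  by (rule sum.Sigma) auto
 also have "... = (SUM (A, x):S. u A)"
  by (rule sum.reindex_bij_witness[of _ prod.swap prod.swap]) (auto simp: S_def)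
 also have "... <= (SUM (A, x):S. C * set_wt L p B)"
 proof (rule sum_mono, clarify)
  fix A x assume "(A, x) : S"
  hence A: "A <= window L" "x : window L" "set_ring L x ep A = B" by (auto simp: S_def)
  hence "card A = card B" using card_occ_ring[OF L A(2), of ep A] by (simp add: Int_absorb2)
  thus "u A <= C * set_wt L p B" using u[OF A(1)] by (simp add: set_wt_def)
 qed
 also have "... = real (card S) * (C * set_wt L p B)" by (simp add: case_prod_unfold)
 also have "... <= real (card (window L)) * (C * set_wt L p B)"
  using preimage_count[OF L, of ep B] C p unfolding S_def by (intro mult_right_mono) (auto simp: set_wt_def)
 finally show ?thesis .
qed

text \<open>The product of \<open>f x + g x\<close> is expanded into a sum over subsets of the
  window; \<open>f\<close> or \<open>g\<close> is set to zero at a site of \<open>X\<close> where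
  its choice contradicts \<open>w\<close>.\<close>

lemma set_wt_marginal:
 assumes X: "X <= window L" and p: "0 <= p" "p <= 1"
 shows "(SUM A:{A:Pow (window L). ALL x:X. x : A <-> w x}. set_wt L p A) = (PROD x:X. if w x then p else 1 - p)"
proof -
 define f where "f x = (if x : X & ~ w x then 0 else p)" for x
 define g where "g x = (if x : X & w x then 0 else 1 - p)" for x
 have fin: "finite (window L)" by simp
 have "(PROD x:window L. f x + g x) = (SUM A:Pow (window L). (PROD x:A. f x) * (PROD x:window L - A. g x))"
  by (rule prod_add) simp
 also have "... = (SUM A:{A:Pow (window L). ALL x:X. x : A <-> w x}. set_wt L p A)"
 proof (rule sum.mono_neutral_cong_right)
  show "ALL A:Pow (window L) - {A:Pow (window L). ALL x:X. x : A <-> w x}. (PROD x:A. f x) * (PROD x:window L - A. g x) = 0"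
  proof
   fix A assume A: "A : Pow (window L) - {A:Pow (window L). ALL x:X. x : A <-> w x}"
   then obtain x where x: "x : X" "(x : A) = (~ w x)" by blast
   show "(PROD x:A. f x) * (PROD x:window L - A. g x) = 0"
   proof (cases "x : A")
    case True
    hence "f x = 0" using x by (simp add: f_def)
    hence "(PROD x:A. f x) = 0" using True A finite_subset[OF _ fin] by (auto intro!: prod_zero)
    thus ?thesis by simp
   next
    case False
    hence "g x = 0" "x : window L - A" using x X by (auto simp: g_def)
    hence "(PROD x:window L - A. g x) = 0" by (auto intro!: prod_zero)
    thus ?thesis by simp
   qed
  qed
  fix A assume A: "A : {A:Pow (window L). ALL x:X. x : A <-> w x}"
  have "(PROD x:A. f x) = (PROD x:A. p)" using A by (intro prod.cong) (auto simp: f_def)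
  moreover have "(PROD x:window L - A. g x) = (PROD x:window L - A. 1 - p)" using A by (intro prod.cong) (auto simp: g_def)
  moreover have "card (window L - A) = card (window L) - card A" using A finite_subset[OF _ fin] by (intro card_Diff_subset) auto
  ultimately show "(PROD x:A. f x) * (PROD x:window L - A. g x) = set_wt L p A" by (simp add: set_wt_def)
 qed auto
 finally have "(SUM A:{A:Pow (window L). ALL x:X. x : A <-> w x}. set_wt L p A) = (PROD x:window L. f x + g x)" by simp
 also have "... = (PROD x:X. if w x then p else 1 - p)"
  by (rule prod.mono_neutral_cong_right) (use X in "auto simp: f_def g_def")
 finally show ?thesis .
qed

context toom
begin

subsection \<open>Discretised cycles\<close>

text \<open>Cut the time interval into \<open>Suc m\<close> slots: two given clocks share some slot
  with probability of order \<open>1 / Suc m\<close>.\<close>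

lemma AE_no_simultaneous:
 "AE om in M. ALL i k u. i ~= k --> ~ (arrival (N om i) u & arrival (N om k) u)"
proof -
 have *: "AE om in M. ALL u<=real T. ~ (arrival (N om i) u & arrival (N om k) u)" if ik: "i ~= k" for i k and T :: nat
 proof -
  define h where "h m = real T / real (Suc m)" for m
  define B where "B j m = {om:space M. ALL l:{i, k}. incr l (real j * h m) (real (Suc j) * h m) om <-> l : {i, k}}" for j m
  define E where "E m = (UN j:{..<Suc m}. B j m)" for m
  have h0: "0 <= h m" for m by (simp add: h_def)
  have hs: "0 <= real j * h m" "real j * h m <= real (Suc j) * h m" for j m
   using h0[of m] by (auto simp: mult_right_mono)
  have Bj: "B j m : events" for j m
   unfolding B_def using hs[of j m] by (intro sets.sets_Collect_finite_All) (auto intro!: predE measurable_incr simp del: of_nat_Suc)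
  have Em: "E m : events" for m
   unfolding E_def using Bj by auto
  have pj: "prob (B j m) <= rt i * rt k * (h m)\<^sup>2" for j m
  proof -
   have d: "real (Suc j) * h m - real j * h m = h m" by (simp add: algebra_simps)
   have "prob (space M Int B j m) = prob (space M) * pattern_prob {i, k} {i, k} (real (Suc j) * h m - real j * h m)"
    unfolding B_def by (rule indep_FF_future) (use hs[of j m] sets.top[of "FF (real j * h m)"] in auto)
   also have "... = incr_prob i (h m) * incr_prob k (h m)"
    unfolding d using ik by (simp add: pattern_prob_def prob_space)
   also have "... <= (rt i * h m) * (rt k * h m)"
    by (intro mult_mono incr_prob_le incr_prob_nonneg mult_nonneg_nonneg rt_nonneg h0)
   also have "space M Int B j m = B j m" by (auto simp: B_def)
   finally show ?thesis by (simp add: power2_eq_square mult_ac)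
  qed
  have pm: "prob (E m) <= rt i * rt k * (real T)\<^sup>2 / real (Suc m)" for m
  proof -
   have "prob (E m) <= (SUM j:{..<Suc m}. prob (B j m))"
    unfolding E_def by (rule finite_measure_subadditive_finite) (use Bj in auto)
   also have "... <= (SUM j:{..<Suc m}. rt i * rt k * (h m)\<^sup>2)" by (intro sum_mono pj)
   also have "... = real (Suc m) * (rt i * rt k * (h m)\<^sup>2)" by simp
   also have "... = rt i * rt k * (real T)\<^sup>2 / real (Suc m)" by (simp add: h_def power2_eq_square)
   finally show ?thesis .
  qed
  have sub: "om : E m" if w: "om : space M" "arrival (N om i) u" "arrival (N om k) u" "u <= real T" for om u m
  proof -
   have u0: "0 < u" using w by (simp add: arrival_def)
   have h: "0 < h m" using u0 w(4) by (simp add: h_def)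
   \<comment> \<open>Slots are open on the left and closed on the right, hence the ceiling minus
     one.\<close>
   define j where "j = nat (\<lceil>u / h m\<rceil> - 1)"
   have c: "0 < \<lceil>u / h m\<rceil>" using u0 h by simp
   hence jr: "real j = of_int \<lceil>u / h m\<rceil> - 1" by (simp add: j_def)
   have "real j < u / h m" "u / h m <= real (Suc j)" unfolding jr of_nat_Suc by linarith+
   hence ju: "real j * h m < u" "u <= real (Suc j) * h m" using h by (simp_all add: field_simps)
   have "real (Suc m) * h m = real T" by (simp add: h_def)
   hence "u / h m <= real (Suc m)" using w(4) h by (simp only: pos_divide_le_eq)
   hence "real j < real (Suc m)" using `real j < u / h m` by linarith
   hence "j < Suc m" by simp
   moreover have "incr l (real j * h m) (real (Suc j) * h m) om" if ar: "arrival (N om l) u" for l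
    unfolding incr_def using arrival_imp_increase[OF counting[OF w(1)] ar hs(1)[of j m] ju] .
   ultimately show ?thesis using w unfolding E_def B_def by blast
  qed
  have lim: "prob (INT m. E m) <= rt i * rt k * (real T)\<^sup>2 / real (Suc m)" for m
   using finite_measure_mono[of "INT m. E m" "E m"] Em pm[of m] by force
  have "prob (INT m. E m) <= 0"
  proof (rule LIMSEQ_le_const)
   show "(%m. rt i * rt k * (real T)\<^sup>2 / real (Suc m)) ----> 0" using lim_const_over_n LIMSEQ_Suc by blast
  qed (use lim in blast)
  hence "(INT m. E m) : null_sets M"
   using Em by (intro null_setsI) (auto simp: emeasure_eq_measure measure_le_0_iff)
  thus ?thesis by (rule AE_I') (use sub in blast)
 qed
 have "AE om in M. ALL ik (T::nat). fst ik ~= snd ik --> (ALL u<=real T. ~ (arrival (N om (fst ik)) u & arrival (N om (snd ik)) u))"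
  unfolding AE_all_countable using * by (intro allI AE_impI)
 thus ?thesis
 proof eventually_elim
  fix om assume a: "ALL ik (T::nat). fst ik ~= snd ik --> (ALL u<=real T. ~ (arrival (N om (fst ik)) u & arrival (N om (snd ik)) u))"
  show "ALL i k u. i ~= k --> ~ (arrival (N om i) u & arrival (N om k) u)"
  proof (intro allI impI)
   fix i k :: "int \<times> sign" and u assume ik: "i ~= k"
   obtain T :: nat where "u <= real T" using real_arch_simple by blast
   thus "~ (arrival (N om i) u & arrival (N om k) u)" using a[rule_format, of "(i, k)" u T] ik by simp
  qed
 qed
qed

definition ids :: "nat => (int \<times> sign) set" where "ids L = window L \<times> UNIV"

lemma finite_ids [simp]: "finite (ids L)" by (simp add: ids_def)

definition sole :: "nat => real => real => int \<times> sign => 'a => bool" where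
 "sole L t u i om <-> i : ids L & (ALL k:ids L. incr k t u om <-> k : {i})"

lemma sole_unique: "sole L t u i om ==> sole L t u k om ==> i = k"
 unfolding sole_def by blast

definition ring_of :: "nat => int \<times> sign => config => config" where
 "ring_of L i s = cycle_ring L (fst i) (snd i) s"

text \<open>A slot in which no clock or several clocks of the window ring is treated as idle; slots
  with several clocks disappear as the mesh tends to zero.\<close>

definition step :: "nat => real => real => 'a => config => config" where
 "step L t u om s = (if EX i. sole L t u i om then ring_of L (THE i. sole L t u i om) s else s)"

lemma step_sole: "sole L t u i om ==> step L t u om s = ring_of L i s"
 unfolding step_def using sole_unique by (metis the_equality)

lemma step_none: "(!!i. ~ sole L t u i om) ==> step L t u om s = s"
 unfolding step_def by simp

primrec chain :: "nat => real => real => nat => 'a => config" where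
 "chain L a h 0 om = sg om a"
| "chain L a h (Suc j) om = step L (a + real j * h) (a + real (Suc j) * h) om (chain L a h j om)"

text \<open>A predicate that looks at finitely many sites is a finite disjunction over the patterns
  on these sites.\<close>

lemma pred_local:
 assumes "finite X" "!!x. x : X ==> Measurable.pred F (%om. D om x)"
  and local: "!!s s'. (!!x. x : X ==> s x = s' x) ==> Q s = Q s'"
 shows "Measurable.pred F (%om. Q (D om))"
proof -
 have "Q (D om) <-> (EX A:Pow X. (ALL x:X. D om x <-> x : A) & Q (%x. x : A))" for om
 proof
  assume q: "Q (D om)"
  have "Q (D om) = Q (%x. x : {x : X. D om x})" by (rule local) simp
  thus "EX A:Pow X. (ALL x:X. D om x <-> x : A) & Q (%x. x : A)"
   using q by (intro bexI[of _ "{x : X. D om x}"] conjI) auto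
 next
  assume "EX A:Pow X. (ALL x:X. D om x <-> x : A) & Q (%x. x : A)"
  then obtain A where A: "ALL x:X. D om x <-> x : A" "Q (%x. x : A)" by blast
  have "Q (D om) = Q (%x. x : A)" by (rule local) (use A(1) in simp)
  thus "Q (D om)" using A(2) by simp
 qed
 moreover have "Measurable.pred F (%om. EX A:Pow X. (ALL x:X. D om x <-> x : A) & Q (%x. x : A))"
  using assms(1,2) by (intro pred_intros_finite pred_intros_logic) auto
 ultimately show ?thesis by simp
qed

lemma pred_ring_of:
 assumes "i : ids L" "!!x. Measurable.pred F (%om. D om x)"
 shows "Measurable.pred F (%om. ring_of L i (D om) x)"
proof (cases "L = 0")
 case True thus ?thesis using assms by (simp add: ids_def window_def)
next
 case False
 have i: "fst i : window L" using assms(1) by (auto simp: ids_def)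
 show ?thesis
 proof (cases "x : window L")
  case True
  have L: "0 < L" using False by simp
  show ?thesis unfolding ring_of_def
  proof (rule pred_local[where X = "window L" and D = D and Q = "%s. cycle_ring L (fst i) (snd i) s x"])
   show "cycle_ring L (fst i) (snd i) s x = cycle_ring L (fst i) (snd i) s' x"
    if "!!x. x : window L ==> s x = s' x" for s s'
    by (rule cycle_ring_local[OF L i that True])
  qed (use assms(2) in simp_all)
 next
  case out: False
  have "0 < L" using False by simp
  from cycle_ring_outside[OF this i out] show ?thesis unfolding ring_of_def using assms by simp
 qed
qed

lemma pred_sole:
 assumes "!!k. k : ids L ==> Measurable.pred F (incr k t u)"
 shows "Measurable.pred F (sole L t u i)"
proof -
 have "Measurable.pred F (%om. i : ids L & (ALL k:ids L. incr k t u om <-> k : {i}))"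
  using assms by (intro pred_intros_finite pred_intros_logic) auto
 thus ?thesis by (simp add: sole_def[abs_def])
qed

lemma pred_chain:
 assumes init: "!!x. Measurable.pred F (%om. sg om a x)"
  and inc: "!!i s u. a <= s ==> s <= u ==> u <= t ==> Measurable.pred F (incr i s u)" and h: "0 <= h"
 shows "a + real j * h <= t ==> Measurable.pred F (%om. chain L a h j om x)"
proof (induction j arbitrary: x)
 case 0 thus ?case using init by simp
next
 case (Suc j)
 let ?s = "a + real j * h" and ?u = "a + real (Suc j) * h"
 have su: "a <= ?s" "?s <= ?u" "?u <= t" using h Suc.prems by (auto simp: algebra_simps)
 have IH: "Measurable.pred F (%om. chain L a h j om x)" for x using Suc.IH su by simp
 have so: "Measurable.pred F (sole L ?s ?u i)" for i using inc su by (intro pred_sole) auto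
 have "chain L a h (Suc j) om x = ((EX i:ids L. sole L ?s ?u i om & ring_of L i (chain L a h j om) x) \<or>
   (ALL i:ids L. ~ sole L ?s ?u i om) & chain L a h j om x)" for om
 proof (cases "EX i. sole L ?s ?u i om")
  case True
  then obtain i where i: "sole L ?s ?u i om" by blast
  hence ii: "i : ids L" by (simp add: sole_def)
  have 1: "chain L a h (Suc j) om = ring_of L i (chain L a h j om)" using step_sole[OF i] by simp
  show ?thesis unfolding 1 using i ii sole_unique[OF i] by blast
 next
  case False
  have 1: "chain L a h (Suc j) om = chain L a h j om" unfolding chain.simps by (rule step_none) (use False in blast)
  show ?thesis unfolding 1 using False by blast
 qed
 moreover have "Measurable.pred F (%om. (EX i:ids L. sole L ?s ?u i om & ring_of L i (chain L a h j om) x) \<or>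
   (ALL i:ids L. ~ sole L ?s ?u i om) & chain L a h j om x)"
  using so IH pred_ring_of[where D = "%om. chain L a h j om", OF _ IH] by (intro pred_intros_finite pred_intros_logic) auto
 ultimately show ?case by simp
qed

subsection \<open>Convergence of the discretisation\<close>

lemma cycle_arrivals_iff: "(i : cycle_arrivals L c u) = (i : ids L & arrival (c i) u)"
 by (cases i) (auto simp: cycle_arrivals_def ids_def window_def)

lemma sorted_list_of_set_append_max:
 fixes ta :: "'b::linorder"
 assumes "finite U" "!!u. u : U ==> u < ta"
 shows "sorted_list_of_set (insert ta U) = sorted_list_of_set U @ [ta]"
proof (rule sorted_distinct_set_unique)
 have s: "set (sorted_list_of_set U) = U" using assms(1) by (rule set_sorted_list_of_set)
 show "sorted (sorted_list_of_set U @ [ta])" "distinct (sorted_list_of_set U @ [ta])"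
  using assms(2) s by (auto simp: sorted_append less_imp_le)
 have "set (sorted_list_of_set (insert ta U)) = insert ta U" by (rule set_sorted_list_of_set) (use assms(1) in simp)
 thus "set (sorted_list_of_set (insert ta U)) = set (sorted_list_of_set U @ [ta])" using s by simp
 show "sorted (sorted_list_of_set (insert ta U))" "distinct (sorted_list_of_set (insert ta U))"
  by (rule sorted_sorted_list_of_set distinct_sorted_list_of_set)+
qed

definition arrival_times :: "nat => 'a => real => real => real set" where
 "arrival_times L om a t = {u. a < u & u <= t & cycle_arrivals L (N om) u ~= {}}"

lemma finite_arrival_times: "om : space M ==> finite (arrival_times L om a t)"
 by (rule finite_subset[of _ "UN i:ids L. {u. arrival (N om i) u & u <= t}"])
  (auto simp: arrival_times_def cycle_arrivals_iff finite_arrivals counting)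

lemma cycle_config_fold: "cycle_config L (N om) a s t =
  fold (%u. ring_of L (THE i. i : cycle_arrivals L (N om) u)) (sorted_list_of_set (arrival_times L om a t)) s"
 unfolding cycle_config_def arrival_times_def ring_of_def case_prod_unfold by simp

lemma small_mesh:
 fixes E :: "real => real"
 assumes U: "finite U" and E: "!!u. u : U ==> 0 < E u"
 obtains m0 where "!!m u v. m0 <= m ==> u : U ==> v : U ==> u < v ==> T / real (Suc m) < v - u"
  "!!m u. m0 <= m ==> u : U ==> T / real (Suc m) < E u"
proof -
 define D where "D = insert 1 ((%(u, v). v - u) ` {(u, v). u : U & v : U & u < v} Un E ` U)"
 have fin: "finite D" unfolding D_def
  using U finite_subset[OF _ finite_cartesian_product[OF U U], of "{(u, v). u : U & v : U & u < v}"] by auto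
 have "Min D : D" using fin by (intro Min_in) (auto simp: D_def)
 hence g0: "0 < Min D" using E by (auto simp: D_def)
 obtain m0 :: nat where m0: "T / Min D < real m0" using reals_Archimedean2 by blast
 have lt: "T / real (Suc m) < x" if "m0 <= m" "x : D" for m x
 proof -
  have "T / Min D < real (Suc m)" using m0 that(1) by simp
  hence "T / real (Suc m) < Min D" using g0 by (simp add: field_simps)
  thus ?thesis using Min_le[OF fin that(2)] by simp
 qed
 show ?thesis
 proof (rule that)
  show "T / real (Suc m) < v - u" if m: "m0 <= m" and u: "u : U" "v : U" "u < v" for m u v
   by (rule lt[OF m]) (use u in "force simp: D_def")
  show "T / real (Suc m) < E u" if m: "m0 <= m" and u: "u : U" for m u
   by (rule lt[OF m]) (use u in "simp add: D_def")
 qed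
qed

lemma sole_arrival:
 assumes w: "om : space M" and sim: "ALL i k u. i ~= k --> ~ (arrival (N om i) u & arrival (N om k) u)"
  and su: "0 <= s" "s <= u" and one: "ALL v:arrival_times L om s u. ALL v':arrival_times L om s u. ~ v < v'"
  and i: "i : ids L" "arrival (N om i) v" "s < v" "v <= u"
 shows "sole L s u i om" "s < v' ==> v' <= u ==> k : ids L ==> arrival (N om k) v' ==> v' = v"
proof -
 show uniq: "v' = v" if "s < v'" "v' <= u" "k : ids L" "arrival (N om k) v'" for v' k
 proof -
  have "v : arrival_times L om s u" "v' : arrival_times L om s u"
   using that i cycle_arrivals_iff[of k L "N om" v'] cycle_arrivals_iff[of i L "N om" v] by (auto simp: arrival_times_def)
  hence "~ v < v'" "~ v' < v" using one by blast+
  thus ?thesis by simp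
 qed
 have inc: "incr k s u om = (EX v. arrival (N om k) v & s < v & v <= u)" for k
  unfolding incr_def by (rule increase_iff_arrival[OF counting[OF w] su])
 have "incr k s u om = (k = i)" if k: "k : ids L" for k
 proof
  assume "incr k s u om"
  then obtain v' where v': "arrival (N om k) v'" "s < v'" "v' <= u" unfolding inc by blast
  hence "v' = v" using uniq k by blast
  thus "k = i" using v' i sim by blast
 qed (use i inc in blast)
 thus "sole L s u i om" using i unfolding sole_def by simp
qed

lemma no_sole:
 assumes w: "om : space M" and su: "0 <= s" "s <= u" and no: "!!v k. s < v ==> v <= u ==> k : ids L ==> ~ arrival (N om k) v"
 shows "~ sole L s u i om"
 using no increase_iff_arrival[OF counting[OF w] su] unfolding sole_def incr_def by blast

text \<open>Once the mesh is below all gaps between arrival times, each slot contains at most one of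
  them, and the chain performs the rings of \<open>cycle_config\<close> one by one in the same
  order.\<close>

lemma chain_eq_cycle_config:
 assumes w: "om : space M" and sim: "ALL i k u. i ~= k --> ~ (arrival (N om i) u & arrival (N om k) u)"
  and a: "0 <= a" and h: "0 < h" and gap: "!!u v. u : arrival_times L om a t ==> v : arrival_times L om a t ==> u < v ==> h < v - u"
 shows "a + real j * h <= t ==> chain L a h j om = cycle_config L (N om) a (sg om a) (a + real j * h)"
proof (induction j)
 case 0
 have "arrival_times L om a a = {}" by (auto simp: arrival_times_def)
 thus ?case by (simp add: cycle_config_fold)
next
 case (Suc j)
 define s0 where "s0 = a + real j * h"
 define u0 where "u0 = a + real (Suc j) * h"
 have "0 <= real j * h" using h by simp
 moreover have us: "u0 = s0 + h" by (simp add: u0_def s0_def algebra_simps)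
 moreover have ut: "u0 <= t" using Suc.prems by (simp only: u0_def)
 ultimately have su: "a <= s0" "s0 <= u0" "0 <= s0" "s0 <= t" using h a by (simp_all add: s0_def)
 have IH: "chain L a h j om = cycle_config L (N om) a (sg om a) s0" using Suc.IH su(4) by (simp only: s0_def)
 have st: "chain L a h (Suc j) om = step L s0 u0 om (chain L a h j om)" by (simp only: chain.simps s0_def u0_def)
 have "chain L a h (Suc j) om = cycle_config L (N om) a (sg om a) u0"
 proof (cases "EX v. s0 < v & v <= u0 & cycle_arrivals L (N om) v ~= {}")
  case False
  have no: "~ sole L s0 u0 i om" for i by (rule no_sole[OF w su(3,2)]) (use False cycle_arrivals_iff in blast)
  have 1: "chain L a h (Suc j) om = chain L a h j om" unfolding st by (rule step_none) (rule no)
  have "(x <= s0) = (x <= u0)" if "cycle_arrivals L (N om) x ~= {}" for x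
   using False that su(2) by force
  hence "arrival_times L om a u0 = arrival_times L om a s0"
   unfolding arrival_times_def by blast
  thus ?thesis unfolding 1 IH cycle_config_fold by simp
 next
  case True
  then obtain v where v: "s0 < v" "v <= u0" "cycle_arrivals L (N om) v ~= {}" by blast
  then obtain i where "i : cycle_arrivals L (N om) v" by blast
  hence i: "i : ids L" "arrival (N om i) v" by (simp_all add: cycle_arrivals_iff)
  have one: "ALL x:arrival_times L om s0 u0. ALL x':arrival_times L om s0 u0. ~ x < x'"
   proof (intro ballI notI)
  fix v v' assume "v : arrival_times L om s0 u0" "v' : arrival_times L om s0 u0" "v < v'"
  thus False using gap[of v v'] su(1) us ut by (auto simp: arrival_times_def)
 qed
  note so = sole_arrival[OF w sim su(3,2) one i v(1,2)]
  have uniq: "v' = v" if v': "s0 < v'" "v' <= u0" "cycle_arrivals L (N om) v' ~= {}" for v'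
   using so(2)[OF v'(1,2)] v'(3) cycle_arrivals_iff by blast
  have ca: "cycle_arrivals L (N om) v = {i}"
  proof (intro equalityI subsetI)
   fix k assume "k : cycle_arrivals L (N om) v"
   hence "arrival (N om k) v" by (simp only: cycle_arrivals_iff)
   hence "k = i" using sim i by blast
   thus "k : {i}" by simp
  qed (use i in "simp add: cycle_arrivals_iff")
  have 1: "chain L a h (Suc j) om = ring_of L i (chain L a h j om)" unfolding st by (rule step_sole[OF so(1)])
  have "a < v & v <= u0" using v su by simp
  moreover have "(x <= u0) = (x = v \<or> x <= s0)" if "cycle_arrivals L (N om) x ~= {}" for x
   using uniq[OF _ _ that] v(2) su(2) by force
  ultimately have U: "arrival_times L om a u0 = insert v (arrival_times L om a s0)"
   unfolding arrival_times_def using v(3) by blast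
  have l: "sorted_list_of_set (arrival_times L om a u0) = sorted_list_of_set (arrival_times L om a s0) @ [v]"
   unfolding U by (rule sorted_list_of_set_append_max[OF finite_arrival_times[OF w]]) (use v in "simp add: arrival_times_def")
  have "(THE i. i : cycle_arrivals L (N om) v) = i" unfolding ca by simp
  thus ?thesis unfolding 1 IH cycle_config_fold l by simp
 qed
 thus ?case by (simp only: u0_def)
qed

lemma chain_tendsto:
 assumes w: "om : space M" and sim: "ALL i k u. i ~= k --> ~ (arrival (N om i) u & arrival (N om k) u)"
  and a: "0 <= a" "a < t"
 shows "EX m0. ALL m>=m0. chain L a ((t - a) / real (Suc m)) (Suc m) om = cycle_config L (N om) a (sg om a) t"
proof -
 obtain m0 where m0: "!!m u v. m0 <= m ==> u : arrival_times L om a t ==> v : arrival_times L om a t ==> u < v ==> (t - a) / real (Suc m) < v - u"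
  by (rule small_mesh[where U = "arrival_times L om a t" and E = "%_. 1" and T = "t - a"], rule finite_arrival_times[OF w], simp, blast)
 show ?thesis
 proof (intro exI[of _ m0] allI impI)
  fix m assume "m0 <= m"
  let ?h = "(t - a) / real (Suc m)"
  have e: "a + real (Suc m) * ?h = t" by simp
  have "chain L a ?h (Suc m) om = cycle_config L (N om) a (sg om a) (a + real (Suc m) * ?h)"
  proof (rule chain_eq_cycle_config[OF w sim a(1)])
   show "a + real (Suc m) * ?h <= t" by (simp only: e)
   show "?h < v - u" if "u : arrival_times L om a t" "v : arrival_times L om a t" "u < v" for u v
    by (rule m0[OF `m0 <= m` that])
  qed (use a in simp)
  thus "chain L a ?h (Suc m) om = cycle_config L (N om) a (sg om a) t" by (simp only: e)
 qed
qed

end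

subsection \<open>Bounds on the law of the configuration\<close>

context toom
begin

definition site_wt :: "bool => real" where "site_wt b = (if b then p else 1 - p)"

text \<open>Domination by \<open>C\<close> times the Bernoulli measure, tested on finite
  cylinders.\<close>

definition law_bound :: "real => real => bool" where
 "law_bound C t = ((ALL X w. finite X --> prob {om:space M. ALL x:X. sg om t x = w x} <= C * (PROD x:X. site_wt (w x))))"

lemma incr_prob_lt1: "incr_prob i h < 1" by (simp add: incr_prob_def)

lemma pattern_prob_single:
 assumes "i : ids L"
 shows "pattern_prob (ids L) {i} h = incr_prob i h / (1 - incr_prob i h) * (PROD k:ids L. 1 - incr_prob k h)"
proof -
 have "pattern_prob (ids L) {i} h = incr_prob i h * (PROD k:ids L - {i}. 1 - incr_prob k h)"
  unfolding pattern_prob_def by (subst prod.remove[OF finite_ids assms]) auto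
 moreover have "(PROD k:ids L. 1 - incr_prob k h) = (1 - incr_prob i h) * (PROD k:ids L - {i}. 1 - incr_prob k h)"
  by (rule prod.remove[OF finite_ids assms])
 ultimately show ?thesis using incr_prob_lt1[of i h] by simp
qed

text \<open>The probability that a given clock is the only one to ring in a slot. It depends on the
  clock through its sign alone, hence the representative \<open>(0, ep)\<close>; for this reason
  rings may be summed over all sites before weights are compared.\<close>

definition sole_prob :: "nat => real => sign => real" where
 "sole_prob L h ep = incr_prob (0, ep) h / (1 - incr_prob (0, ep) h) * (PROD k:ids L. 1 - incr_prob k h)"

lemma pattern_prob_sole: "i : ids L ==> pattern_prob (ids L) {i} h = sole_prob L h (snd i)"
 by (simp add: pattern_prob_single sole_prob_def incr_prob_def)

lemma sole_prob_nonneg: "0 <= h ==> 0 <= sole_prob L h ep"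
 unfolding sole_prob_def using incr_prob_nonneg[of h] incr_prob_lt1
 by (intro mult_nonneg_nonneg prod_nonneg divide_nonneg_nonneg) (auto simp: less_imp_le)

lemma prob_and_sole:
 assumes A: "A : sets (FF t)" "A : events" and tu: "0 <= t" "t <= u" and i: "i : ids L"
 shows "prob (A Int {om:space M. sole L t u i om}) = prob A * sole_prob L (u - t) (snd i)"
proof -
 have "{om:space M. sole L t u i om} = {om:space M. ALL k:ids L. incr k t u om <-> k : {i}}"
  using i by (auto simp: sole_def)
 thus ?thesis using indep_FF_future[OF A tu finite_ids, of L "{i}"] pattern_prob_sole[OF i] by simp
qed

lemma pred_occ:
 assumes "!!x. Measurable.pred R (%om. c om x)"
 shows "Measurable.pred R (%om. occ L (c om) = A)"
proof -
 have "Measurable.pred R (%om. A <= window L & (ALL x:window L. c om x = (x : A)))"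
  using assms by (intro pred_intros_finite pred_intros_logic) auto
 moreover have "(occ L s = A) = (A <= window L & (ALL x:window L. s x = (x : A)))" for s by (auto simp: occ_def)
 ultimately show ?thesis by simp
qed

text \<open>One step preserves the domination. Which clock is alone in the slot is independent of
  the past, and by \<open>ring_weight_sum\<close> the mass flowing into \<open>B\<close> is at most
  \<open>S\<close> times the allowed mass, while with probability \<open>1 - S\<close> the
  configuration stays. The two parts add up to the old bound.\<close>

lemma chain_law:
 assumes L: "0 < L" and C: "0 <= C" and a: "0 <= a" and h: "0 <= h"
  and ad: "!!x. Measurable.pred (FF a) (%om. sg om a x)"
  and init: "law_bound C a"
 shows "B <= window L ==> prob {om:space M. occ L (chain L a h j om) = B} <= C * set_wt L p B"
proof (induction j arbitrary: B)
 case 0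
 have "{om:space M. occ L (chain L a h 0 om) = B} = {om:space M. ALL x:window L. sg om a x = (x : B)}"
  using 0 by (auto simp: occ_def)
 moreover have "(PROD x:window L. site_wt (x : B)) = set_wt L p B"
 proof -
  have "(PROD x:window L. site_wt (x : B)) = (PROD x:B. p) * (PROD x:window L - B. 1 - p)"
   unfolding site_wt_def using 0 by (subst prod.If_cases) (auto simp: Int_absorb1 Diff_eq intro!: arg_cong2[where f = "(*)"] prod.cong)
  also have "... = set_wt L p B" using 0 finite_subset[OF 0 finite_window]
   by (simp add: set_wt_def card_Diff_subset)
  finally show ?thesis .
 qed
 ultimately show ?case using init[unfolded law_bound_def, rule_format, OF finite_window, of L "%x. x : B"] by simp
next
 case (Suc j)
 define s0 where "s0 = a + real j * h"
 define u0 where "u0 = a + real (Suc j) * h"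
 have "0 <= real j * h" using h by simp
 moreover have us: "u0 = s0 + h" by (simp add: u0_def s0_def algebra_simps)
 ultimately have su: "a <= s0" "s0 <= u0" "0 <= s0" using h a by (simp_all add: s0_def)
 have st: "chain L a h (Suc j) om = step L s0 u0 om (chain L a h j om)" for om by (simp only: chain.simps s0_def u0_def)
 define E where "E A = {om:space M. occ L (chain L a h j om) = A}" for A
 have pc: "Measurable.pred (FF s0) (%om. chain L a h j om x)" for x
  by (rule pred_chain[where t = s0]) (use pred_FF_mono[OF ad su(1)] pred_FF_incr a h su in "auto simp: s0_def")
 have pc': "Measurable.pred M (%om. chain L a h j om x)" for x
  by (rule pred_chain[where t = s0]) (use measurable_incr measurable_sg_site a h su in "auto simp: s0_def")
 have EF: "E A : sets (FF s0)" for A using pred_occ[OF pc] by (simp add: E_def pred_def)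
 have EM: "E A : events" for A using pred_occ[OF pc'] by (simp add: E_def pred_def)
 define G where "G i = {om:space M. sole L s0 u0 i om}" for i
 have GM: "G i : events" for i
  unfolding G_def by (intro predE pred_sole measurable_incr) (use su in auto)
 have disj: "disjoint_family_on G (ids L)"
  unfolding disjoint_family_on_def
 proof (intro ballI impI)
  fix m n :: "int \<times> sign" assume "m ~= n"
  thus "G m Int G n = {}" using sole_unique[of L s0 u0 m _ n] unfolding G_def by blast
 qed
 define Z where "Z = space M - (UN i:ids L. G i)"
 have ZM: "Z : events" using GM by (auto simp: Z_def)
 have pEG: "prob (E A Int G i) = prob (E A) * sole_prob L h (snd i)" if "i : ids L" for A i
  unfolding G_def using prob_and_sole[OF EF EM su(3,2) that] us by simp
 define S where "S = (SUM i:ids L. sole_prob L h (snd i))"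
 have pEZ: "prob (E A Int Z) = prob (E A) * (1 - S)" for A
 proof -
  have disj': "disjoint_family_on (%i. E A Int G i) (ids L)" using disj unfolding disjoint_family_on_def by blast
  have "prob (E A Int (UN i:ids L. G i)) = prob (UN i:ids L. E A Int G i)"
   by (simp only: Int_UN_distrib)
  also have "... = (SUM i:ids L. prob (E A Int G i))"
   by (rule finite_measure_finite_Union[OF _ _ disj']) (use EM GM in auto)
  also have "... = prob (E A) * S" by (simp add: pEG S_def sum_distrib_left)
  finally have 1: "prob (E A Int (UN i:ids L. G i)) = prob (E A) * S" .
  have "E A Int Z = E A - (E A Int (UN i:ids L. G i))" using sets.sets_into_space[OF EM[of A]] by (auto simp: Z_def)
  moreover have "prob (E A - (E A Int (UN i:ids L. G i))) = prob (E A) - prob (E A Int (UN i:ids L. G i))"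
   by (rule finite_measure_Diff) (use EM GM in auto)
  ultimately show ?thesis using 1 by (simp add: algebra_simps)
 qed
 have S1: "S <= 1"
 proof -
  have "prob (UN i:ids L. G i) = (SUM i:ids L. prob (G i))"
   by (rule finite_measure_finite_Union[OF _ _ disj]) (use GM in auto)
  also have "... = S"
   unfolding S_def
  proof (intro sum.cong refl)
   fix i assume i: "i : ids L"
   have "prob (space M Int G i) = prob (space M) * sole_prob L (u0 - s0) (snd i)"
    unfolding G_def by (rule prob_and_sole[OF _ _ su(3,2) i]) (use sets.top[of "FF s0"] in auto)
   thus "prob (G i) = sole_prob L h (snd i)"
    using sets.sets_into_space[OF GM[of i]] us by (simp add: prob_space Int_absorb1)
  qed
  finally show ?thesis by (metis prob_le_1)
 qed
 define R where "R x ep = {A:Pow (window L). set_ring L x ep A = B}" for x ep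
 have fR: "finite (R x ep)" for x ep by (simp add: R_def)
 have ins: "fst i : window L" if "i : ids L" for i using that by (auto simp: ids_def)
 have "{om:space M. occ L (chain L a h (Suc j) om) = B} <=
   (E B Int Z) Un (UN i:ids L. UN A:R (fst i) (snd i). E A Int G i)" (is "_ <= ?U")
 proof
  fix om assume "om : {om:space M. occ L (chain L a h (Suc j) om) = B}"
  hence w: "om : space M" "occ L (chain L a h (Suc j) om) = B" by auto
  show "om : ?U"
  proof (cases "EX i. sole L s0 u0 i om")
   case True
   then obtain i where i: "sole L s0 u0 i om" by blast
   hence ii: "i : ids L" by (simp add: sole_def)
   have "occ L (ring_of L i (chain L a h j om)) = B" using w(2) unfolding st step_sole[OF i] .
   hence "set_ring L (fst i) (snd i) (occ L (chain L a h j om)) = B"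
    unfolding ring_of_def occ_ring[OF L ins[OF ii]] .
   moreover have "occ L (chain L a h j om) <= window L" by (auto simp: occ_def)
   ultimately show ?thesis using i ii w(1) unfolding E_def G_def R_def by blast
  next
   case False
   hence "chain L a h (Suc j) om = chain L a h j om" unfolding st by (intro step_none) blast
   hence "om : E B" using w by (simp add: E_def)
   moreover have "om : Z" using False w(1) unfolding Z_def G_def by blast
   ultimately show ?thesis by blast
  qed
 qed
 hence "prob {om:space M. occ L (chain L a h (Suc j) om) = B} <= prob ?U"
  by (rule finite_measure_mono) (use EM GM ZM fR in "auto intro!: sets.Un sets.finite_UN")
 also have "... <= prob (E B Int Z) + prob (UN i:ids L. UN A:R (fst i) (snd i). E A Int G i)"
  by (rule measure_Un_le) (use EM GM ZM fR in "auto intro!: sets.finite_UN")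
 also have "prob (UN i:ids L. UN A:R (fst i) (snd i). E A Int G i)
   <= (SUM i:ids L. prob (UN A:R (fst i) (snd i). E A Int G i))"
  by (rule finite_measure_subadditive_finite) (use EM GM fR in "auto intro!: sets.finite_UN")
 also have "... <= (SUM i:ids L. SUM A:R (fst i) (snd i). prob (E A Int G i))"
  by (intro sum_mono finite_measure_subadditive_finite) (use EM GM fR in auto)
 also have "... = (SUM i:ids L. SUM A:R (fst i) (snd i). prob (E A) * sole_prob L h (snd i))"
  by (intro sum.cong refl) (simp add: pEG)
 also have "... = (SUM x:window L. SUM ep:UNIV. SUM A:R x ep. prob (E A) * sole_prob L h ep)"
  unfolding ids_def by (subst sum.cartesian_product) (simp add: case_prod_unfold)
 also have "... = (SUM ep:UNIV. sole_prob L h ep * (SUM x:window L. SUM A:R x ep. prob (E A)))"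
  by (subst sum.swap) (simp add: sum_distrib_left sum_distrib_right mult.commute)
 also have "... <= (SUM ep:UNIV. sole_prob L h ep * (real (card (window L)) * (C * set_wt L p B)))"
 proof (intro sum_mono mult_left_mono sole_prob_nonneg h)
  show "(SUM x:window L. SUM A:R x ep. prob (E A)) <= real (card (window L)) * (C * set_wt L p B)" for ep
   unfolding R_def by (rule ring_weight_sum[OF L _ _ C]) (use Suc.IH p01 in "auto simp: E_def")
 qed
 also have "... = S * (C * set_wt L p B)"
 proof -
  have "S = (SUM x:window L. SUM ep:UNIV. sole_prob L h ep)"
   unfolding S_def ids_def by (subst sum.cartesian_product) (simp add: case_prod_unfold)
  also have "... = real (card (window L)) * (SUM ep:UNIV. sole_prob L h ep)" by simp
  finally show ?thesis by (simp add: sum_distrib_left sum_distrib_right mult_ac)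
 qed
 also have "prob (E B Int Z) <= C * set_wt L p B * (1 - S)"
  unfolding pEZ using Suc.IH[OF Suc.prems] S1 unfolding E_def by (intro mult_right_mono) auto
 finally show ?case by (simp add: algebra_simps)
qed

lemma chain_marginal:
 assumes L: "0 < L" and C: "0 <= C" and a: "0 <= a" and h: "0 <= h"
  and ad: "!!x. Measurable.pred (FF a) (%om. sg om a x)"
  and init: "law_bound C a" and X: "X <= window L"
 shows "prob {om:space M. ALL x:X. chain L a h j om x = w x} <= C * (PROD x:X. site_wt (w x))"
proof -
 have pc': "Measurable.pred M (%om. chain L a h j om x)" for x
  by (rule pred_chain[where t = "a + real j * h"]) (use measurable_incr measurable_sg_site a h in auto)
 have EM: "{om:space M. occ L (chain L a h j om) = A} : events" for A using pred_occ[OF pc'] by (simp add: pred_def)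
 let ?A = "{A:Pow (window L). ALL x:X. x : A <-> w x}"
 have "{om:space M. ALL x:X. chain L a h j om x = w x} =
   (UN A:?A. {om:space M. occ L (chain L a h j om) = A})"
  using X by (auto simp: occ_def)
 hence "prob {om:space M. ALL x:X. chain L a h j om x = w x} <=
   (SUM A:?A. prob {om:space M. occ L (chain L a h j om) = A})"
  by (simp only:) (rule finite_measure_subadditive_finite, use EM in auto)
 also have "... <= (SUM A:?A. C * set_wt L p A)"
  by (intro sum_mono chain_law[OF L C a h ad init]) auto
 also have "... = C * (PROD x:X. site_wt (w x))"
  using set_wt_marginal[OF X, of p w] p01 by (simp add: site_wt_def flip: sum_distrib_left)
 finally show ?thesis .
qed

definition regular :: "real => real => bool" where
 "regular C t = ((ALL x. Measurable.pred (FF t) (%om. sg om t x)) & law_bound C t)"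

text \<open>The iterated limit is written with countable quantifiers only, which keeps it
  measurable.\<close>

lemma pred_FF_double_limit:
 assumes P: "!!L m. Measurable.pred (FF t) (P L m)"
  and ev: "AE om in M. EX L0::nat. ALL L>=L0. EX m0::nat. ALL m>=m0. P L m om = Q om"
 shows "Measurable.pred (FF t) Q"
proof (rule pred_FF_AE)
 show "Measurable.pred (FF t) (%om. EX L0. ALL L. L0 <= L --> (EX m0. ALL m. m0 <= m --> P L m om))"
  by (intro pred_intros_countable pred_intros_imp' P)
 show "AE om in M. (EX L0. ALL L. L0 <= L --> (EX m0. ALL m. m0 <= m --> P L m om)) <-> Q om"
  using ev
 proof eventually_elim
  fix om assume "EX L0. ALL L>=L0. EX m0. ALL m>=m0. P L m om = Q om"
  then obtain L0 where L0: "!!L. L0 <= L ==> EX m0. ALL m>=m0. P L m om = Q om" by blast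
  show "(EX L0. ALL L. L0 <= L --> (EX m0. ALL m. m0 <= m --> P L m om)) <-> Q om"
  proof
   assume "EX L0. ALL L. L0 <= L --> (EX m0. ALL m. m0 <= m --> P L m om)"
   then obtain L1 where L1: "!!L. L1 <= L ==> EX m0. ALL m>=m0. P L m om" by blast
   obtain m0 where m0: "ALL m>=m0. P (max L0 L1) m om = Q om" using L0[of "max L0 L1"] by auto
   obtain m1 where m1: "ALL m>=m1. P (max L0 L1) m om" using L1[of "max L0 L1"] by auto
   show "Q om" using m0[rule_format, of "max m0 m1"] m1[rule_format, of "max m0 m1"] by simp
  next
   assume "Q om"
   thus "EX L0. ALL L. L0 <= L --> (EX m0. ALL m. m0 <= m --> P L m om)" using L0 by auto
  qed
 qed
qed

lemma nn_integral_liminf_le: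
 assumes "!!n. f n : borel_measurable M" "!!n. k <= n ==> (\<integral>\<^sup>+om. f n om \<partial>M) <= c"
 shows "(\<integral>\<^sup>+om. liminf (%n. f n om) \<partial>M) <= c"
proof -
 have "(\<integral>\<^sup>+om. liminf (%n. f n om) \<partial>M) <= liminf (%n. \<integral>\<^sup>+om. f n om \<partial>M)" by (rule nn_integral_liminf[OF assms(1)])
 also have "... <= limsup (%n. \<integral>\<^sup>+om. f n om \<partial>M)" by (rule Liminf_le_Limsup) simp
 also have "... <= c" using assms(2) by (intro Limsup_bounded) (auto simp: eventually_sequentially)
 finally show ?thesis .
qed

text \<open>Both properties pass from \<open>a\<close> to \<open>t\<close> within one interval of
  the construction: the chain tends to the cycle as the mesh vanishes, the cycle to the process as
  \<open>L\<close> grows. Adaptedness survives up to null sets and the bound by Fatou.\<close>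

lemma slot:
 assumes C: "0 <= C" and a: "0 <= a" "a < t" and reg: "regular C a"
  and lim: "AE om in M. (%L. cycle_config L (N om) a (sg om a) t) ----> sg om t"
 shows "regular C t"
proof -
 have ad: "!!x. Measurable.pred (FF a) (%om. sg om a x)" and lb: "law_bound C a" using reg by (auto simp: regular_def)
 define D where "D L m om = chain L a ((t - a) / real (Suc m)) (Suc m) om" for L m om
 have h0: "0 <= (t - a) / real (Suc m)" for m using a by simp
 have fin: "a + real (Suc m) * ((t - a) / real (Suc m)) = t" for m by simp
 have pF: "Measurable.pred (FF t) (%om. D L m om x)" for L m x
  unfolding D_def by (rule pred_chain[where t = t])
   (use pred_FF_mono[OF ad] pred_FF_incr a h0 fin in "auto simp del: of_nat_Suc")
 have pM: "Measurable.pred M (%om. D L m om x)" for L m x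
  unfolding D_def by (rule pred_chain[where t = t])
   (use measurable_incr measurable_sg_site a h0 fin in "auto simp del: of_nat_Suc")
 have ev: "AE om in M. ALL X. finite X --> (EX L0. ALL L>=L0. EX m0. ALL m>=m0. ALL x:X. D L m om x = sg om t x)"
  using lim AE_no_simultaneous AE_space
 proof eventually_elim
  fix om assume l: "(%L. cycle_config L (N om) a (sg om a) t) ----> sg om t"
   and sim: "ALL i k u. i ~= k --> ~ (arrival (N om i) u & arrival (N om k) u)" and w: "om : space M"
  have evx: "eventually (%L. cycle_config L (N om) a (sg om a) t x = sg om t x) sequentially" for x
  proof -
   have "(%L. cycle_config L (N om) a (sg om a) t x) ----> sg om t x"
    by (rule continuous_on_tendsto_compose[OF continuous_on_product_coordinates l]) auto
   thus ?thesis by (simp add: tendsto_discrete)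
  qed
  show "ALL X. finite X --> (EX L0. ALL L>=L0. EX m0. ALL m>=m0. ALL x:X. D L m om x = sg om t x)"
  proof (intro allI impI)
   fix X :: "int set" assume "finite X"
   hence "eventually (%L. ALL x:X. cycle_config L (N om) a (sg om a) t x = sg om t x) sequentially"
    using evx by (intro eventually_ball_finite) auto
   then obtain L0 where L0: "!!L. L0 <= L ==> ALL x:X. cycle_config L (N om) a (sg om a) t x = sg om t x"
    by (auto simp: eventually_sequentially)
   show "EX L0. ALL L>=L0. EX m0. ALL m>=m0. ALL x:X. D L m om x = sg om t x"
   proof (rule exI[of _ L0], intro allI impI)
    fix L assume "L0 <= L"
    obtain m0 where "ALL m>=m0. D L m om = cycle_config L (N om) a (sg om a) t"
     using chain_tendsto[OF w sim a, of L] unfolding D_def by blast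
    hence "D L m om x = sg om t x" if "m0 <= m" "x : X" for m x
     using L0[OF \<open>L0 <= L\<close>] that by metis
    thus "EX m0. ALL m>=m0. ALL x:X. D L m om x = sg om t x" by blast
   qed
  qed
 qed
 have "Measurable.pred (FF t) (%om. sg om t x)" for x
 proof (rule pred_FF_double_limit)
  show "AE om in M. EX L0. ALL L>=L0. EX m0. ALL m>=m0. D L m om x = sg om t x"
   using ev by eventually_elim (drule spec[of _ "{x}"], simp)
 qed (rule pF)
 moreover have "law_bound C t"
  unfolding law_bound_def
 proof (intro allI impI)
  fix X :: "int set" and w assume fX: "finite X"
  define c where "c = C * (PROD x:X. site_wt (w x))"
  define Q where "Q L m = {om:space M. ALL x:X. D L m om x = w x}" for L m
  have QM: "Q L m : events" for L m
  proof -
   have "Measurable.pred M (%om. ALL x:X. D L m om x = w x)" using pM fX by (intro pred_intros_finite pred_intros_logic) auto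
   thus ?thesis by (simp add: Q_def pred_def)
  qed
  obtain L1 where L1: "0 < L1" "X <= window L1"
  proof -
   have "\<bar>x\<bar> <= Max (insert 0 (abs ` X))" if "x : X" for x using fX that by (intro Max_ge) auto
   then obtain K where K: "X <= {-K..K}" by (force simp: abs_le_iff)
   show ?thesis by (rule that[of "nat (\<bar>K\<bar> + 1)"]) (use K in "auto simp: window_def")
  qed
  have Qle: "emeasure M (Q L m) <= ennreal c" if "L1 <= L" for L m
  proof -
   have "X <= window L" using L1 that by (force simp: window_def)
   hence "prob (Q L m) <= c"
    unfolding Q_def D_def c_def using L1 that by (intro chain_marginal C a ad lb h0) auto
   thus ?thesis by (simp add: emeasure_eq_measure ennreal_leI)
  qed
  let ?T = "{om:space M. ALL x:X. sg om t x = w x}"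
  have TM: "?T : events"
  proof -
   have "Measurable.pred M (%om. ALL x:X. sg om t x = w x)"
    using measurable_sg_site a fX by (intro pred_intros_finite pred_intros_logic) auto
   thus ?thesis by (simp add: pred_def)
  qed
  have "emeasure M ?T = (\<integral>\<^sup>+om. indicator ?T om \<partial>M)" using TM by simp
  \<comment> \<open>The indicator of the limiting event lies below the iterated lower limit because
    each chain eventually agrees with the process on \<open>X\<close>.\<close>
  also have "... <= (\<integral>\<^sup>+om. liminf (%L. liminf (%m. indicator (Q L m) om)) \<partial>M)"
  proof (rule nn_integral_mono_AE)
   show "AE om in M. indicator ?T om <= liminf (%L. liminf (%m. indicator (Q L m) om :: ennreal))"
    using ev AE_space
   proof eventually_elim
    fix om assume e: "ALL X. finite X --> (EX L0. ALL L>=L0. EX m0. ALL m>=m0. ALL x:X. D L m om x = sg om t x)" and sp: "om : space M"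
    show "indicator ?T om <= liminf (%L. liminf (%m. indicator (Q L m) om :: ennreal))"
    proof (cases "om : ?T")
     case True
     obtain L0 where L0: "!!L. L0 <= L ==> EX m0. ALL m>=m0. ALL x:X. D L m om x = sg om t x"
      using e fX by blast
     have "1 <= liminf (%m. indicator (Q L m) om :: ennreal)" if L: "L0 <= L" for L
     proof (rule Liminf_bounded)
      obtain m0 where m0: "ALL m>=m0. ALL x:X. D L m om x = sg om t x" using L0[OF L] by blast
      show "\<forall>\<^sub>F m in sequentially. 1 <= (indicator (Q L m) om :: ennreal)"
       unfolding eventually_sequentially
       by (rule exI[of _ m0]) (use m0 True sp in "auto simp: Q_def indicator_def")
     qed
     hence "1 <= liminf (%L. liminf (%m. indicator (Q L m) om :: ennreal))"
      by (intro Liminf_bounded) (auto simp: eventually_sequentially)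
     thus ?thesis using True by (simp add: indicator_def)
    qed simp
   qed
  qed
  also have "... <= ennreal c"
  proof (rule nn_integral_liminf_le[where k = L1])
   show "(%om. liminf (%m. indicator (Q L m) om :: ennreal)) : borel_measurable M" for L
    using QM by (auto intro!: borel_measurable_liminf)
   show "(\<integral>\<^sup>+om. liminf (%m. indicator (Q L m) om) \<partial>M) <= ennreal c" if L: "L1 <= L" for L
    by (rule nn_integral_liminf_le) (use QM Qle[OF L] in "auto simp: nn_integral_indicator")
  qed
  finally have "emeasure M ?T <= ennreal c" .
  moreover have "0 <= c" unfolding c_def using C p01 by (intro mult_nonneg_nonneg prod_nonneg) (auto simp: site_wt_def)
  ultimately show "prob ?T <= C * (PROD x:X. site_wt (w x))" by (simp add: emeasure_eq_measure c_def)
 qed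
 ultimately show ?thesis by (simp add: regular_def)
qed

text \<open>Conditioning on an event of probability \<open>site_wt \<eta>\<close> raises
  probabilities at most by this factor.\<close>

definition C0 :: real where "C0 = 1 / site_wt \<eta>"

lemma Ber_cylinder:
 assumes "finite X"
 shows "emeasure (Ber p) {s. ALL x:X. s x = w x} = ennreal (PROD x:X. site_wt (w x))"
  and "{s. ALL x:X. s x = w x} : sets (Ber p)"
proof -
 interpret B: product_prob_space "%_ :: int. measure_pmf (bernoulli_pmf p)" UNIV
  by (unfold_locales)
 have e: "{s. ALL x:X. s x = w x} = {s : space (Ber p). ALL x:X. s x : {w x}}" by (auto simp: Ber_def space_PiM)
 have "emeasure (Ber p) {s : space (Ber p). ALL x:X. s x : {w x}} = (PROD x:X. emeasure (measure_pmf (bernoulli_pmf p)) {w x})"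
  unfolding Ber_def by (rule B.emeasure_PiM_Collect) (use assms in auto)
 also have "... = (PROD x:X. ennreal (site_wt (w x)))"
  using p01 by (intro prod.cong refl) (auto simp: site_wt_def emeasure_pmf_single)
 also have "... = ennreal (PROD x:X. site_wt (w x))"
  by (rule prod_ennreal) (use p01 in "auto simp: site_wt_def")
 finally show "emeasure (Ber p) {s. ALL x:X. s x = w x} = ennreal (PROD x:X. site_wt (w x))" unfolding e .
 show "{s. ALL x:X. s x = w x} : sets (Ber p)"
  unfolding e unfolding Ber_def using assms by (intro sets.sets_Collect_finite_All sets_Collect_single') auto
qed

lemma sets_Ber: "sets (Ber p) = sets config_space"
 unfolding Ber_def config_space_def by (intro sets_PiM_cong) auto

lemma initial_law:
 assumes X: "finite X"
 shows "prob {om:space M. ALL x:X. sg om 0 x = w x} =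
   (if \<eta> = w 0 \<or> 0 ~: X then (PROD x:X - {0}. site_wt (w x)) else 0)"
proof -
 define A where "A = {s :: config. ALL x:X. s x = w x}"
 define H where "H = {s :: config. s 0 = \<eta>}"
 have AB: "A : sets (Ber p)" unfolding A_def by (rule Ber_cylinder(2)[OF X])
 have HB: "H : sets (Ber p)" using Ber_cylinder(2)[of "{0}" "%_. \<eta>"] by (simp add: H_def)
 have eH: "emeasure (Ber p) H = ennreal (site_wt \<eta>)" using Ber_cylinder(1)[of "{0}" "%_. \<eta>"] by (simp add: H_def)
 have sp: "0 < site_wt b" for b using p01 by (simp add: site_wt_def)
 have "emeasure M {om:space M. ALL x:X. sg om 0 x = w x} = emeasure (distr M config_space (%om. sg om 0)) A"
  using AB by (subst emeasure_distr) (auto simp: sets_Ber A_def vimage_def Int_def conj_commute)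
 also have "... = emeasure (uniform_measure (Ber p) H) A"
  using process by (simp add: toom_process_def H_def)
 also have "... = emeasure (Ber p) (H Int A) / emeasure (Ber p) H"
  using AB HB by (subst emeasure_uniform_measure) auto
 also have "... = ennreal (if \<eta> = w 0 \<or> 0 ~: X then (PROD x:X - {0}. site_wt (w x)) else 0)"
 proof (cases "\<eta> = w 0 \<or> 0 ~: X")
  case True
  define w' where "w' = w(0 := \<eta>)"
  have "H Int A = {s. ALL x:insert 0 X. s x = w' x}" using True by (auto simp: H_def A_def w'_def)
  hence "emeasure (Ber p) (H Int A) = ennreal (PROD x:insert 0 X. site_wt (w' x))"
   using Ber_cylinder(1)[of "insert 0 X" w'] X by simp
  also have "(PROD x:insert 0 X. site_wt (w' x)) = site_wt \<eta> * (PROD x:X - {0}. site_wt (w x))"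
  proof -
   have "(PROD x:insert 0 X. site_wt (w' x)) = site_wt (w' 0) * (PROD x:X - {0}. site_wt (w' x))"
    using X by (rule prod.insert_remove)
   also have "(PROD x:X - {0}. site_wt (w' x)) = (PROD x:X - {0}. site_wt (w x))" by (rule prod.cong) (auto simp: w'_def)
   finally show ?thesis by (simp add: w'_def)
  qed
  finally have HA: "emeasure (Ber p) (H Int A) = ennreal (site_wt \<eta> * (PROD x:X - {0}. site_wt (w x)))" .
  have "0 <= (PROD x:X - {0}. site_wt (w x))" using sp by (intro prod_nonneg) (auto simp: less_imp_le)
  hence "ennreal (site_wt \<eta> * (PROD x:X - {0}. site_wt (w x))) / ennreal (site_wt \<eta>) =
    ennreal (site_wt \<eta> * (PROD x:X - {0}. site_wt (w x)) / site_wt \<eta>)"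
   using sp[of \<eta>] by (intro divide_ennreal) auto
  also have "site_wt \<eta> * (PROD x:X - {0}. site_wt (w x)) / site_wt \<eta> = (PROD x:X - {0}. site_wt (w x))"
   using sp[of \<eta>] by simp
  finally show ?thesis unfolding eH HA using True by simp
 next
  case False
  hence "H Int A = {}" by (auto simp: H_def A_def)
  thus ?thesis using False by simp
 qed
 finally show ?thesis using sp
  by (subst (asm) emeasure_eq_measure, subst (asm) ennreal_inj) (auto simp: less_imp_le intro!: prod_nonneg)
qed

lemma site_wt_pos: "0 < site_wt b" and site_wt_less1: "site_wt b < 1"
 using p01 by (auto simp: site_wt_def)

lemma C0: "1 <= C0" using site_wt_pos[of \<eta>] site_wt_less1[of \<eta>] by (simp add: C0_def)

lemma regular_0: "regular C0 0"
 unfolding regular_def law_bound_def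
proof (intro conjI allI impI)
 show "Measurable.pred (FF 0) (%om. sg om 0 x)" for x by (rule pred_FF_init) simp
 fix X :: "int set" and w :: "int => bool" assume X: "finite X"
 have nn: "0 <= (PROD x:Z. site_wt (w x))" for Z using site_wt_pos by (intro prod_nonneg) (auto simp: less_imp_le)
 show "prob {om:space M. ALL x:X. sg om 0 x = w x} <= C0 * (PROD x:X. site_wt (w x))"
 proof (cases "0 : X")
  case True
  hence "(PROD x:X. site_wt (w x)) = site_wt (w 0) * (PROD x:X - {0}. site_wt (w x))" using X by (intro prod.remove)
  thus ?thesis unfolding initial_law[OF X] C0_def using True nn[of "X - {0}"] site_wt_pos[of "w 0"] site_wt_pos[of \<eta>]
   by (cases "\<eta> = w 0") simp_all
 next
  case False
  hence "X - {0} = X" by auto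
  thus ?thesis unfolding initial_law[OF X] using False mult_right_mono[OF C0 nn[of X]] by simp
 qed
qed

text \<open>The constant is the same at both ends of a construction interval, so it does not
  deteriorate as intervals are put together.\<close>

theorem regular_all:
 assumes "0 <= t" shows "regular C0 t"
proof -
 obtain de where d: "0 < de" and slots: "!!k::nat. AE om in M. ALL t:{real k * de..real (Suc k) * de}.
     (%L. cycle_config L (N om) (real k * de) (sg om (real k * de)) t) ----> sg om t"
  using process unfolding toom_process_def by blast
 have st: "regular C0 u" if r: "regular C0 (real k * de)" and u: "real k * de < u" "u <= real (Suc k) * de" for k u
 proof (rule slot[OF _ _ u(1) r])
  show "0 <= C0" using C0 by simp
  show "0 <= real k * de" using d by simp
  show "AE om in M. (%L. cycle_config L (N om) (real k * de) (sg om (real k * de)) u) ----> sg om u"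
   using slots[of k] by eventually_elim (use u in auto)
 qed
 have grid: "regular C0 (real k * de)" for k
 proof (induction k)
  case 0 thus ?case using regular_0 by simp
 next
  case (Suc k) show ?case by (rule st[OF Suc]) (use d in auto)
 qed
 show ?thesis
 proof (cases "t = 0")
  case True thus ?thesis using regular_0 by simp
 next
  case False
  define k where "k = nat (\<lceil>t / de\<rceil> - 1)"
  have "0 < t / de" using False assms d by simp
  hence kr: "real k = of_int \<lceil>t / de\<rceil> - 1" by (simp add: k_def)
  have "real k < t / de" "t / de <= real (Suc k)" unfolding kr of_nat_Suc by linarith+
  hence "real k * de < t" "t <= real (Suc k) * de" using d by (simp_all only: pos_less_divide_eq pos_divide_le_eq)
  thus ?thesis by (rule st[OF grid])
 qed
qed

end

subsection \<open>The tagged particle is adapted\<close>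

text \<open>Induction along the half-line: at the infimum of the failures, \<open>left\<close>
  yields the property itself and \<open>right\<close> pushes it beyond.\<close>

lemma real_induction [consumes 1, case_names zero right left]:
 fixes P :: "real => bool"
 assumes t: "0 <= t" and z: "P 0"
  and r: "!!t. 0 <= t ==> (!!s. 0 <= s ==> s <= t ==> P s) ==> EX ep>0. ALL s. t < s & s < t + ep --> P s"
  and l: "!!t. 0 < t ==> (!!s. 0 <= s ==> s < t ==> P s) ==> P t"
 shows "P t"
proof (rule ccontr)
 assume n: "~ P t"
 define S where "S = {s. 0 <= s & ~ P s}"
 have tS: "t : S" using n t by (simp add: S_def)
 have bd: "bdd_below S" by (auto simp: S_def)
 define u where "u = Inf S"
 have u0: "0 <= u" unfolding u_def using tS by (intro cInf_greatest) (auto simp: S_def)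
 have below: "P s" if "0 <= s" "s < u" for s
 proof (rule ccontr)
  assume "~ P s"
  hence "u <= s" unfolding u_def using that bd by (intro cInf_lower) (auto simp: S_def)
  thus False using that by simp
 qed
 have Pu: "P u" using l[of u] below z u0 by (cases "u = 0") auto
 have "EX ep>0. ALL s. u < s & s < u + ep --> P s"
  by (rule r[OF u0]) (use below Pu in "metis order_le_less")
 then obtain ep where e: "0 < ep" "!!s. u < s ==> s < u + ep ==> P s" by blast
 obtain s where s: "s : S" "s < u + ep" using cInf_lessD[of S "u + ep"] tS e(1) unfolding u_def by auto
 have "u <= s" unfolding u_def using s(1) bd by (rule cInf_lower)
 thus False using e(2)[of s] s Pu by (cases "u = s") (auto simp: S_def)
qed

lemma cadlag_site:
 fixes f :: "real => 'i => 'b::topological_space"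
 assumes "cadlag_on T f" shows "cadlag_on T (%t. f t x)"
proof -
 have c: "((%t. f t x) \<longlongrightarrow> l x) F" if "(f \<longlongrightarrow> l) F" for l F
  by (rule continuous_on_tendsto_compose[OF continuous_on_product_coordinates that]) auto
 show ?thesis unfolding cadlag_on_def
 proof (intro ballI conjI)
  fix t assume t: "t : T"
  show "((%t. f t x) \<longlongrightarrow> f t x) (at t within T Int {t<..})" using assms t c unfolding cadlag_on_def by blast
  obtain l where "(f \<longlongrightarrow> l) (at t within T Int {..<t})" using assms t unfolding cadlag_on_def by blast
  from c[OF this] show "EX l. ((%t. f t x) \<longlongrightarrow> l) (at t within T Int {..<t})" by blast
 qed
qed

lemma constant_without_jumps:
 fixes y :: "real => int"
 assumes y: "cadlag_on {0..} y" and a: "0 <= a" "a <= b" and j: "!!u. a < u ==> u <= b ==> y u = left_lim y u"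
 shows "y b = y a"
proof -
 have "t <= b - a --> y (a + t) = y a" if "0 <= t" for t
  using that
 proof (induction t rule: real_induction)
  case zero thus ?case by simp
 next
  case (right t)
  obtain ep where e: "0 < ep" "!!s. a + t <= s ==> s < a + t + ep ==> y s = y (a + t)"
   using cadlag_right_const[OF y, of "a + t"] right(1) a by auto
  show ?case
  proof (intro exI[of _ ep] conjI allI impI)
   fix s assume s: "t < s & s < t + ep" "s <= b - a"
   hence "y (a + t) = y a" using right by auto
   thus "y (a + s) = y a" using e(2)[of "a + s"] s by simp
  qed (rule e(1))
 next
  case (left t)
  show ?case
  proof
   assume tb: "t <= b - a"
   obtain ep where e: "0 < ep" "ep <= a + t" "!!s. a + t - ep < s ==> s < a + t ==> y s = left_lim y (a + t)"
    using cadlag_left_const[OF y, of "a + t"] left(1) a by auto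
   define r where "r = max 0 (t - ep / 2)"
   have "y (a + r) = left_lim y (a + t)" using e left(1) by (intro e(3)) (auto simp: r_def)
   moreover have "y (a + r) = y a" using left(2)[of r] left(1) e(1) tb by (auto simp: r_def)
   ultimately show "y (a + t) = y a" using j[of "a + t"] left(1) tb by simp
  qed
 qed
 from this[of "b - a"] a show ?thesis by simp
qed

text \<open>Rings whose partner lies at or beyond \<open>int L\<close> are dropped, so that the
  result is a function of the window.\<close>

definition lpush :: "nat => int => sign => config => int => int" where
 "lpush L x ep s y = (if s x = ep & (EX z. x < z & z < int L & s z ~= ep) then push x ep s y else y)"

lemma partner_cong:
 assumes "EX z. x < z & z < int L & s z ~= ep" "!!z. x < z ==> z < int L ==> s z = s' z"
 shows "partner x ep s = partner x ep s'"
proof -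
 obtain z0 where z0: "x < z0" "z0 < int L" "s z0 ~= ep" using assms(1) by blast
 obtain z where z: "x < z" "s z ~= ep" "!!u. x < u ==> u < z ==> s u = ep" "partner x ep s = z"
  using first_opposite[of x s ep] z0 by blast
 have "z <= z0" using z(3)[of z0] z0 by force
 hence zL: "z < int L" using z0 by simp
 have "partner x ep s' = z" unfolding partner_def
 proof (rule Least_equality)
  show "x < z & s' z ~= ep" using z assms(2)[of z] zL by simp
  show "z <= y" if y: "x < y & s' y ~= ep" for y
  proof (rule ccontr)
   assume "~ z <= y"
   hence "y < z" by simp
   thus False using z(3)[of y] assms(2)[of y] y zL by simp
  qed
 qed
 thus ?thesis using z(4) by simp
qed

lemma lpush_local:
 assumes x: "x : window L" and eq: "!!z. z : window L ==> s z = s' z"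
 shows "lpush L x ep s y = lpush L x ep s' y"
proof -
 have e: "s z = s' z" if "x <= z" "z < int L" for z using that x eq[of z] by (auto simp: window_def)
 have x': "x < int L" using x by (simp add: window_def)
 have c: "(EX z. x < z & z < int L & s z ~= ep) <-> (EX z. x < z & z < int L & s' z ~= ep)"
  using e by (metis less_imp_le)
 show ?thesis
 proof (cases "s x = ep & (EX z. x < z & z < int L & s z ~= ep)")
  case True
  have p: "partner x ep s = partner x ep s'" by (rule partner_cong[of x L]) (use True e in auto)
  have "EX z>x. s z ~= ep" "EX z>x. s' z ~= ep" using True c by blast+
  moreover have "s' x = ep" using True e[of x] x' by simp
  ultimately show ?thesis using True c p by (simp add: lpush_def push_def)
 next
  case False
  hence "~ (s' x = ep & (EX z. x < z & z < int L & s' z ~= ep))" unfolding c e[OF order_refl x'] .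
  thus ?thesis unfolding lpush_def using False by (simp only: if_False)
 qed
qed

context toom
begin

definition good :: "'a => bool" where
 "good om = (om : space M & cadlag_on {0..} (sg om) & obeys_toom_rules (N om) (sg om) & cadlag_on {0..} (Y om) & Y om 0 = 0
   & follows_push_rules (N om) (sg om) (Y om)
   & (ALL i k u. i ~= k --> ~ (arrival (N om i) u & arrival (N om k) u)))"

lemma AE_good: "AE om in M. good om"
proof -
 have "AE om in M. cadlag_on {0..} (sg om) & obeys_toom_rules (N om) (sg om)" using process by (auto simp: toom_process_def)
 moreover have "AE om in M. Y om 0 = 0 & follows_push_rules (N om) (sg om) (Y om)"
  using tagged by (auto simp: push_tagged_position_def)
 ultimately show ?thesis
  using AE_no_simultaneous AE_space
 proof eventually_elim
  case (elim om)
  moreover have "cadlag_on {0..} (Y om)" using tagged elim(4) by (auto simp: push_tagged_position_def)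
  ultimately show ?case unfolding good_def by blast
 qed
qed

abbreviation before :: "'a => real => config" where "before om u \<equiv> config_before (sg om) u"
abbreviation Yb :: "'a => real => int" where "Yb om u \<equiv> left_lim (Y om) u"

lemma good_left:
 assumes g: "good om" and u: "0 < u" and X: "finite X"
 obtains ep where "0 < ep" "ep <= u" "!!s. u - ep < s ==> s < u ==> Y om s = Yb om u"
  "!!s x. u - ep < s ==> s < u ==> x : X ==> sg om s x = before om u x"
proof -
 obtain ep0 where e0: "0 < ep0" "ep0 <= u" "!!s. u - ep0 < s ==> s < u ==> Y om s = Yb om u"
  using cadlag_left_const[of "Y om" u] g u by (auto simp: good_def)
 have "EX ep>0. ALL s. u - ep < s & s < u --> sg om s x = before om u x" for x
  using cadlag_left_const[OF cadlag_site, of "sg om" u x] g u unfolding good_def config_before_def by metis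
 then obtain E where E: "!!x. 0 < E x" "!!x s. u - E x < s ==> s < u ==> sg om s x = before om u x" by metis
 define ep where "ep = Min (insert ep0 (E ` X))"
 have le: "ep <= ep0" "!!x. x : X ==> ep <= E x" unfolding ep_def using X by (auto intro!: Min_le)
 have "0 < ep" unfolding ep_def using X E(1) e0(1) by (subst Min_gr_iff) auto
 thus ?thesis
 proof (rule that)
  show "sg om s x = before om u x" if "u - ep < s" "s < u" "x : X" for s x
   using E(2)[of x s] le(2)[of x] that by simp
 qed (use le e0 in auto)
qed

lemma good_right:
 assumes g: "good om" and u: "0 <= u" and X: "finite X"
 obtains ep where "0 < ep" "!!s. u <= s ==> s < u + ep ==> Y om s = Y om u"
  "!!s x. u <= s ==> s < u + ep ==> x : X ==> sg om s x = sg om u x"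
proof -
 obtain ep0 where e0: "0 < ep0" "!!s. u <= s ==> s < u + ep0 ==> Y om s = Y om u"
  using cadlag_right_const[of "Y om" u] g u by (auto simp: good_def)
 have "EX ep>0. ALL s. u <= s & s < u + ep --> sg om s x = sg om u x" for x
  using cadlag_right_const[OF cadlag_site, of "sg om" u x] g u unfolding good_def by metis
 then obtain E where E: "!!x. 0 < E x" "!!x s. u <= s ==> s < u + E x ==> sg om s x = sg om u x" by metis
 define ep where "ep = Min (insert ep0 (E ` X))"
 have le: "ep <= ep0" "!!x. x : X ==> ep <= E x" unfolding ep_def using X by (auto intro!: Min_le)
 have "0 < ep" unfolding ep_def using X E(1) e0(1) by (subst Min_gr_iff) auto
 thus ?thesis
 proof (rule that)
  show "sg om s x = sg om u x" if "u <= s" "s < u + ep" "x : X" for s x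
   using E(2)[of s x] le(2)[of x] that by simp
  show "Y om s = Y om u" if "u <= s" "s < u + ep" for s using e0(2)[of s] le(1) that by simp
 qed
qed

lemma arrival_pos: "arrival c u ==> 0 < u" by (simp add: arrival_def)

lemma good_arrival:
 assumes "good om" "arrival (N om (x, ep)) u"
 shows "sg om u = toom_ring x ep (before om u)" "Y om u = push x ep (before om u) (Yb om u)"
 using assms by (auto simp: good_def obeys_toom_rules_def follows_push_rules_def)

lemma good_no_arrival:
 assumes "good om" "0 < u" "!!i. ~ arrival (N om i) u"
 shows "sg om u = before om u" "Y om u = Yb om u"
 using assms by (auto simp: good_def obeys_toom_rules_def follows_push_rules_def)

lemma good_unique: "good om ==> arrival (N om i) u ==> arrival (N om k) u ==> i = k"
 unfolding good_def by blast

text \<open>At time \<open>u\<close> there is an effective ring with both its site and its partner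
  visible to the window; these are the rings that \<open>lpush\<close> takes into account.\<close>

definition visible :: "nat => 'a => real => bool" where
 "visible L om u = (EX x ep. (x, ep) : ids L & arrival (N om (x, ep)) u & before om u x = ep & (EX z. x < z & z < int L & before om u z ~= ep))"

lemma visible_mono:
 assumes L: "L <= L'" and v: "visible L om u" shows "visible L' om u"
proof -
 have "ids L <= ids L'" using L by (auto simp: ids_def window_def)
 moreover have "z < int L ==> z < int L'" for z using L by simp
 ultimately show ?thesis using v unfolding visible_def by blast
qed

text \<open>Although infinitely many clocks ring, the cadlag integer path \<open>Y\<close> moves at
  only finitely many times up to \<open>t\<close>, and each move is due to one ring with a definite
  partner. A single window therefore suffices; real induction plays the part of compactness.\<close>

lemma jumps_localised:
 assumes g: "good om" and t: "0 <= t"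
 shows "EX L. ALL u. 0 < u --> u <= t --> Y om u ~= Yb om u --> visible L om u"
proof -
 define ok where "ok L u = (Y om u ~= Yb om u --> visible L om u)" for L u
 have mono: "ok L u ==> L <= L' ==> ok L' u" for L L' u using visible_mono unfolding ok_def by blast
 have one: "EX L. ok L u" if u: "0 < u" for u
 proof (cases "Y om u = Yb om u")
  case True thus ?thesis by (simp add: ok_def)
 next
  case False
  then obtain x ep where a: "arrival (N om (x, ep)) u" using good_no_arrival(2)[OF g u] by (metis surj_pair)
  have "push x ep (before om u) (Yb om u) ~= Yb om u" using False good_arrival(2)[OF g a] by simp
  then obtain z where z: "before om u x = ep" "x < z" "before om u z ~= ep" by (auto simp: push_def split: if_splits)
  define L where "L = nat (\<bar>x\<bar> + \<bar>z\<bar> + 1)"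
  have "(x, ep) : ids L" "z < int L" by (auto simp: ids_def window_def L_def)
  hence "ok L u" unfolding ok_def visible_def using a z by blast
  thus ?thesis by blast
 qed
 have "EX L. ALL u. 0 < u & u <= t --> ok L u" using t
 proof (induction t rule: real_induction)
  case zero thus ?case by (intro exI[of _ 0]) auto
 next
  case (right t)
  obtain L where L: "!!u. 0 < u ==> u <= t ==> ok L u" using right(2)[of t] right(1) by auto
  obtain ep where e: "0 < ep" "!!s. t <= s ==> s < t + ep ==> Y om s = Y om t"
   using good_right[OF g right(1), of "{}"] by auto
  have "ok L u" if u: "t < u" "u < t + ep" for u
  proof -
   have "0 < u" using u right(1) by simp
   then obtain d where d: "0 < d" "!!s. u - d < s ==> s < u ==> Y om s = Yb om u"
    using good_left[OF g, of u "{}"] by auto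
   define r where "r = max t (u - d / 2)"
   have "Yb om u = Y om r" using d u by (intro d(2)[symmetric]) (auto simp: r_def)
   also have "... = Y om t" using e(2)[of r] u d(1) by (auto simp: r_def)
   also have "... = Y om u" using e(2)[of u] u by simp
   finally show ?thesis by (simp add: ok_def)
  qed
  hence "ALL u. 0 < u & u <= s --> ok L u" if "t < s" "s < t + ep" for s
   using L that by (metis leI le_less_trans)
  thus ?case using e(1) by blast
 next
  case (left t)
  obtain ep where e: "0 < ep" "ep <= t" "!!s. t - ep < s ==> s < t ==> Y om s = Yb om t"
   using good_left[OF g left(1), of "{}"] by auto
  have "0 <= t - ep / 2" "t - ep / 2 < t" using e by auto
  then obtain L1 where L1: "!!u. 0 < u ==> u <= t - ep / 2 ==> ok L1 u" using left(2) by blast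
  obtain L2 where L2: "ok L2 t" using one[OF left(1)] by blast
  have "ok (max L1 L2) u" if u: "0 < u" "u <= t" for u
  proof -
   consider "u <= t - ep / 2" | "u = t" | "t - ep / 2 < u" "u < t" using u by linarith
   thus ?thesis
   proof cases
    case 1 thus ?thesis using mono[OF L1[OF u(1) 1], of "max L1 L2"] by simp
   next
    case 2 thus ?thesis using mono[OF L2, of "max L1 L2"] by simp
   next
    case 3
    obtain d where d: "0 < d" "!!s. u - d < s ==> s < u ==> Y om s = Yb om u"
     using good_left[OF g u(1), of "{}"] by auto
    define r where "r = max (t - ep / 2) (u - d / 2)"
    have "Yb om u = Y om r" using d 3 by (intro d(2)[symmetric]) (auto simp: r_def)
    also have "... = Yb om t" using 3 d(1) e(1) by (intro e(3)) (auto simp: r_def)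
    also have "... = Y om u" using 3 e(1) by (intro e(3)[symmetric]) auto
    finally show ?thesis by (simp add: ok_def)
   qed
  qed
  thus ?case by blast
 qed
 thus ?thesis unfolding ok_def by blast
qed

text \<open>Only the position is discretised: the rings act on the true configuration at the start
  of each slot, which is already known to be adapted.\<close>

primrec ychain :: "nat => real => nat => 'a => int" where
 "ychain L h 0 om = 0"
| "ychain L h (Suc j) om = (if EX i. sole L (real j * h) (real (Suc j) * h) i om
   then (let i = THE i. sole L (real j * h) (real (Suc j) * h) i om in lpush L (fst i) (snd i) (sg om (real j * h)) (ychain L h j om))
   else ychain L h j om)"

declare ychain.simps(2) [simp del]

lemma ychain_sole:
 assumes "sole L (real j * h) (real (Suc j) * h) i om"
 shows "ychain L h (Suc j) om = lpush L (fst i) (snd i) (sg om (real j * h)) (ychain L h j om)"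
proof -
 have "(THE i. sole L (real j * h) (real (Suc j) * h) i om) = i" using assms sole_unique by (metis the_equality)
 thus ?thesis unfolding ychain.simps Let_def using assms by metis
qed

lemma ychain_none:
 "(!!i. ~ sole L (real j * h) (real (Suc j) * h) i om) ==> ychain L h (Suc j) om = ychain L h j om"
 unfolding ychain.simps by simp

lemma pred_ychain:
 assumes h: "0 <= h" shows "real j * h <= t ==> Measurable.pred (FF t) (%om. ychain L h j om = y)"
proof (induction j arbitrary: y)
 case 0 thus ?case by simp
next
 case (Suc j)
 let ?s = "real j * h" and ?u = "real (Suc j) * h"
 have su: "0 <= ?s" "?s <= ?u" "?u <= t" using h Suc.prems by (auto simp: algebra_simps)
 have IH: "Measurable.pred (FF t) (%om. ychain L h j om = y)" for y using Suc.IH su by simp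
 have so: "Measurable.pred (FF t) (sole L ?s ?u i)" for i using pred_FF_incr su by (intro pred_sole) auto
 have sg: "Measurable.pred (FF t) (%om. sg om ?s x)" for x
 proof (rule pred_FF_mono)
  show "Measurable.pred (FF ?s) (%om. sg om ?s x)" using regular_all[OF su(1)] unfolding regular_def by blast
  show "?s <= t" using su by linarith
 qed
 have lp: "Measurable.pred (FF t) (%om. lpush L (fst i) (snd i) (sg om ?s) y' = y)" if "i : ids L" for i y'
 proof (rule pred_local[where X = "window L" and D = "%om. sg om ?s" and Q = "%s. lpush L (fst i) (snd i) s y' = y"])
  have "fst i : window L" using that by (auto simp: ids_def)
  thus "(lpush L (fst i) (snd i) s y' = y) = (lpush L (fst i) (snd i) s' y' = y)"
   if "!!x. x : window L ==> s x = s' x" for s s'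
   using lpush_local[of "fst i" L s s'] that by simp
 qed (use sg in "simp_all add: window_def")
 have "(ychain L h (Suc j) om = y) = ((EX i:ids L. sole L ?s ?u i om & (EX y'. ychain L h j om = y' & lpush L (fst i) (snd i) (sg om ?s) y' = y)) \<or>
   (ALL i:ids L. ~ sole L ?s ?u i om) & ychain L h j om = y)" for om
 proof (cases "EX i. sole L ?s ?u i om")
  case True
  then obtain i where i: "sole L ?s ?u i om" by blast
  hence ii: "i : ids L" by (simp add: sole_def)
  show ?thesis unfolding ychain_sole[OF i] using i ii sole_unique[OF i] by blast
 next
  case False
  hence "ychain L h (Suc j) om = ychain L h j om" by (intro ychain_none) blast
  thus ?thesis using False by metis
 qed
 moreover have "Measurable.pred (FF t) (%om.
   (EX i:ids L. sole L ?s ?u i om & (EX y'. ychain L h j om = y' & lpush L (fst i) (snd i) (sg om ?s) y' = y)) \<or>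
   (ALL i:ids L. ~ sole L ?s ?u i om) & ychain L h j om = y)"
  by (intro pred_intros_finite(3,4) pred_intros_logic(2-5) pred_intros_countable so IH lp finite_ids)
 ultimately show ?case by simp
qed

text \<open>If the mesh is below the gaps between arrivals and below the time for which the window
  and the tag are constant before each arrival, the start of a slot shows the state just before its
  ring.\<close>

lemma ychain_eq:
 assumes g: "good om" and h: "0 < h"
  and jumps: "!!u. 0 < u ==> u <= t ==> Y om u ~= Yb om u ==> visible L om u"
  and gap: "!!u v. u : arrival_times L om 0 t ==> v : arrival_times L om 0 t ==> u < v ==> h < v - u"
  and mesh: "!!u s. u : arrival_times L om 0 t ==> u - h <= s ==> s < u ==>
    0 <= s ==> Y om s = Yb om u & (ALL x:window L. sg om s x = before om u x)"
 shows "real j * h <= t ==> ychain L h j om = Y om (real j * h)"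
proof (induction j)
 case 0 thus ?case using g by (simp add: good_def)
next
 case (Suc j)
 have w: "om : space M" and cY: "cadlag_on {0..} (Y om)" using g by (auto simp: good_def)
 define s0 where "s0 = real j * h"
 define u0 where "u0 = real (Suc j) * h"
 have us: "u0 = s0 + h" by (simp add: u0_def s0_def algebra_simps)
 have ut: "u0 <= t" using Suc.prems by (simp only: u0_def)
 have su: "0 <= s0" "s0 <= u0" "s0 <= t" using h us ut by (simp_all add: s0_def)
 have IH: "ychain L h j om = Y om s0" using Suc.IH su(3) by (simp only: s0_def)
 have one: "ALL v:arrival_times L om s0 u0. ALL v':arrival_times L om s0 u0. ~ v < v'"
  proof (intro ballI notI)
  fix v v' assume "v : arrival_times L om s0 u0" "v' : arrival_times L om s0 u0" "v < v'"
  thus False using gap[of v v'] su(1) us ut by (auto simp: arrival_times_def)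
 qed
 have sim: "ALL i k u. i ~= k --> ~ (arrival (N om i) u & arrival (N om k) u)" using good_unique[OF g] by blast
 have noj: "Y om v = Yb om v" if "s0 < v" "v <= u0" "!!k. k : ids L ==> ~ arrival (N om k) v" for v
  using jumps[of v] that su ut unfolding visible_def by force
 show ?case
 proof (cases "EX v k. s0 < v & v <= u0 & k : ids L & arrival (N om k) v")
  case False
  have "~ sole L s0 u0 i om" for i by (rule no_sole[OF w su(1,2)]) (use False in blast)
  hence "ychain L h (Suc j) om = ychain L h j om" unfolding s0_def u0_def by (rule ychain_none)
  moreover have "Y om u0 = Y om s0"
   by (rule constant_without_jumps[OF cY su(1,2)]) (use noj False in blast)
  ultimately show ?thesis using IH by (simp only: u0_def)
 next
  case True
  then obtain v i where v: "s0 < v" "v <= u0" "i : ids L" "arrival (N om i) v" by blast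
  note so = sole_arrival[OF w sim su(1,2) one v(3,4,1,2)]
  obtain x ep where i: "i = (x, ep)" by (cases i)
  have x: "x : window L" using v(3) i by (simp add: ids_def)
  have m: "Y om s0 = Yb om v" "ALL x:window L. sg om s0 x = before om v x"
   using mesh[of v s0] v us su ut cycle_arrivals_iff[of i L "N om"] by (auto simp: arrival_times_def)
  have "ychain L h (Suc j) om = lpush L x ep (sg om s0) (ychain L h j om)"
   using ychain_sole[OF so(1)[unfolded s0_def u0_def]] i by (simp only: s0_def u0_def fst_conv snd_conv)
  also have "... = lpush L x ep (before om v) (Yb om v)"
   unfolding IH m(1) by (rule lpush_local[OF x]) (use m(2) in blast)
  also have "... = Y om v"
  proof (cases "before om v x = ep & (EX z. x < z & z < int L & before om v z ~= ep)")
   case True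
   thus ?thesis using good_arrival(2)[OF g v(4)[unfolded i]] by (simp add: lpush_def)
  next
   case False
   have "Y om v = Yb om v"
   proof (rule ccontr)
    assume "Y om v ~= Yb om v"
    then obtain x' ep' where x': "arrival (N om (x', ep')) v" "before om v x' = ep'" "EX z. x' < z & z < int L & before om v z ~= ep'"
     using jumps[of v] v su ut unfolding visible_def by force
    have "(x', ep') = i" using good_unique[OF g x'(1) v(4)] .
    thus False using x' False i by simp
   qed
   thus ?thesis unfolding lpush_def using False by (simp only: if_False)
  qed
  also have "... = Y om u0"
  proof (rule constant_without_jumps[OF cY _ v(2), symmetric])
   show "Y om u = Yb om u" if "v < u" "u <= u0" for u
    using noj[of u] so(2)[of u] that v by force
  qed (use v su in simp)
  finally show ?thesis by (simp only: u0_def)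
 qed
qed

lemma ychain_tendsto:
 assumes g: "good om" and t: "0 < t"
 shows "EX L0. ALL L>=L0. EX m0. ALL m>=m0. ychain L (t / real (Suc m)) (Suc m) om = Y om t"
proof -
 obtain L0 where L0: "!!u. 0 < u ==> u <= t ==> Y om u ~= Yb om u ==> visible L0 om u"
  using jumps_localised[OF g, of t] t by auto
 have w: "om : space M" using g by (simp add: good_def)
 show ?thesis
 proof (rule exI[of _ L0], intro allI impI)
  fix L assume L: "L0 <= L"
  have jumps: "visible L om u" if u: "0 < u" "u <= t" "Y om u ~= Yb om u" for u by (rule visible_mono[OF L L0[OF u]])
  define U where "U = arrival_times L om 0 t"
  have "EX ep>0. ALL s. u - ep < s & s < u --> Y om s = Yb om u & (ALL x:window L. sg om s x = before om u x)" if "u : U" for u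
  proof -
   have u: "0 < u" using that by (simp add: U_def arrival_times_def)
   have f: "finite (window L)" by (simp add: window_def)
   show ?thesis by (rule good_left[OF g u f]) blast
  qed
  then obtain E where E: "!!u. u : U ==> 0 < E u"
   "!!u s. u : U ==> u - E u < s ==> s < u ==> Y om s = Yb om u & (ALL x:window L. sg om s x = before om u x)" by metis
  obtain m0 where m0: "!!m u v. m0 <= m ==> u : U ==> v : U ==> u < v ==> t / real (Suc m) < v - u"
   "!!m u. m0 <= m ==> u : U ==> t / real (Suc m) < E u"
   by (rule small_mesh[of U E t]) (use E(1) finite_arrival_times[OF w] in "auto simp: U_def")
  show "EX m0. ALL m>=m0. ychain L (t / real (Suc m)) (Suc m) om = Y om t"
  proof (intro exI[of _ m0] allI impI)
   fix m assume "m0 <= m"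
   let ?h = "t / real (Suc m)"
   have e: "real (Suc m) * ?h = t" by simp
   have "ychain L ?h (Suc m) om = Y om (real (Suc m) * ?h)"
   proof (rule ychain_eq[OF g _ jumps])
    show "?h < v - u" if "u : arrival_times L om 0 t" "v : arrival_times L om 0 t" "u < v" for u v
     using m0(1) `m0 <= m` that by (simp add: U_def)
    show "Y om s = Yb om u & (ALL x:window L. sg om s x = before om u x)"
     if "u : arrival_times L om 0 t" "u - ?h <= s" "s < u" for u s
     using E(2)[of u s] m0(2)[of m u] `m0 <= m` that by (auto simp: U_def)
    show "real (Suc m) * ?h <= t" by (simp only: e)
   qed (use t in simp_all)
   thus "ychain L ?h (Suc m) om = Y om t" by (simp only: e)
  qed
 qed
qed

text \<open>\<open>Y\<close> is given only through its rules, not as a function of the clocks; that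
  it depends on the past alone is read off from the adapted approximations
  \<open>ychain\<close>.\<close>

theorem pred_Y:
 assumes t: "0 <= t" shows "Measurable.pred (FF t) (%om. Y om t = y)"
proof (cases "t = 0")
 case True
 show ?thesis
 proof (rule pred_FF_AE)
  show "Measurable.pred (FF t) (%om. 0 = y)" by simp
  show "AE om in M. (0 = y) = (Y om t = y)" using AE_good by eventually_elim (auto simp: True good_def)
 qed
next
 case False
 define D where "D L m om = ychain L (t / real (Suc m)) (Suc m) om" for L m om
 show ?thesis
 proof (rule pred_FF_double_limit)
  show "Measurable.pred (FF t) (%om. D L m om = y)" for L m
   unfolding D_def by (rule pred_ychain) (use t in "auto simp del: of_nat_Suc")
  show "AE om in M. EX L0. ALL L>=L0. EX m0. ALL m>=m0. (D L m om = y) = (Y om t = y)"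
   using AE_good
  proof eventually_elim
   fix om assume "good om"
   then obtain L0 where "!!L. L0 <= L ==> EX m0. ALL m>=m0. D L m om = Y om t"
    using ychain_tendsto[of om t] t False unfolding D_def by auto
   thus "EX L0. ALL L>=L0. EX m0. ALL m>=m0. (D L m om = y) = (Y om t = y)" by metis
  qed
 qed
qed

end

subsection \<open>The compensator formula\<close>

text \<open>Left end points, since the state of a slot is read at its start.\<close>

lemma riemann_left:
 fixes g :: "real => real"
 assumes at: "a < t" and g: "continuous_on {a..t} g"
 shows "(%m. SUM k<Suc m. (t - a) / real (Suc m) * g (a + real k * ((t - a) / real (Suc m)))) ----> integral {a..t} g"
proof (rule LIMSEQ_I)
 fix r :: real assume r: "0 < r"
 define ep where "ep = r / (2 * (t - a))"
 have e0: "0 < ep" using r at by (simp add: ep_def)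
 have "uniformly_continuous_on {a..t} g" using g by (rule compact_uniformly_continuous) simp
 then obtain d where d: "0 < d" "!!x y. x : {a..t} ==> y : {a..t} ==> \<bar>y - x\<bar> < d ==> \<bar>g y - g x\<bar> < ep"
  using e0 unfolding uniformly_continuous_on_def dist_real_def by metis
 obtain m0 :: nat where m0: "(t - a) / d < real m0" using reals_Archimedean2 by blast
 show "EX m0. ALL m>=m0. norm ((SUM k<Suc m. (t - a) / real (Suc m) * g (a + real k * ((t - a) / real (Suc m)))) - integral {a..t} g) < r"
 proof (intro exI[of _ m0] allI impI)
  fix m assume m: "m0 <= m"
  define h where "h = (t - a) / real (Suc m)"
  have h0: "0 < h" using at by (simp add: h_def)
  have "(t - a) / d < real (Suc m)" using m0 m by simp
  hence hd: "h < d" using d(1) by (simp add: h_def field_simps)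
  have mh: "real (Suc m) * h = t - a" by (simp add: h_def)
  have le: "a + real k * h <= t" if "k <= Suc m" for k
  proof -
   have "real k * h <= real (Suc m) * h" using that h0 by (intro mult_right_mono) auto
   thus ?thesis using mh by simp
  qed
  have int: "g integrable_on {u..v}" if "a <= u" "v <= t" for u v
   by (rule integrable_continuous_real) (rule continuous_on_subset[OF g], use that in auto)
  have st: "\<bar>(SUM k<n. h * g (a + real k * h)) - integral {a..a + real n * h} g\<bar> <= real n * (h * ep)" if "n <= Suc m" for n
   using that
  proof (induction n)
   case 0 thus ?case by simp
  next
   case (Suc n)
   let ?s = "a + real n * h" and ?u = "a + real (Suc n) * h"
   have us: "?u = ?s + h" by (simp add: algebra_simps)
   have "?u <= t" by (rule le[OF Suc.prems])
   moreover have "0 <= real n * h" using h0 by simp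
   ultimately have su: "a <= ?s" "?s <= ?u" "?u <= t" using h0 us by linarith+
   have 1: "integral {a..?s} g + integral {?s..?u} g = integral {a..?u} g"
    by (rule Henstock_Kurzweil_Integration.integral_combine[OF su(1,2) int]) (use su in auto)
   have c: "((%_. g ?s) has_integral (h * g ?s)) {?s..?u}"
    using has_integral_const_real[of "g ?s" ?s ?u] su(2) us by simp
   have "integral {?s..?u} (%x. g ?s - g x) = h * g ?s - integral {?s..?u} g"
    using c int[OF su(1,3)] by (subst Henstock_Kurzweil_Integration.integral_diff) (auto dest: integral_unique)
   moreover have "norm (integral {?s..?u} (%x. g ?s - g x)) <= ep * (?u - ?s)"
   proof (rule integral_bound)
    show "?s <= ?u" by (rule su(2))
    show "continuous_on {?s..?u} (%x. g ?s - g x)"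
     by (intro continuous_intros continuous_on_subset[OF g]) (use su in auto)
    show "norm (g ?s - g x) <= ep" if x: "x : {?s..?u}" for x
    proof -
     have "x : {a..t}" "?s : {a..t}" "\<bar>?s - x\<bar> < d"
      using x su us hd unfolding atLeastAtMost_iff by linarith+
     hence "\<bar>g ?s - g x\<bar> < ep" by (rule d(2))
     thus ?thesis by simp
    qed
   qed
   ultimately have 2: "\<bar>h * g ?s - integral {?s..?u} g\<bar> <= ep * h" using us by simp
   have "\<bar>(SUM k<n. h * g (a + real k * h)) - integral {a..?s} g\<bar> <= real n * (h * ep)" using Suc by simp
   moreover have "real (Suc n) * (h * ep) = real n * (h * ep) + ep * h" by (simp add: algebra_simps)
   ultimately show ?case using 1 2 unfolding sum.lessThan_Suc by linarith
  qed
  have "a + real (Suc m) * h = t" using mh by simp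
  with st[of "Suc m"] have "\<bar>(SUM k<Suc m. h * g (a + real k * h)) - integral {a..t} g\<bar> <= real (Suc m) * (h * ep)"
   by (simp only: order_refl)
  also have "... = (t - a) * ep" using mh by (simp only: mult.assoc[symmetric])
  also have "... = r / 2" using at by (simp add: ep_def field_simps)
  also have "... < r" using r by simp
  finally show "norm ((SUM k<Suc m. (t - a) / real (Suc m) * g (a + real k * ((t - a) / real (Suc m)))) - integral {a..t} g) < r"
   unfolding h_def real_norm_def .
 qed
qed

context toom
begin

definition stateP :: "'a set => (int => config => bool) => real => 'a set" where
 "stateP Ph C s = {om:space M. om : Ph & C (Y om s) (sg om s)}"

definition local_on :: "int set => (int => config => bool) => bool" where
 "local_on X C = (finite X & (ALL y s s'. (ALL x:X. s x = s' x) --> C y s = C y s'))"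

lemma local_onD: "local_on X C ==> (!!x. x : X ==> s x = s' x) ==> C y s = C y s'"
 unfolding local_on_def by blast

lemma pred_state:
 assumes C: "local_on X C" and Yp: "!!y. Measurable.pred F (%om. Y om s = y)"
  and Sp: "!!x. Measurable.pred F (%om. sg om s x)"
 shows "Measurable.pred F (%om. C (Y om s) (sg om s))"
proof -
 have "Measurable.pred F (%om. C y (sg om s))" for y
  by (rule pred_local[where X = X and D = "%om. sg om s" and Q = "C y"])
   (use C Sp in "auto simp: local_on_def")
 hence "Measurable.pred F (%om. EX y. Y om s = y & C y (sg om s))"
  by (intro pred_intros_countable pred_intros_logic Yp)
 thus ?thesis by simp
qed

lemma stateP_events:
 assumes "local_on X C" "Ph : events" "0 <= s" shows "stateP Ph C s : events"
proof -
 have "Measurable.pred M (%om. C (Y om s) (sg om s))"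
  by (rule pred_state[OF assms(1)]) (use measurable_sg_site measurable_Y assms(3) in "auto intro!: pred_eq_const1")
 hence "{om:space M. C (Y om s) (sg om s)} : events" by (simp add: pred_def)
 moreover have "stateP Ph C s = Ph Int {om:space M. C (Y om s) (sg om s)}" unfolding stateP_def by blast
 ultimately show ?thesis using assms(2) by auto
qed

lemma stateP_FF:
 assumes C: "local_on X C" and P: "Ph : sets (FF a)" and a: "a <= s" "0 <= s" shows "stateP Ph C s : sets (FF s)"
proof -
 have "Measurable.pred (FF s) (%om. C (Y om s) (sg om s))"
  by (rule pred_state[OF C pred_Y[OF a(2)]]) (use regular_all[OF a(2)] in "simp add: regular_def")
 hence "{om:space M. C (Y om s) (sg om s)} : sets (FF s)" by (simp add: pred_def)
 moreover have "stateP Ph C s = Ph Int {om:space M. C (Y om s) (sg om s)}" unfolding stateP_def by blast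
 ultimately show ?thesis using P FF_mono[OF a(1)] by (auto intro!: sets.Int)
qed

lemma AE_no_arrival_at:
 assumes s: "0 < s" shows "AE om in M. ALL i. ~ arrival (N om i) s"
 unfolding AE_all_countable
proof
 fix i
 define B where "B n = {om:space M. incr i (s - s / real (Suc n)) s om}" for n
 have s0: "0 <= s - s / real (Suc n)" for n using s by (simp add: field_simps)
 have BM: "B n : events" for n unfolding B_def using measurable_incr[of "s - s / real (Suc n)" s i] s0[of n] s by (simp add: pred_def)
 have pB: "prob (B n) <= rt i * (s / real (Suc n))" for n
 proof -
  have "prob (B n) = incr_prob i (s - (s - s / real (Suc n)))" unfolding B_def by (rule prob_incr[OF s0]) (use s in simp)
  also have "... <= rt i * (s - (s - s / real (Suc n)))" by (rule incr_prob_le) (use s in simp)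
  finally show ?thesis by simp
 qed
 have le: "prob (INT n. B n) <= rt i * s / real (Suc n)" for n
  using finite_measure_mono[of "INT n. B n" "B n"] BM pB[of n] by force
 have "prob (INT n. B n) <= 0"
 proof (rule LIMSEQ_le_const)
  show "(%n. rt i * s / real (Suc n)) ----> 0" using lim_const_over_n LIMSEQ_Suc by blast
 qed (use le in blast)
 hence n: "(INT n. B n) : null_sets M" using BM by (intro null_setsI) (auto simp: emeasure_eq_measure measure_le_0_iff)
 show "AE om in M. ~ arrival (N om i) s"
 proof (rule AE_I'[OF n], rule subsetI)
  fix om assume "om : {om:space M. ~ ~ arrival (N om i) s}"
  hence w: "om : space M" "arrival (N om i) s" by auto
  have "incr i (s - s / real (Suc n)) s om" for n
   unfolding incr_def by (rule arrival_imp_increase[OF counting[OF w(1)] w(2) s0]) (use s in simp_all)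
  thus "om : (INT n. B n)" using w unfolding B_def by blast
 qed
qed

text \<open>Almost surely no clock rings at a given time \<open>s\<close>, so the tag and the
  finitely many sites in question are constant near \<open>s\<close>; the indicators then converge
  and are bounded.\<close>

lemma stateP_continuous:
 assumes C: "local_on X C" and P: "Ph : events"
 shows "continuous_on {0..} (%s. prob (stateP Ph C s))"
 unfolding continuous_on_sequentially comp_def
proof (intro allI ballI impI)
 fix S :: "nat => real" and s assume s: "s : {0..}" and "(ALL n. S n : {0..}) & S ----> s"
 hence S: "!!n. 0 <= S n" "S ----> s" by auto
 have s0: "0 <= s" using s by simp
 have finX: "finite X" using C by (simp add: local_on_def)
 have noarr: "AE om in M. 0 < s --> (ALL i. ~ arrival (N om i) s)"
  using AE_no_arrival_at[of s] by (cases "0 < s") auto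
 have ev: "AE om in M. eventually (%n. indicator (stateP Ph C (S n)) om = (indicator (stateP Ph C s) om :: real)) sequentially"
  using AE_good noarr
 proof eventually_elim
  fix om assume g: "good om" and na: "0 < s --> (ALL i. ~ arrival (N om i) s)"
  obtain e1 where e1: "0 < e1" "!!u. s <= u ==> u < s + e1 ==> Y om u = Y om s"
   "!!u x. s <= u ==> u < s + e1 ==> x : X ==> sg om u x = sg om s x"
   by (rule good_right[OF g s0 finX]) blast
  have "EX e2>0. ALL u. 0 <= u & s - e2 < u & u < s --> Y om u = Y om s & (ALL x:X. sg om u x = sg om s x)"
  proof (cases "0 < s")
   case True
   have eq: "sg om s = before om s" "Y om s = Yb om s" using good_no_arrival[OF g True] na True by blast+
   show ?thesis unfolding eq by (rule good_left[OF g True finX]) blast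
  next
   case False
   thus ?thesis using s0 by (intro exI[of _ 1]) auto
  qed
  then obtain e2 where e2: "0 < e2" "!!u. 0 <= u ==> s - e2 < u ==> u < s ==> Y om u = Y om s & (ALL x:X. sg om u x = sg om s x)"
   by blast
  have "eventually (%n. dist (S n) s < min e1 e2) sequentially"
   using S(2) e1(1) e2(1) by (intro tendstoD) auto
  thus "eventually (%n. indicator (stateP Ph C (S n)) om = (indicator (stateP Ph C s) om :: real)) sequentially"
  proof (rule eventually_mono)
   fix n assume d: "dist (S n) s < min e1 e2"
   have "Y om (S n) = Y om s & (ALL x:X. sg om (S n) x = sg om s x)"
   proof (cases "S n < s")
    case True
    show ?thesis by (rule e2(2)[OF S(1) _ True]) (use d in "unfold dist_real_def, linarith")
   next
    case False
    hence "s <= S n" "S n < s + e1" using d by (auto simp: dist_real_def)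
    thus ?thesis using e1(2,3) by blast
   qed
   hence "C (Y om (S n)) (sg om (S n)) = C (Y om s) (sg om s)" using local_onD[OF C] by metis
   thus "indicator (stateP Ph C (S n)) om = (indicator (stateP Ph C s) om :: real)"
    by (simp add: stateP_def indicator_def)
  qed
 qed
 have "(%n. \<integral>om. indicator (stateP Ph C (S n)) om \<partial>M) ----> (LINT om|M. (indicator (stateP Ph C s) om :: real))"
 proof (rule integral_dominated_convergence[where w = "%_. 1"])
  show "indicator (stateP Ph C s) : borel_measurable M" using stateP_events[OF C P s0] by simp
  show "indicator (stateP Ph C (S n)) : borel_measurable M" for n using stateP_events[OF C P S(1)] by simp
  show "AE om in M. (%n. indicator (stateP Ph C (S n)) om) ----> (indicator (stateP Ph C s) om :: real)"
   using ev by eventually_elim (rule tendsto_eventually)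
 qed (auto simp: indicator_def)
 thus "(%n. prob (stateP Ph C (S n))) ----> prob (stateP Ph C s)"
  using stateP_events[OF C P] S(1) s0 by (simp add: Int_absorb1 sets.sets_into_space)
qed

definition rings :: "int \<times> sign => (int => config => bool) => real => real => 'a => real set" where
 "rings i C a t om = {u. a < u & u <= t & arrival (N om i) u & C (Yb om u) (before om u)}"

lemma finite_rings: "om : space M ==> finite (rings i C a t om)"
 by (rule finite_subset[OF _ finite_arrivals[OF counting, of om i t]]) (auto simp: rings_def)

text \<open>The state is tested at the start of the slot, where it belongs to the past and is
  independent of the increment of the clock in the slot.\<close>

definition slots :: "int \<times> sign => (int => config => bool) => real => real => nat => 'a => nat set" where
 "slots i C a t m om = (let h = (t - a) / real (Suc m) in
   {k. k < Suc m & incr i (a + real k * h) (a + real (Suc k) * h) om & C (Y om (a + real k * h)) (sg om (a + real k * h))})"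

lemma slot_of:
 fixes u a h :: real
 assumes h: "0 < h" and u: "a < u"
 defines "k \<equiv> nat (\<lceil>(u - a) / h\<rceil> - 1)"
 shows "a + real k * h < u" "u <= a + real (Suc k) * h"
  "!!j. a + real j * h < u ==> u <= a + real (Suc j) * h ==> j = k"
proof -
 have "0 < (u - a) / h" using assms by simp
 hence kr: "real k = of_int \<lceil>(u - a) / h\<rceil> - 1" by (simp add: k_def)
 have 1: "real k < (u - a) / h" "(u - a) / h <= real (Suc k)" unfolding kr of_nat_Suc by linarith+
 have "real k * h < u - a" "u - a <= real (Suc k) * h"
  using 1 h by (simp_all only: pos_less_divide_eq pos_divide_le_eq)
 thus "a + real k * h < u" "u <= a + real (Suc k) * h" by linarith+
 fix j assume j: "a + real j * h < u" "u <= a + real (Suc j) * h"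
 have "real j * h < u - a" "u - a <= real (Suc j) * h" using j by linarith+
 hence "real j < (u - a) / h" "(u - a) / h <= real (Suc j)"
  using h by (simp_all only: pos_less_divide_eq pos_divide_le_eq)
 with 1 have "real j < real (Suc k)" "real k < real (Suc j)" by linarith+
 thus "j = k" by simp
qed

lemma slots_subset:
 assumes w: "om : space M" and a: "0 <= a" "a < t"
 defines "h \<equiv> %m. (t - a) / real (Suc m)"
 shows "slots i C a t m om <= (%u. nat (\<lceil>(u - a) / h m\<rceil> - 1)) ` rings i (%_ _. True) a t om"
proof
 fix k assume "k : slots i C a t m om"
 hence k: "k < Suc m" "incr i (a + real k * h m) (a + real (Suc k) * h m) om"
  unfolding slots_def Let_def h_def by blast+
 have h0: "0 < h m" using a by (simp add: h_def)
 have k0: "0 <= real k * h m" using h0 by simp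
 hence s: "0 <= a + real k * h m" "a + real k * h m <= a + real (Suc k) * h m"
  using a(1) h0 by (simp_all add: algebra_simps)
 obtain u where u: "arrival (N om i) u" "a + real k * h m < u" "u <= a + real (Suc k) * h m"
  using k(2) increase_iff_arrival[OF counting[OF w] s] unfolding incr_def by blast
 have "real (Suc k) * h m <= real (Suc m) * h m" using k(1) h0 by (intro mult_right_mono) auto
 hence "u <= t" using u(3) by (simp add: h_def)
 moreover have au: "a < u" using u(2) k0 by linarith
 moreover have "k = nat (\<lceil>(u - a) / h m\<rceil> - 1)" by (rule slot_of(3)[OF h0 au u(2,3)])
 ultimately show "k : (%u. nat (\<lceil>(u - a) / h m\<rceil> - 1)) ` rings i (%_ _. True) a t om"
  using u(1) by (auto simp: rings_def)
qed

lemma card_slots_le: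
 assumes "om : space M" "0 <= a" "a < t"
 shows "card (slots i C a t m om) <= card (rings i (%_ _. True) a t om)"
 using card_mono[OF finite_imageI[OF finite_rings[OF assms(1)]] slots_subset[OF assms]]
  card_image_le[OF finite_rings[OF assms(1)]] order_trans by blast

text \<open>On a fine grid different rings fall into different slots, and the state at the start of
  the slot agrees with the state just before the ring.\<close>

lemma card_slots_eventually:
 assumes g: "good om" and C: "local_on X C" and a: "0 <= a" "a < t"
 shows "eventually (%m. card (slots i C a t m om) = card (rings i C a t om)) sequentially"
proof -
 have w: "om : space M" using g by (simp add: good_def)
 have finX: "finite X" using C by (simp add: local_on_def)
 define U where "U = rings i (%_ _. True) a t om"
 have fin: "finite U" unfolding U_def by (rule finite_rings[OF w])
 have "EX ep>0. ALL s. u - ep < s & s < u --> C (Y om s) (sg om s) = C (Yb om u) (before om u)" if "u : U" for u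
 proof -
  have u: "0 < u" using that a by (simp add: U_def rings_def)
  obtain ep where e: "0 < ep" "!!s. u - ep < s ==> s < u ==> Y om s = Yb om u"
   "!!s x. u - ep < s ==> s < u ==> x : X ==> sg om s x = before om u x"
   by (rule good_left[OF g u finX]) blast
  have "C (Y om s) (sg om s) = C (Yb om u) (before om u)" if s: "u - ep < s" "s < u" for s
   unfolding e(2)[OF s] by (rule local_onD[OF C]) (rule e(3)[OF s])
  thus ?thesis using e(1) by blast
 qed
 then obtain E where E: "!!u. u : U ==> 0 < E u"
  "!!u s. u : U ==> u - E u < s ==> s < u ==> C (Y om s) (sg om s) = C (Yb om u) (before om u)" by metis
 obtain m0 where m0: "!!m u v. m0 <= m ==> u : U ==> v : U ==> u < v ==> (t - a) / real (Suc m) < v - u"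
  "!!m u. m0 <= m ==> u : U ==> (t - a) / real (Suc m) < E u"
  by (rule small_mesh[of U E "t - a"]) (use E(1) fin in auto)
 show ?thesis unfolding eventually_sequentially
 proof (intro exI[of _ m0] allI impI)
  fix m assume m: "m0 <= m"
  define h where "h = (t - a) / real (Suc m)"
  have h0: "0 < h" using a by (simp add: h_def)
  define K where "K u = nat (\<lceil>(u - a) / h\<rceil> - 1)" for u
  have K: "a + real (K u) * h < u" "u <= a + real (Suc (K u)) * h" if "u : U" for u
   using slot_of(1,2)[OF h0, of a u] that unfolding K_def U_def rings_def by blast+
  have st: "a + real (Suc j) * h = a + real j * h + h" for j by (simp add: algebra_simps)
  have Keq: "C (Y om (a + real (K u) * h)) (sg om (a + real (K u) * h)) = C (Yb om u) (before om u)" if u: "u : U" for u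
   by (rule E(2)[OF u _ K(1)[OF u]]) (use K(2)[OF u] m0(2)[OF m u] st[of "K u"] in "unfold h_def[symmetric], linarith")
  have inj: "inj_on K U"
  proof (rule linorder_inj_onI)
   fix u v assume uv: "u < v" "u : U" "v : U"
   show "K u ~= K v"
   proof
    assume e: "K u = K v"
    show False using K(1)[OF uv(2)] K(2)[OF uv(3)] m0(1)[OF m uv(2,3,1)] st[of "K v"] unfolding e h_def[symmetric] by linarith
   qed
  qed auto
  have "slots i C a t m om = K ` rings i C a t om"
  proof (intro equalityI subsetI)
   fix k assume k: "k : slots i C a t m om"
   then obtain u where u: "u : U" "k = K u"
    using slots_subset[OF w a] unfolding U_def K_def h_def by blast
   have "C (Yb om u) (before om u)" using k Keq[OF u(1)] u(2) unfolding slots_def Let_def h_def by blast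
   thus "k : K ` rings i C a t om" using u by (auto simp: U_def rings_def)
  next
   fix k assume "k : K ` rings i C a t om"
   then obtain u where u: "u : rings i C a t om" "k = K u" by blast
   have uU: "u : U" using u(1) by (simp add: U_def rings_def)
   have "real k * h < t - a" using K(1)[OF uU] u by (simp add: rings_def)
   hence "real k * h < real (Suc m) * h" by (simp add: h_def)
   hence "real k < real (Suc m)" using h0 by (simp only: mult_less_cancel_right_pos)
   hence km: "k < Suc m" by simp
   have s: "0 <= a + real k * h" using a(1) h0 by simp
   have "incr i (a + real k * h) (a + real (Suc k) * h) om"
    unfolding incr_def by (rule arrival_imp_increase[OF counting[OF w] _ s])
     (use u K[OF uU] in "auto simp: rings_def")
   moreover have "C (Y om (a + real k * h)) (sg om (a + real k * h))" using Keq[OF uU] u by (simp add: rings_def)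
   ultimately show "k : slots i C a t m om" using km unfolding slots_def Let_def h_def by blast
  qed
  moreover have "inj_on K (rings i C a t om)" by (rule inj_on_subset[OF inj]) (auto simp: U_def rings_def)
  ultimately show "card (slots i C a t m om) = card (rings i C a t om)" by (simp add: card_image)
 qed
qed

definition slot_event :: "'a set => int \<times> sign => (int => config => bool) => real => real => nat => nat => 'a set" where
 "slot_event Ph i C a t m k = (let h = (t - a) / real (Suc m) in
   stateP Ph C (a + real k * h) Int {om:space M. incr i (a + real k * h) (a + real (Suc k) * h) om})"

definition slot_count :: "'a set => int \<times> sign => (int => config => bool) => real => real => nat => 'a => ennreal" where
 "slot_count Ph i C a t m om = (SUM k<Suc m. indicator (slot_event Ph i C a t m k) om)"

lemma slot_count_card:
 assumes "om : space M"
 shows "slot_count Ph i C a t m om = (if om : Ph then of_nat (card (slots i C a t m om)) else 0)"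
proof (cases "om : Ph")
 case True
 have fin: "finite (slots i C a t m om)" by (rule finite_subset[of _ "{..<Suc m}"]) (auto simp: slots_def Let_def)
 have "slot_count Ph i C a t m om = (SUM k<Suc m. indicator (slots i C a t m om) k)"
  unfolding slot_count_def
  by (intro sum.cong refl) (use assms True in "auto simp: slot_event_def slots_def stateP_def Let_def indicator_def")
 also have "... = (SUM k:slots i C a t m om. 1)"
  by (rule sum.mono_neutral_cong_right) (auto simp: slots_def Let_def)
 finally show ?thesis using True by simp
next
 case False
 hence "slot_count Ph i C a t m om = 0"
  unfolding slot_count_def by (intro sum.neutral) (auto simp: slot_event_def stateP_def Let_def)
 thus ?thesis using False by simp
qed

lemma
 assumes C: "local_on X C" and P: "Ph : sets (FF a)" "Ph : events" and a: "0 <= a" "a < t"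
 shows slot_event_events: "slot_event Ph i C a t m k : events" (is ?E)
  and prob_slot_event: "prob (slot_event Ph i C a t m k) =
   incr_prob i ((t - a) / real (Suc m)) * prob (stateP Ph C (a + real k * ((t - a) / real (Suc m))))" (is ?P)
proof -
 define h where "h = (t - a) / real (Suc m)"
 have h0: "0 < h" using a by (simp add: h_def)
 have "0 <= real k * h" using h0 by simp
 hence s: "a <= a + real k * h" "0 <= a + real k * h" "a + real k * h <= a + real (Suc k) * h" "0 <= a + real (Suc k) * h"
  using a h0 by (auto simp: algebra_simps)
 have eq: "slot_event Ph i C a t m k = stateP Ph C (a + real k * h) Int {om:space M. ALL i':{i}. incr i' (a + real k * h) (a + real (Suc k) * h) om <-> i' : {i}}"
  unfolding slot_event_def Let_def h_def[symmetric] by simp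
 have 1: "stateP Ph C (a + real k * h) : events" by (rule stateP_events[OF C P(2) s(2)])
 have "Measurable.pred M (incr i (a + real k * h) (a + real (Suc k) * h))" by (rule measurable_incr[OF s(2,4)])
 hence "{om:space M. incr i (a + real k * h) (a + real (Suc k) * h) om} : events" by (simp add: pred_def)
 thus ?E unfolding slot_event_def Let_def h_def[symmetric] using 1 by blast
 have "prob (slot_event Ph i C a t m k) = prob (stateP Ph C (a + real k * h)) * pattern_prob {i} {i} (a + real (Suc k) * h - (a + real k * h))"
  unfolding eq by (rule indep_FF_future[OF stateP_FF[OF C P(1) s(1,2)] 1 s(2,3)]) simp
 moreover have "a + real (Suc k) * h - (a + real k * h) = h" by (simp add: algebra_simps)
 ultimately show ?P by (simp add: pattern_prob_def h_def)
qed

lemma slot_count_measurable: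
 assumes "local_on X C" "Ph : sets (FF a)" "Ph : events" "0 <= a" "a < t"
 shows "slot_count Ph i C a t m : borel_measurable M"
 unfolding slot_count_def[abs_def] using slot_event_events[OF assms] by (intro borel_measurable_sum) auto

lemma nn_slot_count:
 assumes "local_on X C" "Ph : sets (FF a)" "Ph : events" "0 <= a" "a < t"
 defines "h \<equiv> %m. (t - a) / real (Suc m)"
 shows "(\<integral>\<^sup>+om. slot_count Ph i C a t m om \<partial>M) = ennreal (SUM k<Suc m. incr_prob i (h m) * prob (stateP Ph C (a + real k * h m)))"
proof -
 have h0: "0 <= h m" using assms(5) by (simp add: h_def)
 have "(\<integral>\<^sup>+om. slot_count Ph i C a t m om \<partial>M) = (SUM k<Suc m. emeasure M (slot_event Ph i C a t m k))"
  unfolding slot_count_def using slot_event_events[OF assms(1-5)] by (subst nn_integral_sum) auto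
 also have "... = (SUM k<Suc m. ennreal (incr_prob i (h m) * prob (stateP Ph C (a + real k * h m))))"
  unfolding emeasure_eq_measure prob_slot_event[OF assms(1-5)] h_def ..
 also have "... = ennreal (SUM k<Suc m. incr_prob i (h m) * prob (stateP Ph C (a + real k * h m)))"
  by (rule sum_ennreal) (use incr_prob_nonneg[OF h0] in simp)
 finally show ?thesis .
qed

text \<open>The probability that the clock rings in a slot, divided by the mesh, tends to the
  derivative of \<open>1 - exp (- rt i * x)\<close> at \<open>0\<close>, that is, to the rate; what
  remains is a Riemann sum.\<close>

lemma expected_slot_count_limit:
 assumes C: "local_on X C" and P: "Ph : events" and a: "0 <= a" "a < t"
 defines "h \<equiv> %m. (t - a) / real (Suc m)"
 shows "(%m. SUM k<Suc m. incr_prob i (h m) * prob (stateP Ph C (a + real k * h m)))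
   ----> rt i * integral {a..t} (%s. prob (stateP Ph C s))"
proof -
 have hp: "0 < h m" for m using a by (simp add: h_def)
 have cont: "continuous_on {a..t} (%s. prob (stateP Ph C s))"
  by (rule continuous_on_subset[OF stateP_continuous[OF C P]]) (use a in auto)
 have R: "(%m. SUM k<Suc m. h m * prob (stateP Ph C (a + real k * h m))) ----> integral {a..t} (%s. prob (stateP Ph C s))"
  unfolding h_def by (rule riemann_left[OF a(2) cont])
 have "(%m. (t - a) / real (Suc m)) ----> 0" using lim_const_over_n LIMSEQ_Suc by blast
 hence h0: "h ----> 0" by (simp add: h_def)
 have "((%x. 1 - exp (- (rt i * x))) has_real_derivative rt i) (at 0)"
  by (auto intro!: derivative_eq_intros)
 hence "((%x. (1 - exp (- (rt i * x)) - (1 - exp (- (rt i * 0)))) / (x - 0)) \<longlongrightarrow> rt i) (at 0)"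
  unfolding has_field_derivative_iff .
 hence d: "((%x. incr_prob i x / x) \<longlongrightarrow> rt i) (at 0)" by (simp add: incr_prob_def)
 have "filterlim h (at 0) sequentially"
  using h0 hp by (intro filterlim_atI) (auto simp: less_imp_neq[symmetric] intro!: always_eventually)
 hence q: "(%m. incr_prob i (h m) / h m) ----> rt i" by (rule filterlim_compose[OF d])
 have "(%m. incr_prob i (h m) / h m * (SUM k<Suc m. h m * prob (stateP Ph C (a + real k * h m))))
   ----> rt i * integral {a..t} (%s. prob (stateP Ph C s))" by (rule tendsto_mult[OF q R])
 moreover have "incr_prob i (h m) / h m * (SUM k<Suc m. h m * prob (stateP Ph C (a + real k * h m))) =
   (SUM k<Suc m. incr_prob i (h m) * prob (stateP Ph C (a + real k * h m)))" for m
  unfolding sum_distrib_left by (intro sum.cong refl) (use hp[of m] in simp)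
 ultimately show ?thesis by simp
qed

text \<open>The number of rings need not be measurable by itself, hence the version
  \<open>K\<close>. Slot counts converge to it almost surely, and their expectations factor by
  independence of past and future increments.\<close>

theorem campbell:
 assumes C: "local_on X C" and P: "Ph : sets (FF a)" "Ph : events" and a: "0 <= a" "a <= t"
 obtains K :: "'a => ennreal" where "K : borel_measurable M"
  "AE om in M. K om = (if om : Ph then of_nat (card (rings i C a t om)) else 0)"
  "(\<integral>\<^sup>+om. K om \<partial>M) = ennreal (rt i * integral {a..t} (%s. prob (stateP Ph C s)))"
proof (cases "a = t")
 case True
 have "rings i C a t om = {}" for om using True by (auto simp: rings_def)
 thus ?thesis using that[of "%_. 0"] True by simp
next
 case False
 hence at: "a < t" using a by simp
 have T: "local_on {} (%(_::int) (_::config). True)" by (simp add: local_on_def)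
 have top: "space M : sets (FF a)" "space M : events" using sets.top[of "FF a"] by auto
 \<comment> \<open>A measurable version of the number of all rings of the clock. It dominates every
   slot count, and Fatou makes it integrable.\<close>
 define A where "A om = liminf (%m. slot_count (space M) i (%_ _. True) a t m om)" for om
 have AM: "A : borel_measurable M"
  unfolding A_def[abs_def] by (intro borel_measurable_liminf slot_count_measurable[OF T top a(1) at])
 have Aeq: "AE om in M. A om = of_nat (card (rings i (%_ _. True) a t om))"
  using AE_good
 proof eventually_elim
  fix om assume g: "good om"
  hence w: "om : space M" by (simp add: good_def)
  have "(%m. slot_count (space M) i (%_ _. True) a t m om) ----> of_nat (card (rings i (%_ _. True) a t om))"
   using card_slots_eventually[OF g T a(1) at, of i] by (intro tendsto_eventually) (auto simp: slot_count_card[OF w] w elim: eventually_mono)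
  thus "A om = of_nat (card (rings i (%_ _. True) a t om))" unfolding A_def by (intro lim_imp_Liminf) auto
 qed
 have intA: "(\<integral>\<^sup>+om. A om \<partial>M) < \<infinity>"
 proof -
  have "(\<integral>\<^sup>+om. A om \<partial>M) <= liminf (%m. \<integral>\<^sup>+om. slot_count (space M) i (%_ _. True) a t m om \<partial>M)"
   unfolding A_def by (intro nn_integral_liminf slot_count_measurable[OF T top a(1) at])
  also have "... = ennreal (rt i * integral {a..t} (%s. prob (stateP (space M) (%_ _. True) s)))"
   unfolding nn_slot_count[OF T top a(1) at]
   by (intro lim_imp_Liminf tendsto_ennrealI expected_slot_count_limit[OF T top(2) a(1) at]) simp
  also have "... < \<infinity>" by simp
  finally show ?thesis .
 qed
 define K where "K om = liminf (%m. slot_count Ph i C a t m om)" for om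
 have sm: "slot_count Ph i C a t m : borel_measurable M" for m by (rule slot_count_measurable[OF C P a(1) at])
 have KM: "K : borel_measurable M" unfolding K_def[abs_def] by (intro borel_measurable_liminf sm)
 have ev: "AE om in M. (%m. slot_count Ph i C a t m om) ----> (if om : Ph then of_nat (card (rings i C a t om)) else 0)"
  using AE_good
 proof eventually_elim
  fix om assume g: "good om"
  hence w: "om : space M" by (simp add: good_def)
  show "(%m. slot_count Ph i C a t m om) ----> (if om : Ph then of_nat (card (rings i C a t om)) else 0)"
   using card_slots_eventually[OF g C a(1) at, of i] by (intro tendsto_eventually) (auto simp: slot_count_card[OF w] elim: eventually_mono)
 qed
 have Keq: "AE om in M. K om = (if om : Ph then of_nat (card (rings i C a t om)) else 0)"
  using ev by eventually_elim (unfold K_def, intro lim_imp_Liminf, auto)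
 have limK: "AE om in M. (%m. slot_count Ph i C a t m om) ----> K om"
  using ev Keq by eventually_elim simp
 have "(%m. \<integral>\<^sup>+om. slot_count Ph i C a t m om \<partial>M) ----> (\<integral>\<^sup>+om. K om \<partial>M)"
 proof (rule nn_integral_dominated_convergence[OF sm KM AM _ intA limK])
  fix m show "AE om in M. slot_count Ph i C a t m om <= A om"
   using Aeq AE_space
  proof eventually_elim
   fix om assume A: "A om = of_nat (card (rings i (%_ _. True) a t om))" and w: "om : space M"
   show "slot_count Ph i C a t m om <= A om"
    unfolding A slot_count_card[OF w] using card_slots_le[OF w a(1) at, of i C m] by simp
  qed
 qed
 moreover have "(%m. \<integral>\<^sup>+om. slot_count Ph i C a t m om \<partial>M) ----> ennreal (rt i * integral {a..t} (%s. prob (stateP Ph C s)))"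
  unfolding nn_slot_count[OF C P a(1) at] by (intro tendsto_ennrealI expected_slot_count_limit[OF C P(2) a(1) at])
 ultimately have "(\<integral>\<^sup>+om. K om \<partial>M) = ennreal (rt i * integral {a..t} (%s. prob (stateP Ph C s)))"
  by (rule LIMSEQ_unique)
 thus ?thesis by (rule that[OF KM Keq])
qed

subsection \<open>Every ring has a partner\<close>

lemma prob_constant_stretch:
 assumes "0 <= t"
 shows "prob {om:space M. ALL z:{x<..x + int n}. sg om t z = ep} <= C0 * site_wt ep ^ n"
proof -
 have "law_bound C0 t" using regular_all[OF assms] by (simp add: regular_def)
 hence "prob {om:space M. ALL z:{x<..x + int n}. sg om t z = ep} <= C0 * (PROD z:{x<..x + int n}. site_wt ep)"
  unfolding law_bound_def by (elim allE[of _ "{x<..x + int n}"] allE[of _ "%_. ep"] impE) auto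
 thus ?thesis by simp
qed

text \<open>By \<open>campbell\<close> and the domination, the expected number of rings up to
  \<open>T\<close> whose next \<open>n\<close> sites all carry \<open>ep\<close> is at most
  \<open>rate * T * C0 * site_wt ep ^ n\<close>, which tends to zero; a ring without partner would
  be counted for every \<open>n\<close>.\<close>

lemma AE_partner: "AE om in M. ALL x ep u. arrival (N om (x, ep)) u --> (EX z>x. before om u z ~= ep)"
proof -
 have *: "AE om in M. ALL u<=real T. arrival (N om (x, ep)) u --> (EX z>x. before om u z ~= ep)" for x ep and T :: nat
 proof -
  define C where "C n = (%(y::int) s. ALL z:{x<..x + int n}. s z = ep)" for n
  have loc: "local_on {x<..x + int n} (C n)" for n by (simp add: local_on_def C_def)
  have top: "space M : sets (FF 0)" "space M : events" using sets.top[of "FF 0"] by auto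
  define KP where "KP n K = (K : borel_measurable M & (AE om in M. K om = (if om : space M then of_nat (card (rings (x, ep) (C n) 0 (real T) om)) else 0))
    & (\<integral>\<^sup>+om. K om \<partial>M) = ennreal (rt (x, ep) * integral {0..real T} (%s. prob (stateP (space M) (C n) s))))" for n and K :: "'a => ennreal"
  have ex: "EX K. KP n K" for n
   unfolding KP_def by (rule campbell[OF loc top order_refl, where t = "real T" and i = "(x, ep)"]) (simp, blast)
  from choice[OF allI[OF ex]] obtain K where KK: "ALL n. KP n (K n)" ..
  have K: "K n : borel_measurable M"
   "AE om in M. K n om = (if om : space M then of_nat (card (rings (x, ep) (C n) 0 (real T) om)) else 0)"
   "(\<integral>\<^sup>+om. K n om \<partial>M) = ennreal (rt (x, ep) * integral {0..real T} (%s. prob (stateP (space M) (C n) s)))" for n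
   using KK unfolding KP_def by blast+
  \<comment> \<open>A single ring without partner makes every \<open>K n\<close>, and therefore
    \<open>G\<close>, at least \<open>1\<close>.\<close>
  define G where "G om = (INF n. K n om)" for om
  have GM: "G : borel_measurable M" unfolding G_def[abs_def] using K(1) by simp
  have le: "(\<integral>\<^sup>+om. G om \<partial>M) <= ennreal (rt (x, ep) * (real T * C0) * site_wt ep ^ n)" for n
  proof -
   have "integral {0..real T} (%s. prob (stateP (space M) (C n) s)) <= integral {0..real T} (%_. C0 * site_wt ep ^ n)"
   proof (rule integral_le)
    show "(%s. prob (stateP (space M) (C n) s)) integrable_on {0..real T}"
     by (rule integrable_continuous_real) (rule continuous_on_subset[OF stateP_continuous[OF loc top(2)]], auto)
    show "prob (stateP (space M) (C n) s) <= C0 * site_wt ep ^ n" if "s : {0..real T}" for s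
     using prob_constant_stretch[of s x n ep] that by (simp add: stateP_def C_def)
   qed (rule integrable_continuous_real, simp)
   also have "... = real T * C0 * site_wt ep ^ n" by simp
   finally have "rt (x, ep) * integral {0..real T} (%s. prob (stateP (space M) (C n) s)) <= rt (x, ep) * (real T * C0 * site_wt ep ^ n)"
    by (intro mult_left_mono rt_nonneg)
   moreover have "(\<integral>\<^sup>+om. G om \<partial>M) <= (\<integral>\<^sup>+om. K n om \<partial>M)"
    unfolding G_def by (intro nn_integral_mono INF_lower) simp
   ultimately show ?thesis unfolding K(3) by (simp add: ennreal_leI order_trans mult.assoc)
  qed
  have "(\<integral>\<^sup>+om. G om \<partial>M) <= ennreal 0"
  proof (rule LIMSEQ_le_const)
   have "(%n. rt (x, ep) * (real T * C0) * site_wt ep ^ n) ----> rt (x, ep) * (real T * C0) * 0"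
    using site_wt_pos[of ep] site_wt_less1[of ep] by (intro tendsto_mult tendsto_const LIMSEQ_power_zero) simp
   thus "(%n. ennreal (rt (x, ep) * (real T * C0) * site_wt ep ^ n)) ----> ennreal 0" by (intro tendsto_ennrealI) simp
  qed (use le in blast)
  hence "(\<integral>\<^sup>+om. G om \<partial>M) = 0" by simp
  hence G0: "AE om in M. G om = 0" using GM nn_integral_0_iff_AE by blast
  have Kall: "AE om in M. ALL n. K n om = (if om : space M then of_nat (card (rings (x, ep) (C n) 0 (real T) om)) else 0)"
   unfolding AE_all_countable using K(2) by blast
  show ?thesis using G0 Kall AE_space
  proof eventually_elim
   fix om assume G: "G om = 0" and w: "om : space M"
    and Kn: "ALL n. K n om = (if om : space M then of_nat (card (rings (x, ep) (C n) 0 (real T) om)) else 0)"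
   show "ALL u<=real T. arrival (N om (x, ep)) u --> (EX z>x. before om u z ~= ep)"
   proof (intro allI impI, rule ccontr)
    fix u assume u: "u <= real T" "arrival (N om (x, ep)) u" and n: "~ (EX z>x. before om u z ~= ep)"
    have "1 <= K m om" for m
    proof -
     have "u : rings (x, ep) (C m) 0 (real T) om" using u n arrival_pos[OF u(2)] by (auto simp: rings_def C_def)
     hence "card (rings (x, ep) (C m) 0 (real T) om) ~= 0" using finite_rings[OF w] by auto
     thus ?thesis using Kn w by (simp add: Suc_leI)
    qed
    hence "1 <= G om" unfolding G_def by (intro INF_greatest)
    thus False using G by simp
   qed
  qed
 qed
 have "AE om in M. ALL (xe::int \<times> sign) (T::nat). ALL u<=real T. arrival (N om (fst xe, snd xe)) u --> (EX z>fst xe. before om u z ~= snd xe)"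
  unfolding AE_all_countable using * by blast
 thus ?thesis
 proof eventually_elim
  fix om assume a: "ALL (xe::int \<times> sign) (T::nat). ALL u<=real T. arrival (N om (fst xe, snd xe)) u --> (EX z>fst xe. before om u z ~= snd xe)"
  show "ALL x ep u. arrival (N om (x, ep)) u --> (EX z>x. before om u z ~= ep)"
  proof (intro allI impI)
   fix x ep u assume u: "arrival (N om (x, ep)) u"
   obtain T :: nat where "u <= real T" using real_arch_simple by blast
   thus "EX z>x. before om u z ~= ep" using a[rule_format, of u T "(x, ep)"] u by simp
  qed
 qed
qed

section \<open>The sign of the tag\<close>

lemma tag_sign_step:
 assumes "s y = e" shows "toom_ring x ep s (push x ep s y) = e"
proof (cases "s x = ep & (EX z>x. s z ~= ep)")
 case True
 hence "good_ring e x ep y s" using assms by (simp add: good_ring_def)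
 thus ?thesis
  by (cases rule: ring_cases) (use assms True in auto)
next
 case False
 hence "toom_ring x ep s = s" "push x ep s y = y" by (auto simp: toom_ring_def push_def)
 thus ?thesis using assms by simp
qed

lemma AE_initial_sign: "AE om in M. sg om 0 0 = \<eta>"
proof -
 have "prob {om:space M. ALL x:{0}. sg om 0 x = (%_. \<eta>) x} = 1" by (subst initial_law) auto
 hence p1: "prob {om:space M. sg om 0 0 = \<eta>} = 1" by simp
 have "Measurable.pred M (%om. sg om 0 0 = \<eta>)" using measurable_sg_site[of 0 0] by (intro pred_intros_logic) auto
 hence "{om:space M. sg om 0 0 = \<eta>} : events" by (simp add: pred_def)
 from AE_prob_1[OF p1] show ?thesis by eventually_elim auto
qed

lemma tag_sign:
 assumes g: "good om" and i: "sg om 0 0 = \<eta>" and t: "0 <= t"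
 shows "sg om t (Y om t) = \<eta> & (0 < t --> before om t (Yb om t) = \<eta>)"
 using t
proof (induction t rule: real_induction)
 case zero thus ?case using g i by (simp add: good_def)
next
 have step: "before om t (Yb om t) = \<eta>" if t: "0 < t" and P: "!!ep. 0 < ep ==> EX s. t - ep < s & s < t & sg om s (Y om s) = \<eta>" for t
 proof -
  obtain ep where e: "0 < ep" "!!s. t - ep < s ==> s < t ==> Y om s = Yb om t"
   "!!s x. t - ep < s ==> s < t ==> x : {Yb om t} ==> sg om s x = before om t x"
   using good_left[OF g t, of "{Yb om t}"] by (metis finite.emptyI finite.insertI)
  obtain s where "t - ep < s" "s < t" "sg om s (Y om s) = \<eta>" using P[OF e(1)] by blast
  thus ?thesis using e(2,3)[of s] by simp
 qed
 case (right t)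
 obtain ep where e: "0 < ep" "!!s. t <= s ==> s < t + ep ==> Y om s = Y om t"
  "!!s x. t <= s ==> s < t + ep ==> x : {Y om t} ==> sg om s x = sg om t x"
  using good_right[OF g right(1), of "{Y om t}"] by (metis finite.emptyI finite.insertI)
 have s: "sg om s (Y om s) = \<eta>" if "t <= s" "s < t + ep" for s
  using e(2)[OF that] e(3)[OF that, of "Y om t"] right(2)[of t] right(1) by simp
 have "before om u (Yb om u) = \<eta>" if u: "t < u" "u < t + ep" for u
 proof (rule step)
  show "0 < u" using u right(1) by simp
  show "EX s. u - ep' < s & s < u & sg om s (Y om s) = \<eta>" if "0 < ep'" for ep'
   by (rule exI[of _ "max t (u - ep' / 2)"]) (use that u s[of "max t (u - ep' / 2)"] in auto)
 qed
 thus ?case using s e(1) by (intro exI[of _ ep]) auto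
next
 case (left t)
 have b: "before om t (Yb om t) = \<eta>"
 proof -
  obtain ep where e: "0 < ep" "ep <= t" "!!s. t - ep < s ==> s < t ==> Y om s = Yb om t"
   "!!s x. t - ep < s ==> s < t ==> x : {Yb om t} ==> sg om s x = before om t x"
   using good_left[OF g left(1), of "{Yb om t}"] by (metis finite.emptyI finite.insertI)
  have "t - ep < t - ep / 2" "t - ep / 2 < t" "0 <= t - ep / 2" using e by auto
  thus ?thesis using e(3,4)[of "t - ep / 2"] left(2)[of "t - ep / 2"] by simp
 qed
 have "sg om t (Y om t) = \<eta>"
 proof (cases "EX i. arrival (N om i) t")
  case True
  then obtain x ep where "arrival (N om (x, ep)) t" by (metis surj_pair)
  thus ?thesis using good_arrival[OF g] tag_sign_step[of "before om t" "Yb om t" \<eta> x ep] b by simp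
 next
  case False
  hence na: "~ arrival (N om i) t" for i by blast
  show ?thesis unfolding good_no_arrival[OF g left(1) na] by (rule b)
 qed
 thus ?case using b by blast
qed

end

subsection \<open>The forward equation\<close>

abbreviation (input) count :: "real set => ennreal" where "count \<equiv> emeasure (count_space UNIV)"

text \<open>A locally constant truth value changes only where it differs from its left limit
  \<open>bl\<close>, so exits and entrances balance. The identity is additive in
  \<open>ennreal\<close>, hence no finiteness of the two sets has to be known beforehand.\<close>

lemma crossings:
 fixes b bl :: "real => bool"
 assumes s: "0 <= s" "s <= t"
  and r: "!!u. 0 <= u ==> EX ep>0. ALL v. u <= v & v < u + ep --> b v = b u"
  and l: "!!u. 0 < u ==> EX ep>0. ALL v. u - ep < v & v < u --> b v = bl u"
 shows "of_bool (b t) + count {u. s < u & u <= t & bl u & ~ b u} = of_bool (b s) + count {u. s < u & u <= t & ~ bl u & b u}"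
proof -
 define Lo where "Lo t = {u. s < u & u <= t & bl u & ~ b u}" for t
 define Ga where "Ga t = {u. s < u & u <= t & ~ bl u & b u}" for t
 define P where "P t = (of_bool (b t) + count (Lo t) = of_bool (b s) + count (Ga t))" for t
 have flat: "P t" if P: "P r" and rt: "s <= r" "r <= t" and c: "!!v. r < v ==> v <= t ==> bl v = b v" and e: "b t = b r" for r t
 proof -
  have "(u <= t) = (u <= r)" if "bl u ~= b u" for u using c[of u] that rt by force
  hence "Lo t = Lo r" "Ga t = Ga r" unfolding Lo_def Ga_def by blast+
  thus ?thesis using P e unfolding P_def by simp
 qed
 have same: "bl v = b v" if v: "0 <= u" "u < v" and e: "!!w. u <= w ==> w < z ==> b w = c" and z: "v < z" for u v z c
 proof -
  have "0 < v" using v by simp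
  then obtain ep where d: "0 < ep" "!!w. v - ep < w ==> w < v ==> b w = bl v" using l by blast
  define w where "w = max u (v - ep / 2)"
  have "b w = bl v" by (rule d(2)) (use d(1) v in "auto simp: w_def")
  moreover have "b w = c" by (rule e) (use d(1) v z in "auto simp: w_def")
  moreover have "b v = c" by (rule e) (use v z in auto)
  ultimately show ?thesis by simp
 qed
 have "P (s + t)" if "0 <= t" for t
  using that
 proof (induction t rule: real_induction)
  case zero
  have "Lo s = {}" "Ga s = {}" by (auto simp: Lo_def Ga_def)
  thus ?case by (simp add: P_def)
 next
  case (right t)
  have st: "0 <= s + t" using s right(1) by simp
  then obtain ep where e: "0 < ep" "!!v. s + t <= v ==> v < s + t + ep ==> b v = b (s + t)" using r by blast
  have "P (s + u)" if u: "t < u" "u < t + ep" for u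
  proof (rule flat[of "s + t"])
   show "P (s + t)" using right by simp
   show "bl v = b v" if "s + t < v" "v <= s + u" for v
    by (rule same[OF st that(1) e(2)]) (use that u in auto)
   show "b (s + u) = b (s + t)" by (rule e(2)) (use u in auto)
  qed (use u right(1) in auto)
  thus ?case using e(1) by blast
 next
  case (left t)
  define z where "z = s + t"
  have z: "0 < z" "s < z" using s left(1) by (simp_all add: z_def)
  obtain ep where e: "0 < ep" "!!v. z - ep < v ==> v < z ==> b v = bl z" using l[OF z(1)] by blast
  define q where "q = max s (z - ep / 2)"
  have q: "s <= q" "q < z" "z - ep < q" using e(1) z by (auto simp: q_def)
  have Pq: "P q" using left(2)[of "q - s"] q by (simp add: z_def)
  have bq: "b q = bl z" by (rule e(2)[OF q(3,2)])
  have c: "bl v = b v" if v: "q < v" "v < z" for v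
   by (rule same[where u = q and z = z]) (use v q s e(2) in auto)
  have sp: "(u <= z) = (u = z \<or> u <= q)" if "bl u ~= b u" for u
   using c[of u] that q(2) by force
  have zq: "z ~: Lo q" "z ~: Ga q" using q by (auto simp: Lo_def Ga_def)
  have one: "count (insert z A) = 1 + count A" if "z ~: A" for A
   using that by (cases "finite A") (simp_all add: card_insert_disjoint)
  have L: "Lo z = (if bl z & ~ b z then insert z (Lo q) else Lo q)"
   unfolding Lo_def using sp z(2) by auto
  have G: "Ga z = (if ~ bl z & b z then insert z (Ga q) else Ga q)"
   unfolding Ga_def using sp z(2) by auto
  have "P z"
   using Pq bq unfolding P_def L G by (cases "bl z"; cases "b z") (simp_all add: one zq add_ac)
  thus ?case by (simp add: z_def)
 qed
 from this[of "t - s"] s show ?thesis unfolding P_def Lo_def Ga_def by simp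
qed

lemma prod_list_map_nth: "prod_list (map f w) = (PROD i<length w. f (w ! i))"
 for f :: "'b => 'c::comm_monoid_mult"
 by (induction w) (auto simp: prod.lessThan_Suc_shift simp del: prod.lessThan_Suc)

context toom
begin

sublocale ww: word_weights \<eta> "site_wt \<eta>" "rate lp lm"
 by unfold_locales (use site_wt_pos site_wt_less1 lp lm in "auto simp: rate_def")

lemma ww_wt: "ww.wt b = site_wt b"
 unfolding ww.wt_def unfolding site_wt_def by (cases b; cases \<eta>; simp)

definition word_sites :: "int => bool list => int set" where "word_sites y w = (%i. y - 1 - int i) ` {..<length w}"

lemma local_at_word: "local_on (word_sites y w) (at_word y w)"
 unfolding local_on_def
proof (intro conjI allI impI)
 show "finite (word_sites y w)" by (simp add: word_sites_def)
 fix y' s s' assume "ALL x:word_sites y w. s x = (s' x :: bool)"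
 hence "s (y - 1 - int i) = s' (y - 1 - int i)" if "i < length w" for i using that by (simp add: word_sites_def)
 thus "at_word y w y' s = at_word y w y' s'" unfolding at_word_def by simp
qed

definition mass :: "'a set => real => int => bool list => real" where
 "mass Ph t y w = prob (stateP Ph (at_word y w) t)"

lemma mass_le:
 assumes P: "Ph : events" and t: "0 <= t" shows "mass Ph t y w <= C0 * ww.word_wt w"
proof -
 let ?w = "%x. w ! nat (y - 1 - x)"
 have fin: "finite (word_sites y w)" by (simp add: word_sites_def)
 have "stateP Ph (at_word y w) t <= {om:space M. ALL x:word_sites y w. sg om t x = ?w x}"
  by (auto simp: stateP_def at_word_def word_sites_def)
 moreover have "{om:space M. ALL x:word_sites y w. sg om t x = ?w x} : events"
 proof -
  have "Measurable.pred M (%om. ALL x:word_sites y w. sg om t x = ?w x)"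
   using measurable_sg_site[OF t] fin by (intro pred_intros_finite pred_intros_logic) auto
  thus ?thesis by (simp add: pred_def)
 qed
 ultimately have "mass Ph t y w <= prob {om:space M. ALL x:word_sites y w. sg om t x = ?w x}"
  unfolding mass_def by (rule finite_measure_mono)
 also have "... <= C0 * (PROD x:word_sites y w. site_wt (?w x))"
 proof -
  have "law_bound C0 t" using regular_all[OF t] by (simp only: regular_def)
  from this[unfolded law_bound_def, rule_format, OF fin, of ?w] show ?thesis .
 qed
 also have "(PROD x:word_sites y w. site_wt (?w x)) = (PROD i<length w. site_wt (w ! i))"
  unfolding word_sites_def by (subst prod.reindex) (auto simp: inj_on_def)
 also have "... = ww.word_wt w" by (simp add: ww.word_wt_def prod_list_map_nth ww_wt)
 finally show ?thesis .
qed

lemma mass_nonneg: "0 <= mass Ph t y w" by (simp add: mass_def)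

lemma mass_cont: "Ph : events ==> continuous_on {0..} (%t. mass Ph t y w)"
 unfolding mass_def by (rule stateP_continuous[OF local_at_word])

definition mrings :: "move option => real => real => 'a => real set" where
 "mrings m s t om = (case m of None => {} | Some (i, y', w') => rings i (at_word y' w') s t om)"

lemma mrings_iff: "(u : mrings m s t om) = (s < u & u <= t & (EX i. arrival (N om i) u & matches m i (Yb om u) (before om u)))"
 by (auto simp: mrings_def matches_def rings_def split: option.splits)

text \<open>Each time satisfying \<open>R\<close> belongs to exactly one listed move: the
  enumeration is complete and free of repetition, and no two clocks ring together. Counting measure
  is then additive over the moves.\<close>

lemma count_moves:
 fixes f :: "'k => nat => move option"
 assumes g: "good om" and fin: "finite A"
  and uniq: "!!ka d ka' d' x ep u. ka : A ==> ka' : A ==> arrival (N om (x, ep)) u ==> matches (f ka d) (x, ep) (Yb om u) (before om u)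
   ==> matches (f ka' d') (x, ep) (Yb om u) (before om u) ==> ka = ka' & d = d'"
 and R: "!!x ep u. arrival (N om (x, ep)) u ==> R u = (EX ka:A. EX d. matches (f ka d) (x, ep) (Yb om u) (before om u))"
  and no: "!!u. 0 < u ==> (!!i. ~ arrival (N om i) u) ==> ~ R u" and s: "0 <= s"
 shows "count {u. s < u & u <= t & R u} = (SUM ka:A. \<Sum>d. count (mrings (f ka d) s t om))"
proof -
 have dj: "ka = ka' & d = d'" if q: "ka : A" "ka' : A" "u : mrings (f ka d) s t om" "u : mrings (f ka' d') s t om" for ka ka' d d' u
 proof -
  obtain i where i: "arrival (N om i) u" "matches (f ka d) i (Yb om u) (before om u)" using q(3) unfolding mrings_iff by blast
  obtain k where k: "arrival (N om k) u" "matches (f ka' d') k (Yb om u) (before om u)" using q(4) unfolding mrings_iff by blast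
  obtain x ep where x: "i = (x, ep)" by (cases i)
  have ki: "k = (x, ep)" using good_unique[OF g k(1) i(1)] x by simp
  show ?thesis using uniq[OF q(1,2)] i k unfolding x ki by blast
 qed
 have "(\<Sum>d. count (mrings (f ka d) s t om)) = count (UN d. mrings (f ka d) s t om)" if "ka : A" for ka
  by (rule suminf_emeasure) (use dj[OF that that] in "auto simp: disjoint_family_on_def")
 hence "(SUM ka:A. \<Sum>d. count (mrings (f ka d) s t om)) = (SUM ka:A. count (UN d. mrings (f ka d) s t om))" by simp
 also have "... = count (UN ka:A. UN d. mrings (f ka d) s t om)"
 proof (rule sum_emeasure)
  show "disjoint_family_on (%ka. UN d. mrings (f ka d) s t om) A" unfolding disjoint_family_on_def using dj by blast
 qed (use fin in auto)
 also have "(UN ka:A. UN d. mrings (f ka d) s t om) = {u. s < u & u <= t & R u}"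
 proof (intro set_eqI)
  fix u
  have "R u = (EX ka:A. EX d. EX i. arrival (N om i) u & matches (f ka d) i (Yb om u) (before om u))" if "0 < u"
  proof (cases "EX i. arrival (N om i) u")
   case True
   then obtain x ep where a: "arrival (N om (x, ep)) u" by (metis surj_pair)
   have "arrival (N om i) u = (i = (x, ep))" for i using good_unique[OF g _ a] a by blast
   thus ?thesis using R[OF a] by auto
  qed (use no[OF that] in blast)
  thus "u : (UN ka:A. UN d. mrings (f ka d) s t om) <-> u : {u. s < u & u <= t & R u}"
   unfolding UN_iff mrings_iff mem_Collect_eq using s by fastforce
 qed
 finally show ?thesis ..
qed

definition gained :: "int => bool list => real => real => 'a => ennreal" where
 "gained y w s t om = (SUM ka:gain_kinds w. \<Sum>d. count (mrings (gain \<eta> y w ka d) s t om))"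

definition lost :: "int => bool list => real => real => 'a => ennreal" where
 "lost y w s t om = (SUM ka:loss_kinds. \<Sum>d. count (mrings (loss \<eta> y w ka d) s t om))"

text \<open>\<open>gain_iff\<close> and \<open>loss_iff\<close> at each ring, inserted into
  \<open>crossings\<close>. They apply because the tag keeps its sign and every ring finds a
  partner.\<close>

lemma balance_path:
 assumes g: "good om" and sg: "sg om 0 0 = \<eta>" and pa: "!!x ep u. arrival (N om (x, ep)) u ==> EX z>x. before om u z ~= ep"
  and st: "0 <= s" "s <= t"
 shows "of_bool (at_word y w (Y om t) (sg om t)) + lost y w s t om = of_bool (at_word y w (Y om s) (sg om s)) + gained y w s t om"
proof -
 define b where "b u = (at_word y w (Y om u) (sg om u))" for u
 define bl where "bl u = (at_word y w (Yb om u) (before om u))" for u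
 have finX: "finite (word_sites y w)" by (simp add: word_sites_def)
 have tb: "before om u (Yb om u) = \<eta>" if "0 < u" for u using tag_sign[OF g sg, of u] that by simp
 have gr: "good_ring \<eta> x ep (Yb om u) (before om u)" if "arrival (N om (x, ep)) u" for x ep u
  using tb[OF arrival_pos[OF that]] pa[OF that] by (simp add: good_ring_def)
 have "of_bool (b t) + count {u. s < u & u <= t & bl u & ~ b u} = of_bool (b s) + count {u. s < u & u <= t & ~ bl u & b u}"
 proof (rule crossings[OF st])
  fix u :: real
  { assume u: "0 <= u"
   obtain ep where e: "0 < ep" "!!v. u <= v ==> v < u + ep ==> Y om v = Y om u"
    "!!v x. u <= v ==> v < u + ep ==> x : word_sites y w ==> sg om v x = sg om u x"
    by (rule good_right[OF g u finX]) blast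
   have "b v = b u" if v: "u <= v" "v < u + ep" for v
    unfolding b_def e(2)[OF v] by (rule local_onD[OF local_at_word]) (rule e(3)[OF v])
   thus "EX ep>0. ALL v. u <= v & v < u + ep --> b v = b u" using e(1) by blast }
  { assume u: "0 < u"
   obtain ep where e: "0 < ep" "!!v. u - ep < v ==> v < u ==> Y om v = Yb om u"
    "!!v x. u - ep < v ==> v < u ==> x : word_sites y w ==> sg om v x = before om u x"
    by (rule good_left[OF g u finX]) blast
   have "b v = bl u" if v: "u - ep < v" "v < u" for v
    unfolding b_def bl_def e(2)[OF v] by (rule local_onD[OF local_at_word]) (rule e(3)[OF v])
   thus "EX ep>0. ALL v. u - ep < v & v < u --> b v = bl u" using e(1) by blast }
 qed
 moreover have "count {u. s < u & u <= t & bl u & ~ b u} = lost y w s t om" unfolding lost_def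
 proof (rule count_moves[OF g ww.finite_loss_kinds _ _ _ st(1)])
  show "ka = ka' & d = d'" if "ka : loss_kinds" "ka' : loss_kinds" "matches (loss \<eta> y w ka d) (x, ep) (Yb om u) (before om u)"
   "matches (loss \<eta> y w ka' d') (x, ep) (Yb om u) (before om u)" for ka d ka' d' x ep u
   using that loss_unique by (auto simp: loss_kinds_def)
  show "(bl u & ~ b u) = (EX ka:loss_kinds. EX d. matches (loss \<eta> y w ka d) (x, ep) (Yb om u) (before om u))"
   if a: "arrival (N om (x, ep)) u" for x ep u
   unfolding b_def bl_def good_arrival[OF g a] using loss_iff[OF gr[OF a], of y w] by auto
  show "~ (bl u & ~ b u)" if "0 < u" "!!i. ~ arrival (N om i) u" for u
   unfolding b_def bl_def good_no_arrival[OF g that] by blast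
 qed
 moreover have "count {u. s < u & u <= t & ~ bl u & b u} = gained y w s t om" unfolding gained_def
 proof (rule count_moves[OF g ww.finite_gain_kinds _ _ _ st(1)])
  show "ka = ka' & d = d'" if a: "arrival (N om (x, ep)) u" and m: "matches (gain \<eta> y w ka d) (x, ep) (Yb om u) (before om u)"
   "matches (gain \<eta> y w ka' d') (x, ep) (Yb om u) (before om u)" for ka d ka' d' x ep u
   by (rule gain_unique[OF m tb[OF arrival_pos[OF a]]])
  show "(~ bl u & b u) = (EX ka:gain_kinds w. EX d. matches (gain \<eta> y w ka d) (x, ep) (Yb om u) (before om u))"
   if a: "arrival (N om (x, ep)) u" for x ep u
   unfolding b_def bl_def good_arrival[OF g a] using gain_iff[OF gr[OF a], of w y] by auto
  show "~ (~ bl u & b u)" if "0 < u" "!!i. ~ arrival (N om i) u" for u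
   unfolding b_def bl_def good_no_arrival[OF g that] by blast
 qed
 ultimately show ?thesis unfolding b_def by simp
qed

definition occ_time :: "'a set => real => real => int => bool list => real" where
 "occ_time Ph s t y w = integral {s..t} (%u. mass Ph u y w)"

lemma mass_integrable: "Ph : events ==> 0 <= s ==> (%u. mass Ph u y w) integrable_on {s..t}"
 by (rule integrable_continuous_real[OF continuous_on_subset[OF mass_cont]]) auto

lemma occ_time_nonneg: "Ph : events ==> 0 <= s ==> 0 <= occ_time Ph s t y w"
 unfolding occ_time_def by (rule Henstock_Kurzweil_Integration.integral_nonneg[OF mass_integrable]) (simp_all add: mass_nonneg)

lemma move_term_nonneg: "Ph : events ==> 0 <= s ==> 0 <= ww.move_term (occ_time Ph s t) m"
 unfolding ww.move_term_def using occ_time_nonneg rt_nonneg by (auto split: option.split)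

lemma move_expectation:
 assumes P: "Ph : sets (FF s)" "Ph : events" and st: "0 <= s" "s <= t"
 shows "EX K. K : borel_measurable M & (AE om in M. K om = indicator Ph om * count (mrings m s t om)) &
   (\<integral>\<^sup>+om. K om \<partial>M) = ennreal (ww.move_term (occ_time Ph s t) m)"
proof (cases m)
 case None
 thus ?thesis by (intro exI[of _ "%_. 0"]) (simp add: mrings_def)
next
 case (Some q)
 obtain i y' w' where q: "q = (i, y', w')" by (cases q) auto
 obtain K :: "'a => ennreal" where K: "K : borel_measurable M"
  "AE om in M. K om = (if om : Ph then of_nat (card (rings i (at_word y' w') s t om)) else 0)"
  "(\<integral>\<^sup>+om. K om \<partial>M) = ennreal (rt i * integral {s..t} (%s. prob (stateP Ph (at_word y' w') s)))"
  by (rule campbell[OF local_at_word P st, of i y' w'])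
 have "AE om in M. K om = indicator Ph om * count (mrings m s t om)"
  using K(2) AE_space
 proof eventually_elim
  fix om assume k: "K om = (if om : Ph then of_nat (card (rings i (at_word y' w') s t om)) else 0)" and w: "om : space M"
  show "K om = indicator Ph om * count (mrings m s t om)"
   unfolding k using finite_rings[OF w] by (simp add: Some q mrings_def emeasure_count_space_finite)
 qed
 thus ?thesis using K(1,3) by (intro exI[of _ K]) (simp add: Some q mass_def occ_time_def)
qed

lemma expected_moves:
 fixes f :: "'k => nat => move option"
 assumes P: "Ph : sets (FF s)" "Ph : events" and st: "0 <= s" "s <= t" and A: "finite A"
  and sm: "!!ka. ka : A ==> summable (%d. ww.move_term (occ_time Ph s t) (f ka d))"
 shows "EX K. K : borel_measurable M & (AE om in M. K om = indicator Ph om * (SUM ka:A. \<Sum>d. count (mrings (f ka d) s t om))) &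
   (\<integral>\<^sup>+om. K om \<partial>M) = ennreal (SUM ka:A. \<Sum>d. ww.move_term (occ_time Ph s t) (f ka d))"
proof -
 define Q where "Q m K = (K : borel_measurable M & (AE om in M. K om = indicator Ph om * count (mrings m s t om)) &
   (\<integral>\<^sup>+om. K om \<partial>M) = ennreal (ww.move_term (occ_time Ph s t) m))" for m and K :: "'a => ennreal"
 have "EX K. Q m K" for m unfolding Q_def by (rule move_expectation[OF P st])
 from choice[OF allI[OF this]] obtain G where G: "ALL m. Q m (G m)" ..
 have G: "G m : borel_measurable M" "AE om in M. G m om = indicator Ph om * count (mrings m s t om)"
   "(\<integral>\<^sup>+om. G m om \<partial>M) = ennreal (ww.move_term (occ_time Ph s t) m)" for m
  using G unfolding Q_def by blast+
 note mt0 = move_term_nonneg[OF P(2) st(1), of t]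
 define K where "K om = (SUM ka:A. \<Sum>d. G (f ka d) om)" for om
 have "AE om in M. ALL d. G (f ka d) om = indicator Ph om * count (mrings (f ka d) s t om)" for ka
  unfolding AE_all_countable using G(2) by blast
 hence "AE om in M. ALL ka:A. ALL d. G (f ka d) om = indicator Ph om * count (mrings (f ka d) s t om)"
  using A by (intro AE_finite_allI) auto
 hence 1: "AE om in M. K om = indicator Ph om * (SUM ka:A. \<Sum>d. count (mrings (f ka d) s t om))"
  by eventually_elim (simp add: K_def sum_distrib_left)
 have "(\<integral>\<^sup>+om. K om \<partial>M) = (SUM ka:A. \<Sum>d. \<integral>\<^sup>+om. G (f ka d) om \<partial>M)"
  unfolding K_def using G(1) by (simp add: nn_integral_sum nn_integral_suminf)
 also have "... = (SUM ka:A. ennreal (\<Sum>d. ww.move_term (occ_time Ph s t) (f ka d)))"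
  unfolding G(3) using sm mt0 by (intro sum.cong refl suminf_ennreal2) auto
 also have "... = ennreal (SUM ka:A. \<Sum>d. ww.move_term (occ_time Ph s t) (f ka d))"
  using sm mt0 by (intro sum_ennreal suminf_nonneg) auto
 finally show ?thesis
  using 1 G(1) by (intro exI[of _ K]) (simp add: K_def[abs_def])
qed

text \<open>The expectation of the pathwise balance, restricted to a past event \<open>Ph\<close>;
  \<open>campbell\<close> turns each expected number of rings into rate times occupation time.
  Subtraction is postponed until the expectations are known to be finite.\<close>

theorem forward_equation:
 assumes P: "Ph : sets (FF s)" "Ph : events" and st: "0 <= s" "s <= t"
 shows "mass Ph t y w - mass Ph s y w =
   ww.gain_sum (occ_time Ph s t) y w - ww.loss_sum (occ_time Ph s t) y w"
proof -
 define F where "F = occ_time Ph s t"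
 have F0: "0 <= F y w" for y w unfolding F_def by (rule occ_time_nonneg[OF P(2) st(1)])
 have Fle: "F y w <= (t - s) * C0 * ww.word_wt w" for y w
 proof -
  have "F y w <= integral {s..t} (%_. C0 * ww.word_wt w)"
   unfolding F_def occ_time_def by (rule integral_le[OF mass_integrable[OF P(2) st(1)]]) (use mass_le[OF P(2)] st in "auto intro!: integrable_continuous_real")
  thus ?thesis using st by (simp add: ac_simps)
 qed
 \<comment> \<open>Domination by the product law is the bound with \<open>th = 1\<close>; it makes
   the sums over the ringing distance finite.\<close>
 have Fb: "\<bar>F y w\<bar> <= ((t - s) * C0) * ww.word_wt w * 1 ^ length w" for y w using F0[of y w] Fle[of y w] by simp
 have B: "0 <= (t - s) * C0" using st C0 by simp
 have th: "1 * ww.wt b <= ww.max_wt" for b using ww.max_wt(3) by simp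
 have gs: "summable (%d. ww.move_term F (gain \<eta> y w ka d))" if "ka : gain_kinds w" for ka
  by (rule summable_rabs_cancel[OF ww.gain_summable[OF Fb B order_refl th ww.max_wt(2) that]])
 have ls: "summable (%d. ww.move_term F (loss \<eta> y w ka d))" if "ka : loss_kinds" for ka
  by (rule summable_rabs_cancel[OF ww.loss_summable[OF Fb B order_refl th ww.max_wt(2) that]])
 have "EX KG. KG : borel_measurable M & (AE om in M. KG om = indicator Ph om * gained y w s t om) &
   (\<integral>\<^sup>+om. KG om \<partial>M) = ennreal (ww.gain_sum F y w)"
  unfolding ww.gain_sum_def F_def gained_def by (rule expected_moves[OF P st ww.finite_gain_kinds]) (use gs in "simp only: F_def")
 then obtain KG where KG: "KG : borel_measurable M" "AE om in M. KG om = indicator Ph om * gained y w s t om"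
  "(\<integral>\<^sup>+om. KG om \<partial>M) = ennreal (ww.gain_sum F y w)" by blast
 have "EX KL. KL : borel_measurable M & (AE om in M. KL om = indicator Ph om * lost y w s t om) &
   (\<integral>\<^sup>+om. KL om \<partial>M) = ennreal (ww.loss_sum F y w)"
  unfolding ww.loss_sum_def F_def lost_def by (rule expected_moves[OF P st ww.finite_loss_kinds]) (use ls in "simp only: F_def")
 then obtain KL where KL: "KL : borel_measurable M" "AE om in M. KL om = indicator Ph om * lost y w s t om"
  "(\<integral>\<^sup>+om. KL om \<partial>M) = ennreal (ww.loss_sum F y w)" by blast
 have ev: "stateP Ph (at_word y w) u : events" if "0 <= u" for u by (rule stateP_events[OF local_at_word P(2) that])
 have t: "0 <= t" using st by simp
 have "(\<integral>\<^sup>+om. indicator (stateP Ph (at_word y w) t) om + KL om \<partial>M) = (\<integral>\<^sup>+om. indicator (stateP Ph (at_word y w) s) om + KG om \<partial>M)"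
 proof (rule nn_integral_cong_AE)
  show "AE om in M. indicator (stateP Ph (at_word y w) t) om + KL om = indicator (stateP Ph (at_word y w) s) om + KG om"
   using AE_good AE_initial_sign AE_partner KG(2) KL(2)
  proof eventually_elim
   fix om assume A: "good om" "sg om 0 0 = \<eta>" "ALL x ep u. arrival (N om (x, ep)) u --> (EX z>x. before om u z ~= ep)"
    and k: "KG om = indicator Ph om * gained y w s t om" "KL om = indicator Ph om * lost y w s t om"
   have e: "of_bool (at_word y w (Y om t) (sg om t)) + lost y w s t om = of_bool (at_word y w (Y om s) (sg om s)) + gained y w s t om"
    by (rule balance_path[OF A(1,2) _ st]) (use A(3) in blast)
   have w: "om : space M" using A(1) by (simp add: good_def)
   have i: "indicator (stateP Ph (at_word y w) u) om = (indicator Ph om * of_bool (at_word y w (Y om u) (sg om u)) :: ennreal)" for u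
    using w by (simp add: stateP_def indicator_def)
   show "indicator (stateP Ph (at_word y w) t) om + KL om = indicator (stateP Ph (at_word y w) s) om + KG om"
    unfolding k i distrib_left[symmetric] e ..
  qed
 qed
 hence "ennreal (mass Ph t y w) + ennreal (ww.loss_sum F y w) = ennreal (mass Ph s y w) + ennreal (ww.gain_sum F y w)"
  using ev[OF t] ev[OF st(1)] KG(1) KL(1) by (simp add: nn_integral_add KG(3) KL(3) emeasure_eq_measure mass_def)
 moreover note mt0 = move_term_nonneg[OF P(2) st(1), of t, folded F_def]
 have "0 <= ww.gain_sum F y w" "0 <= ww.loss_sum F y w"
  unfolding ww.gain_sum_def ww.loss_sum_def using gs ls mt0 by (auto intro!: sum_nonneg suminf_nonneg)
 ultimately have "mass Ph t y w + ww.loss_sum F y w = mass Ph s y w + ww.gain_sum F y w"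
  using mass_nonneg by (simp add: ennreal_plus[symmetric] del: ennreal_plus)
 thus ?thesis unfolding F_def by simp
qed

end

subsection \<open>Independence of the past\<close>

context toom
begin

text \<open>On the past event \<open>Ph\<close> the left word is independent of the position and has
  the product law.\<close>

definition split_past :: "real => 'a set => bool" where
 "split_past s Ph = (Ph : sets (FF s) & Ph : events & (ALL y w. mass Ph s y w = ww.word_wt w * mass Ph s y []))"

lemma split_pastD:
 assumes "split_past s Ph" shows "Ph : sets (FF s)" "Ph : events" "mass Ph s y w = ww.word_wt w * mass Ph s y []"
 using assms unfolding split_past_def by blast+

text \<open>\<open>product_preserved\<close> applied to the masses on \<open>Ph\<close>, which solve
  the forward equation from time \<open>s\<close> on and are dominated with the constant
  \<open>C0\<close>.\<close>

lemma split_past_mono: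
 assumes k: "split_past s Ph" and st: "0 <= s" "s <= t" shows "split_past t Ph"
 unfolding split_past_def
proof (intro conjI allI)
 show "Ph : sets (FF t)" using split_pastD(1)[OF k] FF_mono[OF st(2)] by blast
 show "Ph : events" by (rule split_pastD(2)[OF k])
 fix y w
 show "mass Ph t y w = ww.word_wt w * mass Ph t y []"
 proof (rule ww.product_preserved[where a = s and C = C0])
  show "continuous_on {s..} (%t. mass Ph t y w)" for y w
   by (rule continuous_on_subset[OF mass_cont[OF split_pastD(2)[OF k]]]) (use st in auto)
  show "0 <= mass Ph t y w" for t y w by (rule mass_nonneg)
  show "mass Ph t y w <= C0 * ww.word_wt w" if "s <= t" for t y w
   by (rule mass_le[OF split_pastD(2)[OF k]]) (use that st in simp)
  show "mass Ph u y w - mass Ph r y w =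
    ww.gain_sum (%y w. integral {r..u} (%u. mass Ph u y w)) y w - ww.loss_sum (%y w. integral {r..u} (%u. mass Ph u y w)) y w"
   if "s <= r" "r <= u" for r u y w
  proof (fold occ_time_def, rule forward_equation[OF _ split_pastD(2)[OF k] _ that(2)])
   show "Ph : sets (FF r)" using split_pastD(1)[OF k] FF_mono[OF that(1)] by blast
  qed (use st that in simp)
  show "mass Ph s y w = ww.word_wt w * mass Ph s y []" for y w by (rule split_pastD(3)[OF k])
 qed (rule st(2))
qed

text \<open>At time \<open>0\<close> the word occupies negative sites, whose product law is not
  affected by conditioning on the sign at \<open>0\<close>.\<close>

lemma split_past_0: "split_past 0 (space M)"
 unfolding split_past_def
proof (intro conjI allI)
 show "space M : sets (FF 0)" using sets.top[of "FF 0"] by simp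
 fix y w
 have Y0: "AE om in M. Y om 0 = 0" using AE_good by eventually_elim (simp add: good_def)
 have m: "mass (space M) 0 y w = (if y = 0 then ww.word_wt w else 0)" for w
 proof (cases "y = 0")
  case True
  let ?w = "%x. w ! nat (- 1 - x)"
  have fin: "finite (word_sites 0 w)" and no: "0 ~: word_sites 0 w" by (auto simp: word_sites_def)
  have ev: "{om:space M. ALL x:word_sites 0 w. sg om 0 x = ?w x} : events"
  proof -
   have "Measurable.pred M (%om. ALL x:word_sites 0 w. sg om 0 x = ?w x)"
    using measurable_sg_site[of 0] fin by (intro pred_intros_finite pred_intros_logic) auto
   thus ?thesis by (simp add: pred_def)
  qed
  have "mass (space M) 0 y w = prob {om:space M. ALL x:word_sites 0 w. sg om 0 x = ?w x}"
   unfolding mass_def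
  proof (rule finite_measure_eq_AE)
   show "stateP (space M) (at_word y w) 0 : events" by (rule stateP_events[OF local_at_word]) simp_all
   show "AE om in M. (om : stateP (space M) (at_word y w) 0) = (om : {om:space M. ALL x:word_sites 0 w. sg om 0 x = ?w x})"
    using Y0 by eventually_elim (auto simp: stateP_def at_word_def word_sites_def True)
  qed (rule ev)
  also have "... = (PROD x:word_sites 0 w. site_wt (?w x))"
   by (subst initial_law[OF fin]) (use no in simp)
  also have "... = (PROD i<length w. site_wt (w ! i))"
   unfolding word_sites_def by (subst prod.reindex) (auto simp: inj_on_def)
  also have "... = ww.word_wt w" by (simp add: ww.word_wt_def prod_list_map_nth ww_wt)
  finally show ?thesis using True by simp
 next
  case False
  have "mass (space M) 0 y w = prob {}"
   unfolding mass_def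
  proof (rule finite_measure_eq_AE)
   show "stateP (space M) (at_word y w) 0 : events" by (rule stateP_events[OF local_at_word]) simp_all
   show "AE om in M. (om : stateP (space M) (at_word y w) 0) = (om : {})"
    using Y0 by eventually_elim (use False in "auto simp: stateP_def at_word_def")
  qed simp
  thus ?thesis using False by simp
 qed
 show "mass (space M) 0 y w = ww.word_wt w * mass (space M) 0 y []" unfolding m by simp
qed simp

lemma Y_event: "0 <= t ==> {om:space M. Y om t : A} : events"
 using measurable_sets[OF measurable_Y, of t A] by (simp add: vimage_def Int_def conj_commute)

lemma Y_event_FF:
 assumes "0 <= t" "t <= u" shows "{om:space M. Y om t : A} : sets (FF u)"
proof -
 have "Measurable.pred (FF t) (%om. EX y. y : A & Y om t = y)"
  by (intro pred_intros_countable pred_intros_conj1' pred_Y assms)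
 hence "{om:space M. Y om t : A} : sets (FF t)" by (simp add: pred_def)
 thus ?thesis using FF_mono[OF assms(2)] by blast
qed

text \<open>The product form is required for every position separately, so information about the
  present position may be added to the past.\<close>

lemma split_past_restrict:
 assumes k: "split_past s Ph" and s: "0 <= s"
 shows "split_past s (Ph Int {om:space M. Y om s : A})"
 unfolding split_past_def
proof (intro conjI allI)
 show "Ph Int {om:space M. Y om s : A} : sets (FF s)" "Ph Int {om:space M. Y om s : A} : events"
  using split_pastD(1,2)[OF k] Y_event[OF s] Y_event_FF[OF s order_refl] by blast+
 fix y w
 have "stateP (Ph Int {om:space M. Y om s : A}) (at_word y w) s = (if y : A then stateP Ph (at_word y w) s else {})" for w
  by (auto simp: stateP_def at_word_def)
 thus "mass (Ph Int {om:space M. Y om s : A}) s y w = ww.word_wt w * mass (Ph Int {om:space M. Y om s : A}) s y []"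
  unfolding mass_def using split_pastD(3)[OF k, of y w] by (simp add: mass_def)
qed

lemma split_past_UN:
 fixes A :: "nat => 'a set"
 assumes k: "!!n. split_past s (A n)" and d: "disjoint_family A" and s: "0 <= s"
 shows "split_past s (UN n. A n)"
 unfolding split_past_def
proof (intro conjI allI)
 show "(UN n. A n) : sets (FF s)" "(UN n. A n) : events" using split_pastD(1,2)[OF k] by auto
 fix y w
 have m: "(%n. mass (A n) s y w) sums mass (UN n. A n) s y w" for w
 proof -
  have "stateP (UN n. A n) (at_word y w) s = (UN n. stateP (A n) (at_word y w) s)" by (auto simp: stateP_def)
  moreover have "(%n. prob (stateP (A n) (at_word y w) s)) sums prob (UN n. stateP (A n) (at_word y w) s)"
  proof (rule finite_measure_UNION)
   show "range (%n. stateP (A n) (at_word y w) s) <= events"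
    using stateP_events[OF local_at_word split_pastD(2)[OF k] s] by blast
   show "disjoint_family (%n. stateP (A n) (at_word y w) s)"
    using d unfolding disjoint_family_on_def stateP_def by blast
  qed
  ultimately show ?thesis by (simp add: mass_def)
 qed
 have "(%n. mass (A n) s y w) sums (ww.word_wt w * mass (UN n. A n) s y [])"
 proof -
  have "mass (A n) s y w = ww.word_wt w * mass (A n) s y []" for n by (rule split_pastD(3)[OF k])
  thus ?thesis using sums_mult[OF m[of "[]"], of "ww.word_wt w"] by (simp only:)
 qed
 thus "mass (UN n. A n) s y w = ww.word_wt w * mass (UN n. A n) s y []" using m[of w] by (rule sums_unique2[rotated])
qed

text \<open>The event is cut along the values \<open>int_decode n\<close> of the position at
  \<open>s\<close>; on each piece the increment is a function of the position at \<open>t\<close>,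
  which \<open>split_past_restrict\<close> may add.\<close>

lemma split_past_increment:
 assumes k: "split_past s Ph" and st: "0 <= s" "s <= t"
 shows "split_past t (Ph Int {om:space M. Y om t - Y om s : B})"
proof -
 define A where "A n = (Ph Int {om:space M. Y om s : {int_decode n}}) Int {om:space M. Y om t : {z. z - int_decode n : B}}" for n
 have "split_past t (A n)" for n
  unfolding A_def using st by (intro split_past_restrict split_past_mono[OF split_past_restrict[OF k]]) auto
 hence "split_past t (UN n. A n)"
  using st by (intro split_past_UN) (auto simp: disjoint_family_on_def A_def dest: injD[OF inj_int_decode])
 moreover have "(UN n. A n) = Ph Int {om:space M. Y om t - Y om s : B}"
 proof (intro equalityI subsetI)
  fix om assume w: "om : Ph Int {om:space M. Y om t - Y om s : B}"
  have "Y om s = int_decode (int_encode (Y om s))" by simp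
  thus "om : (UN n. A n)" using w unfolding A_def by (intro UN_I[of "int_encode (Y om s)"]) auto
 qed (auto simp: A_def)
 ultimately show ?thesis by simp
qed

end

subsection \<open>Fourier transform of the forward equation\<close>

definition fsum :: "real => (int => real) => nat => complex" where
 "fsum th f R = (SUM y:{- int R..int R}. iexp (th * real_of_int y) * f y)"

lemma fsum_shift:
 "fsum th (%y. f (y - 1)) R = iexp th * (fsum th f R - iexp (th * real R) * f (int R) + iexp (th * (- real R - 1)) * f (- int R - 1))"
proof -
 let ?g = "%y. iexp (th * real_of_int y) * f y"
 have e: "iexp (th * real_of_int y) = iexp th * iexp (th * real_of_int (y - 1))" for y
  by (simp add: exp_add[symmetric] algebra_simps)
 have "fsum th (%y. f (y - 1)) R = (SUM y:{- int R..int R}. iexp th * ?g (y - 1))"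
  unfolding fsum_def by (intro sum.cong refl) (subst e, simp)
 also have "... = iexp th * (SUM y:{- int R - 1..int R - 1}. ?g y)"
  unfolding sum_distrib_left
  by (rule sum.reindex_bij_witness[of _ "%y. y + 1" "%y. y - 1"]) auto
 also have "(SUM y:{- int R - 1..int R - 1}. ?g y) = fsum th f R - ?g (int R) + ?g (- int R - 1)"
 proof -
  have "{- int R - 1..int R} = insert (int R) {- int R - 1..int R - 1}" by auto
  hence 1: "(SUM y:{- int R - 1..int R}. ?g y) = ?g (int R) + (SUM y:{- int R - 1..int R - 1}. ?g y)"
   by (simp del: of_int_of_nat_eq)
  have "{- int R - 1..int R} = insert (- int R - 1) {- int R..int R}" by auto
  hence "(SUM y:{- int R - 1..int R}. ?g y) = ?g (- int R - 1) + fsum th f R"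
   by (simp add: fsum_def del: of_int_of_nat_eq)
  with 1 show ?thesis by (simp add: algebra_simps)
 qed
 finally show ?thesis by simp
qed

lemma fsum_diff: "fsum th (%y. f y - g y) R = fsum th f R - fsum th g R"
 by (simp add: fsum_def algebra_simps sum_subtractf)

lemma fsum_add: "fsum th (%y. f y + g y) R = fsum th f R + fsum th g R"
 by (simp add: fsum_def algebra_simps sum.distrib)

lemma fsum_cmult: "fsum th (%y. c * f y) R = c * fsum th f R"
 by (simp add: fsum_def sum_distrib_left mult_ac)

lemma tails_vanish:
 fixes V :: "int => real"
 assumes V: "!!y. 0 <= V y" "!!R. (SUM y:{- int R..int R}. V y) <= T"
 shows "(%R. V (int R)) ----> 0" "(%R. V (- int R - 1)) ----> 0"
proof -
 have s: "summable (%R. V (g R))" if g: "inj g" and b: "!!n R. R < n ==> g R : {- int n..int n}" for g :: "nat => int"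
 proof (rule summableI_nonneg_bounded[where x = T])
  show "(SUM R<n. V (g R)) <= T" for n
  proof -
   have "(SUM R<n. V (g R)) = (SUM y:g ` {..<n}. V y)"
    by (subst sum.reindex) (use g in "auto intro: inj_on_subset")
   also have "... <= (SUM y:{- int n..int n}. V y)" using b V(1) by (intro sum_mono2) auto
   finally show ?thesis using V(2)[of n] by simp
  qed
 qed (rule V(1))
 show "(%R. V (int R)) ----> 0" by (rule summable_LIMSEQ_zero[OF s]) auto
 show "(%R. V (- int R - 1)) ----> 0" by (rule summable_LIMSEQ_zero[OF s]) (auto simp: inj_def)
qed

text \<open>The inflow into \<open>y\<close> by leftward jumps of the tag, a jump of size
  \<open>k\<close> having weight \<open>q ^ k\<close>.\<close>

definition jump_sum :: "(int => real) => real => int => real" where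
 "jump_sum V q y = (\<Sum>d. q ^ Suc d * V (y + 1 + int d))"

context
 fixes V :: "int => real" and T q th :: real and Vh :: complex
 assumes V: "!!y. 0 <= V y" "!!R. (SUM y:{- int R..int R}. V y) <= T" and q: "0 < q" "q < 1"
  and lim: "fsum th V ----> Vh"
begin

abbreviation (input) "jumpU \<equiv> jump_sum V q"

lemma V_le: "V y <= T"
proof -
 have "V y <= (SUM y:{- int (nat \<bar>y\<bar>)..int (nat \<bar>y\<bar>)}. V y)"
  by (rule member_le_sum) (use V(1) in auto)
 thus ?thesis using V(2)[of "nat \<bar>y\<bar>"] by simp
qed

lemma jumpU_summable: "summable (%d. q ^ Suc d * V (y + 1 + int d))"
proof (rule summable_comparison_test[where g = "%d. T * (q * q ^ d)"])
 show "summable (%d. T * (q * q ^ d))" using q by (intro summable_mult summable_geometric) simp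
 show "EX N. ALL d>=N. norm (q ^ Suc d * V (y + 1 + int d)) <= T * (q * q ^ d)"
  using q V(1) V_le by (auto simp: abs_mult mult.commute[of T] intro!: exI[of _ 0] mult_left_mono)
qed

lemma jumpU_nonneg: "0 <= jumpU y"
 unfolding jump_sum_def by (rule suminf_nonneg[OF jumpU_summable]) (use q V(1) in simp)

lemma jumpU_le: "jumpU y <= T * (q / (1 - q))"
proof -
 have g: "(%d. T * (q * q ^ d)) sums (T * (q * (1 / (1 - q))))"
  using q by (intro sums_mult geometric_sums) simp
 have "jumpU y <= (\<Sum>d. T * (q * q ^ d))"
  unfolding jump_sum_def
  by (rule suminf_le[OF _ jumpU_summable sums_summable[OF g]]) (use q V_le in "auto simp: mult.commute[of T] intro!: mult_left_mono")
 thus ?thesis using sums_unique[OF g] by simp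
qed

text \<open>This one-step recursion replaces an interchange of two infinite sums: summability and
  Fourier transform of the inflow follow from it by algebra.\<close>

lemma jumpU_rec: "jumpU (y - 1) = q * (V y + jumpU y)"
proof -
 have "jumpU (y - 1) = q ^ Suc 0 * V (y - 1 + 1 + int 0) + (\<Sum>d. q ^ Suc (Suc d) * V (y - 1 + 1 + int (Suc d)))"
  unfolding jump_sum_def using suminf_split_head[OF jumpU_summable[of "y - 1"]] by simp
 also have "(\<Sum>d. q ^ Suc (Suc d) * V (y - 1 + 1 + int (Suc d))) = (\<Sum>d. q * (q ^ Suc d * V (y + 1 + int d)))"
  by (intro suminf_cong) (simp add: algebra_simps)
 also have "... = q * jumpU y" unfolding jump_sum_def by (rule suminf_mult[OF jumpU_summable])
 finally show ?thesis by (simp add: algebra_simps)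
qed

text \<open>The recursion is summed over the window, that is, taken at frequency \<open>0\<close>,
  and solved for the sum; the two boundary terms are bounded.\<close>

lemma jumpU_sums: "(SUM y:{- int R..int R}. jumpU y) <= (q * T + T * (q / (1 - q))) / (1 - q)"
proof -
 have f: "fsum 0 f R = of_real (SUM y:{- int R..int R}. f y)" for f by (simp add: fsum_def)
 have "fsum 0 (%y. jumpU (y - 1)) R = fsum 0 (%y. q * (V y + jumpU y)) R" by (simp only: jumpU_rec)
 hence "fsum 0 jumpU R - jumpU (int R) + jumpU (- int R - 1) = q * (fsum 0 V R + fsum 0 jumpU R)"
  by (simp add: fsum_shift fsum_cmult fsum_add)
 hence "(SUM y:{- int R..int R}. jumpU y) - jumpU (int R) + jumpU (- int R - 1) =
   q * ((SUM y:{- int R..int R}. V y) + (SUM y:{- int R..int R}. jumpU y))"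
  unfolding f by (simp only: of_real_add[symmetric] of_real_diff[symmetric] of_real_mult[symmetric] of_real_eq_iff)
 hence "(SUM y:{- int R..int R}. jumpU y) * (1 - q) = q * (SUM y:{- int R..int R}. V y) + jumpU (int R) - jumpU (- int R - 1)"
  by (simp add: algebra_simps)
 also have "... <= q * T + T * (q / (1 - q))"
  using mult_left_mono[OF V(2)[of R], of q] q jumpU_le[of "int R"] jumpU_nonneg[of "- int R - 1"] by linarith
 finally show ?thesis using q by (simp add: pos_le_divide_eq)
qed

lemma boundary_vanishes:
 fixes f :: "int => real"
 assumes "(%R. f (int R)) ----> 0" "(%R. f (- int R - 1)) ----> 0"
 shows "(%R. iexp (th * real R) * f (int R) - iexp (th * (- real R - 1)) * f (- int R - 1)) ----> 0"
proof -
 have "(%R. iexp (th * real R) * f (int R)) ----> 0"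
  by (rule Lim_null_comparison[OF _ tendsto_rabs_zero[OF assms(1)]]) (simp add: norm_mult)
 moreover have "(%R. iexp (th * (- real R - 1)) * f (- int R - 1)) ----> 0"
  by (rule Lim_null_comparison[OF _ tendsto_rabs_zero[OF assms(2)]]) (simp add: norm_mult)
 ultimately show ?thesis using tendsto_diff by fastforce
qed

lemma fsum_shift_lim: "fsum th (%y. V (y - 1)) ----> iexp th * Vh"
proof -
 have "(%R. iexp th * (fsum th V R - (iexp (th * real R) * V (int R) - iexp (th * (- real R - 1)) * V (- int R - 1)))) ----> iexp th * (Vh - 0)"
  by (intro tendsto_intros lim boundary_vanishes tails_vanish[OF V])
 thus ?thesis by (simp add: fsum_shift[abs_def] algebra_simps)
qed

lemma iexp_neq: "iexp th - cx q ~= 0"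
proof
 assume "iexp th - cx q = 0"
 hence "cmod (iexp th) = cmod (cx q)" by simp
 thus False using q by simp
qed

text \<open>In Fourier variables the recursion says that \<open>iexp th - q\<close> times the
  transform of the inflow is \<open>q\<close> times that of \<open>V\<close>, up to boundary terms
  that vanish.\<close>

lemma fsum_jumpU_lim: "fsum th jumpU ----> q / (iexp th - q) * Vh"
proof -
 define b where "b R = iexp (th * real R) * jumpU (int R) - iexp (th * (- real R - 1)) * jumpU (- int R - 1)" for R
 have b0: "b ----> 0"
  unfolding b_def[abs_def] by (intro boundary_vanishes tails_vanish[OF jumpU_nonneg jumpU_sums])
 have "fsum th jumpU R = (q * fsum th V R + iexp th * b R) / (iexp th - q)" for R
 proof -
  have "fsum th (%y. jumpU (y - 1)) R = fsum th (%y. q * (V y + jumpU y)) R" by (simp only: jumpU_rec)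
  hence "iexp th * (fsum th jumpU R - b R) = q * (fsum th V R + fsum th jumpU R)"
   by (simp add: fsum_shift fsum_cmult fsum_add b_def algebra_simps)
  hence "fsum th jumpU R * (iexp th - q) = q * fsum th V R + iexp th * b R" by (simp add: algebra_simps)
  thus ?thesis using iexp_neq by (simp add: nonzero_eq_divide_eq)
 qed
 moreover have "(%R. (q * fsum th V R + iexp th * b R) / (iexp th - q)) ----> (q * Vh + iexp th * 0) / (iexp th - q)"
  by (intro tendsto_intros lim b0 iexp_neq)
 ultimately have "fsum th jumpU ----> (q * Vh + iexp th * 0) / (iexp th - q)" by presburger
 thus ?thesis by simp
qed

end

context toom
begin

definition "hole = site_wt (~ \<eta>)"
definition "fwd = rate lp lm \<eta>"
definition "bwd = rate lp lm (~ \<eta>)"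

lemma hole: "0 < hole" "hole < 1" "1 - site_wt \<eta> = hole" "site_wt \<eta> = 1 - hole"
 using site_wt_pos site_wt_less1 by (auto simp: hole_def site_wt_def)

lemma rates_nonneg: "0 <= fwd" "0 <= bwd" using lp lm by (auto simp: fwd_def bwd_def rate_def)

text \<open>The Levy exponent of the compound Poisson process of the position:
  \<open>hole / (iexp th - hole)\<close> is the sum of \<open>hole ^ k * iexp (- k * th)\<close>
  over \<open>k >= 1\<close>, and \<open>hole / (1 - hole)\<close> is its value at
  \<open>th = 0\<close>.\<close>

definition psi :: "real => complex" where
 "psi th = fwd / hole * (iexp th - 1) + bwd * (hole / (iexp th - hole) - hole / (1 - hole))"

lemma at_word_Nil [simp]: "at_word y [] y' s = (y' = y)" by (simp add: at_word_def)

definition cf :: "'a set => real => real => complex" where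
 "cf Ph th u = (LINT om|M. indicator Ph om *\<^sub>R iexp (th * real_of_int (Y om u)))"

lemma measurable_cf:
 assumes "Ph : events" "0 <= u"
 shows "(%om. indicator Ph om *\<^sub>R iexp (th * real_of_int (Y om u))) : borel_measurable M"
proof -
 have "(%om. iexp (th * real_of_int (Y om u))) : borel_measurable M"
  by (rule measurable_compose[OF measurable_Y[OF assms(2)]]) simp
 thus ?thesis using assms(1) by (intro borel_measurable_scaleR borel_measurable_indicator)
qed

definition word_sum :: "'a set => real => real => nat => 'a => complex" where
 "word_sum Ph u th R om = (SUM y:{- int R..int R}. indicator (stateP Ph (at_word y []) u) om *\<^sub>R iexp (th * real_of_int y))"

lemma sum_indicator_word:
 assumes "om : space M"
 shows "word_sum Ph u th R om =
   (if om : Ph & \<bar>Y om u\<bar> <= int R then iexp (th * real_of_int (Y om u)) else 0)"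
proof -
 have "word_sum Ph u th R om =
   (SUM y:{- int R..int R}. if y = Y om u then (if om : Ph then iexp (th * real_of_int (Y om u)) else 0) else 0)"
  unfolding word_sum_def by (intro sum.cong refl) (use assms in "auto simp: stateP_def indicator_def")
 also have "... = (if Y om u : {- int R..int R} then (if om : Ph then iexp (th * real_of_int (Y om u)) else 0) else 0)"
  by (rule sum.delta) simp
 finally show ?thesis by (auto simp: abs_le_iff)
qed

context
 fixes Ph :: "'a set" and s th :: real
 assumes k: "split_past s Ph" and s0: "0 <= s"
begin

lemma Phi: "Ph : events" by (rule split_pastD(2)[OF k])

abbreviation (input) "marg u y \<equiv> mass Ph u y []"

lemma fsum_marg:
 assumes u: "0 <= u"
 shows "fsum th (marg u) R = (LINT om|M. word_sum Ph u th R om)"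
proof -
 have ev: "stateP Ph (at_word y []) u : events" for y by (rule stateP_events[OF local_at_word Phi u])
 have "(LINT om|M. indicator (stateP Ph (at_word y []) u) om *\<^sub>R iexp (th * real_of_int y)) = iexp (th * real_of_int y) * marg u y" for y
  using ev[of y] by (simp add: mass_def Int_absorb1 sets.sets_into_space scaleR_conv_of_real mult.commute)
 moreover have "integrable M (%om. indicator (stateP Ph (at_word y []) u) om *\<^sub>R iexp (th * real_of_int y))" for y
  using ev[of y] by (intro integrable_scaleR_left integrable_real_indicator) (auto simp: emeasure_eq_measure)
 ultimately show ?thesis
  unfolding fsum_def word_sum_def by (subst Bochner_Integration.integral_sum) auto
qed

lemma fsum_marg_bound:
 assumes u: "0 <= u" shows "cmod (fsum th (marg u) R) <= 1"
proof -
 have ev: "stateP Ph (at_word y []) u : events" for y by (rule stateP_events[OF local_at_word Phi u])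
 have b: "cmod (word_sum Ph u th R om) <= 1"
  if "om : space M" for om
  unfolding sum_indicator_word[OF that] by simp
 have int: "integrable M (word_sum Ph u th R)"
  unfolding word_sum_def[abs_def] using ev by (intro Bochner_Integration.integrable_sum integrable_scaleR_left integrable_real_indicator) (auto simp: emeasure_eq_measure)
 show ?thesis
  unfolding fsum_marg[OF u]
  by (rule order_trans[OF integral_norm_bound integral_le_const[OF integrable_norm[OF int]]]) (use b in auto)
qed

lemma fsum_marg_lim:
 assumes u: "0 <= u" shows "(%R. fsum th (marg u) R) ----> cf Ph th u"
 unfolding fsum_marg[OF u] cf_def
proof (rule integral_dominated_convergence[where w = "%_. 1"])
 have ev: "stateP Ph (at_word y []) u : events" for y by (rule stateP_events[OF local_at_word Phi u])
 show "(%om. indicator Ph om *\<^sub>R iexp (th * real_of_int (Y om u))) : borel_measurable M" by (rule measurable_cf[OF Phi u])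
 show "word_sum Ph u th R : borel_measurable M" for R
  unfolding word_sum_def[abs_def] using ev by (intro borel_measurable_sum borel_measurable_scaleR borel_measurable_indicator) auto
 show "AE om in M. (%R. word_sum Ph u th R om)
   ----> indicator Ph om *\<^sub>R iexp (th * real_of_int (Y om u))"
 proof (rule AE_I2)
  fix om assume w: "om : space M"
  have "eventually (%R. \<bar>Y om u\<bar> <= int R) sequentially"
   unfolding eventually_sequentially by (rule exI[of _ "nat \<bar>Y om u\<bar>"]) auto
  thus "(%R. word_sum Ph u th R om)
   ----> indicator Ph om *\<^sub>R iexp (th * real_of_int (Y om u))"
   unfolding sum_indicator_word[OF w]
   by (intro tendsto_eventually) (erule eventually_mono, simp add: indicator_def)
 qed
 show "AE om in M. norm (word_sum Ph u th R om) <= 1" for R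
  by (rule AE_I2) (subst sum_indicator_word, auto)
qed simp

lemma marg_cont: "continuous_on {0..} (%u. marg u y)" by (rule mass_cont[OF Phi])

lemma marg_int: "0 <= t1 ==> (%u. marg u y) integrable_on {t1..t2}"
 by (rule integrable_continuous_real) (rule continuous_on_subset[OF marg_cont], auto)

text \<open>On product masses the forward equation of the empty word is, by \<open>burke\<close>,
  that of a random walk, and the Fourier transform turns it into multiplication by
  \<open>psi\<close>. Fourier sums are kept over finite windows until dominated convergence permits
  the limit under the time integral.\<close>

lemma cf_integral_equation:
 assumes t: "s <= t1" "t1 <= t2"
 shows "cf Ph th integrable_on {t1..t2}" "cf Ph th t2 - cf Ph th t1 = psi th * integral {t1..t2} (cf Ph th)"
proof -
 have t0: "0 <= t1" "0 <= t2" using t s0 by auto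
 have kt: "split_past u Ph" if "t1 <= u" for u by (rule split_past_mono[OF k s0]) (use t that in simp)
 define V where "V y = integral {t1..t2} (%u. marg u y)" for y
 have V0: "0 <= V y" for y
  unfolding V_def by (rule Henstock_Kurzweil_Integration.integral_nonneg[OF marg_int[OF t0(1)]]) (simp add: mass_nonneg)
 have fs: "fsum th V R = integral {t1..t2} (%u. fsum th (marg u) R)"
  and fint: "(%u. fsum th (marg u) R) integrable_on {t1..t2}" for R th
 proof -
  have h: "((%u. iexp (th * real_of_int y) * cx (marg u y)) has_integral (iexp (th * real_of_int y) * cx (V y))) {t1..t2}" for y
   unfolding V_def by (intro has_integral_mult_right has_integral_of_real integrable_integral marg_int[OF t0(1)])
  have "((%u. fsum th (marg u) R) has_integral fsum th V R) {t1..t2}"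
   unfolding fsum_def by (intro has_integral_sum h) simp
  thus "fsum th V R = integral {t1..t2} (%u. fsum th (marg u) R)" "(%u. fsum th (marg u) R) integrable_on {t1..t2}"
   by (auto simp: has_integral_iff)
 qed
 have h1: "(%_. 1 :: real) integrable_on {t1..t2}" by (rule integrable_continuous_real) simp
 have dc: "cf Ph th integrable_on {t1..t2}" "(%R. integral {t1..t2} (%u. fsum th (marg u) R)) ----> integral {t1..t2} (cf Ph th)"
  using dominated_convergence[where f = "%R u. fsum th (marg u) R" and g = "cf Ph th" and S = "{t1..t2}" and h = "%_. 1 :: real", OF fint h1]
   fsum_marg_bound fsum_marg_lim t0 by auto
 show "cf Ph th integrable_on {t1..t2}" by (rule dc(1))
 define Vh where "Vh = integral {t1..t2} (cf Ph th)"
 have lim: "fsum th V ----> Vh" using dc(2) unfolding Vh_def by (simp add: fs[symmetric])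
 have Vs: "(SUM y:{- int R..int R}. V y) <= t2 - t1" for R
 proof -
  have "(SUM y:{- int R..int R}. V y) = integral {t1..t2} (%u. SUM y:{- int R..int R}. marg u y)"
   unfolding V_def by (subst integral_sum) (use marg_int[OF t0(1)] in auto)
  also have "... <= integral {t1..t2} (%_. 1)"
  proof (rule integral_le)
   show "(%u. SUM y:{- int R..int R}. marg u y) integrable_on {t1..t2}" by (intro integrable_sum marg_int[OF t0(1)]) simp
   fix u assume u: "u : {t1..t2}"
   have ev: "stateP Ph (at_word y []) u : events" for y by (rule stateP_events[OF local_at_word Phi]) (use u t0 in simp)
   have "(SUM y:{- int R..int R}. marg u y) = prob (UN y:{- int R..int R}. stateP Ph (at_word y []) u)"
    unfolding mass_def by (rule finite_measure_finite_Union[symmetric]) (use ev in "auto simp: disjoint_family_on_def stateP_def")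
   thus "(SUM y:{- int R..int R}. marg u y) <= 1" by simp
  qed (auto intro!: integrable_continuous_real)
  also have "... = t2 - t1" using t by simp
  finally show ?thesis .
 qed
 have Vle: "\<bar>V y\<bar> <= t2 - t1" for y
 proof -
  have "V y <= (SUM y:{- int (nat \<bar>y\<bar>)..int (nat \<bar>y\<bar>)}. V y)"
   by (rule member_le_sum) (use V0 in auto)
  thus ?thesis using Vs[of "nat \<bar>y\<bar>"] V0[of y] by simp
 qed
 have Weq: "marg t2 y - marg t1 y = fwd / hole * (V (y - 1) - V y) + bwd * (jump_sum V hole y - hole / (1 - hole) * V y)" for y
 proof -
  have ie: "integral {t1..t2} (%u. mass Ph u y w) = ww.word_wt w * V y" for y w
  proof -
   have "integral {t1..t2} (%u. mass Ph u y w) = integral {t1..t2} (%u. ww.word_wt w * marg u y)"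
    by (rule Henstock_Kurzweil_Integration.integral_cong) (rule split_pastD(3)[OF kt], simp)
   thus ?thesis by (simp add: V_def)
  qed
  have "marg t2 y - marg t1 y = ww.gain_sum (%y w. ww.word_wt w * V y) y [] - ww.loss_sum (%y w. ww.word_wt w * V y) y []"
   using forward_equation[OF split_pastD(1,2)[OF kt[OF order_refl]] t0(1) t(2), of y "[]"] unfolding occ_time_def[abs_def] ie .
  also have "... = ww.word_wt [] * (rate lp lm \<eta> / (1 - site_wt \<eta>) * (V (y - 1) - V y) +
   rate lp lm (~ \<eta>) * ((\<Sum>d. (1 - site_wt \<eta>) ^ Suc d * V (y + 1 + int d)) - (1 - site_wt \<eta>) / site_wt \<eta> * V y))"
   by (rule ww.burke[OF Vle])
  finally show ?thesis unfolding ww.word_wt_Nil hole(3) unfolding hole(4) by (simp add: fwd_def bwd_def jump_sum_def)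
 qed
 have "fsum th (%y. marg t2 y - marg t1 y) R = fwd / hole * (fsum th (%y. V (y - 1)) R - fsum th V R)
   + bwd * (fsum th (jump_sum V hole) R - hole / (1 - hole) * fsum th V R)" for R
  unfolding Weq fsum_add fsum_cmult fsum_diff by simp
 moreover have "(%R. fwd / hole * (fsum th (%y. V (y - 1)) R - fsum th V R)
   + bwd * (fsum th (jump_sum V hole) R - hole / (1 - hole) * fsum th V R)) ---->
   fwd / hole * (iexp th * Vh - Vh) + bwd * (hole / (iexp th - hole) * Vh - hole / (1 - hole) * Vh)"
  by (intro tendsto_intros lim fsum_shift_lim[OF V0 Vs hole(1,2) lim] fsum_jumpU_lim[OF V0 Vs hole(1,2) lim])
 moreover have "(%R. fsum th (%y. marg t2 y - marg t1 y) R) ----> cf Ph th t2 - cf Ph th t1"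
  unfolding fsum_diff by (intro tendsto_diff fsum_marg_lim t0)
 ultimately have "cf Ph th t2 - cf Ph th t1 = fwd / hole * (iexp th * Vh - Vh) + bwd * (hole / (iexp th - hole) * Vh - hole / (1 - hole) * Vh)"
  using LIMSEQ_unique by (simp only:) blast
 moreover have alg: "A * (e * x - x) + B * (a * x - b * x) = (A * (e - 1) + B * (a - b)) * x" for A B a b e x :: complex
  by (simp add: algebra_simps)
 ultimately show "cf Ph th t2 - cf Ph th t1 = psi th * integral {t1..t2} (cf Ph th)"
  unfolding psi_def Vh_def[symmetric] by (simp only: alg)
qed

lemma cf_exp:
 assumes st: "s <= t"
 shows "cf Ph th t = cf Ph th s * exp ((t - s) * psi th)"
proof -
 let ?f = "cf Ph th"
 have int: "?f integrable_on {s..t}" by (rule cf_integral_equation(1)) (use st in auto)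
 have eq: "?f u = ?f s + psi th * integral {s..u} ?f" if "s <= u" for u
  using cf_integral_equation(2)[of s u] that by (simp add: algebra_simps)
 have "continuous_on {s..t} (%u. ?f s + psi th * integral {s..u} ?f)"
  by (intro continuous_intros indefinite_integral_continuous_1 int)
 hence cont: "continuous_on {s..t} ?f"
  by (rule continuous_on_eq) (rule eq[symmetric], simp)
 have der: "(?f has_vector_derivative psi th * ?f u) (at u within {s..t})" if u: "u : {s..t}" for u
 proof (rule has_vector_derivative_transform[OF u])
  show "?f x = ?f s + psi th * integral {s..x} ?f" if "x : {s..t}" for x by (rule eq) (use that in simp)
  have "((%x. psi th * integral {s..x} ?f) has_vector_derivative psi th * ?f u) (at u within {s..t})"
   by (intro has_vector_derivative_mult_right integral_has_vector_derivative[OF cont u])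
  from has_vector_derivative_add[OF has_vector_derivative_const this]
  show "((%x. ?f s + psi th * integral {s..x} ?f) has_vector_derivative psi th * ?f u) (at u within {s..t})" by simp
 qed
 \<comment> \<open>Integrating factor: the derivative of \<open>g\<close> vanishes.\<close>
 define g where "g u = exp (- (of_real (u - s) * psi th)) * ?f u" for u
 obtain c where c: "!!u. u : {s..t} ==> g u = c"
 proof (rule has_vector_derivative_zero_constant[of "{s..t}" g])
  fix u assume u: "u : {s..t}"
  have e: "((%u. exp (- (of_real (u - s) * psi th))) has_vector_derivative (- psi th * exp (- (of_real (u - s) * psi th)))) (at u within {s..t})"
  proof -
   have 1: "((%u. - (of_real (u - s) * psi th)) has_vector_derivative - psi th) (at u within {s..t})"
    by (auto intro!: derivative_eq_intros)
   have 2: "(exp has_field_derivative exp (- (of_real (u - s) * psi th))) (at (- (of_real (u - s) * psi th)))"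
    by (rule DERIV_exp)
   from field_vector_diff_chain_within[OF 1 has_field_derivative_at_within[OF 2]] show ?thesis by (simp add: comp_def)
  qed
  have "(g has_vector_derivative (exp (- (of_real (u - s) * psi th)) * (psi th * ?f u) + - psi th * exp (- (of_real (u - s) * psi th)) * ?f u)) (at u within {s..t})"
   unfolding g_def by (rule has_vector_derivative_mult[OF e der[OF u]])
  thus "(g has_vector_derivative 0) (at u within {s..t})" by (simp add: algebra_simps)
 qed auto
 have "g t = g s" using c[of s] c[of t] st by simp
 hence "exp (- (of_real (t - s) * psi th)) * ?f t = ?f s" by (simp add: g_def)
 hence "?f s * exp (of_real (t - s) * psi th) = exp (of_real (t - s) * psi th) * (exp (- (of_real (t - s) * psi th)) * ?f t)" by (simp only: mult.commute)
 also have "exp (of_real (t - s) * psi th) * (exp (- (of_real (t - s) * psi th)) * ?f t) = ?f t"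
  by (simp only: mult.assoc[symmetric] exp_minus_inverse mult_1_left)
 finally show ?thesis by (rule sym)
qed

end

text \<open>On a piece where the position at \<open>s\<close> is \<open>y\<close> the factor
  belonging to the start is deterministic and cancels. The pieces are added over bounded positions
  first, and the bound \<open>R\<close> is then sent to infinity.\<close>

lemma cf_increment:
 assumes k: "split_past s Ph" and st: "0 <= s" "s <= t"
 shows "(LINT om|M. indicator Ph om *\<^sub>R iexp (th * real_of_int (Y om t - Y om s))) = prob Ph * exp ((t - s) * psi th)"
proof -
 define E where "E om = iexp (th * real_of_int (Y om t - Y om s))" for om
 define e where "e = exp ((t - s) * psi th)"
 have nE: "cmod (E om) = 1" for om by (simp add: E_def)
 have P: "Ph : events" by (rule split_pastD(2)[OF k])
 have t: "0 <= t" using st by simp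
 define Ps where "Ps y = Ph Int {om:space M. Y om s : {y}}" for y
 have ky: "split_past s (Ps y)" for y unfolding Ps_def by (rule split_past_restrict[OF k st(1)])
 have Py: "Ps y : events" for y by (rule split_pastD(2)[OF ky])
 have one: "(LINT om|M. indicator (Ps y) om *\<^sub>R E om) = prob (Ps y) * e" for y
 proof -
  have d: "iexp (th * (a - real_of_int y)) = iexp (- (th * real_of_int y)) * iexp (th * a)" for a
   by (simp add: exp_add[symmetric] algebra_simps)
  have "(LINT om|M. indicator (Ps y) om *\<^sub>R E om) =
    (LINT om|M. iexp (- (th * real_of_int y)) * (indicator (Ps y) om *\<^sub>R iexp (th * real_of_int (Y om t))))"
  proof (intro Bochner_Integration.integral_cong refl)
   fix om
   show "indicator (Ps y) om *\<^sub>R E om =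
    iexp (- (th * real_of_int y)) * (indicator (Ps y) om *\<^sub>R iexp (th * real_of_int (Y om t)))"
   proof (cases "om : Ps y")
    case True
    hence "Y om s = y" by (simp add: Ps_def)
    hence "E om = iexp (- (th * real_of_int y)) * iexp (th * real_of_int (Y om t))"
     by (simp only: E_def of_int_diff d)
    thus ?thesis by (simp only: indicator_simps True if_True scaleR_one)
   qed simp
  qed
  also have "... = iexp (- (th * real_of_int y)) * cf (Ps y) th t"
   unfolding cf_def by (rule integral_mult_right_zero)
  also have "cf (Ps y) th t = cf (Ps y) th s * e" unfolding e_def by (rule cf_exp[OF ky st])
  also have "cf (Ps y) th s = (LINT om|M. indicator (Ps y) om *\<^sub>R iexp (th * real_of_int y))"
   unfolding cf_def by (intro Bochner_Integration.integral_cong refl) (auto simp: indicator_def Ps_def)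
  also have "... = prob (Ps y) * iexp (th * real_of_int y)"
   using Py[of y] by (simp add: Int_absorb1 sets.sets_into_space scaleR_conv_of_real)
  finally show ?thesis by (simp add: exp_minus)
 qed
 define I where "I Ph' = (LINT om|M. indicator Ph' om *\<^sub>R E om)" for Ph'
 have meas: "(%om. indicator Ph' om *\<^sub>R E om) : borel_measurable M" if "Ph' : events" for Ph'
 proof -
  have "(%om. real_of_int (Y om u)) : borel_measurable M" if "0 <= u" for u
   by (rule measurable_compose[OF measurable_Y[OF that]]) simp
  hence "(%om. th * real_of_int (Y om t - Y om s)) : borel_measurable M" using t st(1) by simp
  hence "E : borel_measurable M" unfolding E_def by measurable
  thus ?thesis using that by (intro borel_measurable_scaleR borel_measurable_indicator)
 qed
 define A where "A R = (UN y:{- int R..int R}. Ps y)" for R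
 have ind: "indicator (A R) om = (SUM y:{- int R..int R}. indicator (Ps y) om :: real)" for R om
  unfolding A_def by (rule indicator_UN_disjoint) (auto simp: disjoint_family_on_def Ps_def)
 have IA: "I (A R) = prob (A R) * e" for R
 proof -
  have int: "integrable M (%om. indicator (Ps y) om *\<^sub>R E om)" for y
   by (rule integrable_const_bound[of _ 1, OF _ meas[OF Py]]) (auto simp: indicator_def nE)
  have "I (A R) = (SUM y:{- int R..int R}. cx (prob (Ps y)) * e)"
   unfolding I_def ind scaleR_sum_left by (subst Bochner_Integration.integral_sum) (use int one in auto)
  also have "... = prob (A R) * e"
   unfolding A_def
   by (subst finite_measure_finite_Union) (use Py in "auto simp: disjoint_family_on_def Ps_def sum_distrib_right")
  finally show ?thesis .
 qed
 have AM: "A R : events" for R unfolding A_def using Py by auto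
 have ev: "eventually (%R. indicator (A R) om = (indicator Ph om :: real)) sequentially" if "om : space M" for om
  unfolding eventually_sequentially
  by (rule exI[of _ "nat \<bar>Y om s\<bar>"]) (use that in "auto simp: A_def Ps_def indicator_def")
 have "(%R. I (A R)) ----> I Ph"
  unfolding I_def
 proof (rule integral_dominated_convergence[where w = "%_. 1"])
  show "AE om in M. (%R. indicator (A R) om *\<^sub>R E om) ----> indicator Ph om *\<^sub>R E om"
   by (intro AE_I2 tendsto_scaleR tendsto_const tendsto_eventually ev)
 qed (use meas AM P nE in "auto simp: indicator_def")
 moreover have "(%R. prob (A R)) ----> prob Ph"
 proof -
  have "(%R. \<integral>om. (indicator (A R) om :: real) \<partial>M) ----> (LINT om|M. indicator Ph om)"
  proof (rule integral_dominated_convergence[where w = "%_. 1"])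
   show "AE om in M. (%R. indicator (A R) om) ----> (indicator Ph om :: real)"
    by (intro AE_I2 tendsto_eventually ev)
  qed (use AM P in "auto simp: indicator_def")
  thus ?thesis using AM P by (simp add: Int_absorb1 sets.sets_into_space)
 qed
 hence "(%R. I (A R)) ----> prob Ph * e" unfolding IA by (intro tendsto_intros)
 ultimately have "I Ph = prob Ph * e" by (rule LIMSEQ_unique)
 thus ?thesis by (simp add: I_def E_def e_def)
qed

end

subsection \<open>Independent increments\<close>

context toom
begin

lemma measurable_real_Y: "0 <= t ==> (%om. real_of_int (Y om t)) : borel_measurable M"
 by (rule measurable_compose[OF measurable_Y]) simp_all

text \<open>The law of the increment under \<open>M\<close> and its law under \<open>M\<close>
  conditioned on \<open>Ph\<close> have the same characteristic function,
  \<open>exp ((t - s) * psi th)\<close>, and are therefore equal.\<close>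

lemma increment_indep:
 assumes k: "split_past s Ph" and st: "0 <= s" "s <= t" and B: "B : sets borel"
 shows "prob (Ph Int {om:space M. real_of_int (Y om t) - real_of_int (Y om s) : B}) =
  prob Ph * prob {om:space M. real_of_int (Y om t) - real_of_int (Y om s) : B}"
proof (cases "prob Ph = 0")
 case True
 have P: "Ph : events" by (rule split_pastD(2)[OF k])
 have "prob (Ph Int {om:space M. real_of_int (Y om t) - real_of_int (Y om s) : B}) <= prob Ph"
  by (rule finite_measure_mono[OF _ P]) auto
 thus ?thesis using True by (simp add: measure_le_0_iff)
next
 case False
 have P: "Ph : events" by (rule split_pastD(2)[OF k])
 have pos: "0 < prob Ph" using False by (simp add: zero_less_measure_iff)
 define Z where "Z om = real_of_int (Y om t) - real_of_int (Y om s)" for om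
 have Zm: "Z : borel_measurable M" unfolding Z_def[abs_def] using measurable_real_Y st by simp
 define g where "g om = indicator Ph om / prob Ph" for om
 have gm: "g : borel_measurable M" unfolding g_def[abs_def] using P by simp
 have g0: "0 <= g om" for om using pos by (simp add: g_def)
 have emd: "emeasure (density M g) A = ennreal (prob (Ph Int A) / prob Ph)" if A: "A : events" for A
 proof -
  have "emeasure (density M g) A = (\<integral>\<^sup>+om. ennreal (g om) * indicator A om \<partial>M)"
   using gm A by (intro emeasure_density) auto
  also have "... = (\<integral>\<^sup>+om. ennreal (1 / prob Ph) * indicator (Ph Int A) om \<partial>M)"
   by (intro nn_integral_cong) (simp add: g_def indicator_def)
  also have "... = ennreal (1 / prob Ph) * emeasure M (Ph Int A)" using P A by (simp add: nn_integral_cmult_indicator)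
  finally show ?thesis using pos by (simp add: emeasure_eq_measure ennreal_mult[symmetric])
 qed
 have ps: "prob_space (density M g)"
 proof
  have "Ph Int space M = Ph" using sets.sets_into_space[OF P] by blast
  thus "emeasure (density M g) (space (density M g)) = 1" using emd[OF sets.top] pos by simp
 qed
 define M1 where "M1 = distr (density M g) borel Z"
 define M2 where "M2 = distr M borel Z"
 have Zd: "Z : borel_measurable (density M g)" using Zm by simp
 have r1: "real_distribution M1" unfolding M1_def by (rule prob_space.real_distribution_distr[OF ps Zd])
 have r2: "real_distribution M2" unfolding M2_def by (rule real_distribution_distr[OF Zm])
 have top: "split_past s (space M)" by (rule split_past_mono[OF split_past_0]) (use st in auto)
 have "char M1 = char M2"
 proof
  fix th
  have im: "(%om. iexp (th * Z om)) : borel_measurable M" using Zm by measurable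
  have "char M1 th = (\<integral>om. iexp (th * Z om) \<partial>(density M g))"
   unfolding char_def M1_def by (rule integral_distr[OF Zd]) simp
  also have "... = (LINT om|M. g om *\<^sub>R iexp (th * Z om))"
   by (rule integral_density[OF im gm]) (simp add: g0)
  also have "... = (LINT om|M. (1 / prob Ph) *\<^sub>R (indicator Ph om *\<^sub>R iexp (th * Z om)))"
   by (intro Bochner_Integration.integral_cong refl) (simp add: g_def)
  also have "... = (1 / prob Ph) *\<^sub>R (LINT om|M. indicator Ph om *\<^sub>R iexp (th * Z om))"
   by (rule integral_scaleR_right)
  also have "... = exp ((t - s) * psi th)"
   using cf_increment[OF k st, of th] pos by (simp add: Z_def scaleR_conv_of_real)
  finally have 1: "char M1 th = exp ((t - s) * psi th)" .
  have "char M2 th = (LINT om|M. iexp (th * Z om))"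
   unfolding char_def M2_def by (rule integral_distr[OF Zm]) simp
  also have "... = (LINT om|M. indicator (space M) om *\<^sub>R iexp (th * Z om))"
   by (intro Bochner_Integration.integral_cong refl) simp
  also have "... = exp ((t - s) * psi th)"
   using cf_increment[OF top st, of th] by (simp add: Z_def prob_space)
  finally show "char M1 th = char M2 th" using 1 by simp
 qed
 hence eq: "M1 = M2" by (rule Levy_uniqueness[OF r1 r2])
 define A where "A = {om:space M. Z om : B}"
 have pre: "Z -` B Int space M = A" by (auto simp: A_def)
 have AM: "A : events" using measurable_sets[OF Zm B] by (simp only: pre)
 have "emeasure M1 B = ennreal (prob (Ph Int A) / prob Ph)"
  unfolding M1_def by (subst emeasure_distr[OF Zd B]) (simp add: pre emd[OF AM])
 moreover have "emeasure M2 B = ennreal (prob A)"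
  unfolding M2_def by (subst emeasure_distr[OF Zm B]) (simp add: pre emeasure_eq_measure)
 ultimately have "prob (Ph Int A) / prob Ph = prob A" using eq pos by simp
 thus ?thesis using pos unfolding A_def Z_def by (simp add: field_simps)
qed

text \<open>After each increment the event joins the past without destroying the product form, so
  the factorisation can be iterated.\<close>

theorem indep_increments:
 fixes ta :: "nat => real"
 assumes t0: "0 <= ta 0" and inc: "incseq ta"
 shows "indep_vars (%_. borel) (%i om. real_of_int (Y om (ta (Suc i))) - real_of_int (Y om (ta i))) UNIV"
proof -
 define X where "X i om = real_of_int (Y om (ta (Suc i))) - real_of_int (Y om (ta i))" for i om
 have tn: "0 <= ta i" for i using t0 incseqD[OF inc, of 0 i] by simp
 have ts: "ta i <= ta (Suc i)" for i by (rule incseq_SucD[OF inc])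
 have Xm: "X i : borel_measurable M" for i unfolding X_def[abs_def] using measurable_real_Y tn by simp
 have main: "split_past (ta n) {om:space M. ALL i<n. X i om : B i} &
   prob {om:space M. ALL i<n. X i om : B i} = (PROD i<n. prob {om:space M. X i om : B i})"
  if B: "!!i. B i : sets borel" for B n
 proof (induction n)
  case 0
  have "split_past (ta 0) (space M)" by (rule split_past_mono[OF split_past_0]) (use t0 in auto)
  thus ?case by (simp add: prob_space)
 next
  case (Suc n)
  let ?E = "{om:space M. ALL i<n. X i om : B i}"
  have k: "split_past (ta n) ?E" using Suc by blast
  have e: "{om:space M. ALL i<Suc n. X i om : B i} = ?E Int {om:space M. X n om : B n}"
   by (auto simp: less_Suc_eq)
  have e2: "{om:space M. X n om : B n} = {om:space M. Y om (ta (Suc n)) - Y om (ta n) : {z. real_of_int z : B n}}"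
   by (simp add: X_def)
  have "split_past (ta (Suc n)) (?E Int {om:space M. X n om : B n})"
   unfolding e2 by (rule split_past_increment[OF k tn ts])
  moreover have "prob (?E Int {om:space M. X n om : B n}) = prob ?E * prob {om:space M. X n om : B n}"
   unfolding X_def[of n] by (rule increment_indep[OF k tn ts B])
  ultimately show ?case unfolding e using Suc by simp
 qed
 have "indep_sets (%i. {X i -` A Int space M | A. A : sets borel}) UNIV"
 proof (rule indep_setsI)
  show "{X i -` A Int space M | A. A : sets borel} <= events" for i using measurable_sets[OF Xm] by blast
  fix A and J :: "nat set" assume J: "J ~= {}" "finite J" and A: "ALL j:J. A j : {X j -` A Int space M | A. A : sets borel}"
  hence "ALL j:J. EX B. B : sets borel & A j = X j -` B Int space M" by blast
  from bchoice[OF this] obtain B0 where B0: "!!j. j : J ==> B0 j : sets borel" "!!j. j : J ==> A j = X j -` B0 j Int space M" by blast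
  define B where "B j = (if j : J then B0 j else UNIV)" for j
  have B: "B j : sets borel" for j using B0 by (simp add: B_def)
  define n where "n = Suc (Max J)"
  have Jn: "J <= {..<n}" using J(2) by (auto simp: n_def less_Suc_eq_le)
  have "(INT j:J. A j) = {om:space M. ALL i<n. X i om : B i}"
   using J(1) Jn by (auto simp: B0(2) B_def)
  hence "prob (INT j:J. A j) = (PROD i<n. prob {om:space M. X i om : B i})" using main[of B n, OF B] by simp
  also have "... = (PROD i:J. prob (A i))"
  proof (rule prod.mono_neutral_cong_right[OF finite_lessThan Jn])
   show "ALL i:{..<n} - J. prob {om:space M. X i om : B i} = 1" by (simp add: B_def prob_space)
   show "prob {om:space M. X i om : B i} = prob (A i)" if "i : J" for i
    using B0(2)[OF that] that by (simp add: B_def vimage_def Int_def conj_commute)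
  qed
  finally show "prob (INT j:J. A j) = (PROD j:J. prob (A j))" .
 qed
 hence "indep_vars (%_. borel) X UNIV" unfolding indep_vars_def2 using Xm by simp
 thus ?thesis unfolding X_def[abs_def] .
qed

lemma char_increment:
 assumes "0 <= s" "s <= t"
 shows "(LINT om|M. iexp (th * (real_of_int (Y om t) - real_of_int (Y om s)))) = exp ((t - s) * psi th)"
proof -
 have top: "split_past s (space M)" by (rule split_past_mono[OF split_past_0]) (use assms in auto)
 have "(LINT om|M. iexp (th * (real_of_int (Y om t) - real_of_int (Y om s)))) =
   (LINT om|M. indicator (space M) om *\<^sub>R iexp (th * real_of_int (Y om t - Y om s)))"
  by (intro Bochner_Integration.integral_cong refl) simp
 thus ?thesis using cf_increment[OF top assms, of th] by (simp add: prob_space)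
qed

end

subsection \<open>The exponent near zero\<close>

text \<open>The cubes are dominated by the products of three consecutive integers, the coefficients
  of the third formal derivative of the geometric series.\<close>

lemma summable_power_geometric:
 fixes q :: real
 assumes q: "0 < q" "q < 1"
 shows "summable (%k. real (Suc k) ^ 3 * q ^ Suc k)" "summable (%k. real (Suc k) ^ 2 * q ^ Suc k)"
proof -
 have s0: "summable (%n. 1 * x ^ n)" if "norm x < 1" for x :: real
  using summable_geometric[OF that] by simp
 have s1: "summable (%n. diffs (%_. 1) n * x ^ n)" if "norm x < 1" for x :: real by (rule termdiff_converges[OF that s0])
 have s2: "summable (%n. diffs (diffs (%_. 1)) n * x ^ n)" if "norm x < 1" for x :: real by (rule termdiff_converges[OF that s1])
 have s3: "summable (%n. diffs (diffs (diffs (%_. 1))) n * x ^ n)" if "norm x < 1" for x :: real by (rule termdiff_converges[OF that s2])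
 have s: "summable (%n. q * (diffs (diffs (diffs (%_. 1))) n * q ^ n))" using q by (intro summable_mult s3) simp
 have le3: "real (Suc k) ^ 3 * q ^ Suc k <= q * (diffs (diffs (diffs (%_. 1))) k * q ^ k)" for k
 proof -
  have "real (Suc k) ^ 3 <= real (Suc k) * (real (Suc (Suc k)) * real (Suc (Suc (Suc k))))"
   unfolding power3_eq_cube mult.assoc by (intro mult_mono) auto
  hence "real (Suc k) ^ 3 * q ^ Suc k <= (real (Suc k) * (real (Suc (Suc k)) * real (Suc (Suc (Suc k))))) * q ^ Suc k"
   using q by (intro mult_right_mono) auto
  thus ?thesis by (simp add: diffs_def mult_ac)
 qed
 show 3: "summable (%k. real (Suc k) ^ 3 * q ^ Suc k)"
  by (rule summable_comparison_test'[OF s, of 0]) (use le3 q in simp)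
 show "summable (%k. real (Suc k) ^ 2 * q ^ Suc k)"
  by (rule summable_comparison_test'[OF 3, of 0]) (use q in "simp add: mult_right_mono power_increasing")
qed

text \<open>The variance per unit time of the compound Poisson process: rate times squared jump
  size, summed over the jumps.\<close>

definition tagged_diffusivity :: "real => real => real => sign => real" where
 "tagged_diffusivity lp lm p \<eta> = (let q = if \<eta> then 1 - p else p in
   rate lp lm \<eta> / q + rate lp lm (~ \<eta>) * (\<Sum>k. real (Suc k) ^ 2 * q ^ Suc k))"

lemma tagged_diffusivity_pos:
 assumes "0 <= lp" "0 <= lm" "0 < p" "p < 1" "lp ~= 0 \<or> lm ~= 0"
 shows "0 < tagged_diffusivity lp lm p \<eta>"
proof -
 define q where "q = (if \<eta> then 1 - p else p)"
 have q: "0 < q" "q < 1" using assms by (auto simp: q_def)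
 have "0 < (\<Sum>k. real (Suc k) ^ 2 * q ^ Suc k)"
  by (rule suminf_pos[OF summable_power_geometric(2)[OF q]]) (use q in simp)
 thus ?thesis
  using assms q unfolding tagged_diffusivity_def Let_def q_def[symmetric] rate_def
  by (cases \<eta>) (auto intro: add_pos_nonneg add_nonneg_pos)
qed

lemma iexp_second: "cmod (iexp x - 1 - \<i> * x) <= x\<^sup>2 / 2"
 using iexp_approx1[of x 1] by (simp add: numeral_2_eq_2 algebra_simps)

lemma iexp_third: "cmod (iexp x - 1 - \<i> * x + x\<^sup>2 / 2) <= \<bar>x\<bar> ^ 3 / 6"
proof -
 have "(SUM k<=2. (\<i> * cx x) ^ k / fact k) = 1 + \<i> * x - x\<^sup>2 / 2"
  by (simp add: numeral_2_eq_2 power_mult_distrib)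
 thus ?thesis using iexp_approx1[of x 2] by (simp add: algebra_simps eval_nat_numeral)
qed

lemma iexp_sub_neq: "0 < q ==> q < 1 ==> iexp th - cx q ~= 0"
proof
 assume q: "0 < q" "q < 1" and "iexp th - cx q = 0"
 hence "cmod (iexp th) = cmod (cx q)" by simp
 thus False using q by simp
qed

context toom
begin

definition "diff_const = fwd / hole + bwd * (\<Sum>k. real (Suc k) ^ 2 * hole ^ Suc k)"
definition "third_const = (fwd / hole + bwd * (\<Sum>k. real (Suc k) ^ 3 * hole ^ Suc k)) / 6"
definition "speed = fwd / hole - bwd * hole / (1 - hole)\<^sup>2"

abbreviation (input) "jw k \<equiv> cx (bwd * hole ^ Suc k)"
abbreviation (input) "jx th k \<equiv> - (th * real (Suc k))"
abbreviation (input) "moment m \<equiv> \<Sum>k. real (Suc k) ^ m * hole ^ Suc k"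

text \<open>\<open>psi\<close> written as the integral of \<open>iexp - 1\<close> against the Levy
  measure, which has mass \<open>fwd / hole\<close> at \<open>1\<close> and mass \<open>jw k\<close>
  at \<open>- real (Suc k)\<close>.\<close>

lemma psi_series: "(%k. jw k * (iexp (jx th k) - 1)) sums (psi th - cx (fwd / hole) * (iexp th - 1))"
proof -
 let ?z = "hole * iexp (- th)"
 have nz: "norm ?z < 1" using hole by (simp add: norm_mult)
 have "(%k. ?z * ?z ^ k) sums (?z * (1 / (1 - ?z)))" by (intro sums_mult geometric_sums nz)
 moreover have "?z * (1 / (1 - ?z)) = hole / (iexp th - hole)"
 proof -
  have e: "iexp (- th) * iexp th = 1" by (simp add: exp_add[symmetric])
  have n1: "1 - ?z ~= 0" using nz by auto
  have n2: "iexp th - hole ~= 0" by (rule iexp_sub_neq[OF hole(1,2)])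
  have "?z * (iexp th - hole) = hole * (1 - ?z)" using e by (simp add: algebra_simps)
  thus ?thesis using n1 n2 by (simp add: field_simps)
 qed
 ultimately have "(%k. ?z * ?z ^ k) sums (hole / (iexp th - hole))" by (simp only:)
 moreover have "?z * ?z ^ k = cx (hole ^ Suc k) * iexp (jx th k)" for k
 proof -
  have "iexp (- th) ^ Suc k = iexp (jx th k)"
   by (subst exp_of_nat_mult[symmetric]) (simp add: algebra_simps)
  moreover have "?z * ?z ^ k = cx hole ^ Suc k * iexp (- th) ^ Suc k"
   unfolding power_Suc[symmetric] by (rule power_mult_distrib)
  ultimately show ?thesis by (simp only: of_real_power)
 qed
 ultimately have 1: "(%k. cx (hole ^ Suc k) * iexp (jx th k)) sums (hole / (iexp th - hole))" by (simp only:)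
 have "(%k. hole * hole ^ k) sums (hole * (1 / (1 - hole)))" using hole by (intro sums_mult geometric_sums) simp
 hence 2: "(%k. cx (hole ^ Suc k)) sums cx (hole / (1 - hole))" by (intro sums_of_real) simp
 have "(%k. cx bwd * (cx (hole ^ Suc k) * iexp (jx th k) - cx (hole ^ Suc k)))
   sums (cx bwd * (hole / (iexp th - hole) - cx (hole / (1 - hole))))"
  by (rule sums_mult[OF sums_diff[OF 1 2]])
 thus ?thesis by (simp add: psi_def right_diff_distrib mult.assoc)
qed

lemma speed_series: "(%k. bwd * hole ^ Suc k * real (Suc k)) sums (fwd / hole - speed)"
proof -
 have "(%k. bwd * hole * (of_nat (Suc k) * hole ^ k)) sums (bwd * hole * (1 / (1 - hole)\<^sup>2))"
  using hole by (intro sums_mult geometric_deriv_sums) simp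
 thus ?thesis by (simp add: speed_def mult_ac)
qed

text \<open>A pointwise Taylor bound is integrated against the Levy measure, which produces its
  absolute moment of order \<open>m\<close>; one lemma serves the expansions of second and of third
  order.\<close>

lemma remainder_bound:
 fixes r :: "real => complex"
 assumes r: "!!x. cmod (r x) <= c * \<bar>x\<bar> ^ m" and S: "summable (%k. real (Suc k) ^ m * hole ^ Suc k)"
  and Z: "(%k. jw k * r (jx th k)) sums Z"
 shows "cmod (cx (fwd / hole) * r th + Z) <= c * (fwd / hole + bwd * moment m) * \<bar>th\<bar> ^ m"
proof -
 have A: "0 <= fwd / hole" and B: "0 <= bwd * hole ^ Suc k" for k using hole rates_nonneg by auto
 let ?g = "%k. c * bwd * \<bar>th\<bar> ^ m * (real (Suc k) ^ m * hole ^ Suc k)"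
 have "cmod Z <= suminf ?g"
  unfolding sums_unique[OF Z]
 proof (rule norm_suminf_le)
  fix k
  have "cmod (jw k * r (jx th k)) = bwd * hole ^ Suc k * cmod (r (jx th k))"
   by (simp only: norm_mult norm_of_real abs_of_nonneg[OF B])
  also have "... <= bwd * hole ^ Suc k * (c * \<bar>jx th k\<bar> ^ m)" by (rule mult_left_mono[OF r B])
  also have "... = ?g k" by (simp add: abs_mult power_mult_distrib)
  finally show "cmod (jw k * r (jx th k)) <= ?g k" .
 qed (rule summable_mult[OF S])
 also have "suminf ?g = c * bwd * \<bar>th\<bar> ^ m * moment m" by (rule suminf_mult[OF S])
 finally have 1: "cmod Z <= c * bwd * \<bar>th\<bar> ^ m * moment m" .
 have "cmod (cx (fwd / hole) * r th) = fwd / hole * cmod (r th)"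
  by (simp only: norm_mult norm_of_real abs_of_nonneg[OF A])
 also have "... <= fwd / hole * (c * \<bar>th\<bar> ^ m)" by (rule mult_left_mono[OF r A])
 finally have "cmod (cx (fwd / hole) * r th + Z) <= fwd / hole * (c * \<bar>th\<bar> ^ m) + c * bwd * \<bar>th\<bar> ^ m * moment m"
  using 1 by (rule norm_triangle_le[OF add_mono])
 also have "... = c * (fwd / hole + bwd * moment m) * \<bar>th\<bar> ^ m"
  by (simp only: distrib_left distrib_right mult_ac)
 finally show ?thesis .
qed

lemma second_series:
 "(%k. jw k * (iexp (jx th k) - 1 - \<i> * cx (jx th k)))
   sums (psi th - cx (fwd / hole) * (iexp th - 1) + \<i> * th * cx (fwd / hole - speed))"
proof -
 have "(%k. jw k * (iexp (jx th k) - 1) + \<i> * th * cx (bwd * hole ^ Suc k * real (Suc k)))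
   sums (psi th - cx (fwd / hole) * (iexp th - 1) + \<i> * th * cx (fwd / hole - speed))"
  by (intro sums_add psi_series sums_mult sums_of_real speed_series)
 moreover have "jw k * (iexp (jx th k) - 1) + \<i> * th * cx (bwd * hole ^ Suc k * real (Suc k))
   = jw k * (iexp (jx th k) - 1 - \<i> * cx (jx th k))" for k
  by (simp add: algebra_simps)
 ultimately show ?thesis by (simp only:)
qed

lemma psi_second: "cmod (psi th - \<i> * cx (speed * th)) <= diff_const * th\<^sup>2 / 2"
proof -
 have r: "cmod (iexp x - 1 - \<i> * cx x) <= 1 / 2 * \<bar>x\<bar> ^ 2" for x using iexp_second[of x] by simp
 have alg: "a * (e - 1 - \<i> * t) + (P - a * (e - 1) + \<i> * t * (a - v)) = P - \<i> * (v * t)" for a e t P v :: complex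
  by (simp add: algebra_simps)
 from remainder_bound[where r = "%x. iexp x - 1 - \<i> * cx x", OF r summable_power_geometric(2)[OF hole(1,2)] second_series, of th]
 have "cmod (psi th - \<i> * (cx speed * cx th)) <= 1 / 2 * diff_const * \<bar>th\<bar>\<^sup>2"
  unfolding diff_const_def by (simp only: of_real_diff alg)
 thus ?thesis by simp
qed

text \<open>The second-order bound controls the increments uniformly in the scaling; this one
  identifies the Gaussian limit.\<close>

lemma psi_third: "cmod (psi th - \<i> * cx (speed * th) + cx (diff_const * th\<^sup>2 / 2)) <= third_const * \<bar>th\<bar> ^ 3"
proof -
 have r: "cmod (iexp x - 1 - \<i> * cx x + cx (x\<^sup>2 / 2)) <= 1 / 6 * \<bar>x\<bar> ^ 3" for x using iexp_third[of x] by simp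
 have S2: "(%k. real (Suc k) ^ 2 * hole ^ Suc k) sums moment 2"
  by (rule summable_sums[OF summable_power_geometric(2)[OF hole(1,2)]])
 have "(%k. cx (th\<^sup>2 / 2 * (bwd * (real (Suc k) ^ 2 * hole ^ Suc k)))) sums cx (th\<^sup>2 / 2 * (diff_const - fwd / hole))"
 proof (rule sums_of_real)
  show "(%k. th\<^sup>2 / 2 * (bwd * (real (Suc k) ^ 2 * hole ^ Suc k))) sums (th\<^sup>2 / 2 * (diff_const - fwd / hole))"
   using sums_mult[OF sums_mult[OF S2, of bwd], of "th\<^sup>2 / 2"] by (simp add: diff_const_def)
 qed
 from sums_add[OF second_series this]
 have "(%k. jw k * (iexp (jx th k) - 1 - \<i> * cx (jx th k)) +
    cx (th\<^sup>2 / 2 * (bwd * (real (Suc k) ^ 2 * hole ^ Suc k))))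
   sums (psi th - cx (fwd / hole) * (iexp th - 1) + \<i> * th * cx (fwd / hole - speed) + cx (th\<^sup>2 / 2 * (diff_const - fwd / hole)))" .
 moreover have "jw k * (iexp (jx th k) - 1 - \<i> * cx (jx th k)) +
    cx (th\<^sup>2 / 2 * (bwd * (real (Suc k) ^ 2 * hole ^ Suc k))) =
   jw k * (iexp (jx th k) - 1 - \<i> * cx (jx th k) + cx ((jx th k)\<^sup>2 / 2))" for k
 proof -
  have "th\<^sup>2 / 2 * (bwd * (real (Suc k) ^ 2 * hole ^ Suc k)) = bwd * hole ^ Suc k * ((jx th k)\<^sup>2 / 2)"
   by (simp add: power_mult_distrib)
  thus ?thesis by (simp only: of_real_mult distrib_left)
 qed
 ultimately have Z: "(%k. jw k * (iexp (jx th k) - 1 - \<i> * cx (jx th k) + cx ((jx th k)\<^sup>2 / 2)))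
   sums (psi th - cx (fwd / hole) * (iexp th - 1) + \<i> * th * cx (fwd / hole - speed) + cx (th\<^sup>2 / 2 * (diff_const - fwd / hole)))"
  by (simp only:)
 have alg: "a * (e - 1 - \<i> * t + h) + (P - a * (e - 1) + \<i> * t * (a - v) + h * (d - a)) = P - \<i> * (v * t) + d * h" for a e t P v h d :: complex
  by (simp add: algebra_simps)
 from remainder_bound[where r = "%x. iexp x - 1 - \<i> * cx x + cx (x\<^sup>2 / 2)", OF r summable_power_geometric(1)[OF hole(1,2)] Z]
 have "cmod (psi th - \<i> * (cx speed * cx th) + cx diff_const * cx (th\<^sup>2 / 2)) <=
   1 / 6 * (fwd / hole + bwd * moment 3) * \<bar>th\<bar> ^ 3"
  by (simp only: of_real_diff of_real_mult alg)
 thus ?thesis by (simp add: third_const_def)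
qed

lemma speed_eq: "speed = tagged_speed lp lm p \<eta>"
 unfolding speed_def tagged_speed_def fwd_def bwd_def hole_def site_wt_def rate_def by (cases \<eta>) simp_all

end

subsection \<open>Step approximations in Skorokhod space\<close>

text \<open>Real induction: right continuity carries a partition beyond \<open>t\<close> by adding
  \<open>t\<close>, and the left limit carries one from a nearby \<open>r\<close> up to
  \<open>t\<close> by adding \<open>r\<close> and \<open>t\<close>. Jumps at the points of
  \<open>T\<close> are allowed because the interval \<open>{s<..s'}\<close> omits its left
  end.\<close>

lemma cadlag_oscillation:
 fixes f :: "real => real"
 assumes f: "cadlag_on {0..1} f" and e: "0 < ep"
 shows "EX T. finite T & 1 : T & T <= {0..1} & (ALL s s'. 0 <= s & s < s' & s' <= 1 & T Int {s<..s'} = {} --> \<bar>f s - f s'\<bar> < ep)"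
proof -
 define P where "P t = (EX T. finite T & T <= {0..1} &
  (ALL s s'. 0 <= s & s < s' & s' <= t & T Int {s<..s'} = {} --> \<bar>f s - f s'\<bar> < ep))" for t
 have near: "EX d>0. ALL s:{0..1} Int S. s ~= t & \<bar>s - t\<bar> < d --> \<bar>f s - l\<bar> < ep / 2"
  if "(f \<longlongrightarrow> l) (at t within {0..1} Int S)" for S t l
  using tendstoD[OF that, of "ep / 2"] e unfolding eventually_at dist_real_def by auto
 have "t <= 1 --> P t" if "0 <= t" for t
  using that
 proof (induction t rule: real_induction)
  case zero thus ?case by (auto simp: P_def)
 next
  case (right t)
  show ?case
  proof (cases "t < 1")
   case False thus ?thesis by (intro exI[of _ 1]) auto
  next
   case True
   obtain T where T: "finite T" "T <= {0..1}" "!!s s'. 0 <= s ==> s < s' ==> s' <= t ==> T Int {s<..s'} = {} ==> \<bar>f s - f s'\<bar> < ep"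
    using right True unfolding P_def by (metis less_imp_le order_refl)
   have "(f \<longlongrightarrow> f t) (at t within {0..1} Int {t<..})" using f right(1) True by (simp add: cadlag_on_def)
   from near[OF this] obtain d where d: "0 < d" "!!s. t < s ==> s <= 1 ==> s < t + d ==> \<bar>f s - f t\<bar> < ep / 2"
    using right(1) by auto
   have "P u" if u: "t < u" "u < t + d" "u <= 1" for u
    unfolding P_def
   proof (intro exI[of _ "insert t T"] conjI allI impI)
    fix s s' assume s: "0 <= s & s < s' & s' <= u & insert t T Int {s<..s'} = {}"
    have w: "\<bar>f x - f t\<bar> < ep / 2" if "t <= x" "x <= u" for x
     using d(2)[of x] that u e by (cases "x = t") auto
    show "\<bar>f s - f s'\<bar> < ep"
    proof (cases "s' <= t")
     case True thus ?thesis using T(3)[of s s'] s by blast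
    next
     case False
     hence "t <= s" using s by auto
     thus ?thesis using w[of s] w[of s'] s by (auto simp: abs_if split: if_splits)
    qed
   qed (use T right(1) True in auto)
   thus ?thesis using d(1) by auto
  qed
 next
  case (left t)
  show ?case
  proof
   assume t1: "t <= 1"
   obtain l where "(f \<longlongrightarrow> l) (at t within {0..1} Int {..<t})" using f left(1) t1 by (force simp: cadlag_on_def)
   from near[OF this] obtain d where d: "0 < d" "!!s. 0 <= s ==> s < t ==> t - d < s ==> \<bar>f s - l\<bar> < ep / 2"
    using t1 by auto
   define r where "r = max 0 (t - d / 2)"
   have r: "0 <= r" "r < t" "t - d < r" using d(1) left(1) by (auto simp: r_def)
   have "P r" using left(2)[OF r(1,2)] t1 r by simp
   then obtain T where T: "finite T & T <= {0..1} &
    (ALL s s'. 0 <= s & s < s' & s' <= r & T Int {s<..s'} = {} --> \<bar>f s - f s'\<bar> < ep)"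
    unfolding P_def ..
   show "P t" unfolding P_def
   proof (intro exI[of _ "insert t (insert r T)"] conjI allI impI)
    fix s s' assume s: "0 <= s & s < s' & s' <= t & insert t (insert r T) Int {s<..s'} = {}"
    hence st: "s' < t" by auto
    show "\<bar>f s - f s'\<bar> < ep"
    proof (cases "s' <= r")
     case True thus ?thesis using T[THEN conjunct2, THEN conjunct2, rule_format, of s s'] s by blast
    next
     case False
     hence "r <= s" using s by auto
     thus ?thesis using d(2)[of s] d(2)[of s'] s st r by (auto simp: abs_if split: if_splits)
    qed
   qed (use T left(1) t1 r in auto)
  qed
 qed
 from this[of 1] obtain T where T: "finite T" "T <= {0..1}"
  "!!s s'. 0 <= s & s < s' & s' <= 1 & T Int {s<..s'} = {} ==> \<bar>f s - f s'\<bar> < ep" unfolding P_def by auto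
 show ?thesis
  by (rule exI[of _ "insert 1 T"]) (use T in auto)
qed

definition step_path :: "nat => (nat => real) => real => real" where
 "step_path m v t = v (nat \<lfloor>real m * t\<rfloor>)"

lemma step_path_cadlag: "cadlag_on {0..1} (step_path m v)"
 unfolding cadlag_on_def
proof (intro ballI conjI)
 fix t :: real
 have ev: "((%s. step_path m v s) \<longlongrightarrow> l) (at t within {0..1} Int S)"
  if "0 < d" "!!s. s : S ==> \<bar>s - t\<bar> < d ==> step_path m v s = l" for S d l
  by (rule tendsto_eventually) (use that in "auto simp: eventually_at dist_real_def intro!: exI[of _ d]")
 show "(step_path m v \<longlongrightarrow> step_path m v t) (at t within {0..1} Int {t<..})"
 proof (cases "m = 0")
  case True thus ?thesis by (simp add: step_path_def[abs_def])
 next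
  case False
  define d where "d = (of_int \<lfloor>real m * t\<rfloor> + 1 - real m * t) / real m"
  show ?thesis
  proof (rule ev)
   show "0 < d" using False floor_correct[of "real m * t"] by (simp add: d_def)
   fix s assume "s : {t<..}" "\<bar>s - t\<bar> < d"
   hence "real m * t < real m * s" "real m * (s - t) < of_int \<lfloor>real m * t\<rfloor> + 1 - real m * t"
    using False by (simp_all add: d_def pos_less_divide_eq mult.commute)
   hence "\<lfloor>real m * s\<rfloor> = \<lfloor>real m * t\<rfloor>" using floor_correct[of "real m * t"]
    unfolding right_diff_distrib of_int_add of_int_1 by (intro floor_unique) linarith+
   thus "step_path m v s = step_path m v t" by (simp add: step_path_def)
  qed
 qed
 show "EX l. (step_path m v \<longlongrightarrow> l) (at t within {0..1} Int {..<t})"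
 proof (cases "m = 0")
  case True thus ?thesis by (auto simp: step_path_def[abs_def])
 next
  case False
  define d where "d = (real m * t - of_int (\<lceil>real m * t\<rceil> - 1)) / real m"
  have "(step_path m v \<longlongrightarrow> v (nat (\<lceil>real m * t\<rceil> - 1))) (at t within {0..1} Int {..<t})"
  proof (rule ev)
   show "0 < d" using False ceiling_correct[of "real m * t"] by (simp add: d_def)
   fix s assume "s : {..<t}" "\<bar>s - t\<bar> < d"
   hence "real m * s < real m * t" "real m * (t - s) < real m * t - of_int (\<lceil>real m * t\<rceil> - 1)"
    using False by (simp_all add: d_def pos_less_divide_eq mult.commute)
   hence "\<lfloor>real m * s\<rfloor> = \<lceil>real m * t\<rceil> - 1" using ceiling_correct[of "real m * t"]
    unfolding right_diff_distrib of_int_diff of_int_1 by (intro floor_unique) (unfold of_int_diff of_int_1, linarith+)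
   thus "step_path m v s = v (nat (\<lceil>real m * t\<rceil> - 1))" by (simp add: step_path_def)
  qed
  thus ?thesis by blast
 qed
qed

lemma dist_skorokhod_of_le:
 assumes "cadlag_on {0..1} f" "cadlag_on {0..1} g" "skorokhod_close f g e"
 shows "dist (skorokhod_of f) (skorokhod_of g) <= e"
proof -
 have "skorokhod_close (skorokhod_path (skorokhod_of f)) (skorokhod_path (skorokhod_of g)) e"
  using assms(3) unfolding skorokhod_close_def
  by (auto simp: skorokhod_path_of[OF assms(1)] skorokhod_path_of[OF assms(2), OF time_change_in])
 thus ?thesis unfolding dist_skorokhod_def
  by (intro cInf_lower bdd_belowI[of _ 0]) (auto intro: skorokhod_close_nonneg)
qed

lemma skorokhod_close_uniform: "(!!t. t : {0..1} ==> \<bar>f t - g t\<bar> <= e) ==> 0 <= e ==> skorokhod_close f g e"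
 unfolding skorokhod_close_def by (rule bexI[OF _ id_time_change]) simp

definition hat :: "real => real" where "hat x = max 0 (1 - \<bar>x\<bar>)"

lemma hat: "hat 0 = 1" "1 <= \<bar>x\<bar> ==> hat x = 0" "0 <= hat x" "hat x <= 1" "\<bar>hat x - hat y\<bar> <= \<bar>x - y\<bar>"
 by (auto simp: hat_def)

text \<open>The time change moves each large jump of \<open>f\<close> to the next grid point.\<close>

lemma step_approximation:
 fixes f :: "real => real"
 assumes f: "cadlag_on {0..1} f" and e: "0 < ep"
 shows "EX m0. ALL m>=m0. skorokhod_close f (step_path m (%k. f (real k / real m))) ep"
proof -
 obtain T where T: "finite T" "1 : T" "T <= {0..1}"
  "!!s s'. 0 <= s & s < s' & s' <= 1 & T Int {s<..s'} = {} ==> \<bar>f s - f s'\<bar> < ep"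
  using cadlag_oscillation[OF f e] by auto
 define T0 where "T0 = insert 0 T"
 have T0: "finite T0" "0 : T0" "1 : T0" "T <= T0" "T0 <= {0..1}" using T by (auto simp: T0_def)
 define D where "D = insert 1 ((%(u, v). \<bar>u - v\<bar>) ` {(u, v). u : T0 & v : T0 & u ~= v})"
 define rh where "rh = Min D"
 have fin: "finite D" unfolding D_def
  by (intro finite.insertI finite_imageI finite_subset[OF _ finite_cartesian_product[OF T0(1) T0(1)]]) auto
 have "rh : D" unfolding rh_def by (rule Min_in[OF fin]) (simp add: D_def)
 hence r0: "0 < rh" by (auto simp: D_def)
 have sep: "rh <= \<bar>u - v\<bar>" if "u : T0" "v : T0" "u ~= v" for u v
  unfolding rh_def by (rule Min_le[OF fin]) (use that in "force simp: D_def")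
 define c where "c = real (card T0)"
 \<comment> \<open>The term \<open>c / rh\<close> makes the time change strictly increasing, the
   term \<open>c / ep\<close> keeps it within \<open>ep\<close> of the identity.\<close>
 obtain m0 :: nat where m0: "c / rh + c / ep + 1 < real m0" using reals_Archimedean2 by blast
 have c0: "0 <= c / rh" "0 <= c / ep" using r0 e by (auto simp: c_def)
 show ?thesis
 proof (intro exI[of _ m0] allI impI)
  fix m assume "m0 <= m"
  hence "c / rh + c / ep + 1 < real m" using m0 by linarith
  hence "c / rh < real m" "c / ep < real m" and m: "0 < real m" using c0 by linarith+
  hence cr: "c / (real m * rh) < 1" and ce: "c / real m <= ep" using r0 e by (simp_all add: field_simps)
  define ga where "ga u = of_int \<lceil>real m * u\<rceil> / real m" for u
  have g: "0 <= ga u - u" "ga u - u <= 1 / real m" for u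
  proof -
   have "u = real m * u / real m" using m by simp
   hence "ga u - u = (of_int \<lceil>real m * u\<rceil> - real m * u) / real m" by (simp add: ga_def diff_divide_distrib)
   moreover have "0 <= of_int \<lceil>real m * u\<rceil> - real m * u" "of_int \<lceil>real m * u\<rceil> - real m * u <= 1"
    using ceiling_correct[of "real m * u"] by linarith+
   ultimately show "0 <= ga u - u" "ga u - u <= 1 / real m" using m by (simp_all add: divide_right_mono)
  qed
  have g1: "\<bar>ga u - u\<bar> <= 1 / real m" for u using g[of u] by simp
  \<comment> \<open>The hats have radius \<open>rh\<close>, at most the least distance of two points
    of \<open>T0\<close>. At such a point only its own hat is felt, so \<open>l\<close> sends it
    exactly to the next grid point.\<close>
  define l where "l t = t + (SUM u:T0. (ga u - u) * hat ((t - u) / rh))" for t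
  have lT: "l v = ga v" if v: "v : T0" for v
  proof -
   have "(SUM u:T0. (ga u - u) * hat ((v - u) / rh)) = (SUM u:T0. if u = v then ga v - v else 0)"
   proof (intro sum.cong refl)
    fix u assume u: "u : T0"
    have "1 <= \<bar>(v - u) / rh\<bar>" if "u ~= v"
    proof -
     have "rh <= \<bar>v - u\<bar>" using sep[OF v u] that by blast
     thus ?thesis unfolding abs_divide abs_of_pos[OF r0] using r0 by (simp only: pos_le_divide_eq mult_1)
    qed
    thus "(ga u - u) * hat ((v - u) / rh) = (if u = v then ga v - v else 0)" by (simp add: hat(1,2))
   qed
   also have "... = ga v - v" using sum.delta[OF T0(1), of v] v by simp
   finally show ?thesis by (simp add: l_def)
  qed
  have ld: "\<bar>l t - t\<bar> <= c / real m" for t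
  proof -
   have "\<bar>l t - t\<bar> <= (SUM u:T0. \<bar>(ga u - u) * hat ((t - u) / rh)\<bar>)" unfolding l_def by (simp add: sum_abs)
   also have "... <= (SUM u:T0. 1 / real m * 1)"
    unfolding abs_mult by (intro sum_mono mult_mono g1) (auto simp: hat(3,4))
   finally show ?thesis by (simp add: c_def)
  qed
  have lmono: "l s < l t" if st: "s < t" for s t
  proof -
   have "\<bar>(l t - t) - (l s - s)\<bar> = \<bar>SUM u:T0. (ga u - u) * (hat ((t - u) / rh) - hat ((s - u) / rh))\<bar>"
    unfolding l_def by (simp add: sum_subtractf[symmetric] right_diff_distrib)
   also have "... <= (SUM u:T0. \<bar>(ga u - u) * (hat ((t - u) / rh) - hat ((s - u) / rh))\<bar>)" by (rule sum_abs)
   also have "... <= (SUM u:T0. 1 / real m * ((t - s) / rh))"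
   proof (rule sum_mono)
    fix u
    have "\<bar>hat ((t - u) / rh) - hat ((s - u) / rh)\<bar> <= \<bar>(t - u) / rh - (s - u) / rh\<bar>" by (rule hat(5))
    also have "... = (t - s) / rh" using st r0 by (simp add: diff_divide_distrib[symmetric])
    finally show "\<bar>(ga u - u) * (hat ((t - u) / rh) - hat ((s - u) / rh))\<bar> <= 1 / real m * ((t - s) / rh)"
     unfolding abs_mult by (intro mult_mono g1) auto
   qed
   also have "... = c / (real m * rh) * (t - s)" by (simp add: c_def)
   also have "... < t - s" using mult_strict_right_mono[OF cr, of "t - s"] st by simp
   finally show ?thesis by linarith
  qed
  have lc: "continuous_on {0..1} l"
   unfolding l_def hat_def using r0 by (intro continuous_intros) auto
  have l0: "l 0 = 0" and l1: "l 1 = 1"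
   using lT[OF T0(2)] lT[OF T0(3)] m by (simp_all add: ga_def)
  have "l ` {0..1} = {0..1}"
  proof (intro equalityI subsetI)
   fix y assume "y : l ` {0..1}"
   thus "y : {0..1}" using lmono[of 0] lmono[of _ 1] l0 l1 by (force simp: order_le_less)
  next
   fix y assume "y : {0..1::real}"
   thus "y : l ` {0..1}" using IVT'[of l 0 y 1] l0 l1 lc by (auto simp: image_iff)
  qed
  hence ltc: "l : time_changes" unfolding time_changes_def using lmono lc by (auto intro!: strict_mono_onI)
  show "skorokhod_close f (step_path m (%k. f (real k / real m))) ep"
   unfolding skorokhod_close_def
  proof (intro bexI[OF _ ltc] ballI conjI)
   fix s :: real assume s: "s : {0..1}"
   show "\<bar>l s - s\<bar> <= ep" using ld[of s] ce by linarith
   \<comment> \<open>\<open>u\<close> is the grid point whose value the step path shows at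
     \<open>l s\<close>. No point of \<open>T\<close> separates \<open>s\<close> from
     \<open>u\<close>, because \<open>l\<close> is increasing and maps the points of
     \<open>T\<close> to grid points.\<close>
   define u where "u = of_int \<lfloor>real m * l s\<rfloor> / real m"
   have ls: "0 <= l s" "l s <= 1" using time_change_in[OF ltc s] by auto
   have fl: "0 <= \<lfloor>real m * l s\<rfloor>" using ls m by simp
   have "of_int \<lfloor>real m * l s\<rfloor> <= real m * l s" by simp
   also have "... <= real m" using ls m by simp
   finally have u01: "0 <= u" "u <= 1" using fl m by (simp_all add: u_def)
   have st: "step_path m (%k. f (real k / real m)) (l s) = f u" using fl by (simp add: step_path_def u_def)
   have less: "u < v" if v: "v : T" "s < v" for v
   proof -
    have "l s < ga v" using lmono[OF v(2)] lT[of v] v(1) T0(4) by auto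
    hence "real m * l s < of_int \<lceil>real m * v\<rceil>" using m by (simp add: ga_def field_simps)
    hence "\<lfloor>real m * l s\<rfloor> <= \<lceil>real m * v\<rceil> - 1" by (simp add: floor_less_iff[symmetric])
    hence "of_int \<lfloor>real m * l s\<rfloor> < real m * v" using ceiling_correct[of "real m * v"] by linarith
    thus ?thesis using m by (simp add: u_def field_simps)
   qed
   have ge: "v <= u" if v: "v : T" "v <= s" for v
   proof -
    have "ga v <= l s" using lmono[of v s] lT[of v] v T0(4) by (cases "v = s") auto
    hence "of_int \<lceil>real m * v\<rceil> <= real m * l s" using m by (simp add: ga_def field_simps)
    hence "\<lceil>real m * v\<rceil> <= \<lfloor>real m * l s\<rfloor>" by (simp add: le_floor_iff)
    hence "real m * v <= of_int \<lfloor>real m * l s\<rfloor>" using ceiling_correct[of "real m * v"] by linarith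
    thus ?thesis using m by (simp add: u_def field_simps)
   qed
   consider "s = u" | "s < u" | "u < s" by linarith
   hence "\<bar>f s - f u\<bar> <= ep"
   proof cases
    case 1 thus ?thesis using e by simp
   next
    case 2
    have "T Int {s<..u} = {}" using less by force
    thus ?thesis using T(4)[of s u] 2 s u01 by simp
   next
    case 3
    have "T Int {u<..s} = {}" using ge by force
    thus ?thesis using T(4)[of u s] 3 s u01 by (simp add: abs_minus_commute)
   qed
   thus "\<bar>f s - step_path m (%k. f (real k / real m)) (l s)\<bar> <= ep" unfolding st .
  qed
 qed
qed

abbreviation step_of :: "nat => (real => real) => skorokhod" where
 "step_of m f \<equiv> skorokhod_of (step_path m (%k. f (real k / real m)))"

lemma step_of_tendsto:
 assumes "cadlag_on {0..1} f" shows "(%m. step_of m f) ----> skorokhod_of f"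
proof (rule metric_LIMSEQ_I)
 fix r :: real assume r: "0 < r"
 obtain m0 where m0: "!!m. m0 <= m ==> skorokhod_close f (step_path m (%k. f (real k / real m))) (r / 2)"
  using step_approximation[OF assms, of "r / 2"] r by auto
 have "dist (step_of m f) (skorokhod_of f) < r" if "m0 <= m" for m
  using dist_skorokhod_of_le[OF assms step_path_cadlag m0[OF that]] r by (simp add: dist_commute)
 thus "EX m0. ALL m>=m0. dist (step_of m f) (skorokhod_of f) < r" by blast
qed

lemma step_path_continuous: "continuous_on UNIV (%v. skorokhod_of (step_path m v))"
 unfolding continuous_on_def
proof (intro ballI tendstoI)
 fix v :: "nat => real" and r :: real assume r: "0 < r"
 have c: "((%w. w k) \<longlongrightarrow> v k) (at v within UNIV)" for k
  using continuous_on_product_coordinates[of k] unfolding continuous_on_def by auto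
 have "eventually (%w. ALL k:{..m}. dist (w k) (v k) < r / 2) (at v within UNIV)"
  by (intro eventually_ball_finite ballI tendstoD[OF c]) (use r in auto)
 thus "eventually (%w. dist (skorokhod_of (step_path m w)) (skorokhod_of (step_path m v)) < r) (at v within UNIV)"
 proof eventually_elim
  case (elim w)
  have "skorokhod_close (step_path m w) (step_path m v) (r / 2)"
  proof (rule skorokhod_close_uniform)
   fix t :: real assume t: "t : {0..1}"
   have "real m * t <= real m" using t by (simp add: mult_left_le)
   hence "nat \<lfloor>real m * t\<rfloor> : {..m}" by (simp add: nat_le_iff floor_le_iff)
   thus "\<bar>step_path m w t - step_path m v t\<bar> <= r / 2"
    using elim unfolding step_path_def dist_real_def by (meson less_imp_le)
  qed (use r in simp)
  from dist_skorokhod_of_le[OF step_path_cadlag step_path_cadlag this] r show ?case by simp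
 qed
qed

lemma step_path_measurable:
 assumes "!!k. V k : borel_measurable M"
 shows "(%om. skorokhod_of (step_path m (%k. V k om))) : borel_measurable M"
proof -
 have "(%om k. V k om) : borel_measurable M" by (rule measurable_coordinatewise_then_product) (rule assms)
 from measurable_compose[OF this borel_measurable_continuous_onI[OF step_path_continuous]] show ?thesis .
qed

lemma skorokhod_of_measurable:
 assumes m: "!!t. 0 <= t ==> (%om. X om t) : borel_measurable M" and c: "!!om. om : space M ==> cadlag_on {0..1} (X om)"
 shows "(%om. skorokhod_of (X om)) : borel_measurable M"
 by (rule borel_measurable_LIMSEQ_metric[where f = "%m om. step_of m (X om)"])
  (auto intro!: step_path_measurable m step_of_tendsto c)

subsection \<open>Reduction to Lipschitz test functions\<close>

text \<open>\<open>G k\<close> is the Pasch-Hausdorff envelope, the largest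
  \<open>k\<close>-Lipschitz function below \<open>F\<close>.\<close>

lemma inf_convolution:
 fixes F :: "'c::metric_space => real" and k :: nat
 assumes F: "continuous_on UNIV F" "!!x. \<bar>F x\<bar> <= C"
 defines "G \<equiv> %k x. INF y. F y + real k * dist x y"
 shows "G k x <= F x" "- C <= G k x" "\<bar>G k x - G k y\<bar> <= real k * dist x y" "(%k. G k x) ----> F x"
proof -
 have lb: "- C <= F y + real k * dist x y" for x y k
 proof -
  have "0 <= real k * dist x y" by simp
  thus ?thesis using F(2)[of y] by linarith
 qed
 have bd: "bdd_below (range (%y. F y + real k * dist x y))" for x k using lb by (auto intro!: bdd_belowI[of _ "- C"])
 have GF: "G k x <= F x" for k x unfolding G_def using cINF_lower[OF bd[of k x] UNIV_I, of x] by simp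
 thus "G k x <= F x" .
 show "- C <= G k x" unfolding G_def using lb by (intro cINF_greatest) auto
 have one: "G k x <= G k y + real k * dist x y" for x y
 proof -
  have Gy: "G k y = (INF z. F z + real k * dist y z)" by (simp add: G_def)
  have "G k x - real k * dist x y <= G k y"
   unfolding Gy
  proof (rule cINF_greatest)
   fix z
   have "G k x <= F z + real k * dist x z" unfolding G_def by (rule cINF_lower[OF bd UNIV_I])
   also have "real k * dist x z <= real k * (dist x y + dist y z)" by (intro mult_left_mono dist_triangle) simp
   finally show "G k x - real k * dist x y <= F z + real k * dist y z" by (simp add: algebra_simps)
  qed simp
  thus ?thesis by simp
 qed
 show "\<bar>G k x - G k y\<bar> <= real k * dist x y" using one[of x y] one[of y x] by (simp add: dist_commute abs_le_iff)
 show "(%k. G k x) ----> F x"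
 proof (rule LIMSEQ_I)
  fix r :: real assume r: "0 < r"
  obtain d where d: "0 < d" "!!y. dist y x < d ==> dist (F y) (F x) < r / 2"
   using F(1) r unfolding continuous_on_iff by (metis UNIV_I half_gt_zero)
  \<comment> \<open>Beyond distance \<open>d\<close> the penalty exceeds \<open>2 * C\<close>, the
    largest possible drop of \<open>F\<close>, so only points near \<open>x\<close> compete for the
    infimum.\<close>
  obtain k0 :: nat where k0: "2 * C / d < real k0" using reals_Archimedean2 by blast
  have "norm (G k x - F x) < r" if k: "k0 <= k" for k
  proof -
   have "F x - r / 2 <= G k x"
    unfolding G_def
   proof (rule cINF_greatest)
    fix y
    show "F x - r / 2 <= F y + real k * dist x y"
    proof (cases "dist y x < d")
     case True
     moreover have "0 <= real k * dist x y" by simp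
     ultimately show ?thesis using d(2)[OF True] unfolding dist_real_def by linarith
    next
     case False
     have "2 * C < real k * d" using k0 k d(1) by (simp add: pos_divide_less_eq) (meson less_le_trans mult_right_mono of_nat_mono less_imp_le)
     also have "... <= real k * dist x y" using False by (intro mult_left_mono) (simp_all add: dist_commute)
     finally show ?thesis using F(2)[of x] F(2)[of y] r by linarith
    qed
   qed simp
   thus ?thesis using GF[of k x] r by simp
  qed
  thus "EX k0. ALL k>=k0. norm (G k x - F x) < r" by blast
 qed
qed

text \<open>Lipschitz minorants bound the limit of the expectations from below; the same bound for
  \<open>- F\<close> gives the other half.\<close>

lemma lipschitz_suffices:
 fixes X :: "nat => 'a => 'c::metric_space"
 assumes P: "prob_space M" "prob_space W" and X: "!!n. X n : borel_measurable M" and Z: "Z : borel_measurable W"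
  and L: "!!F C K. (!!x. \<bar>F x\<bar> <= C) ==> (!!x y. \<bar>F x - F y\<bar> <= K * dist x y) ==> 0 <= K ==> continuous_on UNIV F ==>
    (%n. \<integral>om. F (X n om) \<partial>M) ----> (LINT om|W. F (Z om))"
 shows "converges_in_distribution M X W Z"
proof -
 interpret M: prob_space M by fact
 interpret W: prob_space W by fact
 have bdi: "integrable Q (%om. F (V om))" if "prob_space Q" "V : borel_measurable Q" "continuous_on UNIV F" "!!x. \<bar>F x\<bar> <= C"
  for Q :: "'e measure" and V and F :: "'c => real" and C
 proof -
  interpret prob_space Q by fact
  show ?thesis
   by (rule integrable_const_bound[of _ C]) (use that in "auto intro: measurable_compose[OF _ borel_measurable_continuous_onI]")
 qed
 have low: "EX n0. ALL n>=n0. (LINT om|W. F (Z om)) - r < (LINT om|M. F (X n om))"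
  if F: "continuous_on UNIV F" "!!x. \<bar>F x\<bar> <= C" and r: "0 < r" for F :: "'c => real" and C r
 proof -
  define G where "G k x = (INF y. F y + real k * dist x y)" for k :: nat and x
  note ic = inf_convolution[OF F, folded G_def]
  have Gb: "\<bar>G k x\<bar> <= C" for k x using ic(1,2)[of k x] F(2)[of x] by linarith
  have Gc: "continuous_on UNIV (G k)" for k
  proof -
   have "(real k)-lipschitz_on UNIV (G k)" by (rule lipschitz_onI) (use ic(3) in "auto simp: dist_real_def")
   thus ?thesis by (rule lipschitz_on_continuous_on)
  qed
  have "(%k. \<integral>om. G k (Z om) \<partial>W) ----> (LINT om|W. F (Z om))"
  proof (rule integral_dominated_convergence[where w = "%_. C"])
   show "(%om. F (Z om)) : borel_measurable W" "(%om. G k (Z om)) : borel_measurable W" for k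
    by (rule measurable_compose[OF Z borel_measurable_continuous_onI], rule F(1) Gc)+
  qed (auto simp: ic(4) Gb)
  from LIMSEQ_D[OF this, of "r / 2"] r obtain k where k: "\<bar>(LINT om|W. G k (Z om)) - (LINT om|W. F (Z om))\<bar> < r / 2" by auto
  have "(%n. \<integral>om. G k (X n om) \<partial>M) ----> (LINT om|W. G k (Z om))" by (rule L[OF Gb ic(3) _ Gc]) simp
  from LIMSEQ_D[OF this, of "r / 2"] r obtain n0 where n0: "!!n. n0 <= n ==> \<bar>(LINT om|M. G k (X n om)) - (LINT om|W. G k (Z om))\<bar> < r / 2" by auto
  have le: "(LINT om|M. G k (X n om)) <= (LINT om|M. F (X n om))" for n
   by (rule integral_mono[OF bdi[OF P(1) X Gc Gb] bdi[OF P(1) X F] ic(1)])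
  have "(LINT om|W. F (Z om)) - r < (LINT om|M. F (X n om))" if "n0 <= n" for n
   using k n0[OF that] le[of n] unfolding abs_less_iff by linarith
  thus ?thesis by blast
 qed
 have "(%n. \<integral>om. F (X n om) \<partial>M) ----> (LINT om|W. F (Z om))" if F: "continuous_on UNIV F" "bounded (range F)" for F :: "'c => real"
 proof (rule LIMSEQ_I)
  fix r :: real assume r: "0 < r"
  obtain C where C: "!!x. \<bar>F x\<bar> <= C" using F(2) unfolding bounded_iff by auto
  obtain n1 where n1: "!!n. n1 <= n ==> (LINT om|W. F (Z om)) - r < (LINT om|M. F (X n om))" using low[OF F(1) C r] by blast
  have "continuous_on UNIV (%x. - F x)" "!!x. \<bar>- F x\<bar> <= C" using F(1) C by (auto intro: continuous_intros)
  from low[OF this r] obtain n2 where n2: "!!n. n2 <= n ==> - (LINT om|W. F (Z om)) - r < - (LINT om|M. F (X n om))" by auto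
  have "norm ((LINT om|M. F (X n om)) - (LINT om|W. F (Z om))) < r" if "max n1 n2 <= n" for n
   using n1[of n] n2[of n] that by auto
  thus "EX n0. ALL n>=n0. norm ((LINT om|M. F (X n om)) - (LINT om|W. F (Z om))) < r" by blast
 qed
 thus ?thesis unfolding converges_in_distribution_def using X Z by blast
qed

subsection \<open>Ottaviani's inequality\<close>

text \<open>Split according to the first index \<open>i\<close> at which the partial sum exceeds
  \<open>ep\<close>. The later increment is independent of it and with probability at least
  \<open>1 / 2\<close> too small to bring the final sum back below \<open>ep / 2\<close>.\<close>

lemma (in prob_space) ottaviani:
 fixes xi :: "nat => 'a => real" and N :: nat
 assumes ind: "indep_vars (%_. borel) xi UNIV"
 defines "S \<equiv> %i om. SUM l<i. xi l om"
 assumes half: "!!i. i <= N ==> prob {om:space M. \<bar>S N om - S i om\<bar> > ep / 2} <= 1 / 2"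
 shows "prob {om:space M. EX i<=N. \<bar>S i om\<bar> > ep} <= 2 * prob {om:space M. \<bar>S N om\<bar> > ep / 2}"
proof -
 have xm [measurable]: "xi l : borel_measurable M" for l using ind by (simp add: indep_vars_def2)
 have Sm [measurable]: "S i : borel_measurable M" for i unfolding S_def by measurable
 define A where "A i = {om:space M. \<bar>S i om\<bar> > ep & (ALL j<i. \<bar>S j om\<bar> <= ep)}" for i
 define G where "G i = {om:space M. \<bar>S N om - S i om\<bar> <= ep / 2}" for i
 have AM [measurable]: "A i : events" and GM [measurable]: "G i : events" for i unfolding A_def G_def by measurable
 have gh: "1 / 2 <= prob (G i)" if "i <= N" for i
 proof -
  have "G i = space M - {om:space M. \<bar>S N om - S i om\<bar> > ep / 2}" by (auto simp: G_def)
  thus ?thesis using half[OF that] by (simp add: prob_compl)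
 qed
 have AG: "prob (A i Int G i) = prob (A i) * prob (G i)" if i: "i <= N" for i
 proof -
  let ?L = "{..<i}" and ?R = "{i..<N}"
  define P where "P = {x : space (PiM ?L (%_. borel :: real measure)). \<bar>SUM l<i. x l\<bar> > ep & (ALL j<i. \<bar>SUM l<j. x l\<bar> <= ep)}"
  define Q where "Q = {x : space (PiM ?R (%_. borel :: real measure)). \<bar>SUM l:?R. x l\<bar> <= ep / 2}"
  have sm: "(%x. SUM l<j. x l) : borel_measurable (PiM ?L (%_. borel :: real measure))" if "j <= i" for j
   by (intro borel_measurable_sum measurable_component_singleton) (use that in auto)
  have Pm: "P : sets (PiM ?L (%_. borel))" unfolding P_def
   by (intro sets.sets_Collect_conj sets.sets_Collect_finite_All')
    (use sm in "auto intro!: borel_measurable_less borel_measurable_le borel_measurable_abs")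
  have "(%x. SUM l:?R. x l) : borel_measurable (PiM ?R (%_. borel :: real measure))"
   by (intro borel_measurable_sum measurable_component_singleton)
  hence Qm: "Q : sets (PiM ?R (%_. borel))" unfolding Q_def by measurable
  let ?l = "%om. restrict (%l. xi l om) ?L" and ?r = "%om. restrict (%l. xi l om) ?R"
  have iv: "indep_var (PiM ?L (%_. borel)) ?l (PiM ?R (%_. borel)) ?r"
   by (rule indep_var_restrict[OF ind]) auto
  have d: "S N om - S i om = (SUM l:?R. xi l om)" for om
   unfolding S_def lessThan_atLeast0 using i by (simp add: sum_diff_nat_ivl)
  have 1: "?l -` P Int space M = A i"
  proof -
   have "(SUM l<j. ?l om l) = S j om" if "j <= i" for j om
    unfolding S_def by (intro sum.cong) (use that in auto)
   thus ?thesis unfolding A_def P_def by (auto simp: space_PiM less_imp_le)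
  qed
  have 2: "?r -` Q Int space M = G i"
   unfolding G_def Q_def d by (auto simp: space_PiM)
  have "(%om. (?l om, ?r om)) -` (P \<times> Q) Int space M = A i Int G i"
   using 1 2 by auto
  thus ?thesis using indep_varD[OF iv Pm Qm] 1 2 by simp
 qed
 have dj: "disjoint_family_on A {..N}"
  unfolding disjoint_family_on_def
 proof (intro ballI impI)
  fix i j :: nat assume "i ~= j"
  thus "A i Int A j = {}" unfolding A_def
   by (cases i j rule: linorder_cases) (auto dest!: leD)
 qed
 have "{om:space M. EX i<=N. \<bar>S i om\<bar> > ep} <= (UN i<=N. A i)"
 proof
  fix om assume w: "om : {om:space M. EX i<=N. \<bar>S i om\<bar> > ep}"
  define i where "i = (LEAST i. \<bar>S i om\<bar> > ep)"
  obtain i' where i': "i' <= N" "\<bar>S i' om\<bar> > ep" using w by blast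
  have "\<bar>S i om\<bar> > ep" "i <= i'" unfolding i_def using i'(2) by (auto intro: LeastI Least_le)
  moreover have "\<bar>S j om\<bar> <= ep" if "j < i" for j using not_less_Least[of j "%i. \<bar>S i om\<bar> > ep"] that unfolding i_def by force
  ultimately show "om : (UN i<=N. A i)" using w i'(1) by (auto simp: A_def)
 qed
 hence "prob {om:space M. EX i<=N. \<bar>S i om\<bar> > ep} <= prob (UN i<=N. A i)" by (rule finite_measure_mono) measurable
 also have "... = (SUM i<=N. prob (A i))" by (rule finite_measure_finite_Union[OF _ _ dj]) (use AM in auto)
 also have "... <= (SUM i<=N. 2 * prob (A i Int G i))"
 proof (rule sum_mono)
  fix i assume "i : {..N}"
  hence i: "i <= N" by simp
  have "prob (A i) * 1 <= prob (A i) * (2 * prob (G i))" by (rule mult_left_mono) (use gh[OF i] in auto)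
  thus "prob (A i) <= 2 * prob (A i Int G i)" using AG[OF i] by simp
 qed
 also have "... = 2 * prob (UN i<=N. A i Int G i)"
 proof -
  have "disjoint_family_on (%i. A i Int G i) {..N}" using dj unfolding disjoint_family_on_def by blast
  thus ?thesis by (subst finite_measure_finite_Union) (use AM GM in "auto simp: sum_distrib_left")
 qed
 also have "prob (UN i<=N. A i Int G i) <= prob {om:space M. \<bar>S N om\<bar> > ep / 2}"
 proof (rule finite_measure_mono)
  show "(UN i<=N. A i Int G i) <= {om:space M. \<bar>S N om\<bar> > ep / 2}"
  proof
   fix om assume "om : (UN i<=N. A i Int G i)"
   then obtain i where "om : space M" "\<bar>S i om\<bar> > ep" "\<bar>S N om - S i om\<bar> <= ep / 2" by (auto simp: A_def G_def)
   moreover from this(2,3) have "\<bar>S N om\<bar> > ep / 2" by linarith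
   ultimately show "om : {om:space M. \<bar>S N om\<bar> > ep / 2}" by simp
  qed
 qed measurable
 finally show ?thesis by simp
qed

section \<open>Restriction and rescaling of cadlag paths\<close>

lemma cadlag_on_subset: "cadlag_on T f ==> S <= T ==> cadlag_on S f"
 unfolding cadlag_on_def by (meson Int_mono order_refl subsetD tendsto_within_subset)

lemma cadlag_rescale:
 fixes f :: "real => real"
 assumes f: "cadlag_on {0..} f" and c: "0 <= c"
 shows "cadlag_on {0..} (%t. (f (c * t) - w * (c * t)) / r)"
proof (cases "c = 0")
 case True thus ?thesis by (simp add: cadlag_on_const)
next
 case False
 hence c: "0 < c" using c by simp
 have tr: "((%t. (f (c * t) - w * (c * t)) / r) \<longlongrightarrow> (l - w * (c * t)) / r) (at t within {0..} Int S)"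
  if l: "(f \<longlongrightarrow> l) (at (c * t) within {0..} Int S')" and S: "!!s. s : S ==> c * s : S'" for S S' l t
 proof -
  have "filterlim (%t. c * t) (at (c * t) within {0..} Int S') (at t within {0..} Int S)"
   unfolding filterlim_at
   by (intro conjI tendsto_intros) (use c S in "auto simp: eventually_at_filter intro!: always_eventually")
  from filterlim_compose[OF l this] show ?thesis
   unfolding divide_inverse by (intro tendsto_intros)
 qed
 show ?thesis
  unfolding cadlag_on_def
 proof (intro ballI conjI)
  fix t :: real assume t: "t : {0..}"
  hence ct: "c * t : {0..}" using c by simp
  show "((%t. (f (c * t) - w * (c * t)) / r) \<longlongrightarrow> (f (c * t) - w * (c * t)) / r) (at t within {0..} Int {t<..})"
   by (rule tr[where S' = "{c * t<..}"]) (use f ct c in "auto simp: cadlag_on_def")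
  obtain l where "(f \<longlongrightarrow> l) (at (c * t) within {0..} Int {..<c * t})" using f ct unfolding cadlag_on_def by blast
  from tr[OF this, of "{..<t}"] c show "EX l. ((%t. (f (c * t) - w * (c * t)) / r) \<longlongrightarrow> l) (at t within {0..} Int {..<t})" by auto
 qed
qed

subsection \<open>Step approximations of processes with independent increments\<close>

text \<open>Cutting the summation at \<open>m\<close> changes nothing on \<open>[0,1]\<close> and
  makes the functional depend on finitely many coordinates.\<close>

definition step_functional :: "(skorokhod => real) => nat => (nat => real) => real" where
 "step_functional F m f = F (skorokhod_of (step_path m (%k. SUM l<min k m. f l)))"

lemma step_path_cong:
 assumes "!!k. k <= m ==> u k = w k" shows "skorokhod_of (step_path m u) = skorokhod_of (step_path m w)"
proof -
 have "step_path m u t = step_path m w t" if t: "t : {0..1}" for t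
 proof -
  have "real m * t <= real m" using t by (simp add: mult_left_le)
  hence "nat \<lfloor>real m * t\<rfloor> <= m" by (simp add: nat_le_iff floor_le_iff)
  thus ?thesis unfolding step_path_def by (rule assms)
 qed
 hence "restrict (step_path m u) {0..1} = restrict (step_path m w) {0..1}" by (rule restrict_ext)
 thus ?thesis unfolding skorokhod_of_def by simp
qed

lemma step_functional_measurable:
 assumes F: "continuous_on UNIV F"
 shows "step_functional F m : borel_measurable (PiM {..<m} (%_. borel))"
proof -
 have "(%f. SUM l<min k m. f l) : borel_measurable (PiM {..<m} (%_. borel :: real measure))" for k
  by (intro borel_measurable_sum measurable_component_singleton) auto
 from measurable_compose[OF step_path_measurable[OF this] borel_measurable_continuous_onI[OF F]]
 show ?thesis unfolding step_functional_def[abs_def] .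
qed

text \<open>For equally distributed independent increments the expectation is an integral over a
  finite product of the law of one increment. The rescaled position and Brownian motion are compared
  in this form.\<close>

lemma (in prob_space) step_expectation:
 fixes Z :: "'a => real => real"
 defines "xi \<equiv> %m l om. Z om (real (Suc l) / real m) - Z om (real l / real m)"
 assumes m: "0 < m" and Z0: "AE om in M. Z om 0 = 0" and F: "continuous_on UNIV F"
  and ind: "indep_vars (%_. borel) (xi m) UNIV" and law: "!!l. distr M borel (xi m l) = ka"
  and Zm: "!!t. 0 <= t ==> (%om. Z om t) : borel_measurable M"
 shows "(LINT om|M. F (step_of m (Z om))) = (\<integral>f. step_functional F m f \<partial>(PiM {..<m} (%_. ka)))"
proof -
 have xm: "xi m l : borel_measurable M" for l using ind by (simp add: indep_vars_def2)
 have sf: "step_functional F m : borel_measurable (PiM {..<m} (%_. borel))" by (rule step_functional_measurable[OF F])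
 have Fm: "(%om. F (step_of m (Z om))) : borel_measurable M"
  by (intro measurable_compose[OF step_path_measurable borel_measurable_continuous_onI[OF F]] Zm) simp
 have rm: "(%om. \<lambda>l\<in>{..<m}. xi m l om) : measurable M (PiM {..<m} (%_. borel))" by (intro measurable_restrict xm)
 have "(LINT om|M. F (step_of m (Z om))) = (LINT om|M. step_functional F m (\<lambda>l\<in>{..<m}. xi m l om))"
 proof (rule integral_cong_AE[OF Fm measurable_compose[OF rm sf]])
  show "AE om in M. F (step_of m (Z om)) = step_functional F m (\<lambda>l\<in>{..<m}. xi m l om)"
   using Z0
  proof eventually_elim
   fix om assume z: "Z om 0 = 0"
   have "Z om (real k / real m) = (SUM l<k. xi m l om)" for k
    using sum_lessThan_telescope[of "%l. Z om (real l / real m)" k] z by (simp add: xi_def)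
   hence "step_of m (Z om) = skorokhod_of (step_path m (%k. SUM l<min k m. (\<lambda>l\<in>{..<m}. xi m l om) l))"
    by (intro step_path_cong) (simp add: min_absorb1)
   thus "F (step_of m (Z om)) = step_functional F m (\<lambda>l\<in>{..<m}. xi m l om)" by (simp add: step_functional_def)
  qed
 qed
 also have "... = (\<integral>f. step_functional F m f \<partial>(distr M (PiM {..<m} (%_. borel)) (%om. \<lambda>l\<in>{..<m}. xi m l om)))"
  by (rule integral_distr[OF rm sf, symmetric])
 also have "distr M (PiM {..<m} (%_. borel)) (%om. \<lambda>l\<in>{..<m}. xi m l om) = PiM {..<m} (%l. distr M borel (xi m l))"
  by (rule indep_vars_iff_distr_eq_PiM'[THEN iffD1, OF _ xm indep_vars_subset[OF ind]]) (use m in auto)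
 finally show ?thesis unfolding law .
qed

text \<open>Skorohod's representation is applied to the law of a single increment. Independent
  copies of it on a product space represent all \<open>m\<close> increments with pointwise
  convergence, and dominated convergence applies.\<close>

lemma step_functional_limit:
 fixes \<mu> :: "nat => real measure"
 assumes rd: "!!n. real_distribution (\<mu> n)" "real_distribution ka" and w: "weak_conv_m \<mu> ka"
  and F: "continuous_on UNIV F" "!!x. \<bar>F x\<bar> <= C"
 shows "(%n. \<integral>f. step_functional F m f \<partial>(PiM {..<m} (%_. \<mu> n))) ----> (\<integral>f. step_functional F m f \<partial>(PiM {..<m} (%_. ka)))"
proof -
 obtain \<Omega> :: "real measure" and V :: "nat => real => real" and U where S: "prob_space \<Omega>" "!!n. V n : measurable \<Omega> borel" "!!n. distr \<Omega> borel (V n) = \<mu> n"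
  "U : measurable \<Omega> lborel" "distr \<Omega> borel U = ka" "!!x. x : space \<Omega> ==> (%n. V n x) ----> U x"
  using Skorohod[OF rd w] by blast
 have Um: "U : measurable \<Omega> borel" using S(4) by simp
 interpret P: product_prob_space "%_::nat. \<Omega>" "{..<m}" using S(1) by (intro product_prob_spaceI)
 have sets_rd: "sets \<nu> = sets borel" if "real_distribution \<nu>" for \<nu> :: "real measure"
  using that by (simp add: real_distribution_def real_distribution_axioms_def)
 have eq: "(\<integral>f. step_functional F m f \<partial>(PiM {..<m} (%_. \<nu>))) = (\<integral>x. step_functional F m (compose {..<m} T x) \<partial>(PiM {..<m} (%_. \<Omega>)))"
  and cm: "(%x. step_functional F m (compose {..<m} T x)) : borel_measurable (PiM {..<m} (%_. \<Omega>))"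
  if T: "T : measurable \<Omega> borel" "distr \<Omega> borel T = \<nu>" "real_distribution \<nu>" for T \<nu>
 proof -
  have Pn: "product_prob_space (%_::nat. \<nu>)" using T(3) by (intro product_prob_spaceI) (simp add: real_distribution_def)
  have Tm: "T : measurable \<Omega> \<nu>" using T(1) measurable_cong_sets[OF refl sets_rd[OF T(3)]] by blast
  have "distr \<Omega> \<nu> T = distr \<Omega> borel T" by (rule distr_cong) (simp_all add: sets_rd[OF T(3)])
  hence d: "distr (PiM {..<m} (%_. \<Omega>)) (PiM {..<m} (%_. \<nu>)) (compose {..<m} T) = PiM {..<m} (%_. \<nu>)"
   using distr_PiM_finite_prob_space[OF finite_lessThan P.product_prob_space_axioms Pn Tm] T(2) by simp
  have ps: "sets (PiM {..<m} (%_. \<nu>)) = sets (PiM {..<m} (%_. borel))" by (intro sets_PiM_cong sets_rd[OF T(3)] refl)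
  have sf: "step_functional F m : borel_measurable (PiM {..<m} (%_. \<nu>))"
   using step_functional_measurable[OF F(1)] measurable_cong_sets[OF ps refl] by blast
  have co: "compose {..<m} T : measurable (PiM {..<m} (%_. \<Omega>)) (PiM {..<m} (%_. \<nu>))"
   unfolding compose_def by (intro measurable_restrict measurable_compose[OF _ Tm] measurable_component_singleton)
  show "(%x. step_functional F m (compose {..<m} T x)) : borel_measurable (PiM {..<m} (%_. \<Omega>))"
   by (rule measurable_compose[OF co sf])
  show "(\<integral>f. step_functional F m f \<partial>(PiM {..<m} (%_. \<nu>))) = (\<integral>x. step_functional F m (compose {..<m} T x) \<partial>(PiM {..<m} (%_. \<Omega>)))"
   by (subst d[symmetric]) (rule integral_distr[OF co sf])
 qed
 have "(%n. \<integral>x. step_functional F m (compose {..<m} (V n) x) \<partial>(PiM {..<m} (%_. \<Omega>))) ---->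
   (\<integral>x. step_functional F m (compose {..<m} U x) \<partial>(PiM {..<m} (%_. \<Omega>)))"
 proof (rule integral_dominated_convergence[where w = "%_. C"])
  show "AE x in PiM {..<m} (%_. \<Omega>). (%n. step_functional F m (compose {..<m} (V n) x)) ----> step_functional F m (compose {..<m} U x)"
  proof (rule AE_I2)
   fix x assume x: "x : space (PiM {..<m} (%_. \<Omega>))"
   have l: "(%n. compose {..<m} (V n) x l) ----> compose {..<m} U x l" if "l < m" for l
    using S(6)[of "x l"] x that by (auto simp: compose_def space_PiM PiE_iff)
   have "(%n k. SUM l<min k m. compose {..<m} (V n) x l) ----> (%k. SUM l<min k m. compose {..<m} U x l)"
    unfolding limitin_canonical_iff[symmetric] euclidean_product_topology[symmetric] limitin_componentwise
    by (intro conjI ballI) (auto intro!: tendsto_sum l)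
   from continuous_on_tendsto_compose[OF continuous_on_compose2[OF F(1) step_path_continuous[of m] subset_UNIV] this]
   show "(%n. step_functional F m (compose {..<m} (V n) x)) ----> step_functional F m (compose {..<m} U x)"
    by (simp add: step_functional_def)
  qed
 qed (use cm[OF S(2,3) rd(1)] cm[OF Um S(5) rd(2)] F(2) in "auto simp: step_functional_def")
 thus ?thesis unfolding eq[OF S(2,3) rd(1)] eq[OF Um S(5) rd(2)] .
qed

subsection \<open>Convergence of rescaled Levy processes\<close>

lemma exp_near_zero: "EX d>0. ALL z::complex. cmod z < d --> cmod (exp z - 1) <= 2 * cmod z"
proof -
 have "((%z. (exp z - exp 0) / (z - 0)) \<longlongrightarrow> exp 0) (at (0::complex))" using DERIV_exp[of 0] unfolding has_field_derivative_iff .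
 from tendstoD[OF this, of 1] obtain d where d: "0 < d" "!!z::complex. z ~= 0 ==> cmod z < d ==> cmod ((exp z - 1) / z - 1) < 1"
  by (auto simp: eventually_at dist_norm)
 have "cmod (exp z - 1) <= 2 * cmod z" if "cmod z < d" for z
 proof (cases "z = 0")
  case False
  have "cmod ((exp z - 1) / z) <= cmod ((exp z - 1) / z - 1) + cmod (1::complex)" by (rule order_trans[OF _ norm_triangle_ineq]) simp
  hence "cmod ((exp z - 1) / z) <= 2" using d(2)[OF False that] by simp
  thus ?thesis using False by (simp add: norm_divide field_simps)
 qed simp
 thus ?thesis using d(1) by blast
qed

text \<open>Bounded approximations of the square whose expectations are given by the characteristic
  function.\<close>

lemma one_minus_cos_limit: "(%k. 2 * (1 - cos (x / real (Suc k))) * (real (Suc k))\<^sup>2) ----> x\<^sup>2"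
proof -
 have e: "2 * (1 - cos (x / N)) * N\<^sup>2 = (2 * N * sin (x / (2 * N)))\<^sup>2" for N :: real
  using cos_double_sin[of "x / (2 * N)"] by (simp add: power_mult_distrib)
 have "(%k. 2 * real (Suc k) * sin (x / (2 * real (Suc k)))) ----> x"
 proof -
  have "((%y. sin (x * y)) has_real_derivative x) (at 0)" by (auto intro!: derivative_eq_intros)
  hence 1: "((%y. sin (x * y) / y) \<longlongrightarrow> x) (at 0)" by (simp add: has_field_derivative_iff)
  have "(%k. inverse (2 * real (Suc k))) ----> 0"
   using tendsto_mult_left[OF LIMSEQ_inverse_real_of_nat, of "1/2"] by (simp add: field_simps)
  hence "filterlim (%k. inverse (2 * real (Suc k))) (at 0) sequentially"
   by (intro filterlim_atI) (auto intro!: always_eventually)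
  from filterlim_compose[OF 1 this] show ?thesis by (simp add: field_simps)
 qed
 thus ?thesis unfolding e by (rule tendsto_power)
qed

definition gauss :: "real => real measure" where "gauss c = distr std_normal_distribution borel (%x. c * x)"

lemma gauss: "real_distribution (gauss c)" "char (gauss c) th = exp (- (c * th)\<^sup>2 / 2)"
proof -
 interpret real_distribution std_normal_distribution by (rule real_dist_normal_dist)
 show "real_distribution (gauss c)" unfolding gauss_def by (rule real_distribution_distr) simp
 have "char (gauss c) th = char std_normal_distribution (th * c)"
  unfolding char_def gauss_def by (subst integral_distr) (auto simp: mult_ac)
 thus "char (gauss c) th = exp (- (c * th)\<^sup>2 / 2)" by (simp add: char_std_normal_distribution mult.commute exp_of_real)
qed

text \<open>A bounded continuous majorant of the indicator of values beyond \<open>c\<close>, so it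
  passes to weak limits. The fourth power makes its Gaussian value quadratic in the variance, hence
  still small after multiplication by the number of grid intervals.\<close>

definition tail4 :: "real => real measure => real" where "tail4 c mu = (LINT x|mu. min 1 ((x / c) ^ 4))"

lemma gauss_tail:
 assumes e: "0 < ep"
 shows "tail4 ep (gauss c) <= 3 * c ^ 4 / ep ^ 4"
proof -
 interpret real_distribution std_normal_distribution by (rule real_dist_normal_dist)
 have "tail4 ep (gauss c) = (LINT x|std_normal_distribution. min 1 ((c * x / ep) ^ 4))"
  unfolding tail4_def gauss_def by (subst integral_distr) auto
 also have "... <= (LINT x|std_normal_distribution. (c / ep) ^ 4 * x ^ 4)"
 proof (rule integral_mono)
  show "integrable std_normal_distribution (%x. min 1 ((c * x / ep) ^ 4))"
   by (rule integrable_const_bound[of _ 1]) auto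
  show "integrable std_normal_distribution (%x. (c / ep) ^ 4 * x ^ 4)"
   using integrable_std_normal_distribution_moment[of 4] by simp
  show "min 1 ((c * x / ep) ^ 4) <= (c / ep) ^ 4 * x ^ 4" for x by (simp add: power_mult_distrib power_divide)
 qed
 also have "... = (c / ep) ^ 4 * 3"
  using std_normal_distribution_even_moments(1)[of 2] by (simp add: fact_numeral)
 finally show ?thesis by (simp add: power_divide mult.commute)
qed

lemma brownian_step:
 assumes B: "standard_brownian_motion W B" and s: "0 <= s" "s < t" and D: "0 < D"
 shows "distr W borel (%om. sqrt D * B om t - sqrt D * B om s) = gauss (sqrt (D * (t - s)))"
proof -
 interpret prob_space W using B by (simp add: standard_brownian_motion_def)
 have d: "distributed W lborel (%om. B om t - B om s) (normal_density 0 (sqrt (t - s)))"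
  using B s by (simp add: standard_brownian_motion_def)
 have st: "0 < sqrt (t - s)" using s by simp
 have d1: "distributed W lborel (%om. (B om t - B om s - 0) / sqrt (t - s)) std_normal_density"
  using normal_standard_normal_convert[OF st, of "%om. B om t - B om s" 0] d by blast
 define V where "V om = (B om t - B om s) / sqrt (t - s)" for om
 have dV: "distributed W lborel V std_normal_density" using d1 by (simp add: V_def[abs_def])
 have Vm: "V : borel_measurable W" using distributed_measurable[OF dV] by simp
 have law: "distr W lborel V = std_normal_distribution" using distributed_distr_eq_density[OF dV] by simp
 have law': "distr W borel V = distr std_normal_distribution borel (%x. x)"
  unfolding law[symmetric] using Vm by (subst distr_distr) (auto simp: comp_def)
 have "distr W borel (%om. sqrt D * B om t - sqrt D * B om s) = distr W borel (%om. sqrt (D * (t - s)) * V om)"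
 proof (rule distr_cong)
  have "sqrt (D * (t - s)) * V om = sqrt D * (B om t - B om s)" for om unfolding V_def real_sqrt_mult using st by simp
  thus "sqrt D * B om t - sqrt D * B om s = sqrt (D * (t - s)) * V om" for om by (simp only: right_diff_distrib)
 qed simp_all
 also have "... = distr (distr W borel V) borel (%x. sqrt (D * (t - s)) * x)"
  using Vm by (subst distr_distr) (auto simp: comp_def)
 also have "... = gauss (sqrt (D * (t - s)))"
  unfolding law' gauss_def by (subst distr_distr) (auto simp: comp_def)
 finally show ?thesis .
qed

text \<open>All that the limit theorem uses of the tag: a Levy process with exponent
  \<open>\<psi>\<close> whose expansion at \<open>0\<close> has drift \<open>v\<close> and variance
  \<open>D\<close>, with a uniform quadratic bound and a cubic error.\<close>

locale levy_clt = prob_space M for M :: "'a measure" +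
 fixes X :: "'a => real => real" and \<psi> :: "real => complex" and v D K :: real
 assumes D: "0 < D"
  and Xm: "!!t. 0 <= t ==> (%om. X om t) : borel_measurable M"
  and Xc: "!!om. om : space M ==> cadlag_on {0..} (X om)"
  and X0: "AE om in M. X om 0 = 0"
  and Xi: "!!ta :: nat => real. 0 <= ta 0 ==> incseq ta ==> indep_vars (%_. borel) (%i om. X om (ta (Suc i)) - X om (ta i)) UNIV"
  and Xchar: "!!s t th. 0 <= s ==> s <= t ==> (LINT om|M. iexp (th * (X om t - X om s))) = exp ((t - s) * \<psi> th)"
  and psi2: "!!th. cmod (\<psi> th - \<i> * cx (v * th)) <= D * th\<^sup>2 / 2"
  and psi3: "!!th. cmod (\<psi> th - \<i> * cx (v * th) + cx (D * th\<^sup>2 / 2)) <= K * \<bar>th\<bar> ^ 3"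
begin

definition Z :: "nat => 'a => real => real" where "Z n om t = (X om (real n * t) - v * (real n * t)) / sqrt (real n)"
definition expo :: "nat => real => complex" where
 "expo n th = n * (\<psi> (th / sqrt n) - \<i> * cx (v * (th / sqrt n)))"

lemma Zm [measurable]: "0 <= t ==> (%om. Z n om t) : borel_measurable M"
 unfolding Z_def using Xm[of "real n * t"] by simp

lemma Zc: "om : space M ==> cadlag_on {0..} (Z n om)"
 unfolding Z_def[abs_def] by (rule cadlag_rescale[OF Xc]) simp_all

lemma Z0: "AE om in M. Z n om 0 = 0" using X0 by eventually_elim (simp add: Z_def)

lemma Zi:
 fixes ta :: "nat => real"
 assumes "0 <= ta 0" "incseq ta"
 shows "indep_vars (%_. borel) (%i om. Z n om (ta (Suc i)) - Z n om (ta i)) UNIV"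
proof -
 have "indep_vars (%_. borel) (%i om. X om (real n * ta (Suc i)) - X om (real n * ta i)) UNIV"
  using assms by (intro Xi) (auto simp: incseq_def mult_left_mono)
 from indep_vars_compose2[OF this, of "%i x. (x - v * (real n * (ta (Suc i) - ta i))) / sqrt n" "%_. borel"]
 show ?thesis unfolding Z_def by (simp add: algebra_simps diff_divide_distrib add_divide_distrib)
qed

lemma Zchar:
 assumes n: "0 < n" and s: "0 <= s" "s <= t"
 shows "(LINT om|M. iexp (th * (Z n om t - Z n om s))) = exp ((t - s) * expo n th)"
proof -
 define r where "r = th / sqrt n"
 have e: "iexp (th * (Z n om t - Z n om s)) = iexp (r * (X om (n * t) - X om (n * s))) * iexp (- (v * r * (n * (t - s))))" for om
 proof -
  have "th * (Z n om t - Z n om s) = r * (X om (n * t) - X om (n * s)) + - (v * r * (n * (t - s)))"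
   unfolding Z_def r_def by (simp add: diff_divide_distrib right_diff_distrib mult_ac)
  thus ?thesis by (simp only: of_real_add distrib_left exp_add)
 qed
 have "(LINT om|M. iexp (th * (Z n om t - Z n om s))) = exp ((real n * t - real n * s) * \<psi> r) * iexp (- (v * r * (n * (t - s))))"
  unfolding e using Xchar[of "real n * s" "real n * t" r] s by (subst integral_mult_left_zero) (simp add: mult_left_mono)
 also have "... = exp ((t - s) * expo n th)"
  unfolding exp_add[symmetric] expo_def r_def[symmetric] by (simp add: algebra_simps)
 finally show ?thesis by simp
qed

lemma expo_bound: assumes n: "0 < n" shows "cmod (expo n th) <= D * th\<^sup>2 / 2"
proof -
 have "cmod (expo n th) = n * cmod (\<psi> (th / sqrt n) - \<i> * cx (v * (th / sqrt n)))" by (simp add: expo_def norm_mult)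
 also have "... <= n * (D * (th / sqrt n)\<^sup>2 / 2)" by (intro mult_left_mono psi2) simp
 also have "... = D * th\<^sup>2 / 2" using n by (simp add: power_divide)
 finally show ?thesis .
qed

lemma expo_limit: "(%n. expo (Suc n) th) ----> - cx (D * th\<^sup>2 / 2)"
proof -
 have b: "cmod (expo (Suc n) th - - cx (D * th\<^sup>2 / 2)) <= K * \<bar>th\<bar> ^ 3 * inverse (sqrt (real (Suc n)))" for n
 proof -
  let ?n = "real (Suc n)"
  have "expo (Suc n) th - - cx (D * th\<^sup>2 / 2) =
    cx ?n * (\<psi> (th / sqrt ?n) - \<i> * cx (v * (th / sqrt ?n)) + cx (D * (th / sqrt ?n)\<^sup>2 / 2))"
  proof -
   have "D * th\<^sup>2 / 2 = N * (D * (th / sqrt N)\<^sup>2 / 2)" if "0 < N" for N using that by (simp add: power_divide)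
   hence "D * th\<^sup>2 / 2 = ?n * (D * (th / sqrt ?n)\<^sup>2 / 2)" by (metis of_nat_0_less_iff zero_less_Suc)
   thus ?thesis unfolding expo_def by (simp only: of_real_mult distrib_left diff_minus_eq_add)  simp
  qed
  hence "cmod (expo (Suc n) th - - cx (D * th\<^sup>2 / 2)) <= ?n * (K * \<bar>th / sqrt ?n\<bar> ^ 3)"
   using mult_left_mono[OF psi3[of "th / sqrt ?n"], of ?n] by (simp only: norm_mult norm_of_real) simp
  also have "... = K * \<bar>th\<bar> ^ 3 * inverse (sqrt ?n)"
  proof -
   have "N * (K * \<bar>th / sqrt N\<bar> ^ 3) = K * \<bar>th\<bar> ^ 3 * inverse (sqrt N)" if N: "0 < N" for N
   proof -
    have c: "sqrt N ^ 3 = N * sqrt N" using N by (simp add: power3_eq_cube)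
    have a: "\<bar>th / sqrt N\<bar> = \<bar>th\<bar> / sqrt N" using N by (simp add: abs_divide)
    show ?thesis unfolding a power_divide c using N by (simp add: field_simps)
   qed
   thus ?thesis by (metis of_nat_0_less_iff zero_less_Suc)
  qed
  finally show ?thesis .
 qed
 have "(%n. inverse (sqrt (real (Suc n)))) ----> 0"
  using tendsto_real_sqrt[OF LIMSEQ_inverse_real_of_nat] by (simp add: real_sqrt_inverse)
 hence "(%n. K * \<bar>th\<bar> ^ 3 * inverse (sqrt (real (Suc n)))) ----> 0" by (rule tendsto_mult_right_zero)
 from Lim_null_comparison[OF always_eventually[OF allI[OF b]] this] show ?thesis by (rule LIM_zero_cancel)
qed

text \<open>Existence of the moment is not assumed. Fatou applied to the cosine approximations
  bounds it through the characteristic function; the factor 2 is the loss in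
  \<open>exp_near_zero\<close>.\<close>

lemma second_moment:
 assumes n: "0 < n" and s: "0 <= s" "s <= t"
 shows "(\<integral>\<^sup>+om. ennreal ((Z n om t - Z n om s)\<^sup>2) \<partial>M) <= ennreal (2 * (t - s) * D)"
proof -
 define h where "h = t - s"
 define x where "x om = Z n om t - Z n om s" for om
 have h0: "0 <= h" using s by (simp add: h_def)
 have xm [measurable]: "x : borel_measurable M" unfolding x_def[abs_def] by (intro borel_measurable_diff Zm) (use s in auto)
 obtain d where d: "0 < d" "!!z::complex. cmod z < d ==> cmod (exp z - 1) <= 2 * cmod z" using exp_near_zero by blast
 define f where "f k om = 2 * (1 - cos (x om / real (Suc k))) * (real (Suc k))\<^sup>2" for k om
 have f0: "0 <= f k om" for k om by (simp add: f_def)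
 have fm [measurable]: "f k : borel_measurable M" for k unfolding f_def[abs_def] by measurable
 have fi: "integrable M (f k)" for k
 proof (rule integrable_const_bound[of _ "4 * (real (Suc k))\<^sup>2"])
  have "f k om <= 4 * (real (Suc k))\<^sup>2" for om
  proof -
   have "2 * (1 - cos y) <= 2 * (1 - (- 1))" for y :: real by (intro mult_left_mono diff_left_mono) auto
   hence "2 * (1 - cos y) <= 4" for y :: real by simp
   thus ?thesis unfolding f_def by (intro mult_right_mono) auto
  qed
  thus "AE om in M. norm (f k om) <= 4 * (real (Suc k))\<^sup>2" using f0 by simp
 qed measurable
 have ef: "(LINT om|M. f k om) = 2 * (real (Suc k))\<^sup>2 * (1 - Re (exp (h * expo n (1 / real (Suc k)))))" for k
 proof -
  have ci: "integrable M (%om. iexp (x om / real (Suc k)))" by (rule integrable_const_bound[of _ 1]) auto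
  have "(LINT om|M. cos (x om / real (Suc k))) = (LINT om|M. Re (iexp (x om / real (Suc k))))"
   by (intro Bochner_Integration.integral_cong refl) (simp only: Re_exp, simp)
  also have "... = Re (LINT om|M. iexp (x om / real (Suc k)))" by (rule integral_Re[OF ci])
  also have "(LINT om|M. iexp (x om / real (Suc k))) = exp (h * expo n (1 / real (Suc k)))"
   using Zchar[OF n s, of "1 / real (Suc k)"] by (simp add: x_def h_def)
  finally have c: "(LINT om|M. cos (x om / real (Suc k))) = Re (exp (h * expo n (1 / real (Suc k))))" .
  have "integrable M (%om. cos (x om / real (Suc k)))" by (rule integrable_const_bound[of _ 1]) auto
  thus ?thesis unfolding f_def c[symmetric] by (simp add: prob_space)
 qed
 have wl: "(%k. h * D * (1 / real (Suc k))\<^sup>2 / 2) ----> h * D * 0\<^sup>2 / 2"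
  using LIMSEQ_inverse_real_of_nat by (intro tendsto_intros) (simp_all add: inverse_eq_divide)
 have zb: "cmod (h * expo n (1 / real (Suc k))) <= h * D * (1 / real (Suc k))\<^sup>2 / 2" for k
  using mult_left_mono[OF expo_bound[OF n, of "1 / real (Suc k)"] h0] h0 by (simp add: norm_mult)
 have "eventually (%k. h * D * (1 / real (Suc k))\<^sup>2 / 2 < d) sequentially"
  using order_tendstoD(2)[OF wl, of d] d(1) by simp
 hence ev: "eventually (%k. (LINT om|M. f k om) <= 2 * h * D) sequentially"
 proof eventually_elim
  case (elim k)
  let ?z = "cx h * expo n (1 / real (Suc k))"
  have "1 - Re (exp ?z) <= cmod (exp ?z - 1)" using complex_Re_le_cmod[of "1 - exp ?z"] by (simp add: norm_minus_commute)
  also have "... <= 2 * cmod ?z" by (rule d(2)) (use zb[of k] elim in linarith)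
  also have "... <= 2 * (h * D * (1 / real (Suc k))\<^sup>2 / 2)" by (intro mult_left_mono zb) simp
  finally have "2 * (real (Suc k))\<^sup>2 * (1 - Re (exp ?z)) <= 2 * (real (Suc k))\<^sup>2 * (2 * (h * D * (1 / real (Suc k))\<^sup>2 / 2))"
   by (intro mult_left_mono) auto
  also have "... = 2 * h * D" by (simp add: power_divide)
  finally show ?case unfolding ef .
 qed
 have "(\<integral>\<^sup>+om. ennreal ((x om)\<^sup>2) \<partial>M) = (\<integral>\<^sup>+om. liminf (%k. ennreal (f k om)) \<partial>M)"
  unfolding f_def by (intro nn_integral_cong lim_imp_Liminf[symmetric] tendsto_ennrealI one_minus_cos_limit) simp
 also have "... <= liminf (%k. \<integral>\<^sup>+om. ennreal (f k om) \<partial>M)" by (rule nn_integral_liminf) measurable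
 also have "... = liminf (%k. ennreal (LINT om|M. f k om))" using fi f0 by (simp add: nn_integral_eq_integral)
 also have "... <= limsup (%k. ennreal (LINT om|M. f k om))" by (rule Liminf_le_Limsup) simp
 also have "... <= ennreal (2 * h * D)" by (rule Limsup_bounded) (use ev in "auto elim!: eventually_mono intro: ennreal_leI")
 finally show ?thesis by (simp add: x_def h_def)
qed

lemma tail_bound:
 assumes n: "0 < n" and s: "0 <= s" "s <= t" and e: "0 < de"
 shows "prob {om:space M. \<bar>Z n om t - Z n om s\<bar> > de} <= 2 * (t - s) * D / de\<^sup>2"
proof -
 let ?x = "%om. Z n om t - Z n om s"
 have t: "0 <= t" using s by simp
 have xm [measurable]: "?x : borel_measurable M" using s t by measurable
 have "ennreal (prob {om:space M. \<bar>?x om\<bar> > de} * de\<^sup>2) = (\<integral>\<^sup>+om. ennreal (de\<^sup>2) * indicator {om:space M. \<bar>?x om\<bar> > de} om \<partial>M)"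
  by (subst nn_integral_cmult_indicator) (auto simp: emeasure_eq_measure ennreal_mult mult.commute)
 also have "... <= (\<integral>\<^sup>+om. ennreal ((?x om)\<^sup>2) \<partial>M)"
  by (rule nn_integral_mono) (use e in "auto simp: indicator_def abs_le_square_iff[symmetric] intro!: ennreal_leI")
 also have "... <= ennreal (2 * (t - s) * D)" by (rule second_moment[OF n s])
 finally have "prob {om:space M. \<bar>?x om\<bar> > de} * de\<^sup>2 <= 2 * (t - s) * D"
  by (subst (asm) ennreal_le_iff) (use s D in auto)
 thus ?thesis using e by (simp add: pos_le_divide_eq)
qed

text \<open>Ottaviani on dyadic grids, then monotone convergence; right continuity transfers an
  exceedance at any time to a nearby grid point. \<open>B\<close> is a measurable cover of an event
  that involves uncountably many times. The condition on \<open>h\<close> makes the Chebyshev bound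
  \<open>2 * h * D / (ep / 2) ^ 2\<close> at most \<open>1 / 2\<close>.\<close>

lemma oscillation_bound:
 assumes n: "0 < n" and a: "0 <= a" and h: "0 < h" and e: "0 < ep" "16 * h * D <= ep\<^sup>2"
 shows "EX B:events. {om:space M. EX t. a <= t & t < a + h & \<bar>Z n om t - Z n om a\<bar> > ep} <= B &
  prob B <= 2 * prob {om:space M. \<bar>Z n om (a + h) - Z n om a\<bar> > ep / 2}"
proof -
 define p where "p j i = a + real i * (h / 2 ^ j)" for i j :: nat
 have p0: "0 <= p j i" for i j unfolding p_def using a h by simp
 have pe: "p j (2 ^ j) = a + h" and pa: "p j 0 = a" for j by (simp_all add: p_def)
 have pm: "incseq (p j)" for j unfolding p_def incseq_def using h by (intro allI impI add_left_mono mult_right_mono) auto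
 define G where "G j = {om:space M. EX i<=2^j. \<bar>Z n om (p j i) - Z n om a\<bar> > ep}" for j
 have GM: "G j : events" for j
 proof -
  have "G j = (UN i<=2^j. {om:space M. \<bar>Z n om (p j i) - Z n om a\<bar> > ep})" by (auto simp: G_def)
  also have "... : events" using Zm[OF a] Zm[OF p0] by (intro sets.finite_UN) auto
  finally show ?thesis .
 qed
 have Gb: "prob (G j) <= 2 * prob {om:space M. \<bar>Z n om (a + h) - Z n om a\<bar> > ep / 2}" for j
 proof -
  let ?xi = "%i om. Z n om (p j (Suc i)) - Z n om (p j i)"
  have ind: "indep_vars (%_. borel) ?xi UNIV" by (rule Zi[OF p0 pm])
  have S: "(SUM l<i. ?xi l om) = Z n om (p j i) - Z n om a" for i om
   using sum_lessThan_telescope[of "%l. Z n om (p j l)" i] by (simp add: pa)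
  have "prob {om:space M. EX i<=2^j. \<bar>SUM l<i. ?xi l om\<bar> > ep} <= 2 * prob {om:space M. \<bar>SUM l<2^j. ?xi l om\<bar> > ep / 2}"
  proof (rule ottaviani[OF ind])
   fix i :: nat assume i: "i <= 2 ^ j"
   have le: "p j i <= a + h" using incseqD[OF pm[of j] i] pe[of j] by simp
   have "prob {om:space M. \<bar>Z n om (a + h) - Z n om (p j i)\<bar> > ep / 2} <= 2 * (a + h - p j i) * D / (ep / 2)\<^sup>2"
    by (rule tail_bound[OF n p0 le]) (use e in simp)
   also have "... <= 2 * h * D / (ep / 2)\<^sup>2"
    using incseqD[OF pm, of 0 i] pa D by (intro divide_right_mono mult_right_mono mult_left_mono) auto
   also have "... <= 1 / 2" using e by (simp add: power_divide field_simps)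
   finally show "prob {om:space M. \<bar>(SUM l<2^j. ?xi l om) - (SUM l<i. ?xi l om)\<bar> > ep / 2} <= 1 / 2"
    unfolding S pe by simp
  qed
  thus ?thesis unfolding S pe G_def .
 qed
 have inc: "incseq G"
  unfolding incseq_Suc_iff
 proof (intro allI subsetI)
  fix j om assume "om : G j"
  then obtain i where i: "om : space M" "i <= 2 ^ j" "\<bar>Z n om (p j i) - Z n om a\<bar> > ep" by (auto simp: G_def)
  have "p (Suc j) (2 * i) = p j i" by (simp add: p_def)
  thus "om : G (Suc j)" using i unfolding G_def by (auto intro!: exI[of _ "2 * i"])
 qed
 have "(%j. prob (G j)) ----> prob (UN j. G j)" by (rule finite_Lim_measure_incseq[OF _ inc]) (use GM in auto)
 hence 1: "prob (UN j. G j) <= 2 * prob {om:space M. \<bar>Z n om (a + h) - Z n om a\<bar> > ep / 2}"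
  by (rule LIMSEQ_le_const2) (use Gb in blast)
 have 2: "{om:space M. EX t. a <= t & t < a + h & \<bar>Z n om t - Z n om a\<bar> > ep} <= (UN j. G j)"
 proof
  fix om assume "om : {om:space M. EX t. a <= t & t < a + h & \<bar>Z n om t - Z n om a\<bar> > ep}"
  then obtain t where w: "om : space M" and t: "a <= t" "t < a + h" "\<bar>Z n om t - Z n om a\<bar> > ep" by blast
  have "(Z n om \<longlongrightarrow> Z n om t) (at t within {0..} Int {t<..})" using Zc[OF w, of n] t a by (simp add: cadlag_on_def)
  from tendstoD[OF this, of "\<bar>Z n om t - Z n om a\<bar> - ep"] t(3)
  obtain d where d: "0 < d" "!!s. 0 <= s ==> t < s ==> s < t + d ==> \<bar>Z n om s - Z n om t\<bar> < \<bar>Z n om t - Z n om a\<bar> - ep"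
   by (auto simp: eventually_at dist_real_def)
  \<comment> \<open>A grid point less than \<open>b\<close> after \<open>t\<close> still sees the
    exceedance by right continuity, and it lies before \<open>a + h\<close>, so its index is
    admissible.\<close>
  define b where "b = min d (a + h - t)"
  have b: "0 < b" using d(1) t(2) by (simp add: b_def)
  obtain j where "h / b < 2 ^ j" using real_arch_pow[of 2 "h / b"] by auto
  hence hj: "h / 2 ^ j < b" using b by (simp add: field_simps)
  define i where "i = nat \<lceil>(t - a) / (h / 2 ^ j)\<rceil>"
  have c0: "0 < h / 2 ^ j" using h by simp
  have q: "0 <= (t - a) / (h / 2 ^ j)" using t h by simp
  have ir: "(t - a) / (h / 2 ^ j) <= real i" "real i < (t - a) / (h / 2 ^ j) + 1" unfolding i_def using q by linarith+
  have "t - a <= real i * (h / 2 ^ j)" using ir(1) c0 by (simp only: pos_divide_le_eq)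
  moreover have "real i * (h / 2 ^ j) < t - a + h / 2 ^ j"
  proof -
   have "real i * (h / 2 ^ j) < ((t - a) / (h / 2 ^ j) + 1) * (h / 2 ^ j)" by (rule mult_strict_right_mono[OF ir(2) c0])
   thus ?thesis using h unfolding distrib_right by simp
  qed
  ultimately
  have ps: "t <= p j i" "p j i < t + b" using hj unfolding p_def by linarith+
  have "p j i < p j (2 ^ j)" using ps(2) unfolding pe b_def by simp
  hence i2: "i <= 2 ^ j" using incseqD[OF pm, of "2 ^ j" i] by (meson leI less_imp_le not_less)
  have "\<bar>Z n om (p j i) - Z n om a\<bar> > ep"
  proof (cases "p j i = t")
   case False
   hence "\<bar>Z n om (p j i) - Z n om t\<bar> < \<bar>Z n om t - Z n om a\<bar> - ep" using d(2)[OF p0, of j i] ps by (simp add: b_def)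
   thus ?thesis by linarith
  qed (use t in simp)
  thus "om : (UN j. G j)" using w i2 by (auto simp: G_def)
 qed
 show ?thesis by (rule bexI[of _ "UN j. G j"]) (use 1 2 GM in auto)
qed

end

lemma fourth_tail:
 assumes "real_distribution ka" and d: "0 < de"
 shows "measure ka {y. de < \<bar>y\<bar>} <= tail4 de ka"
proof -
 interpret real_distribution ka by fact
 have A: "{y. de < \<bar>y\<bar>} : events" by simp
 have "measure ka {y. de < \<bar>y\<bar>} = (LINT y|ka. indicator {y. de < \<bar>y\<bar>} y)" by simp
 also have "... <= (LINT y|ka. min 1 ((y / de) ^ 4))"
 proof (rule integral_mono)
  show "integrable ka (indicator {y. de < \<bar>y\<bar>} :: real => real)" using A by (intro integrable_real_indicator) (auto simp: emeasure_eq_measure)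
  show "integrable ka (%y. min 1 ((y / de) ^ 4))" by (rule integrable_const_bound[of _ 1]) auto
  show "indicator {y. de < \<bar>y\<bar>} y <= min 1 ((y / de) ^ 4)" for y
  proof (cases "de < \<bar>y\<bar>")
   case True
   hence "1 <= \<bar>y / de\<bar> ^ 4" using d by (intro one_le_power) (simp add: abs_divide)
   hence "1 <= \<bar>(y / de) ^ 4\<bar>" by (simp only: power_abs)
   moreover have "0 <= (y / de) ^ 4" by simp
   ultimately have "1 <= (y / de) ^ 4" by (simp only: abs_of_nonneg)
   thus ?thesis by (simp add: indicator_def)
  qed simp
 qed
 finally show ?thesis by (simp add: tail4_def)
qed

context levy_clt
begin

definition law :: "nat => real => real measure" where "law n h = distr M borel (%om. Z n om h - Z n om 0)"

text \<open>Stationarity: the characteristic function of an increment depends on its length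
  only.\<close>

lemma law:
 assumes "0 <= h"
 shows "real_distribution (law n h)" "0 < n ==> char (law n h) th = exp (h * expo n th)"
  "0 < n ==> 0 <= s ==> distr M borel (%om. Z n om (s + h) - Z n om s) = law n h"
proof -
 have dm: "(%om. Z n om (s + h) - Z n om s) : borel_measurable M" if "0 <= s" for s
  by (intro borel_measurable_diff Zm) (use assms that in auto)
 have rd: "real_distribution (distr M borel (%om. Z n om (s + h) - Z n om s))" if "0 <= s" for s
  by (rule real_distribution_distr[OF dm[OF that]])
 have ch: "char (distr M borel (%om. Z n om (s + h) - Z n om s)) th = exp (h * expo n th)" if "0 <= s" "0 < n" for s th
  unfolding char_def using Zchar[OF that(2,1), of "s + h" th] assms by (subst integral_distr[OF dm[OF that(1)]]) auto
 have l0: "law n h = distr M borel (%om. Z n om (0 + h) - Z n om 0)" by (simp add: law_def)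
 show "real_distribution (law n h)" unfolding l0 by (rule rd) simp
 show "char (law n h) th = exp (h * expo n th)" if "0 < n" unfolding l0 by (rule ch[OF order_refl that])
 show "distr M borel (%om. Z n om (s + h) - Z n om s) = law n h" if n: "0 < n" and s: "0 <= s"
  unfolding l0 by (rule Levy_uniqueness[OF rd[OF s] rd[OF order_refl]]) (simp add: fun_eq_iff ch[OF s n] ch[OF order_refl n, simplified])
qed

lemma law_weak: assumes h: "0 <= h" shows "weak_conv_m (%n. law (Suc n) h) (gauss (sqrt (D * h)))"
proof (rule levy_continuity[OF law(1)[OF h] gauss(1)])
 fix th
 have "(%n. exp (h * expo (Suc n) th)) ----> exp (h * (- cx (D * th\<^sup>2 / 2)))"
  by (intro tendsto_intros expo_limit)
 also have "exp (h * (- cx (D * th\<^sup>2 / 2))) = char (gauss (sqrt (D * h))) th"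
  unfolding gauss(2) using D h by (simp add: power_mult_distrib exp_of_real[symmetric] mult_ac)
 finally show "(%n. char (law (Suc n) h) th) ----> char (gauss (sqrt (D * h))) th" by (simp add: law(2)[OF h])
qed

text \<open>Off a bad event the path stays within \<open>ep\<close> of its step approximation, which
  costs \<open>L * ep\<close>. Each of the \<open>m\<close> grid intervals contributes at most
  \<open>2 * tail\<close> to the probability of the bad event, on which the values differ by at most
  \<open>2 * C\<close>.\<close>

lemma approximation_error:
 fixes F :: "skorokhod => real"
 assumes n: "0 < n" and m: "0 < m" and e: "0 < ep" "16 * (1 / real m) * D <= ep\<^sup>2"
  and F: "continuous_on UNIV F" "!!x. \<bar>F x\<bar> <= C" "!!x y. \<bar>F x - F y\<bar> <= L * dist x y" "0 <= L"
 shows "\<bar>(LINT om|M. F (skorokhod_of (Z n om))) - (LINT om|M. F (step_of m (Z n om)))\<bar>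
   <= L * ep + 4 * C * m * tail4 (ep / 2) (law n (1 / real m))"
proof -
 define a b where "a om = F (skorokhod_of (Z n om))" and "b om = F (step_of m (Z n om))" for om
 define h where "h = 1 / real m"
 have h: "0 < h" "real m * h = 1" using m by (simp_all add: h_def)
 define tail where "tail = tail4 (ep / 2) (law n h)"
 have C: "0 <= C" using F(2)[of undefined] by linarith
 define E where "E k = {om:space M. EX t. real k * h <= t & t < real k * h + h & \<bar>Z n om t - Z n om (real k * h)\<bar> > ep}" for k
 define p where "p k = 2 * prob {om:space M. \<bar>Z n om (real k * h + h) - Z n om (real k * h)\<bar> > ep / 2}" for k
 have "EX B. B : events & E k <= B & prob B <= p k" for k
  using oscillation_bound[OF n _ h(1) e(1), of "real k * h"] h e(2) unfolding E_def p_def h_def by auto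
 from choice[OF allI[OF this]] obtain B where "ALL k. B k : events & E k <= B k & prob (B k) <= p k" ..
 hence B: "B k : events" "E k <= B k" "prob (B k) <= p k" for k by blast+
 have tl: "prob {om:space M. \<bar>Z n om (real k * h + h) - Z n om (real k * h)\<bar> > ep / 2} <= tail" for k
 proof -
  have k0: "0 <= real k * h" using h by simp
  define x where "x om = Z n om (real k * h + h) - Z n om (real k * h)" for om
  have xm: "x : borel_measurable M" unfolding x_def[abs_def] using h k0 by (intro borel_measurable_diff Zm) auto
  have "law n h = distr M borel x" using law(3)[OF less_imp_le[OF h(1)] n k0] by (simp add: x_def[abs_def])
  moreover have "{y :: real. ep / 2 < \<bar>y\<bar>} : sets borel" by measurable
  ultimately have "prob {om:space M. \<bar>x om\<bar> > ep / 2} = measure (law n h) {y. ep / 2 < \<bar>y\<bar>}"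
   using xm by (simp add: measure_distr vimage_def Int_def conj_commute)
  also have "... <= tail" unfolding tail_def by (rule fourth_tail[OF law(1)]) (use h e in auto)
  finally show ?thesis unfolding x_def .
 qed
 define A where "A = (UN k<m. B k)"
 have AM: "A : events" unfolding A_def using B(1) by auto
 have "prob A <= (SUM k<m. prob (B k))" unfolding A_def by (rule finite_measure_subadditive_finite) (use B(1) in auto)
 also have "... <= (SUM k<m. 2 * tail)" by (intro sum_mono order_trans[OF B(3)]) (unfold p_def, intro mult_left_mono tl, simp)
 finally have pA: "prob A <= 2 * real m * tail" by simp
 have close: "\<bar>a om - b om\<bar> <= L * ep + 2 * C * indicator A om" if w: "om : space M" for om
 proof (cases "om : A")
  case True
  thus ?thesis using F(2)[of "skorokhod_of (Z n om)"] F(2)[of "step_of m (Z n om)"] mult_nonneg_nonneg[OF F(4) less_imp_le[OF e(1)]] by (simp add: a_def b_def)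
 next
  case False
  have c: "cadlag_on {0..1} (Z n om)" by (rule cadlag_on_subset[OF Zc[OF w]]) auto
  have "skorokhod_close (Z n om) (step_path m (%k. Z n om (real k / real m))) ep"
  proof (rule skorokhod_close_uniform)
   fix t :: real assume t: "t : {0..1}"
   define k where "k = nat \<lfloor>real m * t\<rfloor>"
   have kr: "real k = of_int \<lfloor>real m * t\<rfloor>" using t by (simp add: k_def)
   have kt: "real k <= real m * t" "real m * t < real k + 1" unfolding kr by linarith+
   have sp: "step_path m (%k. Z n om (real k / real m)) t = Z n om (real k * h)" by (simp add: step_path_def k_def h_def)
   have th: "real k * h <= t" "t < real k * h + h" using kt m by (simp_all add: h_def field_simps)
   have "real m * t <= real m" using t by (simp add: mult_left_le)
   hence "k <= m" using kt(1) by simp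
   then consider "k < m" | "k = m" by linarith
   thus "\<bar>Z n om t - step_path m (%k. Z n om (real k / real m)) t\<bar> <= ep"
   proof cases
    case 1
    hence "om ~: B k" using False by (auto simp: A_def)
    thus ?thesis unfolding sp using B(2)[of k] th w unfolding E_def by force
   next
    case 2
    hence "t = 1" using th t h by simp
    thus ?thesis unfolding sp using 2 h e by simp
   qed
  qed (use e in simp)
  hence "dist (skorokhod_of (Z n om)) (step_of m (Z n om)) <= ep" by (rule dist_skorokhod_of_le[OF c step_path_cadlag])
  from mult_left_mono[OF this F(4)] show ?thesis
   using F(3)[of "skorokhod_of (Z n om)" "step_of m (Z n om)"] False by (simp add: a_def b_def)
 qed
 have m1: "a : borel_measurable M" unfolding a_def[abs_def]
  by (intro measurable_compose[OF skorokhod_of_measurable borel_measurable_continuous_onI[OF F(1)]] Zm cadlag_on_subset[OF Zc]) auto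
 have m2: "b : borel_measurable M" unfolding b_def[abs_def]
  by (intro measurable_compose[OF step_path_measurable borel_measurable_continuous_onI[OF F(1)]] Zm) simp
 have i1: "integrable M a" "integrable M b"
  by (rule integrable_const_bound[of _ C], use F(2) m1 m2 in "auto simp: a_def b_def")+
 have "\<bar>(LINT om|M. a om) - (LINT om|M. b om)\<bar> =
   \<bar>\<integral>om. a om - b om \<partial>M\<bar>" using i1 by simp
 also have "... <= (LINT om|M. \<bar>a om - b om\<bar>)" by (rule integral_abs_bound)
 also have "... <= (LINT om|M. L * ep + 2 * C * indicator A om)"
 proof (rule integral_mono)
  show "integrable M (%om. L * ep + 2 * C * indicator A om)"
   using AM by (intro Bochner_Integration.integrable_add integrable_const integrable_mult_right integrable_real_indicator) (auto simp: emeasure_eq_measure)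
 qed (use i1 close in auto)
 also have "... = L * ep + 2 * C * prob A"
  using AM by (subst Bochner_Integration.integral_add) (auto simp: prob_space Int_absorb1 sets.sets_into_space emeasure_eq_measure)
 also have "... <= L * ep + 2 * C * (2 * real m * tail)" using pA C by (intro add_left_mono mult_left_mono) auto
 finally show ?thesis by (simp add: tail_def h_def a_def b_def)
qed

text \<open>The grid is fixed before \<open>n\<close> grows: for a fixed \<open>m\<close> only the
  convergence of one increment is needed, and the error of the grid is bounded, in the limit, by
  Gaussian tails. Indices are shifted to \<open>Suc n\<close> because the scaling degenerates at
  \<open>0\<close>.\<close>

theorem convergence:
 assumes B: "standard_brownian_motion W B"
 shows "converges_in_distribution M (%n om. skorokhod_of (Z n om)) W (%om. skorokhod_of (%t. sqrt D * B om t))"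
proof -
 interpret W: prob_space W using B by (simp add: standard_brownian_motion_def)
 define V where "V om t = sqrt D * B om t" for om t
 have Vm: "(%om. V om t) : borel_measurable W" if "0 <= t" for t
 proof -
  have "(%om. B om t) : borel_measurable W" using B that unfolding standard_brownian_motion_def by blast
  thus ?thesis unfolding V_def by measurable
 qed
 have Vc: "cadlag_on {0..1} (V om)" if w: "om : space W" for om
 proof -
  have "continuous_on {0..} (V om)" using B w unfolding V_def[abs_def] standard_brownian_motion_def by (auto intro: continuous_intros)
  hence "(V om \<longlongrightarrow> V om t) (at t within {0..1} Int S)" if "t : {0..1}" for t S
   using that unfolding continuous_on_def by (auto intro: tendsto_within_subset)
  thus ?thesis unfolding cadlag_on_def by blast
 qed
 have V0: "AE om in W. V om 0 = 0" using B by (intro AE_I2) (simp add: V_def standard_brownian_motion_def)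
 have Zc1: "cadlag_on {0..1} (Z n om)" if "om : space M" for n om by (rule cadlag_on_subset[OF Zc[OF that]]) auto
 have Zsm: "(%om. skorokhod_of (Z n om)) : borel_measurable M" for n by (rule skorokhod_of_measurable[OF Zm Zc1])
 have Vsm: "(%om. skorokhod_of (V om)) : borel_measurable W" by (rule skorokhod_of_measurable[OF Vm Vc])
 have "converges_in_distribution M (%n om. skorokhod_of (Z n om)) W (%om. skorokhod_of (V om))"
 proof (rule lipschitz_suffices[OF prob_space_axioms W.prob_space_axioms Zsm Vsm])
  fix F :: "skorokhod => real" and C L :: real
  assume F: "!!x. \<bar>F x\<bar> <= C" "!!x y. \<bar>F x - F y\<bar> <= L * dist x y" "0 <= L" "continuous_on UNIV F"
  have C: "0 <= C" using F(1)[of undefined] by linarith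
  let ?a = "%n. \<integral>om. F (skorokhod_of (Z n om)) \<partial>M" and ?am = "%m n. \<integral>om. F (step_of m (Z n om)) \<partial>M"
  let ?b = "\<integral>om. F (skorokhod_of (V om)) \<partial>W" and ?bm = "%m. \<integral>om. F (step_of m (V om)) \<partial>W"
  have grid: "(%n. ?am m (Suc n)) ----> ?bm m" if m: "0 < m" for m
  proof -
   define t where "t l = real l / real m" for l
   have t: "0 <= t l" "t (Suc l) = t l + 1 / real m" "t l < t (Suc l)" "incseq t" for l
    using m by (auto simp: t_def field_simps incseq_def divide_right_mono)
   have h: "0 <= 1 / real m" by simp
   have 1: "?am m (Suc n) = (\<integral>f. step_functional F m f \<partial>(PiM {..<m} (%_. law (Suc n) (1 / real m))))" for n
    by (rule step_expectation[where Z = "Z (Suc n)", OF m Z0 F(4) _ _ Zm])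
     (use Zi[OF t(1,4), of "Suc n"] law(3)[OF h zero_less_Suc t(1), folded t(2)] in "simp_all add: t_def")
   have iB: "W.indep_vars (%_. borel) (%i om. V om (t (Suc i)) - V om (t i)) UNIV"
   proof -
    have "W.indep_vars (%_. borel) (%i om. B om (t (Suc i)) - B om (t i)) UNIV"
     using B t(1,4) unfolding standard_brownian_motion_def by blast
    from W.indep_vars_compose2[OF this, of "%_ x. sqrt D * x" "%_. borel"] show ?thesis by (simp add: V_def right_diff_distrib)
   qed
   have lB: "distr W borel (%om. V om (t (Suc i)) - V om (t i)) = gauss (sqrt (D * (1 / real m)))" for i
   proof -
    have "t (Suc i) - t i = 1 / real m" using t(2)[of i] by simp
    thus ?thesis unfolding V_def brownian_step[OF B t(1,3) D] by (simp only:)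
   qed
   have 2: "?bm m = (\<integral>f. step_functional F m f \<partial>(PiM {..<m} (%_. gauss (sqrt (D * (1 / real m))))))"
    by (rule W.step_expectation[where Z = V, OF m V0 F(4) _ _ Vm]) (use iB lB in "simp_all add: t_def")
   show ?thesis unfolding 1 2 by (rule step_functional_limit[OF law(1)[OF h] gauss(1) law_weak[OF h] F(4,1)])
  qed
  have refine: "?bm ----> ?b"
  proof (rule integral_dominated_convergence[where w = "%_. C"])
   show "(%om. F (skorokhod_of (V om))) : borel_measurable W" by (rule measurable_compose[OF Vsm borel_measurable_continuous_onI[OF F(4)]])
   show "(%om. F (step_of m (V om))) : borel_measurable W" for m
    by (intro measurable_compose[OF step_path_measurable borel_measurable_continuous_onI[OF F(4)]] Vm) simp
   show "AE om in W. (%m. F (step_of m (V om))) ----> F (skorokhod_of (V om))"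
    by (intro AE_I2 continuous_on_tendsto_compose[OF F(4) step_of_tendsto[OF Vc]]) auto
  qed (use F(1) in auto)
  have "(%n. ?a (Suc n)) ----> ?b"
  proof (rule LIMSEQ_I)
   fix r :: real assume r: "0 < r"
   define ep where "ep = r / (4 * (L + 1))"
   have e: "0 < ep" using r F(3) by (simp add: ep_def)
   have Le: "L * ep <= r / 4" using r F(3) by (simp add: ep_def field_simps)
   obtain m1 where m1: "!!m. m1 <= m ==> \<bar>?bm m - ?b\<bar> < r / 4" using LIMSEQ_D[OF refine, of "r / 4"] r by auto
   \<comment> \<open>The first term is the condition of \<open>approximation_error\<close>. The
     second makes \<open>m\<close> Gaussian tails small: \<open>gauss_tail\<close> with variance
     \<open>D / m\<close> and level \<open>ep / 2\<close> gives the constant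
     \<open>192 = 4 * 3 * 16\<close> and a total of order \<open>1 / m\<close>.\<close>
   obtain m2 :: nat where m2: "16 * D / ep\<^sup>2 + 192 * C * D\<^sup>2 / ep ^ 4 * 4 / r < real m2" using reals_Archimedean2 by blast
   define m where "m = max (max m1 m2) 1"
   have m: "0 < m" "m1 <= m" and mr: "real m2 <= real m" by (auto simp: m_def)
   have p: "0 <= 16 * D / ep\<^sup>2" "0 <= 192 * C * D\<^sup>2 / ep ^ 4 * 4 / r" using D C r e by auto
   have "16 * D / ep\<^sup>2 < real m" "192 * C * D\<^sup>2 / ep ^ 4 * 4 / r < real m" using m2 mr p by linarith+
   hence me: "16 * (1 / real m) * D <= ep\<^sup>2" and mt: "192 * C * D\<^sup>2 / ep ^ 4 / real m < r / 4"
    using e m r by (simp_all add: field_simps)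
   let ?q = "%n. tail4 (ep / 2) (law n (1 / real m))"
   have "(%n. ?q (Suc n)) ----> tail4 (ep / 2) (gauss (sqrt (D * (1 / real m))))"
    unfolding tail4_def by (rule weak_conv_imp_integral_bdd_continuous_conv[OF law(1) gauss(1) law_weak, of _ _ 1])
     (auto intro!: continuous_intros simp: e less_imp_neq[OF e, symmetric])
   hence "(%n. 4 * C * m * ?q (Suc n)) ----> 4 * C * m * tail4 (ep / 2) (gauss (sqrt (D * (1 / real m))))"
    by (rule tendsto_mult_left)
   moreover have "4 * C * m * tail4 (ep / 2) (gauss (sqrt (D * (1 / real m)))) < r / 4"
   proof -
    have "4 * C * m * tail4 (ep / 2) (gauss (sqrt (D * (1 / real m)))) <= 4 * C * m * (3 * sqrt (D * (1 / real m)) ^ 4 / (ep / 2) ^ 4)"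
     using C e by (intro mult_left_mono gauss_tail) auto
    also have "sqrt (D * (1 / real m)) ^ 4 = (D / real m)\<^sup>2"
     using D power_mult[of "sqrt (D * (1 / real m))" 2 2] by simp
    also have "4 * C * m * (3 * (D / real m)\<^sup>2 / (ep / 2) ^ 4) = 192 * C * D\<^sup>2 / ep ^ 4 / real m"
     using m e by (simp add: power_divide power2_eq_square field_simps)
    finally show ?thesis using mt by linarith
   qed
   ultimately have ev1: "eventually (%n. 4 * C * m * ?q (Suc n) < r / 4) sequentially" by (rule order_tendstoD(2))
   have ev2: "eventually (%n. \<bar>?am m (Suc n) - ?bm m\<bar> < r / 4) sequentially"
    using tendstoD[OF grid[OF m(1)], of "r / 4"] r by (simp add: dist_real_def)
   have "eventually (%n. norm (?a (Suc n) - ?b) < r) sequentially"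
    using ev1 ev2
   proof eventually_elim
    case (elim n)
    have "\<bar>?a (Suc n) - ?am m (Suc n)\<bar> <= L * ep + 4 * C * m * ?q (Suc n)"
     by (rule approximation_error[OF zero_less_Suc m(1) e me F(4,1,2,3)])
    thus ?case using elim m1[OF m(2)] Le unfolding real_norm_def by linarith
   qed
   thus "EX n0. ALL n>=n0. norm (?a (Suc n) - ?b) < r" unfolding eventually_sequentially .
  qed
  thus "?a ----> ?b" by (rule LIMSEQ_imp_Suc)
 qed
 thus ?thesis by (simp add: V_def[abs_def])
qed

end

context toom
begin

lemma diff_const_eq: "diff_const = tagged_diffusivity lp lm p \<eta>"
 unfolding diff_const_def tagged_diffusivity_def Let_def hole_def site_wt_def fwd_def bwd_def by simp

theorem tagged_clt:
 assumes nz: "lp ~= 0 \<or> lm ~= 0" and B: "standard_brownian_motion W B"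
 shows "converges_in_distribution M
  (%n om. skorokhod_of (%t. (real_of_int (Y om (real n * t)) - tagged_speed lp lm p \<eta> * (real n * t)) / sqrt (real n)))
  W (%om. skorokhod_of (%t. sqrt (tagged_diffusivity lp lm p \<eta>) * B om t))"
proof -
 have cad: "cadlag_on {0..} (%t. real_of_int (f t))" if f: "cadlag_on {0..} f" for f :: "real => int"
 proof -
  have "((%t. real_of_int (f t)) \<longlongrightarrow> real_of_int l) F" if "(f \<longlongrightarrow> l) F" for l F
   by (rule tendsto_eventually) (use that in "auto simp: tendsto_discrete elim: eventually_mono")
  thus ?thesis using f unfolding cadlag_on_def by blast
 qed
 interpret X: levy_clt M "%om t. real_of_int (Y om t)" psi speed diff_const third_const
 proof
  show "0 < diff_const" unfolding diff_const_eq by (rule tagged_diffusivity_pos[OF lp lm p01 nz])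
  show "AE om in M. real_of_int (Y om 0) = 0" using AE_good by eventually_elim (simp add: good_def)
  show "cadlag_on {0..} (%t. real_of_int (Y om t))" if "om : space M" for om
   using tagged that by (intro cad) (simp add: push_tagged_position_def)
  show "(LINT om|M. iexp (th * (real_of_int (Y om t) - real_of_int (Y om s)))) = exp ((t - s) * psi th)"
   if "0 <= s" "s <= t" for s t th using char_increment[OF that] by simp
 qed (use measurable_real_Y indep_increments psi_second psi_third in auto)
 show ?thesis
  using X.convergence[OF B] unfolding X.Z_def[abs_def] unfolding speed_eq diff_const_eq .
qed

end

theorem theorem1p1:
  fixes lp lm p :: real and \<eta> :: sign
  assumes "0 \<le> lp" "0 \<le> lm" "lp \<noteq> 0 \<or> lm \<noteq> 0" "0 < p" "p < 1"
  shows "\<exists>D>0. \<forall>(M :: 'a measure) N \<sigma> Y (W :: 'b measure) B.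
    toom_process M lp lm (uniform_measure (Ber p) {s. s 0 = \<eta>}) N \<sigma> \<longrightarrow>
    push_tagged_position M N \<sigma> 0 Y \<longrightarrow>
    standard_brownian_motion W B \<longrightarrow>
    converges_in_distribution M
      (\<lambda>n \<omega>. skorokhod_of (\<lambda>t. (real_of_int (Y \<omega> (real n * t)) - tagged_speed lp lm p \<eta> * (real n * t)) / sqrt (real n)))
      W (\<lambda>\<omega>. skorokhod_of (\<lambda>t. sqrt D * B \<omega> t))"
proof (intro exI[of _ "tagged_diffusivity lp lm p \<eta>"] conjI allI impI)
  show "0 < tagged_diffusivity lp lm p \<eta>" by (rule tagged_diffusivity_pos) (use assms in auto)
  fix M :: "'a measure" and N \<sigma> Y and W :: "'b measure" and B
  assume "toom_process M lp lm (uniform_measure (Ber p) {s. s 0 = \<eta>}) N \<sigma>" "push_tagged_position M N \<sigma> 0 Y"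
  then interpret toom M lp lm p \<eta> N \<sigma> Y using assms by unfold_locales
  assume "standard_brownian_motion W B"
  then show "converges_in_distribution M
      (\<lambda>n \<omega>. skorokhod_of (\<lambda>t. (real_of_int (Y \<omega> (real n * t)) - tagged_speed lp lm p \<eta> * (real n * t)) / sqrt (real n)))
      W (\<lambda>\<omega>. skorokhod_of (\<lambda>t. sqrt (tagged_diffusivity lp lm p \<eta>) * B \<omega> t))" by (rule tagged_clt[OF assms(3)])
qed

end
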